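(* Let $N\geq2$ and let $\rho\geq0$ be a function on $\mathbb{R}^3$ with $\int_{\mathbb{R}^3}\rho=N$ and $\sqrt{\rho}\in H^1(\mathbb{R}^3)$. Then there is a constant $C$ (depending on $N$ and $\rho$) such that for all $\eta>0$, \[ \mathcal{E}_{\rm OT}(\rho)\leq \frac{\mathcal{E}\left(\eta^3\rho(\eta\,\cdot)\right)}{\eta}\leq \mathcal{E}_{\rm OT}(\rho)+C(\sqrt{\eta}+\eta). \] In particular, \[ \lim_{\eta\to0}\frac{\mathcal{E}\left(\eta^3\rho(\eta\,\cdot)\right)}{\eta}= \mathcal{E}_{\rm OT}(\rho). \]
   Context: For a density $\rho\geq 0$ on $\mathbb{R}^3$ with $\int\rho=N$ and $\sqrt{\rho}\in H^1(\mathbb{R}^3)$, the Levy–Lieb functional is \[ \mathcal{E}(\rho)=\inf\left\{{\rm Tr}\,\left(-\sum_{j=1}^N\Delta_{x_j}+\sum_{1\leq j<k\leq N}\frac{1}{|x_j-x_k|}\right)\Gamma\ :\ \Gamma=\Gamma^*\geq0,\ {\rm Tr}\,\Gamma=1,\ \rho_\Gamma=\rho\right\}, \] where $\Gamma$ ranges over (mixed) states on the fermionic space $\bigwedge_1^N L^2(\mathbb{R}^3)$ (antisymmetric square-integrable functions of $N$ variables in $\mathbb{R}^3$), the trace of the energy being understood in the sense of quadratic forms, and $\rho_\Gamma$ is the one-particle density of $\Gamma$, normalized to have total mass $N$: $\int\phi\,\rho_\Gamma = {\rm Tr}\,\big(\sum_{j=1}^N\phi(x_j)\Gamma\big)$ for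 all $\phi\in L^\infty(\mathbb{R}^3)$ (for a continuous kernel, $\rho_\Gamma(x)=N\int\Gamma(x,x_2,\dots,x_N;x,x_2,\dots,x_N)\,dx_2\cdots dx_N$). The Coulomb multi-marginal optimal transport value is \[ \mathcal{E}_{\rm OT}(\rho)=\min\left\{\int_{(\mathbb{R}^3)^N}\sum_{1\leq j<k\leq N}\frac{1}{|x_j-x_k|}\,d\mathbb{P}(x_1,\dots,x_N)\ :\ \mathbb{P}\ \text{symmetric probability on } (\mathbb{R}^3)^N,\ \rho_{\mathbb{P}}=\rho\right\}, \] where $\rho_{\mathbb{P}}(x)=N\int_{(\mathbb{R}^3)^{N-1}}d\mathbb{P}(x,x_2,\dots,x_N)$. The notation $\eta^3\rho(\eta\,\cdot)$ denotes the function $x\mapsto\eta^3\rho(\eta x)$. *)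

theory Defs
  imports "HOL-Probability.Probability" "HOL-Combinatorics.Permutations"
begin

coinductive smooth_fun :: "('a::euclidean_space \<Rightarrow> real) \<Rightarrow> bool" where
  "continuous_on UNIV f \<Longrightarrow> (\<forall>x. f differentiable (at x)) \<Longrightarrow>
   (\<forall>b\<in>Basis. smooth_fun (\<lambda>x. frechet_derivative f (at x) b)) \<Longrightarrow> smooth_fun f"

definition test_fun :: "('a::euclidean_space \<Rightarrow> real) \<Rightarrow> bool" where
  "test_fun \<phi> \<longleftrightarrow> smooth_fun \<phi> \<and> bounded {x. \<phi> x \<noteq> 0}"

definition L2 :: "('a::euclidean_space \<Rightarrow> complex) \<Rightarrow> bool" where
  "L2 f \<longleftrightarrow> f \<in> borel_measurable lborel \<and> integrable lborel (\<lambda>x. (cmod (f x))\<^sup>2)"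

definition weak_partial ::
  "('a::euclidean_space \<Rightarrow> complex) \<Rightarrow> 'a \<Rightarrow> ('a \<Rightarrow> complex) \<Rightarrow> bool" where
  "weak_partial f b g \<longleftrightarrow>
     (\<forall>\<phi>. test_fun \<phi> \<longrightarrow>
        (\<integral>x. complex_of_real (frechet_derivative \<phi> (at x) b) * f x \<partial>lborel)
        = - (\<integral>x. complex_of_real (\<phi> x) * g x \<partial>lborel))"

definition H1 :: "('a::euclidean_space \<Rightarrow> complex) \<Rightarrow> bool" where
  "H1 f \<longleftrightarrow> L2 f \<and> (\<forall>b\<in>Basis. \<exists>g. L2 g \<and> weak_partial f b g)"

text \<open>A choice of weak partial derivative (unique almost everywhere).\<close>
definition wgrad :: "('a::euclidean_space \<Rightarrow> complex) \<Rightarrow> 'a \<Rightarrow> 'a \<Rightarrow> complex" where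
  "wgrad f b = (SOME g. L2 g \<and> weak_partial f b g)"

section \<open>N-particle configurations: (R^3)^N = real^3^'n with N = CARD('n)\<close>

definition perm_conf :: "('n::finite \<Rightarrow> 'n) \<Rightarrow> real^3^'n \<Rightarrow> real^3^'n" where
  "perm_conf \<sigma> x = (\<chi> i. x $ (\<sigma> i))"

text \<open>Coulomb interaction sum_{j<k} 1/|x_j - x_k| (value +infinity on coincidences).\<close>
definition coulomb :: "real^3^'n::finite \<Rightarrow> ennreal" where
  "coulomb x = (\<Sum>(j,k)\<in>{(j,k). j \<noteq> k}. inverse (ennreal (dist (x $ j) (x $ k)))) / 2"

definition antisym_fun :: "(real^3^'n::finite \<Rightarrow> complex) \<Rightarrow> bool" where
  "antisym_fun \<Psi> \<longleftrightarrow> (\<forall>\<sigma>. \<sigma> permutes (UNIV :: 'n set) \<longrightarrow>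
      (\<forall>x. \<Psi> (perm_conf \<sigma> x) = of_int (sign \<sigma>) * \<Psi> x))"

text \<open>Quadratic form of H = -Laplacian + Coulomb on a wave function (+infinity outside
  the form domain). The basis of real^3^'n consists of the 3N coordinate directions,
  so the kinetic part is sum_j integral |grad_{x_j} Psi|^2.\<close>
definition form_energy :: "(real^3^'n::finite \<Rightarrow> complex) \<Rightarrow> ennreal" where
  "form_energy \<Psi> =
     (if H1 \<Psi> then
        (\<Sum>b\<in>Basis. \<integral>\<^sup>+x. ennreal ((cmod (wgrad \<Psi> b x))\<^sup>2) \<partial>lborel)
        + (\<integral>\<^sup>+x. coulomb x * ennreal ((cmod (\<Psi> x))\<^sup>2) \<partial>lborel)
      else top)"

text \<open>Mixed fermionic states Gamma = sum_k lam_k |Psi_k><Psi_k| (spectral decomposition):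
  lam_k >= 0, sum lam_k = 1 (Tr Gamma = 1), Psi_k orthonormal antisymmetric L^2 functions.\<close>
definition mixed_state :: "(nat \<Rightarrow> real) \<Rightarrow> (nat \<Rightarrow> real^3^'n::finite \<Rightarrow> complex) \<Rightarrow> bool" where
  "mixed_state lam \<Psi> \<longleftrightarrow>
     (\<forall>k. lam k \<ge> 0) \<and> lam sums 1 \<and>
     (\<forall>k. L2 (\<Psi> k) \<and> antisym_fun (\<Psi> k)) \<and>
     (\<forall>k l. (\<integral>x. \<Psi> k x * cnj (\<Psi> l x) \<partial>lborel) = (if k = l then 1 else 0))"

text \<open>One-particle density of the state equals rho (tested against all bounded Borel phi):
  integral phi rho = Tr (sum_j phi(x_j) Gamma).\<close>
definition state_density :: "(nat \<Rightarrow> real) \<Rightarrow> (nat \<Rightarrow> real^3^'n::finite \<Rightarrow> complex)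
     \<Rightarrow> (real^3 \<Rightarrow> real) \<Rightarrow> bool" where
  "state_density lam \<Psi> \<rho> \<longleftrightarrow>
     (\<forall>\<phi> :: real^3 \<Rightarrow> real. \<phi> \<in> borel_measurable borel \<longrightarrow> bounded (range \<phi>) \<longrightarrow>
        (\<lambda>k. lam k * (\<integral>x. (\<Sum>j\<in>UNIV. \<phi> (x $ j)) * (cmod (\<Psi> k x))\<^sup>2 \<partial>lborel))
          sums (\<integral>y. \<phi> y * \<rho> y \<partial>lborel))"

definition levy_lieb :: "'n::finite itself \<Rightarrow> (real^3 \<Rightarrow> real) \<Rightarrow> ennreal" where
  "levy_lieb _ \<rho> = Inf {(\<Sum>k. ennreal (lam k) * form_energy (\<Psi> k)) | lam (\<Psi> :: nat \<Rightarrow> real^3^'n \<Rightarrow> complex).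
       mixed_state lam \<Psi> \<and> state_density lam \<Psi> \<rho>}"

definition OT_admissible :: "(real^3^'n::finite) measure \<Rightarrow> (real^3 \<Rightarrow> real) \<Rightarrow> bool" where
  "OT_admissible P \<rho> \<longleftrightarrow>
     prob_space P \<and> sets P = sets borel \<and>
     (\<forall>\<sigma>. \<sigma> permutes (UNIV :: 'n set) \<longrightarrow> distr P borel (perm_conf \<sigma>) = P) \<and>
     (\<forall>A \<in> sets (borel :: (real^3) measure). \<forall>j.
        of_nat CARD('n) * emeasure P {x \<in> space P. x $ j \<in> A}
          = (\<integral>\<^sup>+y\<in>A. ennreal (\<rho> y) \<partial>lborel))"

definition E_OT :: "'n::finite itself \<Rightarrow> (real^3 \<Rightarrow> real) \<Rightarrow> ennreal" where
  "E_OT _ \<rho> = Inf {(\<integral>\<^sup>+x. coulomb x \<partial>P) | P :: (real^3^'n) measure. OT_admissible P \<rho>}"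

end

theory Submission
 imports Defs
begin

text \<open>Lower bound: the diagonal of a state, dilated, is a transport plan. Upper bound: a nearly optimal plan is
discretized by a smooth partition into cells of side \<open>ep\<close> and replaced by a mixture of Slater determinants of
\<open>sqrt \<rho>\<close> localized to the cells, at kinetic cost of order \<open>1 / ep^2\<close>. The density is kept exactly. The interaction
changes only by order \<open>ep^2\<close>: the kernel is semiconcave away from zero, and B-spline cells reproduce linear functions, so
the first-order terms average out. Exchanging particles beforehand keeps all particles a fixed distance apart.\<close>

text \<open>The rate \<open>sqrt \<eta>\<close> dictates the order of the discretization. After
  division by \<open>\<eta>\<close>, localization to cells of side \<open>ep\<close> costs
  \<open>\<eta> / ep^2\<close>; an interaction error of order \<open>ep^2\<close> balances this at
  \<open>ep^2 = sqrt \<eta>\<close>, whereas a first-order error \<open>ep\<close> would only give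
  \<open>\<eta>\<close> to the power 1/3. The obstacle is that keeping the density exactly forces
  each cell to carry \<open>\<rho>\<close> times its bump, whose barycentre is not the lattice
  point. The sum of these displacements, weighted by mass, is still of order \<open>ep^2\<close>:
  \<open>sqrt \<rho>\<close> in \<open>H1\<close> makes translations of \<open>\<rho>\<close>
  Lipschitz in L1, which supplies the second factor \<open>ep\<close>. The quadratic remainder of
  the kernel needs a distance between particles that does not shrink with \<open>\<eta>\<close>. The
  exchange providing it costs order \<open>1 / d\<close> per unit of removed weight, while the
  removed configurations have energy of order \<open>1 / dl\<close> with \<open>dl\<close> much
  smaller than \<open>d\<close>; so it is paid for, up to far-out mass. Determinants of different
  cell configurations may overlap, although a state is given by an orthonormal family.\<close>

section \<open>Smooth test functions\<close>

definition flat_exp :: "nat => real => real" where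
 "flat_exp k t = (if t > 0 then exp (-1/t) / t ^ k else 0)"

text \<open>Differentiating \<open>exp (-1/t) / t ^ k\<close> only produces members of the same
  family, with exponents \<open>k+1\<close> and \<open>k+2\<close>; this is why the exponent is
  carried along.\<close>

lemma flat_exp_has_derivative:
 "(flat_exp k has_real_derivative (flat_exp (k+2) t - of_nat k * flat_exp (k+1) t)) (at t)"
proof -
 consider "t > 0" | "t < 0" | "t = 0" by linarith
 then show ?thesis
 proof cases
  case 1
  have "((%t. exp (-1/t) / t ^ k) has_real_derivative (flat_exp (k+2) t - of_nat k * flat_exp (k+1) t)) (at t)"
  proof -
   have e: "((%t. exp (-1/t)) has_real_derivative exp (-1/t) / t^2) (at t)"
    using 1 by (auto intro!: derivative_eq_intros simp: field_simps power2_eq_square)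
   have p: "((%t. t ^ k) has_real_derivative real k * t ^ (k - Suc 0)) (at t)"
    by (rule DERIV_pow)
   have "(exp (-1/t) / t^2 * t ^ k - exp (-1/t) * (real k * t ^ (k - Suc 0))) / (t ^ k * t ^ k)
     = flat_exp (k+2) t - real k * flat_exp (k+1) t"
    using 1 by (cases k) (auto simp: flat_exp_def field_simps power2_eq_square)
   with DERIV_divide[OF e p] 1 show ?thesis by simp
  qed
  then show ?thesis
   by (rule DERIV_cong_ev[THEN iffD1, rotated -1])
    (use 1 in \<open>auto simp: flat_exp_def intro!: eventually_nhds[THEN iffD2] exI[of _ "{0<..}"]\<close>)
 next
  case 2
  have "((%t. 0) has_real_derivative (flat_exp (k+2) t - of_nat k * flat_exp (k+1) t)) (at t)"
   using 2 unfolding flat_exp_def by auto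
  then show ?thesis
   by (rule DERIV_cong_ev[THEN iffD1, rotated -1])
    (use 2 in \<open>auto simp: flat_exp_def intro!: eventually_nhds[THEN iffD2] exI[of _ "{..<0}"]\<close>)
 next
  case 3
  \<comment> \<open>The right difference quotient at 0 is \<open>u ^ (k+1) / exp u\<close> at
    \<open>u = 1/h\<close>, where the exponential wins.\<close>
  have "((%h. inverse h ^ (k+1) / exp (inverse h)) \<longlongrightarrow> 0) (at_right (0::real))"
   by (rule filterlim_compose[OF tendsto_power_div_exp_0 filterlim_inverse_at_top_right])
  then have r: "((%h. flat_exp k h / h) \<longlongrightarrow> 0) (at_right 0)"
   by (rule Lim_transform_eventually)
    (auto simp: eventually_at_right_field flat_exp_def field_simps exp_minus power_inverse intro!: exI[of _ 1])
  have l: "((%h. flat_exp k h / h) \<longlongrightarrow> 0) (at_left 0)"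
   by (rule Lim_transform_eventually[OF tendsto_const])
    (auto simp: eventually_at_left_field flat_exp_def intro!: exI[of _ "-1"])
  from l r have "((%h. flat_exp k h / h) \<longlongrightarrow> 0) (at 0)"
   by (simp add: filterlim_at_split)
  then show ?thesis using 3 by (simp add: DERIV_def flat_exp_def)
 qed
qed

text \<open>An algebra of functions closed under directional derivatives, hence consisting of smooth functions.\<close>

inductive flat_alg :: "('a::euclidean_space => real) => bool" where
 const: "flat_alg (%x. c)"
| base: "flat_alg (%x. flat_exp k (x \<bullet> v + d))"
| add: "flat_alg f ==> flat_alg g ==> flat_alg (%x. f x + g x)"
| mult: "flat_alg f ==> flat_alg g ==> flat_alg (%x. f x * g x)"

lemma flat_alg_derivative:
 assumes "flat_alg f"
 shows "EX f'. (ALL x. (f has_derivative f' x) (at x)) & (ALL b. flat_alg (%x. f' x b))"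
 using assms
proof induction
 case (const c)
 show ?case by (rule exI[of _ "%x v. 0"]) (auto intro: flat_alg.const)
next
 case (base k v d)
 let ?D = "%x. flat_exp (k+2) (x \<bullet> v + d) + (- of_nat k) * flat_exp (k+1) (x \<bullet> v + d)"
 have "((%x. flat_exp k (x \<bullet> v + d)) has_derivative (%b. ?D x * (b \<bullet> v))) (at x)" for x
  by (rule has_derivative_eq_rhs[OF DERIV_compose_FDERIV[where f="flat_exp k" and g="%x. x \<bullet> v + d", OF flat_exp_has_derivative[of k "x \<bullet> v + d"]]])
   (auto intro!: derivative_eq_intros simp: fun_eq_iff)
 moreover have "flat_alg (%x. ?D x * (b \<bullet> v))" for b
  by (intro flat_alg.intros)
 ultimately show ?case by (intro exI[of _ "%x b. ?D x * (b \<bullet> v)"]) blast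
next
 case (add f g)
 then obtain f' g' where "ALL x. (f has_derivative f' x) (at x)" "ALL b. flat_alg (%x. f' x b)"
  "ALL x. (g has_derivative g' x) (at x)" "ALL b. flat_alg (%x. g' x b)" by blast
 then show ?case
  by (intro exI[of _ "%x b. f' x b + g' x b"]) (auto intro!: has_derivative_add flat_alg.intros)
next
 case (mult f g)
 then obtain f' g' where "ALL x. (f has_derivative f' x) (at x)" "ALL b. flat_alg (%x. f' x b)"
  "ALL x. (g has_derivative g' x) (at x)" "ALL b. flat_alg (%x. g' x b)" by blast
 with mult show ?case
  by (intro exI[of _ "%x b. f x * g' x b + f' x b * g x"]) (auto intro!: has_derivative_mult flat_alg.intros)
qed

text \<open>\<open>smooth_fun\<close> is coinductive, so it contains every class of differentiable
  functions closed under partial derivatives: \<open>flat_alg\<close> itself serves as the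
  invariant.\<close>

lemma flat_alg_smooth: "flat_alg f ==> smooth_fun f"
proof (coinduction arbitrary: f rule: smooth_fun.coinduct)
 case smooth_fun
 then obtain f' where f': "ALL x. (f has_derivative f' x) (at x)" "ALL b. flat_alg (%x. f' x b)"
  using flat_alg_derivative by blast
 have "(%x. frechet_derivative f (at x) b) = (%x. f' x b)" for b
  using f'(1) by (metis frechet_derivative_at)
 moreover have "continuous_on UNIV f"
  using f'(1) by (meson continuous_at_imp_continuous_on has_derivative_continuous)
 moreover have "ALL x. f differentiable at x" using f'(1) by (auto simp: differentiable_def)
 ultimately show ?case using f'(2) by (intro exI[of _ f]) auto
qed

lemma flat_alg_prod: "finite I ==> (!!i. i \<in> I ==> flat_alg (f i)) ==> flat_alg (%x. \<Prod>i\<in>I. f i x)"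
 by (induction I rule: finite_induct) (auto intro: flat_alg.intros)

lemma smooth_funD:
 assumes "smooth_fun f"
 shows "continuous_on UNIV f" "!!x. f differentiable at x"
  "!!b. b \<in> Basis ==> smooth_fun (%x. frechet_derivative f (at x) b)"
 using assms by (auto elim: smooth_fun.cases)

text \<open>Coinduction needs a family closed under partial derivatives. The factor \<open>d\<close>
  provides this: each derivative multiplies it by \<open>c\<close>.\<close>

lemma smooth_fun_affine:
 fixes f :: "'a::euclidean_space => real"
 assumes "smooth_fun f"
 shows "smooth_fun (%x. d * f (c *\<^sub>R x + v))"
 using assms
proof (coinduction arbitrary: f d rule: smooth_fun.coinduct)
 case smooth_fun
 note f = smooth_funD[OF this]
 have D: "((%x. d * f (c *\<^sub>R x + v)) has_derivative (%b. d * (c * frechet_derivative f (at (c *\<^sub>R x + v)) b))) (at x)" for x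
 proof -
  have 1: "(f has_derivative frechet_derivative f (at (c *\<^sub>R x + v))) (at (c *\<^sub>R x + v))"
   using f(2) frechet_derivative_works by blast
  have "((%x. f (c *\<^sub>R x + v)) has_derivative (%b. frechet_derivative f (at (c *\<^sub>R x + v)) (c *\<^sub>R b))) (at x)"
   by (rule has_derivative_compose[where g=f and f="%x. c *\<^sub>R x + v", OF _ 1]) (auto intro!: derivative_eq_intros)
  moreover have "frechet_derivative f (at (c *\<^sub>R x + v)) (c *\<^sub>R b) = c * frechet_derivative f (at (c *\<^sub>R x + v)) b" for b
   using linear_frechet_derivative[OF f(2)] by (simp add: linear_cmul)
  ultimately show ?thesis by (auto intro!: derivative_eq_intros)
 qed
 have E: "(%x. frechet_derivative (%x. d * f (c *\<^sub>R x + v)) (at x) b)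
  = (%x. (d * c) * (%x. frechet_derivative f (at x) b) (c *\<^sub>R x + v))" for b
  by (simp add: fun_eq_iff frechet_derivative_at[OF D, symmetric])
 have "continuous_on UNIV (%x. d * f (c *\<^sub>R x + v))"
  using D by (meson continuous_at_imp_continuous_on has_derivative_continuous)
 moreover have "ALL x. (%x. d * f (c *\<^sub>R x + v)) differentiable at x"
  using D by (auto simp: differentiable_def)
 moreover have "EX f' d'. (%x. frechet_derivative (%x. d * f (c *\<^sub>R x + v)) (at x) b) = (%x. d' * f' (c *\<^sub>R x + v)) & smooth_fun f'"
  if "b \<in> Basis" for b
  by (rule exI[of _ "%x. frechet_derivative f (at x) b"], rule exI[of _ "d * c"]) (use E f(3) that in auto)
 ultimately show ?case by (intro exI[of _ "%x. d * f (c *\<^sub>R x + v)"]) simp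
qed

lemma frechet_affine:
 fixes f :: "'a::euclidean_space => real"
 assumes "smooth_fun f"
 shows "frechet_derivative (%x. f (c *\<^sub>R x + v)) (at x) b = c * frechet_derivative f (at (c *\<^sub>R x + v)) b"
proof -
 note f = smooth_funD[OF assms]
 have 1: "(f has_derivative frechet_derivative f (at (c *\<^sub>R x + v))) (at (c *\<^sub>R x + v))"
  using f(2) frechet_derivative_works by blast
 have "((%x. f (c *\<^sub>R x + v)) has_derivative (%b. frechet_derivative f (at (c *\<^sub>R x + v)) (c *\<^sub>R b))) (at x)"
  by (rule has_derivative_compose[where g=f and f="%x. c *\<^sub>R x + v", OF _ 1]) (auto intro!: derivative_eq_intros)
 moreover have "frechet_derivative f (at (c *\<^sub>R x + v)) (c *\<^sub>R b) = c * frechet_derivative f (at (c *\<^sub>R x + v)) b" for b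
  using linear_frechet_derivative[OF f(2)] by (simp add: linear_cmul)
 ultimately show ?thesis by (simp add: frechet_derivative_at[symmetric])
qed

lemma test_fun_affine:
 fixes f :: "'a::euclidean_space => real"
 assumes "test_fun f" "c ~= 0"
 shows "test_fun (%x. f (c *\<^sub>R x + v))"
proof -
 have "{x. f (c *\<^sub>R x + v) ~= 0} \<subseteq> (%y. (1/c) *\<^sub>R (y - v)) ` {x. f x ~= 0}"
 proof
  fix x assume "x \<in> {x. f (c *\<^sub>R x + v) ~= 0}"
  then show "x \<in> (%y. (1/c) *\<^sub>R (y - v)) ` {x. f x ~= 0}"
   using assms(2) by (intro image_eqI[of _ _ "c *\<^sub>R x + v"]) auto
 qed
 moreover have "bounded ((%y. (1/c) *\<^sub>R (y - v)) ` {x. f x ~= 0})"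
 proof -
  have "bounded {x. f x ~= 0}" using assms(1) by (simp add: test_fun_def)
  then obtain B where "!!x. f x ~= 0 ==> norm x <= B" by (auto simp: bounded_iff)
  then show ?thesis
   by (auto simp: bounded_iff intro!: exI[of _ "\<bar>1/c\<bar> * (B + norm v)"] mult_left_mono divide_right_mono
     order_trans[OF norm_triangle_ineq4])
 qed
 ultimately show ?thesis
  using assms smooth_fun_affine[of f 1 c v] unfolding test_fun_def by (auto intro: bounded_subset)
qed

text \<open>As \<open>n\<close> grows, \<open>flat_exp 0\<close> of a multiple of \<open>t\<close>
  tends to the indicator of \<open>t > 0\<close>. So these products tend pointwise to the indicator
  of the open box, outside of which they all vanish.\<close>

definition box_bump :: "'a::euclidean_space => 'a => nat => 'a => real" where
 "box_bump a c n x = (\<Prod>b\<in>Basis. flat_exp 0 (real (Suc n) * ((x - a) \<bullet> b)) * flat_exp 0 (real (Suc n) * ((c - x) \<bullet> b)))"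

lemma test_fun_box_bump: "test_fun (box_bump a c n)"
proof -
 have "flat_alg (%x. \<Prod>b\<in>Basis. flat_exp 0 (x \<bullet> (real (Suc n) *\<^sub>R b) + - (real (Suc n) * (a \<bullet> b)))
  * flat_exp 0 (x \<bullet> ((- real (Suc n)) *\<^sub>R b) + real (Suc n) * (c \<bullet> b)))"
  by (intro flat_alg_prod flat_alg.intros) auto
 also have "(%x. \<Prod>b\<in>Basis. flat_exp 0 (x \<bullet> (real (Suc n) *\<^sub>R b) + - (real (Suc n) * (a \<bullet> b)))
  * flat_exp 0 (x \<bullet> ((- real (Suc n)) *\<^sub>R b) + real (Suc n) * (c \<bullet> b))) = box_bump a c n"
  unfolding box_bump_def by (simp add: fun_eq_iff inner_diff_left right_diff_distrib del: of_nat_Suc)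
 finally have "smooth_fun (box_bump a c n)" by (rule flat_alg_smooth)
 moreover have "{x. box_bump a c n x ~= 0} \<subseteq> box a c"
 proof safe
  fix x assume nz: "box_bump a c n x ~= 0"
  show "x \<in> box a c" unfolding mem_box
  proof
   fix b :: 'a assume "b \<in> Basis"
   with nz have "flat_exp 0 (real (Suc n) * ((x - a) \<bullet> b)) ~= 0" "flat_exp 0 (real (Suc n) * ((c - x) \<bullet> b)) ~= 0"
    unfolding box_bump_def by auto
   then have "real (Suc n) * ((x - a) \<bullet> b) > 0" "real (Suc n) * ((c - x) \<bullet> b) > 0"
    unfolding flat_exp_def by (auto split: if_splits)
   then show "a \<bullet> b < x \<bullet> b & x \<bullet> b < c \<bullet> b" by (auto simp: zero_less_mult_iff inner_diff_left)
  qed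
 qed
 ultimately show ?thesis unfolding test_fun_def by (auto intro: bounded_subset[OF bounded_box])
qed

lemma flat_exp_0_bounds: "0 <= flat_exp 0 t" "flat_exp 0 t <= 1"
 by (auto simp: flat_exp_def)

lemma flat_exp_0_scaled_limit:
 "(%n. flat_exp 0 (real (Suc n) * t)) \<longlonglongrightarrow> (if t > 0 then 1 else 0)"
proof (cases "t > 0")
 case True
 have "(%n. exp (- (1/t) * inverse (real (Suc n)))) \<longlonglongrightarrow> exp (- (1/t) * 0)"
  by (intro tendsto_intros LIMSEQ_inverse_real_of_nat)
 with True show ?thesis by (simp add: flat_exp_def field_simps del: of_nat_Suc)
qed (auto simp: flat_exp_def zero_less_mult_iff)

lemma box_bump_bounds: "0 <= box_bump a c n x" "box_bump a c n x <= 1"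
 unfolding box_bump_def
 by (auto intro!: prod_nonneg prod_le_1 mult_le_one simp: flat_exp_0_bounds simp del: of_nat_Suc)

lemma box_bump_tendsto: "(%n. box_bump a c n x) \<longlonglongrightarrow> indicator (box a c) x"
proof -
 have "(%n. box_bump a c n x) \<longlonglongrightarrow> (\<Prod>b\<in>Basis. (if (x - a) \<bullet> b > 0 then 1 else 0) * (if (c - x) \<bullet> b > 0 then 1 else 0))"
  unfolding box_bump_def by (intro tendsto_intros flat_exp_0_scaled_limit)
 also have "(\<Prod>b\<in>Basis. (if (x - a) \<bullet> b > 0 then 1 else (0::real)) * (if (c - x) \<bullet> b > 0 then 1 else 0)) = indicator (box a c) x"
  by (auto simp: indicator_def mem_box inner_diff_left prod_zero_iff)
 finally show ?thesis .
qed

lemma box_bump_zero: "x \<notin> box a c ==> box_bump a c n x = 0"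
proof -
 assume "x \<notin> box a c"
 then obtain b where "b \<in> Basis" "(x - a) \<bullet> b <= 0 | (c - x) \<bullet> b <= 0"
  by (auto simp: mem_box inner_diff_left not_less)
 then have "flat_exp 0 (real (Suc n) * ((x - a) \<bullet> b)) * flat_exp 0 (real (Suc n) * ((c - x) \<bullet> b)) = 0"
  by (auto simp: flat_exp_def mult_le_0_iff zero_less_mult_iff)
 with \<open>b \<in> Basis\<close> show ?thesis unfolding box_bump_def by (meson finite_Basis prod_zero)
qed

section \<open>Square-integrable functions and uniqueness of weak derivatives\<close>

lemma nn_integral_lborel_shift:
 fixes c :: "'a::euclidean_space"
 assumes "F \<in> borel_measurable borel"
 shows "(\<integral>\<^sup>+x. F (x + c) \<partial>lborel) = (\<integral>\<^sup>+x. F x \<partial>lborel)"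
 using nn_integral_distr[of "(+) c" lborel borel F] assms by (simp add: lborel_distr_plus add.commute)

lemma lborel_shift:
 fixes c :: "'a::euclidean_space" and F :: "'a => 'b::{banach, second_countable_topology}"
 assumes "F \<in> borel_measurable borel"
 shows "integrable lborel (%x. F (x + c)) \<longleftrightarrow> integrable lborel F"
  and "(\<integral>x. F (x + c) \<partial>lborel) = (\<integral>x. F x \<partial>lborel)"
 using integrable_distr_eq[of "(+) c" lborel borel F] integral_distr[of "(+) c" lborel borel F] assms
 by (simp_all add: lborel_distr_plus add.commute)

lemma L2_measurable: "L2 f ==> f \<in> borel_measurable borel"
 by (simp add: L2_def)

lemma L2_square_integrable: "L2 f ==> integrable lborel (%x. (cmod (f x))^2)"
 by (simp add: L2_def)

lemma le_one_plus_square: "(t::real) <= 1 + t^2"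
proof -
 have "2 * t * 1 <= t^2 + 1^2" by (rule sum_squares_bound)
 moreover have "0 <= t^2" by simp
 ultimately show ?thesis unfolding power_one mult_1_right by linarith
qed

lemma integrable_indicator_cball [simp]: "integrable lborel (%x. indicator (cball (a::'a::euclidean_space) R) x :: real)"
 using emeasure_bounded_finite[of "cball a R"] by (simp add: integrable_indicator_iff)

text \<open>On the ball of radius \<open>R\<close> the product is dominated by
  \<open>M * (1 + |f|^2)\<close>, an integrable bound; outside it vanishes.\<close>

lemma L2_times_bounded:
 fixes ph :: "'a::euclidean_space => complex"
 assumes f: "L2 f" and ph: "ph \<in> borel_measurable borel" "!!x. cmod (ph x) <= M" "!!x. R < norm x ==> ph x = 0"
 shows "integrable lborel (%x. ph x * f x)"
proof (rule Bochner_Integration.integrable_bound)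
 show "integrable lborel (%x. M * (indicator (cball 0 R) x + (cmod (f x))^2))"
  using L2_square_integrable[OF f] by auto
 show "(%x. ph x * f x) \<in> borel_measurable lborel" using ph L2_measurable[OF f] by auto
 have "M \<ge> 0" using ph(2)[of 0] norm_ge_zero order_trans by blast
 have "cmod (ph x) * cmod (f x) <= M * (indicator (cball 0 R) x + (cmod (f x))^2)" for x
  using mult_mono[OF ph(2)[of x] le_one_plus_square[of "cmod (f x)"]] ph(3)[of x] \<open>M \<ge> 0\<close>
  by (auto simp: indicator_def)
 then show "AE x in lborel. norm (ph x * f x) <= norm (M * (indicator (cball 0 R) x + (cmod (f x))^2))"
  by (auto simp: norm_mult intro!: order_trans[OF _ abs_ge_self])
qed

lemma L2_local: "L2 f ==> integrable lborel (%x. indicator (cball 0 R) x *\<^sub>R f x)"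
 using L2_times_bounded[of f "%x. of_real (indicator (cball 0 R) x)" 1 R]
 by (auto simp: scaleR_conv_of_real indicator_def)

text \<open>Boxes form an intersection-stable generator of the Borel sets, so the vanishing of the
  integrals spreads by Dynkin's argument to all Borel sets, and a function with vanishing integrals
  over all of them is 0 almost everywhere.\<close>

lemma ae_zero_of_box_integrals:
 fixes h :: "'a::euclidean_space => complex"
 assumes m: "h \<in> borel_measurable borel"
  and loc: "!!R. integrable lborel (%x. indicator (cball 0 R) x *\<^sub>R h x)"
  and z: "!!a c. (\<integral>x. indicator (box a c) x *\<^sub>R h x \<partial>lborel) = 0"
 shows "AE x in lborel. h x = 0"
proof -
 have "AE x in lborel. indicator (box (- real n *\<^sub>R One) (real n *\<^sub>R One)) x *\<^sub>R h x = 0" for n :: nat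
 proof -
  \<comment> \<open>As \<open>h\<close> is only locally integrable, the argument runs on a bounded
    box \<open>U\<close>; the boxes for all \<open>n\<close> exhaust the space.\<close>
  define U where "U = box (- real n *\<^sub>R One) (real n *\<^sub>R One :: 'a)"
  define k where "k = (%x. indicator U x *\<^sub>R h x)"
  obtain R where R: "U \<subseteq> cball 0 R" unfolding U_def
   using bounded_subset_ballD[OF bounded_box] ball_subset_cball by (metis order_trans)
  have "integrable lborel (%x. indicator U x *\<^sub>R (indicator (cball 0 R) x *\<^sub>R h x))"
   by (rule integrable_mult_indicator[OF _ loc]) (auto simp: U_def)
  then have ik: "integrable lborel k"
   by (rule Bochner_Integration.integrable_cong[THEN iffD1, rotated -1]) (use R in "auto simp: k_def indicator_def")
  have "set_lebesgue_integral lborel A k = 0" if "A \<in> sets borel" for A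
  proof -
   have G: "Int_stable (range (%(a, b). box a b :: 'a set))"
    by (auto simp: Int_stable_def box_Int_box)
   have S: "A \<in> sigma_sets UNIV (range (%(a, b). box a b))"
    using that unfolding borel_eq_box by simp
   show ?thesis
   proof (rule sigma_sets_induct_disjoint[OF G _ S])
    fix A :: "'a set" assume "A \<in> range (%(a, b). box a b)"
    then obtain a b where A: "A = box a b" by auto
    then obtain c d where cd: "A \<inter> U = box c d" by (auto simp: U_def box_Int_box)
    have "set_lebesgue_integral lborel A k = (\<integral>x. indicator (box c d) x *\<^sub>R h x \<partial>lborel)"
     unfolding set_lebesgue_integral_def k_def cd[symmetric] by (simp add: indicator_inter_arith)
    then show "set_lebesgue_integral lborel A k = 0" using z[of c d] by simp
   next
    fix A :: "'a set" assume S: "A \<in> sigma_sets UNIV (range (%(a, b). box a b))" and 0: "set_lebesgue_integral lborel A k = 0"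
    have A: "A \<in> sets borel" using S unfolding borel_eq_box by simp
    have "set_lebesgue_integral lborel (A \<union> (UNIV - A)) k = set_lebesgue_integral lborel A k + set_lebesgue_integral lborel (UNIV - A) k"
     by (rule set_integral_Un) (use ik A in "auto simp: set_integrable_def intro!: integrable_mult_indicator")
    moreover have "set_lebesgue_integral lborel UNIV k = 0"
     using z[of "- real n *\<^sub>R One" "real n *\<^sub>R One"] by (simp add: set_lebesgue_integral_def k_def U_def)
    ultimately show "set_lebesgue_integral lborel (UNIV - A) k = 0" using 0 by simp
   next
    fix F :: "nat => 'a set"
    assume dj: "disjoint_family F" and S: "range F \<subseteq> sigma_sets UNIV (range (%(a, b). box a b))"
     and 0: "!!i. set_lebesgue_integral lborel (F i) k = 0"
    have F: "F i \<in> sets borel" for i using S unfolding borel_eq_box by auto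
    have "set_lebesgue_integral lborel (\<Union>i. F i) k = (\<Sum>i. set_lebesgue_integral lborel (F i) k)"
     by (rule lebesgue_integral_countable_add)
      (use ik F dj in "auto simp: set_integrable_def disjoint_family_on_def intro!: integrable_mult_indicator")
    with 0 show "set_lebesgue_integral lborel (\<Union>i. F i) k = 0" by simp
   qed (auto simp: set_lebesgue_integral_def)
  qed
  then have "AE x in lborel. k x = 0" by (intro sigma_finite_measure.density_zero[OF lborel.sigma_finite_measure_axioms ik]) auto
  then show ?thesis by (simp add: k_def U_def)
 qed
 then have "AE x in lborel. \<forall>n::nat. indicator (box (- real n *\<^sub>R One) (real n *\<^sub>R One)) x *\<^sub>R h x = 0"
  unfolding AE_all_countable by blast
 then show ?thesis
 proof (eventually_elim)
  fix x assume a: "\<forall>n::nat. indicator (box (- real n *\<^sub>R One) (real n *\<^sub>R One)) x *\<^sub>R h x = 0"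
  obtain n :: nat where n: "norm x < real n" using reals_Archimedean2 by blast
  have "x \<in> box (- real n *\<^sub>R One) (real n *\<^sub>R One)" unfolding mem_box
   using Basis_le_norm[of _ x] n by (auto simp: abs_le_iff intro: le_less_trans) (smt (verit))
  with a[rule_format, of n] show "h x = 0" by (simp add: indicator_def)
 qed
qed

text \<open>Fundamental lemma of the calculus of variations. The bumps converge to box indicators
  and are dominated by the indicator of a ball, which reduces the claim to integrals over
  boxes.\<close>

lemma ae_zero_of_test:
 fixes h :: "'a::euclidean_space => complex"
 assumes m: "h \<in> borel_measurable borel"
  and loc: "!!R. integrable lborel (%x. indicator (cball 0 R) x *\<^sub>R h x)"
  and z: "!!ph. test_fun ph ==> (\<integral>x. complex_of_real (ph x) * h x \<partial>lborel) = 0"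
 shows "AE x in lborel. h x = 0"
proof (rule ae_zero_of_box_integrals[OF m loc])
 fix a c :: 'a
 obtain R where R: "box a c \<subseteq> cball 0 R"
  using bounded_subset_ballD[OF bounded_box] ball_subset_cball by (metis order_trans)
 have mb: "box_bump a c n \<in> borel_measurable borel" for n
  using test_fun_box_bump[of a c n] smooth_funD(1) unfolding test_fun_def
  by (auto intro: borel_measurable_continuous_onI)
 have "(%n. \<integral>x. complex_of_real (box_bump a c n x) * h x \<partial>lborel) \<longlonglongrightarrow> (\<integral>x. indicator (box a c) x *\<^sub>R h x \<partial>lborel)"
 proof (rule integral_dominated_convergence[where w="%x. norm (indicator (cball 0 R) x *\<^sub>R h x)"])
  show "integrable lborel (%x. norm (indicator (cball 0 R) x *\<^sub>R h x))" by (rule integrable_norm[OF loc])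
  show "AE x in lborel. (%n. complex_of_real (box_bump a c n x) * h x) \<longlonglongrightarrow> indicator (box a c) x *\<^sub>R h x"
   unfolding scaleR_conv_of_real by (intro AE_I2 tendsto_intros box_bump_tendsto)
  show "AE x in lborel. norm (complex_of_real (box_bump a c n x) * h x) <= norm (indicator (cball 0 R) x *\<^sub>R h x)" for n
   using R box_bump_bounds[of a c n] box_bump_zero[of _ a c n]
  proof (intro AE_I2)
   fix x show "norm (complex_of_real (box_bump a c n x) * h x) <= norm (indicator (cball 0 R) x *\<^sub>R h x)"
   proof (cases "x \<in> box a c")
    case True
    then have "x \<in> cball 0 R" using R by blast
    then show ?thesis using box_bump_bounds[of a c n x] by (simp add: norm_mult mult_left_le_one_le del: mem_cball)
   qed (simp add: box_bump_zero)
  qed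
 qed (use m mb in auto)
 then show "(\<integral>x. indicator (box a c) x *\<^sub>R h x \<partial>lborel) = 0"
  by (simp add: z test_fun_box_bump LIMSEQ_const_iff)
qed

lemma L2_diff: "L2 f ==> L2 g ==> L2 (%x. f x - g x)"
proof -
 assume "L2 f" "L2 g"
 have "integrable lborel (%x. (cmod (f x - g x))^2)"
 proof (rule Bochner_Integration.integrable_bound)
  show "integrable lborel (%x. 2 * (cmod (f x))^2 + 2 * (cmod (g x))^2)"
   using \<open>L2 f\<close> \<open>L2 g\<close> by (auto simp: L2_def)
  have "(cmod (u - v))^2 <= 2 * (cmod u)^2 + 2 * (cmod v)^2" for u v
  proof -
   have "(cmod (u - v))^2 <= (cmod u + cmod v)^2" by (intro power_mono norm_triangle_ineq4) auto
   also have "... <= 2 * (cmod u)^2 + 2 * (cmod v)^2"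
    using sum_squares_bound[of "cmod u" "cmod v"] by (simp add: power2_sum)
   finally show ?thesis .
  qed
  then show "AE x in lborel. norm ((cmod (f x - g x))^2) <= norm (2 * (cmod (f x))^2 + 2 * (cmod (g x))^2)"
   by auto
 qed (use \<open>L2 f\<close> \<open>L2 g\<close> in "auto simp: L2_def")
 then show ?thesis using \<open>L2 f\<close> \<open>L2 g\<close> by (auto simp: L2_def)
qed

lemma test_fun_bounds:
 assumes "test_fun ph"
 obtains M R where "0 < M" "0 < R" "!!x. \<bar>ph x\<bar> <= M" "!!x. R < norm x ==> ph x = 0"
proof -
 have c: "continuous_on UNIV ph" and "bounded {x. ph x ~= 0}"
  using assms smooth_funD(1) by (auto simp: test_fun_def)
 then obtain B where B: "!!x. ph x ~= 0 ==> norm x <= B" "B > 0"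
  by (auto simp: bounded_pos)
 have "bounded (ph ` cball 0 B)"
  by (intro compact_imp_bounded compact_continuous_image continuous_on_subset[OF c]) auto
 then obtain M where M: "M > 0" "!!x. x \<in> cball 0 B ==> \<bar>ph x\<bar> <= M" by (auto simp: bounded_pos)
 have "\<bar>ph x\<bar> <= M" for x
  using M(2)[of x] B(1)[of x] M(1) by (cases "ph x = 0") auto
 with M B show ?thesis by (intro that[of M B]) force+
qed

lemma test_fun_measurable: "test_fun ph ==> ph \<in> borel_measurable borel"
 using smooth_funD(1) by (auto simp: test_fun_def intro: borel_measurable_continuous_onI)

lemma test_fun_partial:
 assumes "test_fun ph" "b \<in> Basis"
 shows "test_fun (%x. frechet_derivative ph (at x) b)"
proof -
 obtain M R where R: "0 < R" "!!x. R < norm x ==> ph x = 0" using test_fun_bounds[OF assms(1)] by metis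
 have "frechet_derivative ph (at x) b = 0" if "R < norm x" for x
 proof -
  have "((%x. 0) has_derivative (%x. 0)) (at x)" by simp
  then have "(ph has_derivative (%x. 0)) (at x)"
  proof (rule has_derivative_transform_within_open[of _ _ _ _ "- cball 0 R"])
   show "x \<in> - cball 0 R" using that by simp
  qed (use R(2) in auto)
  then show ?thesis by (metis frechet_derivative_at)
 qed
 then have "{x. frechet_derivative ph (at x) b ~= 0} \<subseteq> cball 0 R" by force
 then show ?thesis using assms smooth_funD(3)
  by (auto simp: test_fun_def intro: bounded_subset[OF bounded_cball])
qed

lemma weak_partial_unique:
 assumes "L2 g1" "L2 g2" "weak_partial f b g1" "weak_partial f b g2"
 shows "AE x in lborel. g1 x = g2 x"
proof -
 have "AE x in lborel. g1 x - g2 x = 0"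
 proof (rule ae_zero_of_test)
  show "(%x. g1 x - g2 x) \<in> borel_measurable borel"
   using L2_measurable[OF assms(1)] L2_measurable[OF assms(2)] by auto
  show "integrable lborel (%x. indicator (cball 0 R) x *\<^sub>R (g1 x - g2 x))" for R
   using L2_local[OF L2_diff[OF assms(1,2)]] .
  fix ph :: "'a => real" assume t: "test_fun ph"
  obtain M R where R: "!!x. \<bar>ph x\<bar> <= M" "!!x. R < norm x ==> ph x = 0" using test_fun_bounds[OF t] by metis
  have "integrable lborel (%x. complex_of_real (ph x) * g x)" if "L2 g" for g
   by (rule L2_times_bounded[OF that, of _ M R]) (use R test_fun_measurable[OF t] in auto)
  with assms t show "(\<integral>x. complex_of_real (ph x) * (g1 x - g2 x) \<partial>lborel) = 0"
   by (simp add: right_diff_distrib weak_partial_def)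
 qed
 then show ?thesis by simp
qed

text \<open>\<open>wgrad\<close> is an arbitrary choice among the weak derivatives. By uniqueness
  its norm may be computed from any weak derivative at hand, which is how all kinetic energies are
  evaluated.\<close>

lemma nn_integral_wgrad:
 assumes "L2 g" "weak_partial f b g"
 shows "(\<integral>\<^sup>+x. ennreal ((cmod (wgrad f b x))^2) \<partial>lborel) = (\<integral>\<^sup>+x. ennreal ((cmod (g x))^2) \<partial>lborel)"
proof -
 have "L2 (wgrad f b) & weak_partial f b (wgrad f b)"
  unfolding wgrad_def by (rule someI[of _ g]) (use assms in auto)
 then have "AE x in lborel. wgrad f b x = g x" using weak_partial_unique assms by blast
 then show ?thesis by (intro nn_integral_cong_AE) auto
qed

section \<open>Weak derivatives as derivatives along lines\<close>

text \<open>Integrability on the product space, as Fubini requires it. By translation invariance the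
  bound for the integral over \<open>x\<close> does not depend on the shift \<open>s\<close>, and
  \<open>s\<close> runs over a bounded interval.\<close>

lemma shift_product_integrable:
 fixes g :: "'a::euclidean_space => complex" and ph :: "'a => complex"
 assumes g: "L2 g" and ph[measurable]: "ph \<in> borel_measurable borel" and b: "!!x. cmod (ph x) <= M" "!!x. R < norm x ==> ph x = 0"
 shows "integrable (lborel \<Otimes>\<^sub>M lborel) (%(x, s). ph x * (indicator {0..h::real} s *\<^sub>R g (x + s *\<^sub>R b)))"
  (is "integrable _ (%(x, s). ?F x s)")
proof -
 note [measurable] = L2_measurable[OF g]
 have M: "0 <= M" using b(1)[of 0] norm_ge_zero order_trans by blast
 have [measurable]: "cball (0::'a) R \<in> sets borel" by simp
 have fin: "(\<integral>\<^sup>+x. ennreal ((cmod (g x))^2) \<partial>lborel) < \<infinity>"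
  using L2_square_integrable[OF g] by (simp add: integrable_iff_bounded)
 have "(\<integral>\<^sup>+z. norm (case z of (x, s) => ?F x s) \<partial>(lborel \<Otimes>\<^sub>M lborel)) = (\<integral>\<^sup>+s. \<integral>\<^sup>+x. norm (?F x s) \<partial>lborel \<partial>lborel)"
  by (subst lborel_pair.nn_integral_snd[symmetric]) (auto simp: case_prod_beta)
 also have "... <= (\<integral>\<^sup>+s. \<integral>\<^sup>+x. ennreal (M * indicator {0..h} s) * (indicator (cball 0 R) x + ennreal ((cmod (g (x + s *\<^sub>R b)))^2)) \<partial>lborel \<partial>lborel)"
 proof (intro nn_integral_mono)
  fix s :: real and x :: 'a
  have "norm (?F x s) <= (M * indicator {0..h} s) * (indicator (cball 0 R) x + (cmod (g (x + s *\<^sub>R b)))^2)"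
   using mult_mono[OF b(1)[of x] le_one_plus_square[of "cmod (g (x + s *\<^sub>R b))"]] b(2)[of x] M
   by (auto simp: indicator_def norm_mult)
  then show "ennreal (norm (?F x s)) <= ennreal (M * indicator {0..h} s) * (indicator (cball 0 R) x + ennreal ((cmod (g (x + s *\<^sub>R b)))^2))"
   using M by (auto simp: ennreal_mult[symmetric] ennreal_plus[symmetric] ennreal_indicator[symmetric] simp del: ennreal_plus intro!: ennreal_leI)
 qed
 also have "... = (\<integral>\<^sup>+s. ennreal (M * indicator {0..h} s) * (emeasure lborel (cball (0::'a) R) + (\<integral>\<^sup>+x. ennreal ((cmod (g x))^2) \<partial>lborel)) \<partial>lborel)"
 proof (intro nn_integral_cong)
  fix s :: real
  have "(\<integral>\<^sup>+x. ennreal ((cmod (g (x + s *\<^sub>R b)))^2) \<partial>lborel) = (\<integral>\<^sup>+x. ennreal ((cmod (g x))^2) \<partial>lborel)"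
   by (rule nn_integral_lborel_shift[of "%x. ennreal ((cmod (g x))^2)"]) simp
  have "(\<integral>\<^sup>+x. ennreal (M * indicator {0..h} s) * (indicator (cball 0 R) x + ennreal ((cmod (g (x + s *\<^sub>R b)))^2)) \<partial>lborel)
   = ennreal (M * indicator {0..h} s) * (\<integral>\<^sup>+x. indicator (cball 0 R) x + ennreal ((cmod (g (x + s *\<^sub>R b)))^2) \<partial>lborel)"
   by (rule nn_integral_cmult) measurable
  also have "(\<integral>\<^sup>+x. indicator (cball 0 R) x + ennreal ((cmod (g (x + s *\<^sub>R b)))^2) \<partial>lborel)
   = (\<integral>\<^sup>+x. indicator (cball (0::'a) R) x \<partial>lborel) + (\<integral>\<^sup>+x. ennreal ((cmod (g (x + s *\<^sub>R b)))^2) \<partial>lborel)"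
   by (rule nn_integral_add) measurable
  finally show "(\<integral>\<^sup>+x. ennreal (M * indicator {0..h} s) * (indicator (cball 0 R) x + ennreal ((cmod (g (x + s *\<^sub>R b)))^2)) \<partial>lborel)
    = ennreal (M * indicator {0..h} s) * (emeasure lborel (cball (0::'a) R) + (\<integral>\<^sup>+x. ennreal ((cmod (g x))^2) \<partial>lborel))"
   using \<open>(\<integral>\<^sup>+x. ennreal ((cmod (g (x + s *\<^sub>R b)))^2) \<partial>lborel) = _\<close> by simp
 qed
 also have "... = ennreal M * emeasure lborel {0..h} * (emeasure lborel (cball (0::'a) R) + (\<integral>\<^sup>+x. ennreal ((cmod (g x))^2) \<partial>lborel))"
  using M by (simp add: nn_integral_multc ennreal_mult nn_integral_cmult ennreal_indicator)
 also have "... < \<infinity>"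
  using fin emeasure_lborel_cball_finite[of "0::'a" R] emeasure_bounded_finite[of "{0..h}"] by (auto simp: ennreal_mult_less_top)
 finally show ?thesis by (intro integrableI_bounded) (auto simp: case_prod_beta)
qed

definition line_integral :: "('a::euclidean_space => complex) => 'a => real => 'a => complex" where
 "line_integral g b h x = (\<integral>s. indicator {0..h} s *\<^sub>R g (x + s *\<^sub>R b) \<partial>lborel)"

lemma line_integral_measurable: "L2 g ==> line_integral g b h \<in> borel_measurable borel"
proof -
 assume "L2 g"
 note [measurable] = L2_measurable[OF this]
 show ?thesis unfolding line_integral_def by measurable
qed

text \<open>By Fubini and translation invariance, the shift along the segment passes from
  \<open>g\<close> to the test function, with opposite sign.\<close>

lemma line_integral_test:
 fixes g :: "'a::euclidean_space => complex" and ph :: "'a => complex"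
 assumes g: "L2 g" and ph[measurable]: "ph \<in> borel_measurable borel" and b: "!!x. cmod (ph x) <= M" "!!x. R < norm x ==> ph x = 0"
 shows "integrable lborel (%x. ph x * line_integral g b h x)"
  and "(\<integral>x. ph x * line_integral g b h x \<partial>lborel)
   = (\<integral>s. indicator {0..h} s *\<^sub>R (\<integral>x. ph (x - s *\<^sub>R b) * g x \<partial>lborel) \<partial>lborel)"
proof -
 note [measurable] = L2_measurable[OF g]
 note I = shift_product_integrable[OF g ph b, where b=b and h=h]
 have E: "(\<integral>s. ph x * (indicator {0..h} s *\<^sub>R g (x + s *\<^sub>R b)) \<partial>lborel) = ph x * line_integral g b h x" for x
  unfolding line_integral_def by (rule integral_mult_right_zero)
 show "integrable lborel (%x. ph x * line_integral g b h x)"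
  using lborel_pair.integrable_fst'[OF I] by (simp only: E prod.case)
 have "(\<integral>x. ph x * line_integral g b h x \<partial>lborel) = (\<integral>s. (\<integral>x. ph x * (indicator {0..h} s *\<^sub>R g (x + s *\<^sub>R b)) \<partial>lborel) \<partial>lborel)"
  using lborel_pair.Fubini_integral[OF I] by (simp only: E prod.case)
 also have "... = (\<integral>s. indicator {0..h} s *\<^sub>R (\<integral>x. ph x * g (x + s *\<^sub>R b) \<partial>lborel) \<partial>lborel)"
  by simp
 also have "(%s. \<integral>x. ph x * g (x + s *\<^sub>R b) \<partial>lborel) = (%s. \<integral>x. ph (x - s *\<^sub>R b) * g x \<partial>lborel)"
 proof
  fix s show "(\<integral>x. ph x * g (x + s *\<^sub>R b) \<partial>lborel) = (\<integral>x. ph (x - s *\<^sub>R b) * g x \<partial>lborel)"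
   using lborel_shift(2)[of "%x. ph (x - s *\<^sub>R b) * g x" "s *\<^sub>R b"] by simp
 qed
 finally show "(\<integral>x. ph x * line_integral g b h x \<partial>lborel)
   = (\<integral>s. indicator {0..h} s *\<^sub>R (\<integral>x. ph (x - s *\<^sub>R b) * g x \<partial>lborel) \<partial>lborel)" .
qed

lemma L2_shift: "L2 f ==> L2 (%x. f (x + c))"
 unfolding L2_def using lborel_shift(1)[of "%x. (cmod (f x))^2" c] by auto

lemma emeasure_lborel_Icc_less_top [simp]: "emeasure lborel {a..b::real} < \<top>"
 using emeasure_bounded_finite[of "{a..b}"] by simp

lemma integrable_pair_mult:
 fixes f :: "'a::euclidean_space => real" and g :: "'b::euclidean_space => real"
 assumes f: "integrable lborel f" and g: "integrable lborel g"
 shows "integrable (lborel \<Otimes>\<^sub>M lborel) (%(x, y). f x * g y)"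
proof -
 have [measurable]: "f \<in> borel_measurable borel" "g \<in> borel_measurable borel" using f g by auto
 have "(\<integral>\<^sup>+z. norm (case z of (x, y) => f x * g y) \<partial>(lborel \<Otimes>\<^sub>M lborel)) = (\<integral>\<^sup>+x. \<integral>\<^sup>+y. norm (f x * g y) \<partial>lborel \<partial>lborel)"
  by (subst lborel.nn_integral_fst[symmetric]) (auto simp: case_prod_beta)
 also have "... = (\<integral>\<^sup>+x. ennreal (norm (f x)) * (\<integral>\<^sup>+y. norm (g y) \<partial>lborel) \<partial>lborel)"
  by (intro nn_integral_cong) (simp add: abs_mult ennreal_mult nn_integral_cmult)
 also have "... = (\<integral>\<^sup>+x. norm (f x) \<partial>lborel) * (\<integral>\<^sup>+y. norm (g y) \<partial>lborel)"
  by (simp add: nn_integral_multc)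
 also have "... < \<infinity>" using f g by (simp add: integrable_iff_bounded ennreal_mult_less_top)
 finally show ?thesis by (intro integrableI_bounded) (auto simp: case_prod_beta)
qed

lemma line_integral_local:
 assumes g: "L2 g"
 shows "integrable lborel (%x. indicator (cball 0 R) x *\<^sub>R line_integral g b h x)"
proof -
 have "integrable lborel (%x. complex_of_real (indicator (cball 0 R) x) * line_integral g b h x)"
  by (rule line_integral_test(1)[OF g, where M=1 and R=R]) (auto simp: indicator_def)
 then show ?thesis by (simp add: scaleR_conv_of_real)
qed

lemma test_fun_FTC:
 fixes ph :: "'a::euclidean_space => real"
 assumes t: "test_fun ph" and b: "b \<in> Basis" and "0 <= h"
 shows "(\<integral>s. indicator {0..h} s *\<^sub>R frechet_derivative ph (at (x - s *\<^sub>R b)) b \<partial>lborel) = ph x - ph (x - h *\<^sub>R b)"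
proof -
 have s: "smooth_fun ph" using t by (simp add: test_fun_def)
 have c: "continuous_on UNIV (%x. frechet_derivative ph (at x) b)"
  using smooth_funD(1)[OF smooth_funD(3)[OF s b]] .
 have "(\<integral>s. indicator {0..h} s *\<^sub>R frechet_derivative ph (at (x - s *\<^sub>R b)) b \<partial>lborel)
  = - ph (x - h *\<^sub>R b) - (- ph (x - 0 *\<^sub>R b))"
 proof (rule integral_FTC_Icc)
  show "0 <= h" by fact
  show "((%s. - ph (x - s *\<^sub>R b)) has_vector_derivative frechet_derivative ph (at (x - s *\<^sub>R b)) b) (at s within {0..h})" for s
  proof -
   have 1: "(ph has_derivative frechet_derivative ph (at (x - s *\<^sub>R b))) (at (x - s *\<^sub>R b))"
    using smooth_funD(2)[OF s] frechet_derivative_works by blast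
   have "((%s. ph (x - s *\<^sub>R b)) has_derivative (%d. frechet_derivative ph (at (x - s *\<^sub>R b)) (- (d *\<^sub>R b)))) (at s within {0..h})"
    by (rule has_derivative_compose[where g=ph and f="%s. x - s *\<^sub>R b", OF _ 1]) (auto intro!: derivative_eq_intros)
   moreover have "frechet_derivative ph (at (x - s *\<^sub>R b)) (- (d *\<^sub>R b)) = - (d * frechet_derivative ph (at (x - s *\<^sub>R b)) b)" for d
    using linear_frechet_derivative[OF smooth_funD(2)[OF s]] by (simp add: linear_cmul linear_neg)
   ultimately have "((%s. - ph (x - s *\<^sub>R b)) has_derivative (%d. d * frechet_derivative ph (at (x - s *\<^sub>R b)) b)) (at s within {0..h})"
    using has_derivative_minus by fastforce
   then show ?thesis by (simp add: has_vector_derivative_def)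
  qed
  show "continuous_on {0..h} (%s. frechet_derivative ph (at (x - s *\<^sub>R b)) b)"
   by (rule continuous_on_compose2[OF c]) (auto intro!: continuous_intros)
 qed
 then show ?thesis by simp
qed

text \<open>A weak derivative along \<open>b\<close> is a derivative along almost every line parallel to \<open>b\<close>, in integrated form.\<close>

lemma translation_formula:
 assumes f: "L2 f" and g: "L2 g" and w: "weak_partial f b g" and b: "b \<in> Basis" and h: "0 <= h"
 shows "AE x in lborel. f (x + h *\<^sub>R b) - f x = line_integral g b h x"
proof -
 note fm[measurable] = L2_measurable[OF f] and gm[measurable] = L2_measurable[OF g]
 note lm[measurable] = line_integral_measurable[OF g, of b h]
 have "AE x in lborel. f (x + h *\<^sub>R b) - f x - line_integral g b h x = 0"
 proof (rule ae_zero_of_test)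
  show "(%x. f (x + h *\<^sub>R b) - f x - line_integral g b h x) \<in> borel_measurable borel" by measurable
  show "integrable lborel (%x. indicator (cball 0 R) x *\<^sub>R (f (x + h *\<^sub>R b) - f x - line_integral g b h x))" for R
   using L2_local[OF L2_shift[OF f]] L2_local[OF f] line_integral_local[OF g]
   by (simp only: scaleR_diff_right) (intro Bochner_Integration.integrable_diff)
  fix ph :: "'a => real" assume t: "test_fun ph"
  obtain M R where R: "0 < R" "!!x. \<bar>ph x\<bar> <= M" "!!x. R < norm x ==> ph x = 0" using test_fun_bounds[OF t] by metis
  note pm[measurable] = test_fun_measurable[OF t]
  let ?d = "%x. frechet_derivative ph (at x) b"
  have td: "test_fun ?d" by (rule test_fun_partial[OF t b])
  obtain M' R' where R': "0 < R'" "!!x. \<bar>?d x\<bar> <= M'" "!!x. R' < norm x ==> ?d x = 0" using test_fun_bounds[OF td] by metis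
  note dm[measurable] = test_fun_measurable[OF td]
  have i1: "integrable lborel (%x. complex_of_real (ph x) * f (x + h *\<^sub>R b))"
   by (rule L2_times_bounded[OF L2_shift[OF f], of _ M R]) (use R in auto)
  have i2: "integrable lborel (%x. complex_of_real (ph x) * f x)"
   by (rule L2_times_bounded[OF f, of _ M R]) (use R in auto)
  have i3: "integrable lborel (%x. complex_of_real (ph x) * line_integral g b h x)"
   by (rule line_integral_test(1)[OF g, where M=M and R=R]) (use R in auto)
  have sz: "ph (x - s *\<^sub>R b) = 0" if "R + h < norm x" "s <= h" "0 <= s" for x s
  proof (rule R(3))
   have "norm x <= norm (x - s *\<^sub>R b) + norm (s *\<^sub>R b)" by (metis diff_add_cancel norm_triangle_ineq)
   then show "R < norm (x - s *\<^sub>R b)" using that b by simp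
  qed
  have i4: "integrable lborel (%x. complex_of_real (ph (x - h *\<^sub>R b)) * f x)"
   by (rule L2_times_bounded[OF f, of _ M "R + h"]) (use R sz h in auto)
  have sz': "?d (x - s *\<^sub>R b) = 0" if "R' + h < norm x" "s <= h" "0 <= s" for x s
  proof (rule R'(3))
   have "norm x <= norm (x - s *\<^sub>R b) + norm (s *\<^sub>R b)" by (metis diff_add_cancel norm_triangle_ineq)
   then show "R' < norm (x - s *\<^sub>R b)" using that b by simp
  qed
  have I: "integrable (lborel \<Otimes>\<^sub>M lborel) (%(x, s). (indicator {0..h} s *\<^sub>R complex_of_real (?d (x - s *\<^sub>R b))) * f x)"
  proof (rule Bochner_Integration.integrable_bound)
   have "integrable (lborel \<Otimes>\<^sub>M lborel) (%(x, s). (M' * norm (indicator (cball 0 (R' + h)) x *\<^sub>R f x)) * indicator {0..h} s)"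
    by (rule integrable_pair_mult) (use integrable_norm[OF L2_local[OF f]] emeasure_bounded_finite[of "{0..h}"] in "auto simp: integrable_indicator_iff")
   then show "integrable (lborel \<Otimes>\<^sub>M lborel) (%(x, s). (M' * norm (indicator (cball 0 (R' + h)) x *\<^sub>R f x)) * indicator {0..h} s)" .
   have M': "0 <= M'" using R'(2)[of 0] by (meson abs_ge_zero order_trans)
   have "norm ((indicator {0..h} s *\<^sub>R complex_of_real (?d (x - s *\<^sub>R b))) * f x) <= (M' * norm (indicator (cball 0 (R' + h)) x *\<^sub>R f x)) * indicator {0..h} s" for x s
   proof (cases "s \<in> {0..h} & norm x <= R' + h")
    case True then show ?thesis using mult_right_mono[OF R'(2)[of "x - s *\<^sub>R b"]] M' by (auto simp: norm_mult)
   next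
    case False then show ?thesis using sz'[of x s] M' by (auto simp: indicator_def)
   qed
   then show "AE z in lborel \<Otimes>\<^sub>M lborel. norm (case z of (x, s) => (indicator {0..h} s *\<^sub>R complex_of_real (?d (x - s *\<^sub>R b))) * f x)
    <= norm (case z of (x, s) => (M' * norm (indicator (cball 0 (R' + h)) x *\<^sub>R f x)) * indicator {0..h} s)"
    by (intro AE_I2) (auto intro!: order_trans[OF _ abs_ge_self] split: prod.splits)
  qed (simp add: case_prod_beta)
  \<comment> \<open>The shift is moved from \<open>f\<close> to \<open>ph\<close>, the difference of
    \<open>ph\<close> is written as an integral of its derivative along \<open>b\<close>, and under
    the \<open>s\<close>-integral the weak derivative is applied to the shifted test
    function.\<close>
  have "(\<integral>x. complex_of_real (ph x) * f (x + h *\<^sub>R b) \<partial>lborel) - (\<integral>x. complex_of_real (ph x) * f x \<partial>lborel)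
   = (\<integral>x. complex_of_real (ph (x - h *\<^sub>R b)) * f x \<partial>lborel) - (\<integral>x. complex_of_real (ph x) * f x \<partial>lborel)"
   using lborel_shift(2)[of "%x. complex_of_real (ph (x - h *\<^sub>R b)) * f x" "h *\<^sub>R b"] by simp
  also have "... = (\<integral>x. complex_of_real (ph (x - h *\<^sub>R b)) * f x - complex_of_real (ph x) * f x \<partial>lborel)"
   using i4 i2 by simp
  also have "... = - (\<integral>x. (\<integral>s. (indicator {0..h} s *\<^sub>R complex_of_real (?d (x - s *\<^sub>R b))) * f x \<partial>lborel) \<partial>lborel)"
  proof -
   have "(\<integral>s. (indicator {0..h} s *\<^sub>R complex_of_real (?d (x - s *\<^sub>R b))) * f x \<partial>lborel) = complex_of_real (ph x - ph (x - h *\<^sub>R b)) * f x" for x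
   proof -
    have "(\<integral>s. (indicator {0..h} s *\<^sub>R complex_of_real (?d (x - s *\<^sub>R b))) * f x \<partial>lborel)
     = (\<integral>s. complex_of_real (indicator {0..h} s *\<^sub>R ?d (x - s *\<^sub>R b)) \<partial>lborel) * f x"
     by (simp add: scaleR_conv_of_real)
    then show ?thesis unfolding integral_complex_of_real test_fun_FTC[OF t b h] .
   qed
   then show ?thesis unfolding Bochner_Integration.integral_minus[symmetric]
    by (intro Bochner_Integration.integral_cong) (auto simp: algebra_simps)
  qed
  also have "(\<integral>x. (\<integral>s. (indicator {0..h} s *\<^sub>R complex_of_real (?d (x - s *\<^sub>R b))) * f x \<partial>lborel) \<partial>lborel)
   = (\<integral>s. (\<integral>x. (indicator {0..h} s *\<^sub>R complex_of_real (?d (x - s *\<^sub>R b))) * f x \<partial>lborel) \<partial>lborel)"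
   using lborel_pair.Fubini_integral[OF I] by simp
  also have "... = (\<integral>s. indicator {0..h} s *\<^sub>R - (\<integral>x. complex_of_real (ph (x - s *\<^sub>R b)) * g x \<partial>lborel) \<partial>lborel)"
  proof (rule Bochner_Integration.integral_cong[OF refl])
   fix s :: real
   have ts: "test_fun (%x. ph (x - s *\<^sub>R b))" using test_fun_affine[OF t, of 1 "- s *\<^sub>R b"] by simp
   have "frechet_derivative (%x. ph (x - s *\<^sub>R b)) (at x) b = ?d (x - s *\<^sub>R b)" for x
    using frechet_affine[of ph 1 "- s *\<^sub>R b" x b] t by (simp add: test_fun_def)
   with w ts have "(\<integral>x. complex_of_real (?d (x - s *\<^sub>R b)) * f x \<partial>lborel) = - (\<integral>x. complex_of_real (ph (x - s *\<^sub>R b)) * g x \<partial>lborel)"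
    unfolding weak_partial_def by auto
   then show "(\<integral>x. (indicator {0..h} s *\<^sub>R complex_of_real (?d (x - s *\<^sub>R b))) * f x \<partial>lborel)
    = indicator {0..h} s *\<^sub>R - (\<integral>x. complex_of_real (ph (x - s *\<^sub>R b)) * g x \<partial>lborel)"
    by simp
  qed
  also have "- ... = (\<integral>x. complex_of_real (ph x) * line_integral g b h x \<partial>lborel)"
   using line_integral_test(2)[OF g, where ph="%x. complex_of_real (ph x)" and M=M and R=R and h=h and b=b] R by simp
  finally show "(\<integral>x. complex_of_real (ph x) * (f (x + h *\<^sub>R b) - f x - line_integral g b h x) \<partial>lborel) = 0"
   using i1 i2 i3 by (simp add: right_diff_distrib)
 qed
 then show ?thesis by simp
qed

text \<open>Lipschitz functions of bounded support are admissible in the definition of the weak derivative.\<close>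

lemma weak_partial_lipschitz_test:
 fixes \<psi> \<psi>' :: "'a::euclidean_space => real"
 assumes f: "L2 f" and g: "L2 g" and w: "weak_partial f b g" and b: "b \<in> Basis"
  and pm[measurable]: "\<psi> \<in> borel_measurable borel" "\<psi>' \<in> borel_measurable borel"
  and bd: "!!x. \<bar>\<psi> x\<bar> <= M" and sp: "!!x. R < norm x ==> \<psi> x = 0"
  and lip: "!!x t. \<bar>\<psi> (x + t *\<^sub>R b) - \<psi> x\<bar> <= C * \<bar>t\<bar>"
  and der: "AE x in lborel. ((%t. \<psi> (x + t *\<^sub>R b)) has_real_derivative \<psi>' x) (at 0)"
 shows "(\<integral>x. complex_of_real (\<psi>' x) * f x \<partial>lborel) = - (\<integral>x. complex_of_real (\<psi> x) * g x \<partial>lborel)"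
proof -
 note fm[measurable] = L2_measurable[OF f] and gm[measurable] = L2_measurable[OF g]
 have C: "0 <= C" using lip[of 0 1] by (auto intro: order_trans[OF abs_ge_zero])
 have sz: "\<psi> (x + s *\<^sub>R b) = 0" if "R + 1 < norm x" "\<bar>s\<bar> <= 1" for x s
 proof (rule sp)
  have "norm x <= norm (x + s *\<^sub>R b) + norm (s *\<^sub>R b)" by (metis add_diff_cancel norm_triangle_ineq4)
  then show "R < norm (x + s *\<^sub>R b)" using that b by simp
 qed
 have sz0: "\<psi> x = 0" if "R + 1 < norm x" for x using sz[of x 0] that by simp
 define B where "B = (\<integral>x. norm (indicator (cball 0 (R+1)) x *\<^sub>R g x) \<partial>lborel)"
 define A where "A = (\<integral>x. complex_of_real (\<psi> x) * g x \<partial>lborel)"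
 have i0: "integrable lborel (%x. complex_of_real (\<psi> (x + s *\<^sub>R b)) * k x)" if "\<bar>s\<bar> <= 1" "L2 k" for s k
  by (rule L2_times_bounded[OF that(2), of _ M "R + 1"]) (use bd sz that in auto)
 \<comment> \<open>Shifting a Lipschitz function by \<open>s\<close> changes its pairing with
   \<open>g\<close> by at most \<open>C * s * B\<close>, where \<open>B\<close> is the L1 norm of
   \<open>g\<close> near the support.\<close>
 have near: "norm ((\<integral>x. complex_of_real (\<psi> (x - s *\<^sub>R b)) * g x \<partial>lborel) - A) <= C * s * B" if "0 <= s" "s <= 1" for s
 proof -
  have "(\<integral>x. complex_of_real (\<psi> (x - s *\<^sub>R b)) * g x \<partial>lborel) - A = (\<integral>x. complex_of_real (\<psi> (x - s *\<^sub>R b)) * g x - complex_of_real (\<psi> x) * g x \<partial>lborel)"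
   unfolding A_def using i0[OF _ g, of "-s"] i0[OF _ g, of 0] that by simp
  also have "norm ... <= (\<integral>x. C * s * norm (indicator (cball 0 (R+1)) x *\<^sub>R g x) \<partial>lborel)"
  proof (rule Bochner_Integration.integral_norm_bound_integral)
   show "integrable lborel (%x. complex_of_real (\<psi> (x - s *\<^sub>R b)) * g x - complex_of_real (\<psi> x) * g x)"
    using i0[OF _ g, of "-s"] i0[OF _ g, of 0] that by simp
   show "integrable lborel (%x. C * s * norm (indicator (cball 0 (R+1)) x *\<^sub>R g x))"
    by (intro integrable_mult_right integrable_norm L2_local g)
   fix x
   have "norm (complex_of_real (\<psi> (x - s *\<^sub>R b)) * g x - complex_of_real (\<psi> x) * g x) = \<bar>\<psi> (x + (-s) *\<^sub>R b) - \<psi> x\<bar> * norm (g x)"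
    by (simp add: left_diff_distrib[symmetric] norm_mult flip: of_real_diff)
   also have "... <= C * s * norm (indicator (cball 0 (R+1)) x *\<^sub>R g x)"
    using lip[of x "-s"] sz[of x "-s"] sz0[of x] that mult_right_mono[OF lip[of x "-s"], of "norm (g x)"] by (auto simp: indicator_def)
   finally show "norm (complex_of_real (\<psi> (x - s *\<^sub>R b)) * g x - complex_of_real (\<psi> x) * g x) <= C * s * norm (indicator (cball 0 (R+1)) x *\<^sub>R g x)" .
  qed
  also have "... = C * s * B" by (simp add: B_def)
  finally show ?thesis .
 qed
 have B: "0 <= B" unfolding B_def by simp
 \<comment> \<open>A backward difference quotient: moving its shift onto \<open>f\<close> gives the
   forward translate of \<open>translation_formula\<close>. Its limit is computed twice, by
   dominated convergence and through the line integral of \<open>g\<close>.\<close>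
 define Q where "Q = (%h. \<integral>x. complex_of_real ((\<psi> (x + (-h) *\<^sub>R b) - \<psi> x) / (-h)) * f x \<partial>lborel)"
 have Q: "norm (Q h + A) <= C * h * B" if "0 < h" "h <= 1" for h
 proof -
  let ?J = "%s. \<integral>x. complex_of_real (\<psi> (x - s *\<^sub>R b)) * g x \<partial>lborel"
  have "complex_of_real h * Q h = (\<integral>x. complex_of_real (\<psi> x) * f x - complex_of_real (\<psi> (x - h *\<^sub>R b)) * f x \<partial>lborel)"
   unfolding Q_def integral_mult_right_zero[symmetric] using that
   by (intro Bochner_Integration.integral_cong) (auto simp: field_simps)
  also have "... = (\<integral>x. complex_of_real (\<psi> x) * f x \<partial>lborel) - (\<integral>x. complex_of_real (\<psi> (x - h *\<^sub>R b)) * f x \<partial>lborel)"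
   using i0[OF _ f, of "-h"] i0[OF _ f, of 0] that by simp
  also have "(\<integral>x. complex_of_real (\<psi> (x - h *\<^sub>R b)) * f x \<partial>lborel) = (\<integral>x. complex_of_real (\<psi> x) * f (x + h *\<^sub>R b) \<partial>lborel)"
   using lborel_shift(2)[of "%x. complex_of_real (\<psi> (x - h *\<^sub>R b)) * f x" "h *\<^sub>R b"] by simp
  also have "... = (\<integral>x. complex_of_real (\<psi> x) * f x + complex_of_real (\<psi> x) * line_integral g b h x \<partial>lborel)"
  proof (rule integral_cong_AE)
   show "AE x in lborel. complex_of_real (\<psi> x) * f (x + h *\<^sub>R b) = complex_of_real (\<psi> x) * f x + complex_of_real (\<psi> x) * line_integral g b h x"
    using translation_formula[OF f g w b, of h] that
    by (auto elim!: eventually_mono simp: algebra_simps)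
  qed (use line_integral_measurable[OF g, of b h] in measurable)
  also have "... = (\<integral>x. complex_of_real (\<psi> x) * f x \<partial>lborel) + (\<integral>x. complex_of_real (\<psi> x) * line_integral g b h x \<partial>lborel)"
   using i0[OF _ f, of 0] line_integral_test(1)[OF g, where ph="%x. complex_of_real (\<psi> x)" and M=M and R=R and h=h and b=b] bd sp by simp
  also have "(\<integral>x. complex_of_real (\<psi> x) * line_integral g b h x \<partial>lborel) = (\<integral>s. indicator {0..h} s *\<^sub>R ?J s \<partial>lborel)"
   using line_integral_test(2)[OF g, where ph="%x. complex_of_real (\<psi> x)" and M=M and R=R and h=h and b=b] bd sp by simp
  finally have 1: "complex_of_real h * Q h = - (\<integral>s. indicator {0..h} s *\<^sub>R ?J s \<partial>lborel)" by simp
  have Jm[measurable]: "?J \<in> borel_measurable borel" by measurable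
  have JB: "norm (?J s - A) <= C * h * B" if "s \<in> {0..h}" for s
   using near[of s] that \<open>h <= 1\<close> C B mult_right_mono[OF mult_left_mono[of s h C], of B] by auto
  have iJ: "integrable lborel (%s. indicator {0..h} s *\<^sub>R (?J s - A))"
  proof (rule Bochner_Integration.integrable_bound)
   show "integrable lborel (%s::real. (C * h * B) * indicator {0..h} s)"
    by (intro integrable_mult_right) (simp add: integrable_indicator_iff)
   show "AE s in lborel. norm (indicator {0..h} s *\<^sub>R (?J s - A)) <= norm ((C * h * B) * indicator {0..h} s)"
    using JB by (intro AE_I2) (auto simp: indicator_def intro: order_trans[OF _ abs_ge_self])
  qed measurable
  have iA: "integrable lborel (%s::real. indicator {0..h} s *\<^sub>R A)"
   by (intro integrable_scaleR_left) (simp add: integrable_indicator_iff)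
  have "(\<integral>s. indicator {0..h} s *\<^sub>R ?J s \<partial>lborel) = (\<integral>s. indicator {0..h} s *\<^sub>R (?J s - A) + indicator {0..h} s *\<^sub>R A \<partial>lborel)"
   by (intro Bochner_Integration.integral_cong) (auto simp: algebra_simps)
  also have "... = (\<integral>s. indicator {0..h} s *\<^sub>R (?J s - A) \<partial>lborel) + complex_of_real h * A"
   using that by (subst Bochner_Integration.integral_add[OF iJ iA]) (simp add: scaleR_conv_of_real)
  finally have 2: "(\<integral>s. indicator {0..h} s *\<^sub>R ?J s \<partial>lborel) = (\<integral>s. indicator {0..h} s *\<^sub>R (?J s - A) \<partial>lborel) + complex_of_real h * A" .
  have "complex_of_real h * (Q h + A) = - (\<integral>s. indicator {0..h} s *\<^sub>R (?J s - A) \<partial>lborel)"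
   using 1 unfolding 2 distrib_left by simp
  moreover have "norm (\<integral>s. indicator {0..h} s *\<^sub>R (?J s - A) \<partial>lborel) <= (\<integral>s. (C * h * B) * indicator {0..h} s \<partial>lborel)"
  proof (rule Bochner_Integration.integral_norm_bound_integral[OF iJ])
   show "integrable lborel (%s::real. (C * h * B) * indicator {0..h} s)"
    by (intro integrable_mult_right) (simp add: integrable_indicator_iff)
   show "norm (indicator {0..h} s *\<^sub>R (?J s - A)) <= (C * h * B) * indicator {0..h} s" for s
    using JB[of s] by (cases "s \<in> {0..h}") (simp_all only: indicator_simps, simp_all)
  qed
  ultimately have "norm (complex_of_real h * (Q h + A)) <= (\<integral>s. (C * h * B) * indicator {0..h} s \<partial>lborel)"
   by (simp only: norm_minus_cancel)
  also have "... = h * (C * h * B)" using that by simp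
  finally show ?thesis using that by (simp add: norm_mult)
 qed
 let ?h = "%n. inverse (real (Suc n))"
 have "(%n. Q (?h n)) \<longlonglongrightarrow> (\<integral>x. complex_of_real (\<psi>' x) * f x \<partial>lborel)"
  unfolding Q_def
 proof (rule integral_dominated_convergence[where w="%x. C * norm (indicator (cball 0 (R+1)) x *\<^sub>R f x)"])
  show "integrable lborel (%x. C * norm (indicator (cball 0 (R+1)) x *\<^sub>R f x))"
   by (intro integrable_mult_right integrable_norm L2_local f)
  show "AE x in lborel. (%n. complex_of_real ((\<psi> (x + (- ?h n) *\<^sub>R b) - \<psi> x) / (- ?h n)) * f x) \<longlonglongrightarrow> complex_of_real (\<psi>' x) * f x"
   using der
  proof eventually_elim
   fix x assume "((%t. \<psi> (x + t *\<^sub>R b)) has_real_derivative \<psi>' x) (at 0)"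
   then have D: "((%h. (\<psi> (x + h *\<^sub>R b) - \<psi> x) / h) \<longlongrightarrow> \<psi>' x) (at 0)" by (simp add: DERIV_def)
   have "filterlim (%n. - ?h n) (at 0) sequentially"
   proof -
    have "(%n. - ?h n) \<longlonglongrightarrow> - 0" by (intro tendsto_minus LIMSEQ_inverse_real_of_nat)
    then show ?thesis by (auto simp: filterlim_at)
   qed
   from filterlim_compose[OF D this]
   show "(%n. complex_of_real ((\<psi> (x + (- ?h n) *\<^sub>R b) - \<psi> x) / (- ?h n)) * f x) \<longlonglongrightarrow> complex_of_real (\<psi>' x) * f x"
    by (intro tendsto_intros)
  qed
  fix n
  have h: "0 < ?h n" "?h n <= 1" by (auto simp: inverse_le_1_iff)
  show "AE x in lborel. norm (complex_of_real ((\<psi> (x + (- ?h n) *\<^sub>R b) - \<psi> x) / (- ?h n)) * f x) <= C * norm (indicator (cball 0 (R+1)) x *\<^sub>R f x)"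
  proof (rule AE_I2)
   fix x
   have "\<bar>(\<psi> (x + (- ?h n) *\<^sub>R b) - \<psi> x) / (- ?h n)\<bar> <= C"
    using lip[of x "- ?h n"] h unfolding abs_divide by (simp add: pos_divide_le_eq del: of_nat_Suc)
   moreover have "(\<psi> (x + (- ?h n) *\<^sub>R b) - \<psi> x) / (- ?h n) = 0" if "x \<notin> cball 0 (R+1)"
    using sz[of x "- ?h n"] sz0[of x] that h by (simp del: of_nat_Suc)
   ultimately show "norm (complex_of_real ((\<psi> (x + (- ?h n) *\<^sub>R b) - \<psi> x) / (- ?h n)) * f x) <= C * norm (indicator (cball 0 (R+1)) x *\<^sub>R f x)"
    using mult_right_mono[of "\<bar>(\<psi> (x + (- ?h n) *\<^sub>R b) - \<psi> x) / (- ?h n)\<bar>" C "norm (f x)"]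
    unfolding norm_mult norm_of_real by (cases "x \<in> cball 0 (R+1)") (simp_all del: of_nat_Suc)
  qed
 qed measurable
 moreover have "(%n. Q (?h n)) \<longlonglongrightarrow> - A"
 proof -
  have "(%n. C * ?h n * B) \<longlonglongrightarrow> C * 0 * B" by (intro tendsto_intros LIMSEQ_inverse_real_of_nat)
  then have "(%n. C * ?h n * B) \<longlonglongrightarrow> 0" by simp
  then have "(%n. Q (?h n) + A) \<longlonglongrightarrow> 0"
   by (rule Lim_null_comparison[rotated]) (intro always_eventually allI Q, auto simp: inverse_le_1_iff)
  from tendsto_diff[OF this tendsto_const[of A]] show ?thesis by simp
 qed
 ultimately show ?thesis unfolding A_def by (rule LIMSEQ_unique)
qed

lemma L2_bounded_mult:
 assumes "L2 f" and [measurable]: "m \<in> borel_measurable borel" and "!!x. cmod (m x) <= M"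
 shows "L2 (%x. m x * f x)"
proof -
 note [measurable] = L2_measurable[OF assms(1)]
 have "integrable lborel (%x. (cmod (m x * f x))^2)"
 proof (rule Bochner_Integration.integrable_bound)
  show "integrable lborel (%x. M^2 * (cmod (f x))^2)" using L2_square_integrable[OF assms(1)] by simp
  show "AE x in lborel. norm ((cmod (m x * f x))^2) <= norm (M^2 * (cmod (f x))^2)"
   using assms(3) by (auto simp: norm_mult power_mult_distrib intro!: mult_right_mono power_mono)
 qed measurable
 then show ?thesis by (auto simp: L2_def)
qed

lemma L2_cmult: "L2 f ==> L2 (%x. c * f x)"
 by (rule L2_bounded_mult[where M="cmod c"]) auto

lemma L2_add: "L2 f ==> L2 g ==> L2 (%x. f x + g x)"
 using L2_diff[of f "%x. - 1 * g x"] L2_cmult[of g "-1"] by simp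

lemma L2_zero: "L2 (%x. 0)"
 by (simp add: L2_def)

lemma L2_sum: "finite K ==> (!!k. k \<in> K ==> L2 (f k)) ==> L2 (%x. \<Sum>k\<in>K. f k x)"
 by (induction K rule: finite_induct) (auto intro: L2_zero L2_add)

lemma L2_test_integrable:
 assumes "L2 f" "test_fun ph"
 shows "integrable lborel (%x. complex_of_real (ph x) * f x)"
proof -
 obtain M R where R: "!!x. \<bar>ph x\<bar> <= M" "!!x. R < norm x ==> ph x = 0" using test_fun_bounds[OF assms(2)] by metis
 note [measurable] = test_fun_measurable[OF assms(2)]
 show ?thesis by (rule L2_times_bounded[OF assms(1), of _ M R]) (use R in auto)
qed

lemma weak_partial_cmult:
 "weak_partial f b g ==> weak_partial (%x. c * f x) b (%x. c * g x)"
 unfolding weak_partial_def by (simp add: mult.left_commute[of _ c])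

lemma weak_partial_add:
 assumes "L2 f" "L2 f'" "L2 g" "L2 g'" "b \<in> Basis" "weak_partial f b g" "weak_partial f' b g'"
 shows "weak_partial (%x. f x + f' x) b (%x. g x + g' x)"
 unfolding weak_partial_def
proof (intro allI impI)
 fix ph :: "'a => real" assume t: "test_fun ph"
 show "(\<integral>x. complex_of_real (frechet_derivative ph (at x) b) * (f x + f' x) \<partial>lborel) = - (\<integral>x. complex_of_real (ph x) * (g x + g' x) \<partial>lborel)"
  using assms t L2_test_integrable[OF _ t] L2_test_integrable[OF _ test_fun_partial[OF t assms(5)]]
  by (simp add: distrib_left weak_partial_def)
qed

lemma weak_partial_sum:
 assumes "finite K" "b \<in> Basis" "!!k. k \<in> K ==> L2 (f k) & L2 (g k) & weak_partial (f k) b (g k)"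
 shows "weak_partial (%x. \<Sum>k\<in>K. f k x) b (%x. \<Sum>k\<in>K. g k x)"
 using assms
proof (induction K rule: finite_induct)
 case empty show ?case by (simp add: weak_partial_def)
next
 case (insert k K)
 then show ?case by (simp, intro weak_partial_add) (auto intro!: L2_sum)
qed

lemma test_fun_line_derivative:
 assumes "smooth_fun ph"
 shows "((%t. ph (x + t *\<^sub>R b)) has_real_derivative frechet_derivative ph (at (x + t *\<^sub>R b)) b) (at t within S)"
proof -
 have 1: "(ph has_derivative frechet_derivative ph (at (x + t *\<^sub>R b))) (at (x + t *\<^sub>R b))"
  using smooth_funD(2)[OF assms] frechet_derivative_works by blast
 have "((%s. ph (x + s *\<^sub>R b)) has_derivative (%d. frechet_derivative ph (at (x + t *\<^sub>R b)) (d *\<^sub>R b))) (at t within S)"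
  by (rule has_derivative_compose[where g=ph and f="%s. x + s *\<^sub>R b", OF _ 1]) (auto intro!: derivative_eq_intros)
 then show ?thesis
  using linear_frechet_derivative[OF smooth_funD(2)[OF assms], of "x + t *\<^sub>R b"]
  by (simp add: has_field_derivative_def linear_cmul mult.commute[of "frechet_derivative _ _ _"] mult_commute_abs)
qed

lemma test_fun_lipschitz:
 assumes t: "test_fun ph" and b: "b \<in> Basis"
 obtains C where "0 <= C" "!!x t. \<bar>ph (x + t *\<^sub>R b) - ph x\<bar> <= C * \<bar>t\<bar>"
proof -
 obtain M where M: "0 < M" "!!x. \<bar>frechet_derivative ph (at x) b\<bar> <= M"
  using test_fun_bounds[OF test_fun_partial[OF t b]] by metis
 have s: "smooth_fun ph" using t by (simp add: test_fun_def)
 have "\<bar>ph (x + t *\<^sub>R b) - ph x\<bar> <= M * \<bar>t\<bar>" for x t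
  using field_differentiable_bound[of UNIV "%t. ph (x + t *\<^sub>R b)" "%t. frechet_derivative ph (at (x + t *\<^sub>R b)) b" M t 0]
   test_fun_line_derivative[OF s, of x b] M(2) by auto
 then show ?thesis using M(1) by (intro that[of M]) auto
qed

text \<open>Product rule for a factor depending on one coordinate. The factor is absorbed into the
  test function, which stays Lipschitz with bounded support; the finitely many corners in
  \<open>S\<close> only affect hyperplanes of measure 0.\<close>

lemma weak_partial_mult_coordinate:
 fixes m m' :: "real => real" and f g :: "'a::euclidean_space => complex"
 assumes f: "L2 f" and g: "L2 g" and w: "weak_partial f b g" and b: "b \<in> Basis" and b': "b' \<in> Basis"
  and mm[measurable]: "m \<in> borel_measurable borel" "m' \<in> borel_measurable borel"
  and mB: "!!t. \<bar>m t\<bar> <= M" and mL: "!!s t. \<bar>m s - m t\<bar> <= C * \<bar>s - t\<bar>" and m'B: "!!t. \<bar>m' t\<bar> <= C"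
  and S: "finite S" and md: "!!t. t \<notin> S ==> (m has_real_derivative m' t) (at t)"
 shows "weak_partial (%x. complex_of_real (m (x \<bullet> b')) * f x) b
  (%x. complex_of_real (m (x \<bullet> b')) * g x + (if b = b' then complex_of_real (m' (x \<bullet> b')) * f x else 0))"
 unfolding weak_partial_def
proof (intro allI impI)
 fix ph :: "'a => real" assume t: "test_fun ph"
 have s: "smooth_fun ph" using t by (simp add: test_fun_def)
 obtain M1 R where R: "0 < M1" "0 < R" "!!x. \<bar>ph x\<bar> <= M1" "!!x. R < norm x ==> ph x = 0" using test_fun_bounds[OF t] by metis
 obtain C1 where C1: "0 <= C1" "!!x t. \<bar>ph (x + t *\<^sub>R b) - ph x\<bar> <= C1 * \<bar>t\<bar>" using test_fun_lipschitz[OF t b] by metis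
 note pm[measurable] = test_fun_measurable[OF t]
 let ?d = "%x. frechet_derivative ph (at x) b"
 note td = test_fun_partial[OF t b]
 note dm[measurable] = test_fun_measurable[OF td]
 have M: "0 <= M" using mB[of 0] by linarith
 have C: "0 <= C" using m'B[of 0] by linarith
 define \<psi> where "\<psi> = (%x. ph x * m (x \<bullet> b'))"
 define \<psi>' where "\<psi>' = (%x. ?d x * m (x \<bullet> b') + (if b = b' then ph x * m' (x \<bullet> b') else 0))"
 have PSI: "(\<integral>x. complex_of_real (\<psi>' x) * f x \<partial>lborel) = - (\<integral>x. complex_of_real (\<psi> x) * g x \<partial>lborel)"
 proof (rule weak_partial_lipschitz_test[OF f g w b, where M="M1 * M" and R=R and C="C1 * M + M1 * C"])
  show "\<psi> \<in> borel_measurable borel" "\<psi>' \<in> borel_measurable borel" unfolding \<psi>_def \<psi>'_def by measurable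
  show "\<bar>\<psi> x\<bar> <= M1 * M" for x unfolding \<psi>_def abs_mult using R(1,3) mB by (intro mult_mono) (auto intro: less_imp_le)
  show "R < norm x ==> \<psi> x = 0" for x using R(4) by (simp add: \<psi>_def)
  show "\<bar>\<psi> (x + t *\<^sub>R b) - \<psi> x\<bar> <= (C1 * M + M1 * C) * \<bar>t\<bar>" for x t
  proof -
   have "\<psi> (x + t *\<^sub>R b) - \<psi> x = (ph (x + t *\<^sub>R b) - ph x) * m ((x + t *\<^sub>R b) \<bullet> b') + ph x * (m ((x + t *\<^sub>R b) \<bullet> b') - m (x \<bullet> b'))"
    by (simp add: \<psi>_def algebra_simps)
   also have "\<bar>...\<bar> <= C1 * \<bar>t\<bar> * M + M1 * (C * \<bar>t\<bar>)"
   proof -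
    have "\<bar>m ((x + t *\<^sub>R b) \<bullet> b') - m (x \<bullet> b')\<bar> <= C * \<bar>(x + t *\<^sub>R b) \<bullet> b' - x \<bullet> b'\<bar>" by (rule mL)
    also have "... <= C * \<bar>t\<bar>" using b b' C by (auto simp: inner_add_left inner_Basis intro!: mult_left_mono)
    finally have 2: "\<bar>m ((x + t *\<^sub>R b) \<bullet> b') - m (x \<bullet> b')\<bar> <= C * \<bar>t\<bar>" .
    have "\<bar>ph (x + t *\<^sub>R b) - ph x\<bar> * \<bar>m ((x + t *\<^sub>R b) \<bullet> b')\<bar> <= (C1 * \<bar>t\<bar>) * M"
     using C1 mB by (intro mult_mono) auto
    moreover have "\<bar>ph x\<bar> * \<bar>m ((x + t *\<^sub>R b) \<bullet> b') - m (x \<bullet> b')\<bar> <= M1 * (C * \<bar>t\<bar>)"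
     using 2 R(1,3) by (intro mult_mono) (auto intro: less_imp_le)
    ultimately show ?thesis by (intro order_trans[OF abs_triangle_ineq]) (auto simp: abs_mult intro: add_mono)
   qed
   finally show ?thesis by (simp add: algebra_simps)
  qed
  have "AE x in lborel. \<forall>s\<in>S. x \<bullet> b' ~= s"
   using S AE_lborel_inner_neq[OF b'] by (intro AE_finite_allI)
  then show "AE x in lborel. ((%t. \<psi> (x + t *\<^sub>R b)) has_real_derivative \<psi>' x) (at 0)"
  proof eventually_elim
   fix x assume a: "\<forall>s\<in>S. x \<bullet> b' ~= s"
   have 1: "((%t. ph (x + t *\<^sub>R b)) has_real_derivative ?d x) (at 0)"
    using test_fun_line_derivative[OF s, of x b 0 UNIV] by simp
   have d: "(m has_real_derivative m' (x \<bullet> b')) (at (x \<bullet> b' + 0 * (b \<bullet> b')))" using md a by auto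
   have "((%t. m (x \<bullet> b' + t * (b \<bullet> b'))) has_real_derivative m' (x \<bullet> b') * (b \<bullet> b')) (at 0)"
    by (rule DERIV_chain2[of m _ "%t. x \<bullet> b' + t * (b \<bullet> b')", OF d]) (auto intro!: derivative_eq_intros)
   then have 2: "((%t. m ((x + t *\<^sub>R b) \<bullet> b')) has_real_derivative m' (x \<bullet> b') * (b \<bullet> b')) (at 0)"
    by (simp add: inner_add_left)
   show "((%t. \<psi> (x + t *\<^sub>R b)) has_real_derivative \<psi>' x) (at 0)"
    unfolding \<psi>_def \<psi>'_def using DERIV_mult[OF 1 2] b b'
    by (cases "b = b'") (auto simp: inner_Basis mult.commute)
  qed
 qed
 have i1: "integrable lborel (%x. complex_of_real (?d x) * (complex_of_real (m (x \<bullet> b')) * f x))"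
  by (rule L2_test_integrable[OF _ td]) (rule L2_bounded_mult[OF f, where M=M], use mB in auto)
 have i2: "integrable lborel (%x. complex_of_real (ph x) * (complex_of_real (m' (x \<bullet> b')) * f x))"
  by (rule L2_test_integrable[OF _ t]) (rule L2_bounded_mult[OF f, where M=C], use m'B in auto)
 have i3: "integrable lborel (%x. complex_of_real (ph x) * (complex_of_real (m (x \<bullet> b')) * g x))"
  by (rule L2_test_integrable[OF _ t]) (rule L2_bounded_mult[OF g, where M=M], use mB in auto)
 show "(\<integral>x. complex_of_real (?d x) * (complex_of_real (m (x \<bullet> b')) * f x) \<partial>lborel)
  = - (\<integral>x. complex_of_real (ph x) * (complex_of_real (m (x \<bullet> b')) * g x + (if b = b' then complex_of_real (m' (x \<bullet> b')) * f x else 0)) \<partial>lborel)"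
 proof (cases "b = b'")
  case True
  let ?P = "\<integral>x. complex_of_real (?d x) * (complex_of_real (m (x \<bullet> b')) * f x) \<partial>lborel"
  let ?Q = "\<integral>x. complex_of_real (ph x) * (complex_of_real (m' (x \<bullet> b')) * f x) \<partial>lborel"
  have "(\<integral>x. complex_of_real (\<psi>' x) * f x \<partial>lborel) = ?P + ?Q"
   using True by (subst Bochner_Integration.integral_add[OF i1 i2, symmetric]) (auto simp: \<psi>'_def algebra_simps)
  then have "?P + ?Q = - (\<integral>x. complex_of_real (\<psi> x) * g x \<partial>lborel)" using PSI by (simp only:)
  moreover have "p = - (s + q)" if "p + q = - s" for p q s :: complex
  proof -
   have "p = (p + q) - q" by simp
   then show ?thesis unfolding that by simp
  qed
  ultimately have "?P = - ((\<integral>x. complex_of_real (\<psi> x) * g x \<partial>lborel) + ?Q)" by blast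
  also have "(\<integral>x. complex_of_real (\<psi> x) * g x \<partial>lborel) + ?Q = (\<integral>x. complex_of_real (ph x) * (complex_of_real (m (x \<bullet> b')) * g x) + complex_of_real (ph x) * (complex_of_real (m' (x \<bullet> b')) * f x) \<partial>lborel)"
   by (subst Bochner_Integration.integral_add[OF i3 i2]) (simp add: \<psi>_def mult.assoc)
  finally show ?thesis unfolding distrib_left using True by simp
 next
  case False
  then show ?thesis using PSI
   by (simp add: \<psi>_def \<psi>'_def mult.assoc)
 qed
qed

section \<open>Dilations and the L2 modulus of continuity\<close>

lemma nn_integral_lborel_scale:
 fixes F :: "'a::euclidean_space => ennreal"
 assumes [measurable]: "F \<in> borel_measurable borel" and "c > 0"
 shows "(\<integral>\<^sup>+x. F x \<partial>lborel) = ennreal (c ^ DIM('a)) * (\<integral>\<^sup>+x. F (c *\<^sub>R x) \<partial>lborel)"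
proof -
 have "(\<integral>\<^sup>+x. F x \<partial>lborel) = (\<integral>\<^sup>+x. F x \<partial>density (distr lborel borel (%x. 0 + c *\<^sub>R x)) (%_. \<bar>c\<bar> ^ DIM('a)))"
  using lborel_affine[of c "0::'a"] assms(2) by simp
 also have "... = (\<integral>\<^sup>+x. ennreal (c ^ DIM('a)) * F (c *\<^sub>R x) \<partial>lborel)"
  using assms(2) by (simp add: nn_integral_density nn_integral_distr)
 finally show ?thesis by (simp add: nn_integral_cmult)
qed

lemma lborel_scale:
 fixes F :: "'a::euclidean_space => 'b::{banach, second_countable_topology}"
 assumes [measurable]: "F \<in> borel_measurable borel" and "c > 0"
 shows "integrable lborel (%x. F (c *\<^sub>R x)) \<longleftrightarrow> integrable lborel F"
  and "(\<integral>x. F x \<partial>lborel) = (c ^ DIM('a)) *\<^sub>R (\<integral>x. F (c *\<^sub>R x) \<partial>lborel)"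
proof -
 have "(\<integral>\<^sup>+x. norm (F x) \<partial>lborel) = ennreal (c ^ DIM('a)) * (\<integral>\<^sup>+x. norm (F (c *\<^sub>R x)) \<partial>lborel)"
  by (rule nn_integral_lborel_scale) (use assms in auto)
 then show "integrable lborel (%x. F (c *\<^sub>R x)) \<longleftrightarrow> integrable lborel F"
  using assms(2) by (auto simp: integrable_iff_bounded ennreal_mult_less_top)
 have "(\<integral>x. F x \<partial>lborel) = (\<integral>x. F x \<partial>density (distr lborel borel (%x. 0 + c *\<^sub>R x)) (%_. ennreal (\<bar>c\<bar> ^ DIM('a))))"
  using lborel_affine[of c "0::'a"] assms(2) by simp
 also have "... = (\<integral>x. (c ^ DIM('a)) *\<^sub>R F (c *\<^sub>R x) \<partial>lborel)"
  using assms(2) by (subst integral_density) (auto simp: integral_distr)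
 finally show "(\<integral>x. F x \<partial>lborel) = (c ^ DIM('a)) *\<^sub>R (\<integral>x. F (c *\<^sub>R x) \<partial>lborel)" by simp
qed

lemma L2_scale: "L2 f ==> c > 0 ==> L2 (%x. f (c *\<^sub>R x))"
 unfolding L2_def using lborel_scale(1)[of "%x. (cmod (f x))^2" c] by auto

text \<open>The weak derivative of \<open>f\<close> is tested against the inversely dilated test
  function; the Jacobians on the two sides cancel, and the chain rule leaves one factor
  \<open>c\<close>.\<close>

lemma weak_partial_scale:
 fixes f g :: "'a::euclidean_space => complex"
 assumes f: "L2 f" and g: "L2 g" and w: "weak_partial f b g" and b: "b \<in> Basis" and c: "c > 0"
 shows "weak_partial (%x. f (c *\<^sub>R x)) b (%x. complex_of_real c * g (c *\<^sub>R x))"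
 unfolding weak_partial_def
proof (intro allI impI)
 fix ph :: "'a => real" assume t: "test_fun ph"
 note [measurable] = L2_measurable[OF f] L2_measurable[OF g] test_fun_measurable[OF t]
 have s: "smooth_fun ph" using t by (simp add: test_fun_def)
 have t': "test_fun (%x. ph ((1/c) *\<^sub>R x))" using test_fun_affine[OF t, of "1/c" 0] c by simp
 have d: "frechet_derivative (%x. ph ((1/c) *\<^sub>R x)) (at x) b = (1/c) * frechet_derivative ph (at ((1/c) *\<^sub>R x)) b" for x
  using frechet_affine[OF s, of "1/c" 0 x b] by simp
 have w': "(\<integral>x. complex_of_real (frechet_derivative (%x. ph ((1/c) *\<^sub>R x)) (at x) b) * f x \<partial>lborel)
   = - (\<integral>x. complex_of_real (ph ((1/c) *\<^sub>R x)) * g x \<partial>lborel)"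
  using w t' unfolding weak_partial_def by blast
 have fd: "(%x. frechet_derivative ph (at ((1/c) *\<^sub>R x)) b) \<in> borel_measurable borel"
  by (rule measurable_compose[OF _ test_fun_measurable[OF test_fun_partial[OF t b]]]) simp
 have 1: "(\<integral>x. complex_of_real (frechet_derivative (%x. ph ((1/c) *\<^sub>R x)) (at x) b) * f x \<partial>lborel)
  = (c ^ DIM('a)) *\<^sub>R (\<integral>x. complex_of_real ((1/c) * frechet_derivative ph (at x) b) * f (c *\<^sub>R x) \<partial>lborel)"
  unfolding d by (subst lborel_scale(2)[where c=c]) (use c fd in auto)
 have 2: "(\<integral>x. complex_of_real (ph ((1/c) *\<^sub>R x)) * g x \<partial>lborel) = (c ^ DIM('a)) *\<^sub>R (\<integral>x. complex_of_real (ph x) * g (c *\<^sub>R x) \<partial>lborel)"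
  by (subst lborel_scale(2)[where c=c]) (use c in auto)
 have 3: "(\<integral>x. complex_of_real ((1/c) * frechet_derivative ph (at x) b) * f (c *\<^sub>R x) \<partial>lborel)
   = complex_of_real (1/c) * (\<integral>x. complex_of_real (frechet_derivative ph (at x) b) * f (c *\<^sub>R x) \<partial>lborel)"
  unfolding of_real_mult mult.assoc by (rule integral_mult_right_zero)
 have "(c ^ DIM('a)) *\<^sub>R (complex_of_real (1/c) * (\<integral>x. complex_of_real (frechet_derivative ph (at x) b) * f (c *\<^sub>R x) \<partial>lborel))
   = (c ^ DIM('a)) *\<^sub>R - (\<integral>x. complex_of_real (ph x) * g (c *\<^sub>R x) \<partial>lborel)"
  using w' unfolding 1 2 3 by simp
 then have "complex_of_real (1/c) * (\<integral>x. complex_of_real (frechet_derivative ph (at x) b) * f (c *\<^sub>R x) \<partial>lborel)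
   = - (\<integral>x. complex_of_real (ph x) * g (c *\<^sub>R x) \<partial>lborel)"
  using c by (simp del: scaleR_minus_right)
 then have "(\<integral>x. complex_of_real (frechet_derivative ph (at x) b) * f (c *\<^sub>R x) \<partial>lborel)
   = - (complex_of_real c * (\<integral>x. complex_of_real (ph x) * g (c *\<^sub>R x) \<partial>lborel))"
  using c by (simp add: field_simps)
 also have "complex_of_real c * (\<integral>x. complex_of_real (ph x) * g (c *\<^sub>R x) \<partial>lborel) = (\<integral>x. complex_of_real (ph x) * (complex_of_real c * g (c *\<^sub>R x)) \<partial>lborel)"
  by (simp add: mult.left_commute[of _ "complex_of_real c"])
 finally show "(\<integral>x. complex_of_real (frechet_derivative ph (at x) b) * f (c *\<^sub>R x) \<partial>lborel)
   = - (\<integral>x. complex_of_real (ph x) * (complex_of_real c * g (c *\<^sub>R x)) \<partial>lborel)" .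
qed

text \<open>One factor \<open>h\<close> comes from Cauchy-Schwarz on the segment, the other from
  integrating over its length after the order of integration is exchanged.\<close>

lemma L2_translation_bound:
 assumes f: "L2 f" and g: "L2 g" and w: "weak_partial f b g" and b: "b \<in> Basis" and h: "0 <= h"
 shows "(\<integral>\<^sup>+x. ennreal ((cmod (f (x + h *\<^sub>R b) - f x))^2) \<partial>lborel) <= ennreal (h^2) * (\<integral>\<^sup>+x. ennreal ((cmod (g x))^2) \<partial>lborel)"
proof -
 note [measurable] = L2_measurable[OF f] L2_measurable[OF g]
 have CS: "ennreal ((cmod (line_integral g b h x))^2) <= ennreal h * (\<integral>\<^sup>+s. indicator {0..h} s * ennreal ((cmod (g (x + s *\<^sub>R b)))^2) \<partial>lborel)" for x
 proof -
  have "ennreal (cmod (line_integral g b h x)) <= (\<integral>\<^sup>+s. ennreal (cmod (indicator {0..h} s *\<^sub>R g (x + s *\<^sub>R b))) \<partial>lborel)"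
  proof (cases "integrable lborel (%s. indicator {0..h} s *\<^sub>R g (x + s *\<^sub>R b))")
   case True then show ?thesis unfolding line_integral_def by (rule integral_norm_bound_ennreal)
  qed (simp add: line_integral_def not_integrable_integral_eq)
  \<comment> \<open>The indicator is doubled so that Cauchy-Schwarz separates the length of the
    segment from the integral of \<open>|g|^2\<close>.\<close>
  also have "... = (\<integral>\<^sup>+s. indicator {0..h} s * (indicator {0..h} s * ennreal (cmod (g (x + s *\<^sub>R b)))) \<partial>lborel)"
   by (intro nn_integral_cong) (auto simp: indicator_def)
  finally have 1: "ennreal (cmod (line_integral g b h x)) <= ..." .
  have "ennreal ((cmod (line_integral g b h x))^2) = (ennreal (cmod (line_integral g b h x)))^2" by (simp add: ennreal_power)
  also have "... <= (\<integral>\<^sup>+s. indicator {0..h} s * (indicator {0..h} s * ennreal (cmod (g (x + s *\<^sub>R b)))) \<partial>lborel)^2"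
   by (rule power_mono[OF 1]) simp
  also have "... <= (\<integral>\<^sup>+s. (indicator {0..h} s)^2 \<partial>lborel) * (\<integral>\<^sup>+s. (indicator {0..h} s * ennreal (cmod (g (x + s *\<^sub>R b))))^2 \<partial>lborel)"
   by (rule Cauchy_Schwarz_nn_integral) measurable
  also have "(\<integral>\<^sup>+s. (indicator {0..h} s)^2 \<partial>lborel) = ennreal h"
  proof -
   have "(\<integral>\<^sup>+s. (indicator {0..h} s)^2 \<partial>lborel) = (\<integral>\<^sup>+s. indicator {0..h} s \<partial>lborel)"
    by (intro nn_integral_cong) (auto simp: indicator_def)
   then show ?thesis using h by simp
  qed
  also have "(\<integral>\<^sup>+s. (indicator {0..h} s * ennreal (cmod (g (x + s *\<^sub>R b))))^2 \<partial>lborel) = (\<integral>\<^sup>+s. indicator {0..h} s * ennreal ((cmod (g (x + s *\<^sub>R b)))^2) \<partial>lborel)"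
   by (intro nn_integral_cong) (auto simp: indicator_def ennreal_power)
  finally show ?thesis .
 qed
 have "(\<integral>\<^sup>+x. ennreal ((cmod (f (x + h *\<^sub>R b) - f x))^2) \<partial>lborel) = (\<integral>\<^sup>+x. ennreal ((cmod (line_integral g b h x))^2) \<partial>lborel)"
  using translation_formula[OF f g w b h] by (intro nn_integral_cong_AE) (auto elim!: eventually_mono)
 also have "... <= (\<integral>\<^sup>+x. ennreal h * (\<integral>\<^sup>+s. indicator {0..h} s * ennreal ((cmod (g (x + s *\<^sub>R b)))^2) \<partial>lborel) \<partial>lborel)"
  by (intro nn_integral_mono CS)
 also have "... = ennreal h * (\<integral>\<^sup>+x. (\<integral>\<^sup>+s. indicator {0..h} s * ennreal ((cmod (g (x + s *\<^sub>R b)))^2) \<partial>lborel) \<partial>lborel)"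
  by (rule nn_integral_cmult) measurable
 also have "(\<integral>\<^sup>+x. (\<integral>\<^sup>+s. indicator {0..h} s * ennreal ((cmod (g (x + s *\<^sub>R b)))^2) \<partial>lborel) \<partial>lborel)
  = (\<integral>\<^sup>+s. (\<integral>\<^sup>+x. indicator {0..h} s * ennreal ((cmod (g (x + s *\<^sub>R b)))^2) \<partial>lborel) \<partial>lborel)"
  by (rule lborel_pair.Fubini') measurable
 also have "... = (\<integral>\<^sup>+s. indicator {0..h} s * (\<integral>\<^sup>+x. ennreal ((cmod (g x))^2) \<partial>lborel) \<partial>lborel)"
  using nn_integral_lborel_shift[of "%x. ennreal ((cmod (g x))^2)"]
  by (intro nn_integral_cong) (simp add: nn_integral_cmult)
 also have "... = ennreal h * (\<integral>\<^sup>+x. ennreal ((cmod (g x))^2) \<partial>lborel)"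
  using h by (simp add: nn_integral_multc)
 finally show ?thesis using h by (simp add: power2_eq_square ennreal_mult mult.assoc)
qed

section \<open>Product structure of configuration space\<close>

lemma axis_image_Basis: "(Basis :: ('a::euclidean_space^'n::finite) set) = (%(i, u). axis i u) ` (UNIV \<times> Basis)"
 by (auto simp: Basis_vec_def)

lemma inj_axis: "inj_on (%(i, u). axis i u :: 'a::euclidean_space^'n::finite) (UNIV \<times> Basis)"
 by (auto simp: inj_on_def axis_eq_axis)

lemma prod_Basis_vec:
 fixes F :: "'a::euclidean_space^'n::finite => 'c::comm_monoid_mult"
 shows "(\<Prod>b\<in>Basis. F b) = (\<Prod>i\<in>UNIV. \<Prod>u\<in>Basis. F (axis i u))"
 unfolding axis_image_Basis prod.reindex[OF inj_axis] prod.cartesian_product by (simp add: case_prod_beta)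

lemma sum_Basis_vec:
 fixes F :: "'a::euclidean_space^'n::finite => 'c::comm_monoid_add"
 shows "(\<Sum>b\<in>Basis. F b) = (\<Sum>i\<in>UNIV. \<Sum>u\<in>Basis. F (axis i u))"
 unfolding axis_image_Basis sum.reindex[OF inj_axis] sum.cartesian_product by (simp add: case_prod_beta)

lemma vec_nth_measurable [measurable]: "(%x. x $ i) \<in> borel_measurable (borel :: ('a::euclidean_space^'n::finite) measure)"
 by (intro borel_measurable_continuous_onI continuous_intros)

lemma vec_lambda_measurable:
 fixes f :: "'b => 'n::finite => 'a::euclidean_space"
 assumes "!!i. (%w. f w i) \<in> borel_measurable M"
 shows "(%w. \<chi> i. f w i) \<in> borel_measurable M"
proof (subst borel_measurable_euclidean_space, intro ballI)
 fix b :: "'a^'n" assume "b \<in> Basis"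
 then obtain i u where "b = axis i u" "u \<in> Basis" by (auto simp: Basis_vec_def)
 with assms[of i] show "(%x. (\<chi> i. f x i) \<bullet> b) \<in> borel_measurable M" by (simp add: inner_axis)
qed

text \<open>Lebesgue measure is determined by the volumes of boxes, and a box in the space of
  vectors is a product of boxes, one for each component.\<close>

lemma lborel_vec: "lborel = distr (PiM UNIV (%_::'n::finite. lborel :: 'a::euclidean_space measure)) borel (%w. \<chi> i. w i)"
proof (rule lborel_eqI)
 interpret product_sigma_finite "%_::'n. lborel :: 'a measure" by standard
 have m: "(%w. \<chi> i. w i) \<in> borel_measurable (PiM UNIV (%_::'n. lborel :: 'a measure))"
  by (rule vec_lambda_measurable) simp
 fix l u :: "'a^'n" assume le: "!!b. b \<in> Basis ==> l \<bullet> b <= u \<bullet> b"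
 have le': "l $ i \<bullet> b <= u $ i \<bullet> b" if "b \<in> Basis" for i b
  using le[of "axis i b"] that by (auto simp: inner_axis Basis_vec_def)
 have "(%w. \<chi> i. w i) -` box l u \<inter> space (PiM UNIV (%_::'n. lborel :: 'a measure)) = (\<Pi>\<^sub>E i\<in>UNIV. box (l $ i) (u $ i))"
  by (auto simp: mem_box Basis_vec_def inner_axis space_PiM PiE_def Pi_iff)
 then have "emeasure (distr (PiM UNIV (%_::'n. lborel :: 'a measure)) borel (%w. \<chi> i. w i)) (box l u)
   = emeasure (PiM UNIV (%_::'n. lborel :: 'a measure)) (\<Pi>\<^sub>E i\<in>UNIV. box (l $ i) (u $ i))"
  using m by (simp add: emeasure_distr)
 also have "... = (\<Prod>i\<in>UNIV. emeasure lborel (box (l $ i) (u $ i)))"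
  by (rule emeasure_PiM) auto
 also have "... = (\<Prod>i\<in>UNIV. ennreal (\<Prod>b\<in>Basis. (u $ i - l $ i) \<bullet> b))"
  using le' by (simp add: emeasure_lborel_box)
 also have "... = ennreal (\<Prod>i\<in>UNIV. \<Prod>b\<in>Basis. (u $ i - l $ i) \<bullet> b)"
  using le' by (intro prod_ennreal) (auto intro!: prod_nonneg simp: inner_diff_left)
 also have "... = ennreal (\<Prod>b\<in>Basis. (u - l) \<bullet> b)"
  by (simp add: prod_Basis_vec inner_axis)
 finally show "emeasure (distr (PiM UNIV (%_::'n. lborel :: 'a measure)) borel (%w. \<chi> i. w i)) (box l u) = (\<Prod>b\<in>Basis. (u - l) \<bullet> b)" .
qed simp

lemma vec_lambda_measurable_PiM [measurable]:
 "(%w. \<chi> i. w i) \<in> measurable (PiM UNIV (%_::'n::finite. lborel :: 'a::euclidean_space measure)) borel"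
 by (rule vec_lambda_measurable) simp

lemma nn_integral_vec_prod:
 fixes h :: "'n::finite => 'a::euclidean_space => ennreal"
 assumes [measurable]: "!!i. h i \<in> borel_measurable borel"
 shows "(\<integral>\<^sup>+x. (\<Prod>i\<in>UNIV. h i (x $ i)) \<partial>lborel) = (\<Prod>i\<in>UNIV. \<integral>\<^sup>+y. h i y \<partial>lborel)"
proof -
 interpret product_sigma_finite "%_::'n. lborel :: 'a measure" by standard
 have "(\<integral>\<^sup>+x. (\<Prod>i\<in>UNIV. h i (x $ i)) \<partial>lborel) = (\<integral>\<^sup>+w. (\<Prod>i\<in>UNIV. h i (w i)) \<partial>PiM UNIV (%_::'n. lborel :: 'a measure))"
  by (subst lborel_vec, subst nn_integral_distr) auto
 also have "... = (\<Prod>i\<in>UNIV. \<integral>\<^sup>+y. h i y \<partial>lborel)"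
  by (rule product_nn_integral_prod) auto
 finally show ?thesis .
qed

lemma integral_vec_prod:
 fixes h :: "'n::finite => 'a::euclidean_space => 'c::{real_normed_field, banach, second_countable_topology}"
 assumes i: "!!i. integrable lborel (h i)"
 shows "integrable lborel (%x. \<Prod>i\<in>UNIV. h i (x $ i))"
  and "(\<integral>x. (\<Prod>i\<in>UNIV. h i (x $ i)) \<partial>lborel) = (\<Prod>i\<in>UNIV. \<integral>y. h i y \<partial>lborel)"
proof -
 interpret product_sigma_finite "%_::'n. lborel :: 'a measure" by standard
 have [measurable]: "h i \<in> borel_measurable borel" for i using i[of i] by auto
 have [measurable]: "(%x. \<Prod>i\<in>UNIV. h i (x $ i)) \<in> borel_measurable borel" by measurable
 show "integrable lborel (%x. \<Prod>i\<in>UNIV. h i (x $ i))"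
  by (subst lborel_vec, subst integrable_distr_eq) (auto intro!: product_integrable_prod i)
 show "(\<integral>x. (\<Prod>i\<in>UNIV. h i (x $ i)) \<partial>lborel) = (\<Prod>i\<in>UNIV. \<integral>y. h i y \<partial>lborel)"
  by (subst lborel_vec, subst integral_distr) (auto intro!: product_integral_prod i)
qed

lemma integral_vec_split:
 fixes F :: "'a::euclidean_space^'n::finite => 'c::{banach, second_countable_topology}"
 assumes F: "integrable lborel F"
 shows "(\<integral>x. F x \<partial>lborel) = (\<integral>w. (\<integral>y. F (\<chi> j. (w(i := y)) j) \<partial>lborel) \<partial>PiM (UNIV - {i}) (%_. lborel))"
proof -
 interpret product_sigma_finite "%_::'n. lborel :: 'a measure" by standard
 have [measurable]: "F \<in> borel_measurable borel" using F by auto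
 have I: "integrable (PiM UNIV (%_. lborel)) (%w. F (\<chi> j. w j))"
  using F by (subst (asm) lborel_vec, subst (asm) integrable_distr_eq) auto
 have "(\<integral>x. F x \<partial>lborel) = (\<integral>w. F (\<chi> j. w j) \<partial>PiM UNIV (%_. lborel))"
  by (subst lborel_vec, subst integral_distr) auto
 also have "... = (\<integral>w. F (\<chi> j. w j) \<partial>PiM (insert i (UNIV - {i})) (%_. lborel))" by (simp add: insert_absorb)
 also have "... = (\<integral>w. (\<integral>y. F (\<chi> j. (w(i := y)) j) \<partial>lborel) \<partial>PiM (UNIV - {i}) (%_. lborel))"
  by (rule product_integral_insert) (use I in "auto simp: insert_absorb")
 finally show ?thesis .
qed

text \<open>Only the factors of \<open>i\<close> and \<open>j\<close> meet the kernel; all others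
  integrate to 1. Coordinate \<open>i\<close> is integrated first, which turns the kernel into a
  function of coordinate \<open>j\<close> alone and leaves a product.\<close>

lemma nn_integral_vec_pair:
 fixes h :: "'n::finite => 'a::euclidean_space => ennreal" and k :: "'a => 'a => ennreal"
 assumes [measurable]: "!!i. h i \<in> borel_measurable borel" "(%(y, z). k y z) \<in> borel_measurable (borel \<Otimes>\<^sub>M borel)"
  and n: "!!i. (\<integral>\<^sup>+y. h i y \<partial>lborel) = 1" and ij: "i ~= j"
 shows "(\<integral>\<^sup>+x. k (x $ i) (x $ j) * (\<Prod>l\<in>UNIV. h l (x $ l)) \<partial>lborel) = (\<integral>\<^sup>+z. (\<integral>\<^sup>+y. k y z * h i y \<partial>lborel) * h j z \<partial>lborel)"
proof -
 interpret product_sigma_finite "%_::'n. lborel :: 'a measure" by standard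
 define K where "K z = (\<integral>\<^sup>+y. k y z * h i y \<partial>lborel)" for z
 have [measurable]: "(%(z, y). k y z) \<in> borel_measurable (borel \<Otimes>\<^sub>M borel)"
  using measurable_compose[OF measurable_pair_swap' assms(2)] by (simp add: case_prod_beta)
 have [measurable]: "K \<in> borel_measurable borel" unfolding K_def by measurable
 have [measurable]: "(%w. k (w i) (w j)) \<in> borel_measurable (PiM UNIV (%_::'n. lborel :: 'a measure))"
  using measurable_compose[of "%w. (w i, w j)" "PiM UNIV (%_::'n. lborel :: 'a measure)" "borel \<Otimes>\<^sub>M borel" "%(y, z). k y z" borel] by simp
 have [measurable]: "(%x. k (x $ i) (x $ j)) \<in> borel_measurable (borel :: ('a^'n) measure)"
  using measurable_compose[of "%x. (x $ i, x $ j)" "borel :: ('a^'n) measure" "borel \<Otimes>\<^sub>M borel" "%(y, z). k y z" borel] by simp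
 have "(\<integral>\<^sup>+x. k (x $ i) (x $ j) * (\<Prod>l\<in>UNIV. h l (x $ l)) \<partial>lborel)
  = (\<integral>\<^sup>+w. k (w i) (w j) * (\<Prod>l\<in>UNIV. h l (w l)) \<partial>PiM UNIV (%_. lborel))"
  by (subst lborel_vec, subst nn_integral_distr) auto
 also have "... = (\<integral>\<^sup>+w. k (w i) (w j) * (\<Prod>l\<in>UNIV. h l (w l)) \<partial>PiM (insert i (UNIV - {i})) (%_. lborel))" by (simp add: insert_absorb)
 also have "... = (\<integral>\<^sup>+w. (\<integral>\<^sup>+y. k y (w j) * (\<Prod>l\<in>UNIV. h l ((w(i := y)) l)) \<partial>lborel) \<partial>PiM (UNIV - {i}) (%_. lborel))"
  using ij by (subst product_nn_integral_insert) (auto simp: insert_absorb)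
 also have "... = (\<integral>\<^sup>+w. (\<Prod>l\<in>UNIV - {i}. (if l = j then %z. K z * h j z else h l) (w l)) \<partial>PiM (UNIV - {i}) (%_. lborel))"
 proof (intro nn_integral_cong)
  fix w :: "'n => 'a"
  have "(\<integral>\<^sup>+y. k y (w j) * (\<Prod>l\<in>UNIV. h l ((w(i := y)) l)) \<partial>lborel) = (\<integral>\<^sup>+y. (k y (w j) * h i y) * (\<Prod>l\<in>UNIV - {i}. h l (w l)) \<partial>lborel)"
   by (intro nn_integral_cong) (simp add: prod.remove[of UNIV i] mult.assoc)
  also have "... = K (w j) * (\<Prod>l\<in>UNIV - {i}. h l (w l))"
   unfolding K_def by (rule nn_integral_multc) measurable
  also have "... = (\<Prod>l\<in>UNIV - {i}. (if l = j then %z. K z * h j z else h l) (w l))"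
   using ij by (simp add: prod.remove[of "UNIV - {i}" j] mult.assoc)
  finally show "(\<integral>\<^sup>+y. k y (w j) * (\<Prod>l\<in>UNIV. h l ((w(i := y)) l)) \<partial>lborel) = ..." .
 qed
 also have "... = (\<Prod>l\<in>UNIV - {i}. \<integral>\<^sup>+z. (if l = j then %z. K z * h j z else h l) z \<partial>lborel)"
  by (rule product_nn_integral_prod) auto
 also have "... = (\<integral>\<^sup>+z. K z * h j z \<partial>lborel)"
  using ij n by (simp add: prod.remove[of "UNIV - {i}" j])
 finally show ?thesis unfolding K_def .
qed

lemma perm_conf_measurable [measurable]: "perm_conf \<sigma> \<in> borel_measurable borel"
 unfolding perm_conf_def by (rule vec_lambda_measurable) simp

text \<open>Permuting the particles maps boxes to boxes of the same volume, and box volumes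
  characterize Lebesgue measure.\<close>

lemma lborel_perm_conf:
 fixes \<sigma> :: "'n::finite => 'n"
 assumes s: "\<sigma> permutes UNIV"
 shows "distr lborel borel (perm_conf \<sigma>) = lborel"
proof (rule lborel_eqI[symmetric])
 fix l u :: "real^3^'n" assume le: "!!b. b \<in> Basis ==> l \<bullet> b <= u \<bullet> b"
 let ?p = "perm_conf (inv \<sigma>)"
 have le': "l $ i \<bullet> b <= u $ i \<bullet> b" if "b \<in> Basis" for i b
  using le[of "axis i b"] that by (auto simp: inner_axis Basis_vec_def)
 have bx: "x \<in> box a c \<longleftrightarrow> (ALL i. \<forall>b\<in>Basis. a $ i \<bullet> b < x $ i \<bullet> b & x $ i \<bullet> b < c $ i \<bullet> b)" for x a c :: "real^3^'n"
  by (auto simp: mem_box Basis_vec_def inner_axis)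
 have "perm_conf \<sigma> -` box l u = box (?p l) (?p u)"
  unfolding set_eq_iff vimage_eq bx perm_conf_def vec_lambda_beta
  using permutes_inverses[OF s] by metis
 then have "emeasure (distr lborel borel (perm_conf \<sigma>)) (box l u) = emeasure lborel (box (?p l) (?p u))"
  by (simp add: emeasure_distr)
 also have "... = ennreal (\<Prod>b\<in>Basis. (?p u - ?p l) \<bullet> b)"
 proof (rule emeasure_lborel_box)
  fix b :: "real^3^'n" assume "b \<in> Basis"
  then obtain i v where "b = axis i v" "v \<in> Basis" unfolding axis_image_Basis by auto
  then show "?p l \<bullet> b <= ?p u \<bullet> b" using le'[of v "inv \<sigma> i"] by (simp add: inner_axis perm_conf_def)
 qed
 also have "(\<Prod>b\<in>Basis. (?p u - ?p l) \<bullet> b) = (\<Prod>i\<in>UNIV. \<Prod>b\<in>Basis. (u $ (inv \<sigma> i) - l $ (inv \<sigma> i)) \<bullet> b)"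
  by (simp add: prod_Basis_vec inner_axis perm_conf_def)
 also have "... = (\<Prod>i\<in>UNIV. \<Prod>b\<in>Basis. (u $ i - l $ i) \<bullet> b)"
  using prod.permute[OF permutes_inv[OF s], of "%i. \<Prod>b\<in>Basis. (u $ i - l $ i) \<bullet> b"] by (simp add: comp_def)
 also have "... = (\<Prod>b\<in>Basis. (u - l) \<bullet> b)" by (simp add: prod_Basis_vec inner_axis)
 finally show "emeasure (distr lborel borel (perm_conf \<sigma>)) (box l u) = (\<Prod>b\<in>Basis. (u - l) \<bullet> b)" .
qed simp

lemma L2_vec_prod:
 fixes f :: "'n::finite => 'a::euclidean_space => complex"
 assumes "!!i. L2 (f i)"
 shows "L2 (%x. \<Prod>i\<in>UNIV. f i (x $ i))"
proof -
 note [measurable] = L2_measurable[OF assms]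
 have "integrable lborel (%x::'a^'n. \<Prod>i\<in>UNIV. (cmod (f i (x $ i)))^2)"
  by (rule integral_vec_prod) (rule L2_square_integrable[OF assms])
 then show ?thesis unfolding L2_def by (simp add: prod_norm[symmetric] prod_power_distrib[symmetric])
qed

lemma nn_integral_norm_vec_prod:
 fixes f :: "'n::finite => 'a::euclidean_space => complex"
 assumes "!!i. L2 (f i)"
 shows "(\<integral>\<^sup>+x. ennreal ((cmod (\<Prod>i\<in>UNIV. f i (x $ i)))^2) \<partial>lborel) = (\<Prod>i\<in>UNIV. \<integral>\<^sup>+y. ennreal ((cmod (f i y))^2) \<partial>lborel)"
proof -
 note [measurable] = L2_measurable[OF assms]
 show ?thesis
  by (subst nn_integral_vec_prod[symmetric])
   (auto simp: prod_norm[symmetric] prod_power_distrib[symmetric] prod_ennreal intro!: nn_integral_cong)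
qed

text \<open>With the other particles fixed, the test function becomes a Lipschitz function of
  bounded support in one particle, which is all that \<open>weak_partial_lipschitz_test\<close> asks
  for. Fubini then integrates over the other particles.\<close>

lemma weak_partial_vec_prod:
 fixes f :: "'n::finite => 'a::euclidean_space => complex"
 assumes f: "!!j. L2 (f j)" and g: "L2 g" and b: "b \<in> Basis" and w: "weak_partial (f i) b g"
 shows "weak_partial (%x. \<Prod>j\<in>UNIV. f j (x $ j)) (axis i b) (%x. \<Prod>j\<in>UNIV. (f(i := g)) j (x $ j))"
 unfolding weak_partial_def
proof (intro allI impI)
 fix ph :: "'a^'n => real" assume t: "test_fun ph"
 have ab: "axis i b \<in> (Basis :: ('a^'n) set)" using b by (auto simp: Basis_vec_def)
 have s: "smooth_fun ph" using t by (simp add: test_fun_def)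
 obtain M R where R: "0 < M" "0 < R" "!!x. \<bar>ph x\<bar> <= M" "!!x. R < norm x ==> ph x = 0" using test_fun_bounds[OF t] by metis
 obtain C where C: "0 <= C" "!!x t. \<bar>ph (x + t *\<^sub>R axis i b) - ph x\<bar> <= C * \<bar>t\<bar>" using test_fun_lipschitz[OF t ab] by metis
 let ?d = "%x. frechet_derivative ph (at x) (axis i b)"
 note td = test_fun_partial[OF t ab]
 note pm = test_fun_measurable[OF t] and dm = test_fun_measurable[OF td]
 have g': "L2 ((f(i := g)) j)" for j using f g by auto
 have I1: "integrable lborel (%x. complex_of_real (?d x) * (\<Prod>j\<in>UNIV. f j (x $ j)))"
  by (rule L2_test_integrable[OF L2_vec_prod[OF f] td])
 have I2: "integrable lborel (%x. complex_of_real (ph x) * (\<Prod>j\<in>UNIV. (f(i := g)) j (x $ j)))"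
  by (rule L2_test_integrable[OF L2_vec_prod[OF g'] t])
 have eq: "(\<integral>y. complex_of_real (?d (\<chi> j. (w(i := y)) j)) * (\<Prod>j\<in>UNIV. f j ((\<chi> j. (w(i := y)) j) $ j)) \<partial>lborel)
   = - (\<integral>y. complex_of_real (ph (\<chi> j. (w(i := y)) j)) * (\<Prod>j\<in>UNIV. (f(i := g)) j ((\<chi> j. (w(i := y)) j) $ j)) \<partial>lborel)" for w :: "'n => 'a"
 proof -
  let ?x = "%y. \<chi> j. (w(i := y)) j"
  let ?c = "\<Prod>j\<in>UNIV - {i}. f j (w j)"
  have xm: "?x \<in> borel_measurable borel" by (rule vec_lambda_measurable) auto
  have xa: "?x (y + t *\<^sub>R b) = ?x y + t *\<^sub>R axis i b" for y t by (auto simp: vec_eq_iff axis_def)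
  have main: "(\<integral>y. complex_of_real (?d (?x y)) * f i y \<partial>lborel) = - (\<integral>y. complex_of_real (ph (?x y)) * g y \<partial>lborel)"
  proof (rule weak_partial_lipschitz_test[OF f g w b, where M=M and R=R and C=C])
   show "(%y. ph (?x y)) \<in> borel_measurable borel" "(%y. ?d (?x y)) \<in> borel_measurable borel"
    using measurable_compose[OF xm pm] measurable_compose[OF xm dm] by auto
   show "\<bar>ph (?x y)\<bar> <= M" for y by (rule R)
   show "ph (?x y) = 0" if "R < norm y" for y
    using R(4)[of "?x y"] Finite_Cartesian_Product.norm_nth_le[of "?x y" i] that by auto
   show "\<bar>ph (?x (y + t *\<^sub>R b)) - ph (?x y)\<bar> <= C * \<bar>t\<bar>" for y t unfolding xa by (rule C)
   show "AE y in lborel. ((%t. ph (?x (y + t *\<^sub>R b))) has_real_derivative ?d (?x y)) (at 0)"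
   proof (rule AE_I2)
    fix y
    show "((%t. ph (?x (y + t *\<^sub>R b))) has_real_derivative ?d (?x y)) (at 0)"
     unfolding xa using test_fun_line_derivative[OF s, of "?x y" "axis i b" 0 UNIV] by (simp only: scaleR_zero_left add_0_right)
   qed
  qed
  have 1: "(\<Prod>j\<in>UNIV. f j (?x y $ j)) = f i y * ?c" for y by (simp add: prod.remove[of UNIV i])
  have 2: "(\<Prod>j\<in>UNIV. (f(i := g)) j (?x y $ j)) = g y * ?c" for y by (simp add: prod.remove[of UNIV i])
  show ?thesis unfolding 1 2 mult.assoc[symmetric] integral_mult_left_zero main by simp
 qed
 show "(\<integral>x. complex_of_real (?d x) * (\<Prod>j\<in>UNIV. f j (x $ j)) \<partial>lborel) = - (\<integral>x. complex_of_real (ph x) * (\<Prod>j\<in>UNIV. (f(i := g)) j (x $ j)) \<partial>lborel)"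
  unfolding integral_vec_split[OF I1, of i] integral_vec_split[OF I2, of i] eq by simp
qed

section \<open>Slater determinants\<close>

definition slater :: "('n::finite => 'a::euclidean_space => complex) => 'a^'n => complex" where
 "slater f x = det (\<chi> i j. f j (x $ i)) / complex_of_real (sqrt (fact CARD('n)))"

abbreviation perms :: "('n::finite => 'n) set" where "perms \<equiv> {p. p permutes UNIV}"

lemma slater_expand:
 fixes f :: "'n::finite => 'a::euclidean_space => complex"
 shows "slater f x = (\<Sum>p\<in>perms. (of_int (sign p) / complex_of_real (sqrt (fact CARD('n)))) * (\<Prod>i\<in>UNIV. f (p i) (x $ i)))"
 unfolding slater_def det_def by (simp add: sum_divide_distrib)

lemma antisym_slater:
 fixes f :: "'n::finite => real^3 => complex"
 shows "antisym_fun (slater f)"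
 unfolding antisym_fun_def
proof (intro allI impI)
 fix p :: "'n => 'n" and x :: "real^3^'n" assume p: "p permutes UNIV"
 have "det (\<chi> i. (\<chi> i j. f j (x $ i)) $ p i :: complex^'n^'n) = of_int (sign p) * det (\<chi> i j. f j (x $ i))"
  by (rule det_permute_rows[OF p])
 then show "slater f (perm_conf p x) = of_int (sign p) * slater f x"
  by (simp add: slater_def perm_conf_def)
qed

lemma finite_perms [simp]: "finite (perms :: ('n::finite => 'n) set)"
 by (rule finite_permutations) simp

lemma card_perms: "card (perms :: ('n::finite => 'n) set) = fact CARD('n)"
 by (rule card_permutations) auto

lemma L2_slater:
 assumes "!!i. L2 (f i)"
 shows "L2 (slater f)"
 unfolding slater_expand[abs_def] by (intro L2_sum L2_cmult L2_vec_prod assms) simp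

text \<open>In the term of the permutation \<open>p\<close>, particle \<open>i\<close> occurs only
  in the orbital \<open>p i\<close>, so exactly this factor is replaced by its derivative.\<close>

definition slater_partial :: "('n::finite => 'a::euclidean_space => complex) => ('n => 'a => complex) => 'n => 'a^'n => complex" where
 "slater_partial f g i x = (\<Sum>p\<in>perms. (of_int (sign p) / complex_of_real (sqrt (fact CARD('n)))) * (\<Prod>j\<in>UNIV. ((%j. f (p j))(i := g (p i))) j (x $ j)))"

lemma weak_partial_slater:
 fixes f :: "'n::finite => 'a::euclidean_space => complex"
 assumes f: "!!i. L2 (f i)" and g: "!!i. L2 (g i)" and b: "b \<in> Basis" and w: "!!i. weak_partial (f i) b (g i)"
 shows "L2 (slater_partial f g i)" "weak_partial (slater f) (axis i b) (slater_partial f g i)"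
proof -
 have l: "L2 (((%j. f (p j))(i := g (p i))) j)" for p j using f g by auto
 show "L2 (slater_partial f g i)"
  unfolding slater_partial_def[abs_def] by (intro L2_sum L2_cmult L2_vec_prod l) simp
 show "weak_partial (slater f) (axis i b) (slater_partial f g i)"
  unfolding slater_expand[abs_def] slater_partial_def[abs_def]
 proof (rule weak_partial_sum)
  show "axis i b \<in> (Basis :: ('a^'n) set)" using b by (auto simp: Basis_vec_def)
 qed (auto simp only: finite_perms intro!: conjI L2_cmult L2_vec_prod weak_partial_cmult weak_partial_vec_prod l f g w b)
qed

lemma norm_sign [simp]: "cmod (of_int (sign p)) = 1"
 by (cases "evenperm p") (auto simp: sign_def)

lemma sign_squared [simp]: "(real_of_int (sign p))^2 = 1"
 by (cases "evenperm p") (auto simp: sign_def)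

lemma norm_sum_squared_le:
 assumes "finite I"
 shows "(cmod (\<Sum>i\<in>I. a i))^2 <= real (card I) * (\<Sum>i\<in>I. (cmod (a i))^2)"
proof -
 have "(cmod (\<Sum>i\<in>I. a i))^2 <= (\<Sum>i\<in>I. cmod (a i))^2"
  by (intro power_mono norm_sum) auto
 also have "... = (\<Sum>i\<in>I. 1 * cmod (a i))^2" by simp
 also have "... <= (\<Sum>i\<in>I. 1^2) * (\<Sum>i\<in>I. (cmod (a i))^2)" by (rule Cauchy_Schwarz_ineq_sum)
 finally show ?thesis by simp
qed

text \<open>A crude count: the square of a sum of \<open>N!\<close> terms is at most
  \<open>N!\<close> times the sum of the squares. This cancels the normalization and leaves a sum
  over permutations, each of which contributes the same kinetic energy once all particles are
  summed.\<close>

lemma slater_kinetic: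
 fixes f :: "'n::finite => 'a::euclidean_space => complex" and g :: "'n => 'a => 'a => complex"
 assumes f: "!!i. L2 (f i)" and g: "!!i b. b \<in> Basis ==> L2 (g i b)" and n: "!!i. (\<integral>\<^sup>+y. ennreal ((cmod (f i y))^2) \<partial>lborel) = 1"
 shows "(\<Sum>i\<in>UNIV. \<Sum>b\<in>Basis. \<integral>\<^sup>+x. ennreal ((cmod (slater_partial f (%i. g i b) i x))^2) \<partial>lborel)
  <= fact CARD('n) * (\<Sum>i\<in>UNIV. \<Sum>b\<in>Basis. \<integral>\<^sup>+y. ennreal ((cmod (g i b y))^2) \<partial>lborel)"
proof -
 let ?T = "%i b. \<integral>\<^sup>+y. ennreal ((cmod (g i b y))^2) \<partial>lborel"
 have one: "(\<integral>\<^sup>+x. ennreal ((cmod (slater_partial f (%i. g i b) i x))^2) \<partial>lborel) <= (\<Sum>p\<in>perms. ?T (p i) b)" if b: "b \<in> Basis" for i b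
 proof -
  let ?F = "%p j. ((%j. f (p j))(i := g (p i) b)) j"
  have l: "L2 (?F p j)" for p j using f g b by auto
  note [measurable] = L2_measurable[OF l]
  have "(\<integral>\<^sup>+x. ennreal ((cmod (slater_partial f (%i. g i b) i x))^2) \<partial>lborel)
   <= (\<integral>\<^sup>+x. (\<Sum>p\<in>perms. ennreal ((cmod (\<Prod>j\<in>UNIV. ?F p j (x $ j)))^2)) \<partial>lborel)"
  proof (intro nn_integral_mono)
   fix x :: "'a^'n"
   have "(cmod (slater_partial f (%i. g i b) i x))^2 <= real (card (perms :: ('n => 'n) set)) *
    (\<Sum>p\<in>perms. (cmod ((of_int (sign p) / complex_of_real (sqrt (fact CARD('n)))) * (\<Prod>j\<in>UNIV. ?F p j (x $ j))))^2)"
    unfolding slater_partial_def by (rule norm_sum_squared_le) simp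
   also have "... = (\<Sum>p\<in>perms. (cmod (\<Prod>j\<in>UNIV. ?F p j (x $ j)))^2)"
    unfolding card_perms sum_distrib_left
    by (intro sum.cong refl) (simp add: norm_mult norm_divide power_mult_distrib power_divide)
   finally show "ennreal ((cmod (slater_partial f (%i. g i b) i x))^2) <= (\<Sum>p\<in>perms. ennreal ((cmod (\<Prod>j\<in>UNIV. ?F p j (x $ j)))^2))"
    by (subst sum_ennreal) (auto intro: ennreal_leI)
  qed
  also have "... = (\<Sum>p\<in>perms. \<integral>\<^sup>+x. ennreal ((cmod (\<Prod>j\<in>UNIV. ?F p j (x $ j)))^2) \<partial>lborel)"
   by (rule nn_integral_sum) measurable
  also have "... = (\<Sum>p\<in>perms. ?T (p i) b)"
  proof (intro sum.cong refl)
   fix p :: "'n => 'n"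
   show "(\<integral>\<^sup>+x. ennreal ((cmod (\<Prod>j\<in>UNIV. ?F p j (x $ j)))^2) \<partial>lborel) = ?T (p i) b"
    unfolding nn_integral_norm_vec_prod[of "?F p", OF l] using n by (simp add: prod.remove[of UNIV i])
  qed
  finally show ?thesis .
 qed
 have "(\<Sum>i\<in>UNIV. \<Sum>b\<in>Basis. \<integral>\<^sup>+x. ennreal ((cmod (slater_partial f (%i. g i b) i x))^2) \<partial>lborel)
  <= (\<Sum>i\<in>UNIV. \<Sum>b\<in>Basis. \<Sum>p\<in>(perms :: ('n => 'n) set). ?T (p i) b)"
  by (intro sum_mono one)
 also have "... = (\<Sum>p\<in>(perms :: ('n => 'n) set). \<Sum>i\<in>UNIV. \<Sum>b\<in>Basis. ?T (p i) b)"
 proof -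
  have "(\<Sum>i\<in>UNIV. \<Sum>b\<in>Basis. \<Sum>p\<in>(perms :: ('n => 'n) set). ?T (p i) b) = (\<Sum>i\<in>UNIV. \<Sum>p\<in>(perms :: ('n => 'n) set). \<Sum>b\<in>Basis. ?T (p i) b)"
   by (intro sum.cong refl sum.swap)
  also have "... = (\<Sum>p\<in>(perms :: ('n => 'n) set). \<Sum>i\<in>UNIV. \<Sum>b\<in>Basis. ?T (p i) b)" by (rule sum.swap)
  finally show ?thesis .
 qed
 also have "... = (\<Sum>p\<in>(perms :: ('n => 'n) set). \<Sum>i\<in>UNIV. \<Sum>b\<in>Basis. ?T i b)"
 proof (rule sum.cong[OF refl])
  fix p :: "'n => 'n" assume "p \<in> perms"
  then show "(\<Sum>i\<in>UNIV. \<Sum>b\<in>Basis. ?T (p i) b) = (\<Sum>i\<in>UNIV. \<Sum>b\<in>Basis. ?T i b)"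
   using sum.permute[of p UNIV "%i. \<Sum>b\<in>Basis. ?T i b"] by (simp add: comp_def)
 qed
 also have "... = fact CARD('n) * (\<Sum>i\<in>UNIV. \<Sum>b\<in>Basis. ?T i b)" by (simp add: card_perms)
 finally show ?thesis .
qed

lemma norm_sum_squared_disjoint:
 fixes a :: "'i => complex"
 assumes "finite I" "!!i j. i \<in> I ==> j \<in> I ==> i ~= j ==> a i = 0 | a j = 0"
 shows "(cmod (\<Sum>i\<in>I. a i))^2 = (\<Sum>i\<in>I. (cmod (a i))^2)"
proof (cases "\<exists>i\<in>I. a i ~= 0")
 case True
 then obtain i where i: "i \<in> I" "a i ~= 0" by blast
 then have "!!j. j \<in> I - {i} ==> a j = 0" using assms(2) by blast
 then show ?thesis using assms(1) i(1) by (simp add: sum.remove[of I i])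
qed simp

text \<open>Two different permutations put orbitals with disjoint supports at some particle, so at
  every point at most one term of the determinant is nonzero and there are no cross terms.\<close>

lemma slater_norm_disjoint:
 fixes f :: "'n::finite => 'a::euclidean_space => complex"
 assumes "!!i j y. i ~= j ==> f i y = 0 | f j y = 0"
 shows "(cmod (slater f x))^2 = (\<Sum>p\<in>perms. (\<Prod>i\<in>UNIV. (cmod (f (p i) (x $ i)))^2)) / fact CARD('n)"
proof -
 have "(cmod (slater f x))^2 = (\<Sum>p\<in>perms. (cmod ((of_int (sign p) / complex_of_real (sqrt (fact CARD('n)))) * (\<Prod>i\<in>UNIV. f (p i) (x $ i))))^2)"
  unfolding slater_expand
 proof (rule norm_sum_squared_disjoint)
  fix p q :: "'n => 'n" assume "p ~= q"
  then obtain i where "p i ~= q i" by auto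
  then have "f (p i) (x $ i) = 0 | f (q i) (x $ i) = 0" by (rule assms)
  then have "(\<Prod>i\<in>UNIV. f (p i) (x $ i)) = 0 | (\<Prod>i\<in>UNIV. f (q i) (x $ i)) = 0" by (auto intro: prod_zero)
  then show "of_int (sign p) / complex_of_real (sqrt (fact CARD('n))) * (\<Prod>i\<in>UNIV. f (p i) (x $ i)) = 0 |
   of_int (sign q) / complex_of_real (sqrt (fact CARD('n))) * (\<Prod>i\<in>UNIV. f (q i) (x $ i)) = 0" by auto
 qed simp
 then show ?thesis
  by (simp add: norm_mult norm_divide power_mult_distrib power_divide prod_norm[symmetric] prod_power_distrib[symmetric] sum_divide_distrib)
qed

lemma slater_norm_perm:
 fixes f :: "'n::finite => real^3 => complex"
 assumes p: "p permutes (UNIV :: 'n set)"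
 shows "(\<Prod>i\<in>UNIV. (cmod (f (p i) (x $ i)))^2) = (\<Prod>i\<in>UNIV. (cmod (f i (perm_conf (inv p) x $ i)))^2)"
 using prod.permute[OF p, of "%i. (cmod (f i (x $ inv p i)))^2"] permutes_inverses[OF p]
 by (simp add: comp_def perm_conf_def)

text \<open>Against weights invariant under permutations of the particles, a Slater determinant of functions with
 disjoint supports has the same density as the product of these functions.\<close>

lemma nn_integral_slater:
 fixes f :: "'n::finite => real^3 => complex"
 assumes f: "!!i. L2 (f i)" and d: "!!i j y. i ~= j ==> f i y = 0 | f j y = 0"
  and [measurable]: "S \<in> borel_measurable borel" and inv: "!!p x. p permutes UNIV ==> S (perm_conf p x) = S x"
 shows "(\<integral>\<^sup>+x. S x * ennreal ((cmod (slater f x))^2) \<partial>lborel) = (\<integral>\<^sup>+x. S x * ennreal (\<Prod>i\<in>UNIV. (cmod (f i (x $ i)))^2) \<partial>lborel)"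
proof -
 note [measurable] = L2_measurable[OF f]
 let ?G = "%x. \<Prod>i\<in>UNIV. (cmod (f i (x $ i)))^2"
 have "(\<integral>\<^sup>+x. S x * ennreal ((cmod (slater f x))^2) \<partial>lborel) = (\<integral>\<^sup>+x. (\<Sum>p\<in>perms. ennreal (1 / fact CARD('n)) * (S x * ennreal (?G (perm_conf (inv p) x)))) \<partial>lborel)"
 proof (intro nn_integral_cong)
  fix x
  have "ennreal ((cmod (slater f x))^2) = ennreal (\<Sum>p\<in>perms. 1 / fact CARD('n) * ?G (perm_conf (inv p) x))"
  proof (intro arg_cong[of _ _ ennreal])
   have "(cmod (slater f x))^2 = (\<Sum>p\<in>perms. (\<Prod>i\<in>UNIV. (cmod (f (p i) (x $ i)))^2)) / fact CARD('n)"
    by (rule slater_norm_disjoint) (rule d)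
   then show "(cmod (slater f x))^2 = (\<Sum>p\<in>perms. 1 / fact CARD('n) * ?G (perm_conf (inv p) x))"
    unfolding sum_divide_distrib by (auto simp: slater_norm_perm intro!: sum.cong)
  qed
  also have "... = (\<Sum>p\<in>perms. ennreal (1 / fact CARD('n) * ?G (perm_conf (inv p) x)))"
   by (rule sum_ennreal[symmetric]) (intro mult_nonneg_nonneg prod_nonneg; simp)
  also have "... = (\<Sum>p\<in>perms. ennreal (1 / fact CARD('n)) * ennreal (?G (perm_conf (inv p) x)))"
   by (intro sum.cong refl ennreal_mult'' prod_nonneg) simp
  finally show "S x * ennreal ((cmod (slater f x))^2) = (\<Sum>p\<in>perms. ennreal (1 / fact CARD('n)) * (S x * ennreal (?G (perm_conf (inv p) x))))"
   by (simp add: sum_distrib_left mult.left_commute)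
 qed
 also have "... = (\<Sum>p\<in>perms. \<integral>\<^sup>+x. ennreal (1 / fact CARD('n)) * (S x * ennreal (?G (perm_conf (inv p) x))) \<partial>lborel)"
  by (rule nn_integral_sum) measurable
 also have "... = (\<Sum>p\<in>(perms :: ('n => 'n) set). ennreal (1 / fact CARD('n)) * (\<integral>\<^sup>+x. S x * ennreal (?G x) \<partial>lborel))"
 proof (intro sum.cong refl)
  fix p :: "'n => 'n" assume "p \<in> perms"
  then have ip: "inv p permutes UNIV" by (auto intro: permutes_inv)
  have "(\<integral>\<^sup>+x. S x * ennreal (?G x) \<partial>lborel) = (\<integral>\<^sup>+x. S (perm_conf (inv p) x) * ennreal (?G (perm_conf (inv p) x)) \<partial>lborel)"
   by (subst lborel_perm_conf[OF ip, symmetric], subst nn_integral_distr) auto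
  also have "... = (\<integral>\<^sup>+x. S x * ennreal (?G (perm_conf (inv p) x)) \<partial>lborel)" by (simp add: inv[OF ip])
  finally show "(\<integral>\<^sup>+x. ennreal (1 / fact CARD('n)) * (S x * ennreal (?G (perm_conf (inv p) x))) \<partial>lborel)
   = ennreal (1 / fact CARD('n)) * (\<integral>\<^sup>+x. S x * ennreal (?G x) \<partial>lborel)"
   by (simp add: nn_integral_cmult)
 qed
 also have "... = (\<integral>\<^sup>+x. S x * ennreal (?G x) \<partial>lborel)"
 proof -
  have "ennreal (fact CARD('n)) * ennreal (1 / fact CARD('n)) = 1"
   by (subst ennreal_mult[symmetric]) auto
  then show ?thesis by (simp add: card_perms mult.assoc[symmetric] ennreal_of_nat_eq_real_of_nat[symmetric] flip: ennreal_fact)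
 qed
 finally show ?thesis .
qed

section \<open>Diagonalization of symmetric matrices\<close>

lemma sum_remove2:
 fixes f :: "'k => 'b::comm_monoid_add"
 assumes "finite K" "p \<in> K" "q \<in> K" "p ~= q"
 shows "sum f K = f p + (f q + sum f (K - {p, q}))"
proof -
 have "sum f K = f p + sum f (K - {p})" using assms by (simp add: sum.remove)
 also have "sum f (K - {p}) = f q + sum f (K - {p} - {q})" using assms by (simp add: sum.remove)
 also have "K - {p} - {q} = K - {p, q}" by auto
 finally show ?thesis .
qed

text \<open>The angle \<open>t/2\<close> diagonalizes the 2 by 2 block with diagonal
  \<open>a\<close>, \<open>b\<close> and off-diagonal entry \<open>h\<close>. The new diagonal
  entries have the same sum \<open>a + b\<close> and the difference \<open>r\<close>, so the sum of
  their squares grows by \<open>2 * h^2\<close>.\<close>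

lemma jacobi_rotation:
 fixes a b h :: real
 assumes "h ~= 0"
 shows "EX c s. c^2 + s^2 = 1 &
  a^2 + b^2 < (c^2 * a + 2 * c * s * h + s^2 * b)^2 + (s^2 * a - 2 * c * s * h + c^2 * b)^2"
proof -
 define r where "r = sqrt ((a - b)^2 + (2 * h)^2)"
 have r2: "r^2 = (a - b)^2 + (2 * h)^2" unfolding r_def by (rule real_sqrt_pow2) auto
 have "0 < (2 * h)^2" using assms by simp
 then have rpos: "r > 0" unfolding r_def real_sqrt_gt_0_iff by (intro add_nonneg_pos) auto
 have "((a - b) / r)^2 + (2 * h / r)^2 = 1"
  unfolding power_divide add_divide_distrib[symmetric] r2[symmetric] using rpos by simp
 then obtain t where t: "(a - b) / r = cos t" "2 * h / r = sin t" using sincos_total_2pi by metis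
 define c s where "c = cos (t/2)" and "s = sin (t/2)"
 have cs: "c^2 + s^2 = 1" by (simp add: c_def s_def)
 have "cos t = c^2 - s^2" using cos_double[of "t/2"] by (simp add: c_def s_def)
 moreover have "sin t = 2 * s * c" using sin_double[of "t/2"] by (simp add: c_def s_def)
 moreover have "a - b = r * cos t" "2 * h = r * sin t" using t rpos by (simp_all add: field_simps)
 ultimately have ab: "a - b = r * (c^2 - s^2)" "2 * h = r * (2 * s * c)" by simp_all
 define x y where "x = c^2 * a + 2 * c * s * h + s^2 * b" and "y = s^2 * a - 2 * c * s * h + c^2 * b"
 have "x + y = (c^2 + s^2) * (a + b)" unfolding x_def y_def by (simp add: algebra_simps)
 then have xy: "x + y = a + b" using cs by simp
 have "x - y = (c^2 - s^2) * (a - b) + 2 * c * s * (2 * h)" unfolding x_def y_def by (simp add: algebra_simps)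
 also have "... = r * (c^2 + s^2)^2" unfolding ab by (simp add: algebra_simps power2_eq_square)
 finally have xmy: "x - y = r" using cs by simp
 have "2 * (x^2 + y^2) = (x + y)^2 + (x - y)^2" by (simp add: power2_eq_square algebra_simps)
 also have "... = (a + b)^2 + ((a - b)^2 + (2 * h)^2)" unfolding xy xmy r2 ..
 also have "... > (a + b)^2 + (a - b)^2" using \<open>0 < (2 * h)^2\<close> by simp
 also have "(a + b)^2 + (a - b)^2 = 2 * (a^2 + b^2)" by (simp add: power2_eq_square algebra_simps)
 finally have "a^2 + b^2 < x^2 + y^2" by simp
 then show ?thesis using cs unfolding x_def y_def by blast
qed

text \<open>Diagonalization of a symmetric matrix indexed by a finite set: an orthogonal matrix maximizing the sum of the
 squares of the diagonal entries diagonalizes, since otherwise a Jacobi rotation would increase this sum.\<close>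

lemma symmetric_diagonalization:
 fixes M :: "'k => 'k => real"
 assumes fin: "finite K" and sym: "!!k l. M k l = M l k"
 shows "\<exists>U :: 'k \<times> 'k => real. (\<forall>k\<in>K. \<forall>l\<in>K. (\<Sum>j\<in>K. U (j, k) * U (j, l)) = (if k = l then 1 else 0)) &
  (\<forall>i\<in>K. \<forall>j\<in>K. i ~= j --> (\<Sum>k\<in>K. \<Sum>l\<in>K. U (i, k) * M k l * U (j, l)) = 0)"
proof -
 \<comment> \<open>Matrices are functions on pairs, set to 0 outside \<open>K\<close>, so that the
   orthogonal ones form a closed subset of a compact cube in the product topology.\<close>
 define S where "S = {U :: 'k \<times> 'k => real. (ALL z. z \<notin> K \<times> K --> U z = 0) &
  (\<forall>k\<in>K. \<forall>l\<in>K. (\<Sum>j\<in>K. U (j, k) * U (j, l)) = (if k = l then 1 else 0))}"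
 define A where "A = (%(U :: 'k \<times> 'k => real) i j. \<Sum>k\<in>K. \<Sum>l\<in>K. U (i, k) * M k l * U (j, l))"
 define \<Phi> where "\<Phi> = (%U. \<Sum>i\<in>K. (A U i i)^2)"
 have cc: "continuous_on UNIV (%U :: 'k \<times> 'k => real. U z)" for z
  by (rule continuous_on_product_coordinates)
 have "compact (PiE UNIV (%_. {-1..1}) :: ('k \<times> 'k => real) set)"
  by (subst compactin_euclidean_iff[symmetric], subst euclidean_product_topology[symmetric], subst compactin_PiE) auto
 moreover have "closed S"
 proof -
  have "S = (\<Inter>z\<in>- (K \<times> K). {U. U z = 0}) \<inter> (\<Inter>k\<in>K. \<Inter>l\<in>K. {U. (\<Sum>j\<in>K. U (j, k) * U (j, l)) = (if k = l then 1 else 0)})"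
   unfolding S_def by auto
  moreover have "closed {U :: 'k \<times> 'k => real. U z = 0}" for z
   by (intro closed_Collect_eq cc continuous_intros)
  moreover have "closed {U :: 'k \<times> 'k => real. (\<Sum>j\<in>K. U (j, k) * U (j, l)) = (if k = l then 1 else 0)}" for k l
   by (intro closed_Collect_eq continuous_on_sum continuous_on_mult cc continuous_intros)
  ultimately show ?thesis by (auto intro!: closed_INT)
 qed
 moreover have "S \<subseteq> PiE UNIV (%_. {-1..1})"
 proof
  fix U assume U: "U \<in> S"
  have "\<bar>U (j, k)\<bar> <= 1" for j k
  proof (cases "(j, k) \<in> K \<times> K")
   case True
   then have "U (j, k) * U (j, k) <= (\<Sum>j\<in>K. U (j, k) * U (j, k))"
    using fin by (intro member_le_sum) auto
   also have "... = 1" using U True unfolding S_def by auto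
   finally show ?thesis by (simp add: abs_square_le_1 power2_eq_square[symmetric])
  qed (use U in "auto simp: S_def")
  then show "U \<in> PiE UNIV (%_. {-1..1})" by (auto simp: PiE_def Pi_iff abs_le_iff)
 qed
 ultimately have "compact S" by (metis compact_Int_closed inf.absorb_iff2)
 moreover have "(%(j, k). if j = k & j \<in> K then 1 else 0) \<in> S"
  unfolding S_def using fin by (auto simp: if_distrib[of "%x. x * _"] sum.delta cong: if_cong)
 moreover have "continuous_on S \<Phi>"
  unfolding \<Phi>_def A_def by (intro continuous_intros continuous_on_subset[OF cc]) auto
 ultimately obtain U where U: "U \<in> S" and max: "!!V. V \<in> S ==> \<Phi> V <= \<Phi> U"
  using continuous_attains_sup[of S \<Phi>] by blast
 have "A U p q = 0" if pq: "p \<in> K" "q \<in> K" "p ~= q" for p q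
 proof (rule ccontr)
  assume h: "A U p q ~= 0"
  obtain c s where cs: "c^2 + s^2 = 1" and inc: "(A U p p)^2 + (A U q q)^2 <
   (c^2 * A U p p + 2 * c * s * A U p q + s^2 * A U q q)^2 + (s^2 * A U p p - 2 * c * s * A U p q + c^2 * A U q q)^2"
   using jacobi_rotation[OF h] by metis
  \<comment> \<open>Rows \<open>p\<close> and \<open>q\<close> are rotated by the Jacobi angle. The
    matrix stays orthogonal, and of the diagonal entries only those at \<open>p\<close> and
    \<open>q\<close> change.\<close>
  define V where "V = (%(j, k). if j = p then c * U (p, k) + s * U (q, k) else if j = q then c * U (q, k) - s * U (p, k) else U (j, k))"
  have Vp: "V (p, k) = c * U (p, k) + s * U (q, k)" and Vq: "V (q, k) = c * U (q, k) - s * U (p, k)" for k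
   using pq by (auto simp: V_def)
  have Vo: "V (j, k) = U (j, k)" if "j ~= p" "j ~= q" for j k using that by (auto simp: V_def)
  have sA: "A U q p = A U p q"
  proof -
   have "A U q p = (\<Sum>k\<in>K. \<Sum>l\<in>K. U (q, l) * M l k * U (p, k))" unfolding A_def by (rule sum.swap)
   also have "... = A U p q" unfolding A_def
   proof (intro sum.cong refl)
    fix k l show "U (q, l) * M l k * U (p, k) = U (p, k) * M k l * U (q, l)" using sym[of l k] by (simp only: mult_ac)
   qed
   finally show ?thesis .
  qed
  have "V \<in> S"
  proof -
   have "(\<Sum>j\<in>K. V (j, k) * V (j, l)) = (\<Sum>j\<in>K. U (j, k) * U (j, l))" for k l
   proof -
    have "V (p, k) * V (p, l) + V (q, k) * V (q, l) = (c^2 + s^2) * (U (p, k) * U (p, l) + U (q, k) * U (q, l))"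
     unfolding Vp Vq by (simp add: algebra_simps power2_eq_square)
    moreover have "(\<Sum>j\<in>K - {p, q}. V (j, k) * V (j, l)) = (\<Sum>j\<in>K - {p, q}. U (j, k) * U (j, l))"
     by (intro sum.cong) (auto simp: Vo)
    ultimately show ?thesis using cs by (simp add: sum_remove2[OF fin pq] add.assoc[symmetric])
   qed
   then show ?thesis using U pq unfolding S_def by (auto simp: V_def)
  qed
  moreover have "\<Phi> U < \<Phi> V"
  proof -
   have "A V p p = c^2 * A U p p + c * s * A U p q + c * s * A U q p + s^2 * A U q q"
   proof -
    have "A V p p = (\<Sum>k\<in>K. \<Sum>l\<in>K. c^2 * (U (p, k) * M k l * U (p, l)) + c * s * (U (p, k) * M k l * U (q, l))
      + c * s * (U (q, k) * M k l * U (p, l)) + s^2 * (U (q, k) * M k l * U (q, l)))"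
     unfolding A_def Vp by (intro sum.cong refl) (simp add: algebra_simps power2_eq_square)
    then show ?thesis by (simp only: sum.distrib sum_distrib_left A_def)
   qed
   moreover have "A V q q = s^2 * A U p p - c * s * A U p q - c * s * A U q p + c^2 * A U q q"
   proof -
    have "A V q q = (\<Sum>k\<in>K. \<Sum>l\<in>K. s^2 * (U (p, k) * M k l * U (p, l)) - c * s * (U (p, k) * M k l * U (q, l))
      - c * s * (U (q, k) * M k l * U (p, l)) + c^2 * (U (q, k) * M k l * U (q, l)))"
     unfolding A_def Vq by (intro sum.cong refl) (simp add: algebra_simps power2_eq_square)
    then show ?thesis by (simp only: sum.distrib sum_subtractf sum_distrib_left A_def)
   qed
   moreover have "(\<Sum>i\<in>K - {p, q}. (A V i i)^2) = (\<Sum>i\<in>K - {p, q}. (A U i i)^2)"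
    unfolding A_def by (intro sum.cong refl) (auto simp: Vo)
   ultimately have "A V p p = c^2 * A U p p + 2 * c * s * A U p q + s^2 * A U q q"
    "A V q q = s^2 * A U p p - 2 * c * s * A U p q + c^2 * A U q q"
    "(\<Sum>i\<in>K - {p, q}. (A V i i)^2) = (\<Sum>i\<in>K - {p, q}. (A U i i)^2)"
    using sA by simp_all
   then show ?thesis using inc unfolding \<Phi>_def sum_remove2[OF fin pq] by simp
  qed
  ultimately show False using max by fastforce
 qed
 then show ?thesis using U unfolding S_def A_def by (intro exI[of _ U]) auto
qed

section \<open>States from non-orthogonal mixtures\<close>

lemma slater_nonzeroD:
 assumes "slater f x ~= 0"
 shows "EX p. p permutes UNIV & (ALL i. f (p i) (x $ i) ~= 0)"
proof -
 obtain p where "p \<in> perms" "(\<Prod>i\<in>UNIV. f (p i) (x $ i)) ~= 0"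
  using assms unfolding slater_expand by (metis (no_types, lifting) mult_zero_right sum.neutral)
 then show ?thesis by (auto simp: prod_zero_iff)
qed

lemma slater_integral_one:
 fixes f :: "'n::finite => real^3 => complex"
 assumes f: "!!i. L2 (f i)" and d: "!!i j y. i ~= j ==> f i y = 0 | f j y = 0"
  and n: "!!i. (\<integral>\<^sup>+y. ennreal ((cmod (f i y))^2) \<partial>lborel) = 1"
 shows "(\<integral>x. (cmod (slater f x))^2 \<partial>lborel) = 1"
proof -
 note [measurable] = L2_measurable[OF f]
 have "(\<integral>\<^sup>+x. 1 * ennreal ((cmod (slater f x))^2) \<partial>lborel) = (\<integral>\<^sup>+x. 1 * ennreal (\<Prod>i\<in>UNIV. (cmod (f i (x $ i)))^2) \<partial>lborel)"
  by (rule nn_integral_slater[OF f]) (use d in auto)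
 also have "... = (\<integral>\<^sup>+x. (\<Prod>i\<in>UNIV. ennreal ((cmod (f i (x $ i)))^2)) \<partial>lborel)" by (simp add: prod_ennreal)
 also have "... = 1" by (subst nn_integral_vec_prod) (auto simp: n)
 finally have "(\<integral>\<^sup>+x. ennreal ((cmod (slater f x))^2) \<partial>lborel) = 1" by simp
 then show ?thesis using L2_measurable[OF L2_slater[of f, OF f]] by (subst integral_eq_nn_integral) auto
qed

text \<open>Slater determinants of normalized indicators of thin annuli around the origin.\<close>

lemma orthonormal_antisym_near_origin:
 assumes "dl > 0"
 shows "\<exists>\<Theta> :: nat => real^3^'n::finite => complex. (ALL k. L2 (\<Theta> k) & antisym_fun (\<Theta> k) & (ALL x. \<Theta> k x ~= 0 --> (ALL i. norm (x $ i) < dl))) &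
  (ALL k l. (\<integral>x. \<Theta> k x * cnj (\<Theta> l x) \<partial>lborel) = (if k = l then 1 else 0))"
proof -
 \<comment> \<open>Radii decreasing from \<open>dl\<close> cut the ball of radius \<open>dl\<close>
   into infinitely many disjoint annuli of positive finite volume.\<close>
 define r where "r j = dl / real (Suc j)" for j :: nat
 define D where "D j = ball (0 :: real^3) (r j) - ball 0 (r (Suc j))" for j
 have rm: "r j <= r i" if "i <= j" for i j
  unfolding r_def by (rule divide_left_mono) (use assms that in auto)
 have r1: "0 < r j" for j by (simp add: r_def assms)
 have r2: "r (Suc j) < r j" for j
  unfolding r_def by (rule divide_strict_left_mono) (use assms in auto)
 have r3: "r j <= dl" for j using rm[of 0 j] by (simp add: r_def)
 note r = r1 r2 r3
 have Ddis: "D i \<inter> D j = {}" if "i < j" for i j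
 proof -
  have "ball 0 (r j) \<subseteq> ball (0 :: real^3) (r (Suc i))" using rm[of "Suc i" j] that by (intro subset_ball) auto
  then show ?thesis unfolding D_def by blast
 qed
 have Ddis': "i = j" if "y \<in> D i" "y \<in> D j" for i j y
  using Ddis[of i j] Ddis[of j i] that nat_neq_iff[of i j] by blast
 have Dm[measurable]: "D j \<in> sets borel" for j by (simp add: D_def)
 have Dfin: "emeasure lborel (D j) < \<infinity>" for j
  by (intro emeasure_bounded_finite bounded_subset[OF bounded_ball, of _ 0 "r j"]) (auto simp: D_def)
 have Dpos: "emeasure lborel (D j) > 0" for j
 proof -
  define c where "c = ((r j + r (Suc j)) / 2) *\<^sub>R (axis 1 1 :: real^3)"
  define e where "e = (r j - r (Suc j)) / 2"
  have nc: "norm c = (r j + r (Suc j)) / 2" using r(1)[of j] r(1)[of "Suc j"] by (simp add: c_def)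
  have "ball c e \<subseteq> D j"
  proof
   fix y assume "y \<in> ball c e"
   then have "norm (c - y) < e" by (simp add: dist_norm)
   moreover have "norm y <= norm c + norm (c - y)" "norm c <= norm y + norm (c - y)"
    using norm_triangle_ineq4[of c "c - y"] norm_triangle_ineq[of y "c - y"] by auto
   ultimately show "y \<in> D j" using nc by (auto simp: D_def e_def field_simps)
  qed
  then have "emeasure lborel (ball c e) <= emeasure lborel (D j)" by (rule emeasure_mono) simp
  moreover have "emeasure lborel (ball c e) > 0"
   using r(2)[of j] by (simp add: e_def emeasure_ball)
  ultimately show ?thesis by order
 qed
 define m where "m j = measure lborel (D j)" for j
 have m: "0 < m j" "emeasure lborel (D j) = ennreal (m j)" for j
 proof -
  show e: "emeasure lborel (D j) = ennreal (m j)"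
   unfolding m_def by (rule emeasure_eq_ennreal_measure) (use Dfin[of j] in auto)
  show "0 < m j" using Dpos[of j] unfolding e by simp
 qed
 \<comment> \<open>The particles are numbered by \<open>e\<close>; \<open>prod_encode\<close> then
   reserves a separate annulus for every pair of a determinant index and a particle. This makes
   orbitals disjoint within a determinant and between determinants.\<close>
 obtain e :: "'n => nat" where e: "inj e" using ex_bij_betw_finite_nat[of "UNIV :: 'n set"] by (auto simp: bij_betw_def)
 define f where "f k i y = complex_of_real (indicator (D (prod_encode (k, e i))) y / sqrt (m (prod_encode (k, e i))))" for k i y
 have fm[measurable]: "f k i \<in> borel_measurable borel" for k i unfolding f_def by measurable
 have fsq: "(cmod (f k i y))^2 = (1 / m (prod_encode (k, e i))) * indicator (D (prod_encode (k, e i))) y" for k i y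
  using m(1)[of "prod_encode (k, e i)"] by (auto simp: f_def indicator_def power_divide norm_divide)
 have fn: "(\<integral>\<^sup>+y. ennreal ((cmod (f k i y))^2) \<partial>lborel) = 1" for k i
 proof -
  have "(\<integral>\<^sup>+y. ennreal ((cmod (f k i y))^2) \<partial>lborel) = ennreal (1 / m (prod_encode (k, e i))) * emeasure lborel (D (prod_encode (k, e i)))"
  proof -
   have "(\<integral>\<^sup>+y. ennreal ((cmod (f k i y))^2) \<partial>lborel) = (\<integral>\<^sup>+y. ennreal (1 / m (prod_encode (k, e i))) * indicator (D (prod_encode (k, e i))) y \<partial>lborel)"
    unfolding fsq by (intro nn_integral_cong) (auto simp: indicator_def)
   then show ?thesis by (simp add: nn_integral_cmult_indicator)
  qed
  then show ?thesis using m[of "prod_encode (k, e i)"] by (simp add: ennreal_mult[symmetric])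
 qed
 have fL: "L2 (f k i)" for k i
 proof -
  have "(%y. (cmod (f k i y))^2) \<in> borel_measurable lborel" by measurable
  then have "integrable lborel (%y. (cmod (f k i y))^2)" by (rule integrableI_bounded) (simp add: fn)
  then show ?thesis unfolding L2_def by simp
 qed
 have fd: "f k i y = 0 | f l j y = 0" if "(k, i) ~= (l, j)" for k i l j y
 proof -
  have "prod_encode (k, e i) ~= prod_encode (l, e j)" using that by (auto simp: prod_encode_eq inj_eq[OF e])
  then have "y \<notin> D (prod_encode (k, e i)) | y \<notin> D (prod_encode (l, e j))" using Ddis' by blast
  then show ?thesis by (auto simp: f_def)
 qed
 define \<Theta> where "\<Theta> k = slater (f k)" for k
 have dis: "\<Theta> k x = 0 | \<Theta> l x = 0" if kl: "k ~= l" for k l x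
 proof (rule ccontr)
  assume "~ ?thesis"
  then have "slater (f k) x ~= 0" "slater (f l) x ~= 0" by (auto simp: \<Theta>_def)
  then obtain p q where "ALL i. f k (p i) (x $ i) ~= 0" "ALL i. f l (q i) (x $ i) ~= 0"
   using slater_nonzeroD[of "f k" x] slater_nonzeroD[of "f l" x] by blast
  then show False using fd[of k "p undefined" l "q undefined" "x $ undefined"] kl by auto
 qed
 have 1: "(\<integral>x. \<Theta> k x * cnj (\<Theta> l x) \<partial>lborel) = 0" if "k ~= l" for k l
 proof -
  have z: "\<Theta> k x * cnj (\<Theta> l x) = 0" for x using dis[OF that, of x] by auto
  show ?thesis unfolding z by simp
 qed
 have 2: "(\<integral>x. \<Theta> k x * cnj (\<Theta> k x) \<partial>lborel) = 1" for k
 proof -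
  have "(\<integral>x. (cmod (slater (f k) x))^2 \<partial>lborel) = 1"
  proof (rule slater_integral_one[OF fL])
   show "f k i y = 0 | f k j y = 0" if "i ~= j" for i j y using fd[of k i k j y] that by blast
  qed (rule fn)
  then show ?thesis unfolding \<Theta>_def complex_norm_square[symmetric] integral_complex_of_real by simp
 qed
 have 3: "norm (x $ i) < dl" if "\<Theta> k x ~= 0" for k x i
 proof -
  obtain p where "f k (p i) (x $ i) ~= 0" using slater_nonzeroD[of "f k" x] \<open>\<Theta> k x ~= 0\<close> unfolding \<Theta>_def by blast
  then show ?thesis using r(3)[of "prod_encode (k, e (p i))"] by (auto simp: f_def indicator_def D_def split: if_splits)
 qed
 show ?thesis
 proof (intro exI conjI allI impI)
  show "L2 (\<Theta> k)" "antisym_fun (\<Theta> k)" for k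
   unfolding \<Theta>_def by (rule L2_slater[OF fL], rule antisym_slater)
  show "norm (x $ i) < dl" if "\<Theta> k x ~= 0" for k x i using 3 that by blast
  show "(\<integral>x. \<Theta> k x * cnj (\<Theta> l x) \<partial>lborel) = (if k = l then 1 else 0)" for k l
   using 1[of k l] 2[of k] by (cases "k = l") simp_all
 qed
qed

lemma L2_product_integrable:
 assumes "L2 f" "L2 g"
 shows "integrable lborel (%x. f x * cnj (g x))"
proof (rule Bochner_Integration.integrable_bound)
 note [measurable] = L2_measurable[OF assms(1)] L2_measurable[OF assms(2)]
 have [measurable]: "(cnj :: complex => complex) \<in> borel_measurable borel"
  by (intro borel_measurable_continuous_onI continuous_intros)
 show "integrable lborel (%x. (cmod (f x))^2 + (cmod (g x))^2)" using assms by (auto simp: L2_def)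
 have "cmod (f x) * cmod (g x) <= (cmod (f x))^2 + (cmod (g x))^2" for x
 proof -
  have "2 * (cmod (f x) * cmod (g x)) <= (cmod (f x))^2 + (cmod (g x))^2"
   using sum_squares_bound[of "cmod (f x)" "cmod (g x)"] by (simp add: mult.assoc)
  moreover have "0 <= cmod (f x) * cmod (g x)" by simp
  ultimately show ?thesis by linarith
 qed
 then show "AE x in lborel. norm (f x * cnj (g x)) <= norm ((cmod (f x))^2 + (cmod (g x))^2)"
  by (auto simp: norm_mult intro!: AE_I2 order_trans[OF _ abs_ge_self])
 show "(%x. f x * cnj (g x)) \<in> borel_measurable lborel" by measurable
qed

text \<open>An orthogonal change of the family preserves the pointwise sum of squares, and with it
  the mass, the density, and the kinetic and Coulomb energies of the mixture.\<close>

lemma orthogonal_mix_norm: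
 fixes U :: "'k \<times> 'k => real" and z :: "'k => complex"
 assumes fin: "finite K" and U: "!!k l. k \<in> K ==> l \<in> K ==> (\<Sum>j\<in>K. U (j, k) * U (j, l)) = (if k = l then 1 else 0)"
 shows "(\<Sum>i\<in>K. (cmod (\<Sum>k\<in>K. complex_of_real (U (i, k)) * z k))^2) = (\<Sum>k\<in>K. (cmod (z k))^2)"
proof -
 have "complex_of_real (\<Sum>i\<in>K. (cmod (\<Sum>k\<in>K. complex_of_real (U (i, k)) * z k))^2)
   = (\<Sum>i\<in>K. (\<Sum>k\<in>K. complex_of_real (U (i, k)) * z k) * (\<Sum>l\<in>K. complex_of_real (U (i, l)) * cnj (z l)))"
  by (simp add: complex_norm_square del: of_real_power)
 also have "... = (\<Sum>i\<in>K. \<Sum>k\<in>K. \<Sum>l\<in>K. complex_of_real (U (i, k) * U (i, l)) * (z k * cnj (z l)))"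
  unfolding sum_product by (intro sum.cong refl) (simp add: mult_ac)
 also have "... = (\<Sum>k\<in>K. \<Sum>i\<in>K. \<Sum>l\<in>K. complex_of_real (U (i, k) * U (i, l)) * (z k * cnj (z l)))"
  by (rule sum.swap)
 also have "... = (\<Sum>k\<in>K. \<Sum>l\<in>K. \<Sum>i\<in>K. complex_of_real (U (i, k) * U (i, l)) * (z k * cnj (z l)))"
  by (intro sum.cong refl sum.swap)
 also have "... = (\<Sum>k\<in>K. \<Sum>l\<in>K. complex_of_real (\<Sum>i\<in>K. U (i, k) * U (i, l)) * (z k * cnj (z l)))"
  by (simp add: sum_distrib_right)
 also have "... = (\<Sum>k\<in>K. \<Sum>l\<in>K. (if k = l then z k * cnj (z l) else 0))"
  by (intro sum.cong refl) (simp add: U)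
 also have "... = complex_of_real (\<Sum>k\<in>K. (cmod (z k))^2)"
  using fin by (simp add: complex_norm_square sum.delta del: of_real_power)
 finally show ?thesis by (simp only: of_real_eq_iff)
qed

lemma coulomb_measurable [measurable]: "coulomb \<in> borel_measurable borel"
 unfolding coulomb_def case_prod_beta by measurable

lemma antisym_cmult: "antisym_fun f ==> antisym_fun (%x. c * f x)"
 unfolding antisym_fun_def by simp

lemma antisym_sum: "(!!k. k \<in> K ==> antisym_fun (f k)) ==> antisym_fun (%x. \<Sum>k\<in>K. f k x)"
 unfolding antisym_fun_def by (simp add: sum_distrib_left)

text \<open>An upper bound from an unnormalized mixture that need not be orthogonal. Its Gram matrix is diagonalized; functions
 supported near the diagonal, orthogonal to the mixture, complete the spectral decomposition with weight 0.\<close>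

lemma levy_lieb_le_mixture:
 fixes F :: "'k => real^3^'n::finite => complex" and G :: "'k => real^3^'n => real^3^'n => complex"
 assumes fin: "finite K" and dl: "dl > 0"
  and F: "!!k. k \<in> K ==> L2 (F k)" and anti: "!!k. k \<in> K ==> antisym_fun (F k)"
  and re: "!!k x. k \<in> K ==> cnj (F k x) = F k x"
  and G: "!!k b. k \<in> K ==> b \<in> Basis ==> L2 (G k b)" and w: "!!k b. k \<in> K ==> b \<in> Basis ==> weak_partial (F k) b (G k b)"
  and near: "!!k x. k \<in> K ==> (!!i. norm (x $ i) < dl) ==> F k x = 0"
  and mass: "(\<Sum>k\<in>K. \<integral>x. (cmod (F k x))^2 \<partial>lborel) = 1"
  and dens: "!!ph. ph \<in> borel_measurable borel ==> bounded (range ph) ==>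
   (\<Sum>k\<in>K. \<integral>x. (\<Sum>j\<in>UNIV. ph (x $ j)) * (cmod (F k x))^2 \<partial>lborel) = (\<integral>y. ph y * \<rho> y \<partial>lborel)"
 shows "levy_lieb TYPE('n) \<rho> <= (\<Sum>k\<in>K. (\<Sum>b\<in>Basis. \<integral>\<^sup>+x. ennreal ((cmod (G k b x))^2) \<partial>lborel)
   + (\<integral>\<^sup>+x. coulomb x * ennreal ((cmod (F k x))^2) \<partial>lborel))"
proof -
 define M where "M k l = Re (\<integral>x. F k x * cnj (F l x) \<partial>lborel)" for k l
 \<comment> \<open>Extension by 0 makes the Gram matrix symmetric for all indices, as the
   diagonalization lemma demands. On \<open>K\<close> the inner products are real because the
   functions are.\<close>
 define M' where "M' k l = (if k \<in> K & l \<in> K then M k l else 0)" for k l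
 have Msym: "M' k l = M' l k" for k l
 proof (cases "k \<in> K & l \<in> K")
  case True
  have "F k x * cnj (F l x) = F l x * cnj (F k x)" for x using True by (simp only: re mult.commute)
  then show ?thesis using True by (simp only: M'_def M_def conj_commute)
 qed (auto simp: M'_def)
 have FF: "(\<integral>x. F k x * F l x \<partial>lborel) = complex_of_real (M k l)" if "k \<in> K" "l \<in> K" for k l
 proof -
  have "cnj (\<integral>x. F k x * F l x \<partial>lborel) = (\<integral>x. F k x * F l x \<partial>lborel)"
  proof -
   have "cnj (\<integral>x. F k x * F l x \<partial>lborel) = (\<integral>x. cnj (F k x * F l x) \<partial>lborel)" by (rule Bochner_Integration.integral_cnj[symmetric])
   also have "... = (\<integral>x. F k x * F l x \<partial>lborel)"
    by (rule Bochner_Integration.integral_cong[OF refl]) (use that in "simp add: re")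
   finally show ?thesis .
  qed
  then have "(\<integral>x. F k x * F l x \<partial>lborel) = complex_of_real (Re (\<integral>x. F k x * F l x \<partial>lborel))"
   by (metis Reals_cnj_iff of_real_Re)
  then show ?thesis using that by (simp add: M_def re)
 qed
 obtain U :: "'k \<times> 'k => real" where U: "(\<forall>k\<in>K. \<forall>l\<in>K. (\<Sum>j\<in>K. U (j, k) * U (j, l)) = (if k = l then 1 else 0)) &
  (\<forall>i\<in>K. \<forall>j\<in>K. i ~= j --> (\<Sum>k\<in>K. \<Sum>l\<in>K. U (i, k) * M' k l * U (j, l)) = 0)"
  using symmetric_diagonalization[of K M', OF fin Msym] by (elim exE)
 have U0: "(\<Sum>j\<in>K. U (j, k) * U (j, l)) = (if k = l then 1 else 0)" if "k \<in> K" "l \<in> K" for k l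
  using conjunct1[OF U] that by blast
 have U1: "(\<Sum>k\<in>K. \<Sum>l\<in>K. U (i, k) * M k l * U (j, l)) = 0" if "i \<in> K" "j \<in> K" "i ~= j" for i j
 proof -
  have "(\<Sum>k\<in>K. \<Sum>l\<in>K. U (i, k) * M k l * U (j, l)) = (\<Sum>k\<in>K. \<Sum>l\<in>K. U (i, k) * M' k l * U (j, l))"
   by (intro sum.cong refl) (simp add: M'_def)
  then show ?thesis using conjunct2[OF U] that by simp
 qed
 define g where "g i x = (\<Sum>k\<in>K. complex_of_real (U (i, k)) * F k x)" for i x
 define H where "H i b x = (\<Sum>k\<in>K. complex_of_real (U (i, k)) * G k b x)" for i b x
 have gL: "L2 (g i)" for i unfolding g_def[abs_def] by (intro L2_sum fin L2_cmult F)
 have HL: "L2 (H i b)" if "b \<in> Basis" for i b unfolding H_def[abs_def] by (intro L2_sum fin L2_cmult G that)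
 have gw: "weak_partial (g i) b (H i b)" if "b \<in> Basis" for i b
  unfolding g_def[abs_def] H_def[abs_def]
  by (rule weak_partial_sum[OF fin that]) (auto intro!: L2_cmult F G weak_partial_cmult w that)
 have ga: "antisym_fun (g i)" for i unfolding g_def[abs_def] by (intro antisym_sum antisym_cmult anti)
 have gnear: "g i x = 0" if "!!i. norm (x $ i) < dl" for i x
  unfolding g_def using near[OF _ that] by simp
 have greal: "cnj (g i x) = g i x" for i x unfolding g_def by (simp add: re)
 have gnorm: "(\<Sum>i\<in>K. (cmod (g i x))^2) = (\<Sum>k\<in>K. (cmod (F k x))^2)" for x
  unfolding g_def by (rule orthogonal_mix_norm[OF fin U0])
 have Hnorm: "(\<Sum>i\<in>K. (cmod (H i b x))^2) = (\<Sum>k\<in>K. (cmod (G k b x))^2)" for b x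
  unfolding H_def by (rule orthogonal_mix_norm[OF fin U0])
 have gorth: "(\<integral>x. g i x * cnj (g j x) \<partial>lborel) = 0" if "i \<in> K" "j \<in> K" "i ~= j" for i j
 proof -
  have int: "integrable lborel (%x. F k x * F l x)" if "k \<in> K" "l \<in> K" for k l
   using L2_product_integrable[OF F[OF that(1)] F[OF that(2)]] that by (simp add: re)
  have "g i x * cnj (g j x) = (\<Sum>k\<in>K. \<Sum>l\<in>K. complex_of_real (U (i, k) * U (j, l)) * (F k x * F l x))" for x
   unfolding greal unfolding g_def sum_product by (intro sum.cong refl) (simp add: mult_ac)
  then have "(\<integral>x. g i x * cnj (g j x) \<partial>lborel) = (\<integral>x. (\<Sum>k\<in>K. \<Sum>l\<in>K. complex_of_real (U (i, k) * U (j, l)) * (F k x * F l x)) \<partial>lborel)"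
   by (intro Bochner_Integration.integral_cong refl)
  also have "... = (\<Sum>k\<in>K. \<integral>x. (\<Sum>l\<in>K. complex_of_real (U (i, k) * U (j, l)) * (F k x * F l x)) \<partial>lborel)"
   by (rule Bochner_Integration.integral_sum) (intro Bochner_Integration.integrable_sum integrable_mult_right int)
  also have "... = (\<Sum>k\<in>K. \<Sum>l\<in>K. \<integral>x. complex_of_real (U (i, k) * U (j, l)) * (F k x * F l x) \<partial>lborel)"
   by (intro sum.cong refl Bochner_Integration.integral_sum integrable_mult_right int)
  also have "... = (\<Sum>k\<in>K. \<Sum>l\<in>K. complex_of_real (U (i, k) * U (j, l)) * (\<integral>x. F k x * F l x \<partial>lborel))"
   by (simp only: integral_mult_right_zero)
  also have "... = complex_of_real (\<Sum>k\<in>K. \<Sum>l\<in>K. U (i, k) * M k l * U (j, l))"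
   unfolding of_real_sum by (intro sum.cong refl) (simp add: FF mult_ac)
  finally show ?thesis using U1[OF that] by simp
 qed
 define n where "n i = (\<integral>x. (cmod (g i x))^2 \<partial>lborel)" for i
 have n0: "0 <= n i" for i unfolding n_def by simp
 have nsum: "(\<Sum>i\<in>K. n i) = 1"
 proof -
  have "(\<Sum>i\<in>K. n i) = (\<integral>x. (\<Sum>i\<in>K. (cmod (g i x))^2) \<partial>lborel)"
   unfolding n_def by (rule Bochner_Integration.integral_sum[symmetric]) (rule L2_square_integrable[OF gL])
  also have "... = (\<Sum>k\<in>K. \<integral>x. (cmod (F k x))^2 \<partial>lborel)"
   unfolding gnorm by (rule Bochner_Integration.integral_sum) (rule L2_square_integrable[OF F])
  finally show ?thesis using mass by simp
 qed
 \<comment> \<open>Combinations of norm 0 cannot be normalized; they vanish almost everywhere and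
   drop out of the mass and the density.\<close>
 define K' where "K' = {i \<in> K. n i > 0}"
 have finK': "finite K'" "K' \<subseteq> K" using fin by (auto simp: K'_def)
 have gz: "AE x in lborel. g i x = 0" if "i \<in> K - K'" for i
 proof -
  have "n i = 0" using that n0[of i] by (auto simp: K'_def)
  then have "AE x in lborel. (cmod (g i x))^2 = 0"
   unfolding n_def integral_nonneg_eq_0_iff_AE[OF L2_square_integrable[OF gL] AE_I2[OF zero_le_power2]] .
  then show ?thesis by simp
 qed
 obtain e :: "nat => 'k" where "bij_betw e {0..<card K'} K'" using ex_bij_betw_nat_finite[OF finK'(1)] by (elim exE)
 then obtain m where e: "bij_betw e {..<m::nat} K'" by (simp only: atLeast0LessThan) 
 have eK: "e k \<in> K'" if "k < m" for k using e that by (auto simp: bij_betw_def)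
 have einj: "e k = e l \<longleftrightarrow> k = l" if "k < m" "l < m" for k l using e that by (auto simp: bij_betw_def inj_on_def)
 have ereindex: "(\<Sum>k<m. h (e k)) = sum h K'" for h :: "'k => real"
  by (rule sum.reindex_bij_betw[OF e])
 have ereindex': "(\<Sum>k<m. h (e k)) = sum h K'" for h :: "'k => ennreal"
  by (rule sum.reindex_bij_betw[OF e])
 have npos: "n (e k) > 0" if "k < m" for k using eK[OF that] by (auto simp: K'_def)
 obtain \<Theta> :: "nat => real^3^'n => complex" where
  TT: "(ALL k. L2 (\<Theta> k) & antisym_fun (\<Theta> k) & (ALL x. \<Theta> k x ~= 0 --> (ALL i. norm (x $ i) < dl))) &
   (ALL k l. (\<integral>x. \<Theta> k x * cnj (\<Theta> l x) \<partial>lborel) = (if k = l then 1 else 0))"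
  using orthonormal_antisym_near_origin[OF dl] by (elim exE)
 have T: "L2 (\<Theta> k)" "antisym_fun (\<Theta> k)" "(\<integral>x. \<Theta> k x * cnj (\<Theta> l x) \<partial>lborel) = (if k = l then 1 else 0)" for k l
  using conjunct1[OF TT] conjunct2[OF TT] by simp_all
 have T3: "norm (x $ i) < dl" if "\<Theta> k x ~= 0" for k x i
  using conjunct1[OF TT] that by simp
 \<comment> \<open>The fillers live where all particles are within \<open>dl\<close> of the origin,
   and there every \<open>g i\<close> vanishes. Orthogonality between the two families is therefore
   pointwise.\<close>
 have gT: "g i x = 0 | \<Theta> k x = 0" for i k x using T3[of k x] gnear[of x] by blast
 \<comment> \<open>The nonzero eigenvalues of the Gram matrix, which are the squared norms of the
   \<open>g i\<close>, become the weights. Since \<open>mixed_state\<close> asks for an infinite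
   orthonormal sequence, the functions \<open>\<Theta>\<close> follow with weight 0.\<close>
 define lam where "lam k = (if k < m then n (e k) else 0)" for k
 define \<Psi> where "\<Psi> k = (if k < m then (%x. complex_of_real (1 / sqrt (n (e k))) * g (e k) x) else \<Theta> k)" for k
 have lamsum: "(%k. lam k * h k) sums (\<Sum>k<m. n (e k) * h k)" for h :: "nat => real"
  using sums_finite[of "{..<m}" "%k. lam k * h k"] by (simp add: lam_def)
 have "mixed_state lam \<Psi>"
  unfolding mixed_state_def
 proof (intro conjI allI)
  show "0 <= lam k" for k using n0 by (simp add: lam_def)
  have "(\<Sum>k<m. n (e k)) = sum n K" unfolding ereindex
   by (rule sum.mono_neutral_left[OF fin finK'(2)]) (use n0 in "auto simp: K'_def not_less intro: antisym")
  then show "lam sums 1" using lamsum[of "%_. 1"] nsum by simp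
  show "L2 (\<Psi> k)" for k unfolding \<Psi>_def by (cases "k < m") (simp_all only: if_True if_False L2_cmult[OF gL] T(1))
  show "antisym_fun (\<Psi> k)" for k unfolding \<Psi>_def by (cases "k < m") (simp_all only: if_True if_False antisym_cmult[OF ga] T(2))
  show "(\<integral>x. \<Psi> k x * cnj (\<Psi> l x) \<partial>lborel) = (if k = l then 1 else 0)" for k l
  proof -
   consider "k < m" "l < m" | "k < m" "~ l < m" | "~ k < m" "l < m" | "~ k < m" "~ l < m" by blast
   then show ?thesis
   proof cases
    case 1
    have eq: "\<Psi> k x * cnj (\<Psi> l x) = complex_of_real (1 / sqrt (n (e k)) * (1 / sqrt (n (e l)))) * (g (e k) x * cnj (g (e l) x))" for x
     using 1 by (simp add: \<Psi>_def)
    have i: "(\<integral>x. \<Psi> k x * cnj (\<Psi> l x) \<partial>lborel) = complex_of_real (1 / sqrt (n (e k)) * (1 / sqrt (n (e l)))) * (\<integral>x. g (e k) x * cnj (g (e l) x) \<partial>lborel)"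
     unfolding eq by (rule integral_mult_right_zero)
    show ?thesis
    proof (cases "k = l")
     case True
     have "(\<integral>x. g (e l) x * cnj (g (e l) x) \<partial>lborel) = complex_of_real (n (e l))"
      unfolding complex_norm_square[symmetric] n_def integral_complex_of_real ..
     then show ?thesis using True npos[of l] 1 unfolding i by (simp flip: of_real_mult)
    next
     case False
     then have "e k ~= e l" using einj 1 by simp
     then show ?thesis using gorth[of "e k" "e l"] eK 1 finK' False unfolding i by auto
    qed
   next
    case 2 then have z: "\<Psi> k x * cnj (\<Psi> l x) = 0" for x using gT[of "e k" x l] by (auto simp: \<Psi>_def)
    show ?thesis unfolding z using 2 by auto
   next
    case 3 then have z: "\<Psi> k x * cnj (\<Psi> l x) = 0" for x using gT[of "e l" x k] by (auto simp: \<Psi>_def)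
    show ?thesis unfolding z using 3 by auto
   next
    case 4 then show ?thesis using T(3) by (simp add: \<Psi>_def)
   qed
  qed
 qed
 moreover have "state_density lam \<Psi> \<rho>"
  unfolding state_density_def
 proof (intro allI impI)
  fix ph :: "real^3 => real" assume ph[measurable]: "ph \<in> borel_measurable borel" and bd: "bounded (range ph)"
  obtain B where B: "!!y. \<bar>ph y\<bar> <= B" using bd by (auto simp: bounded_iff)
  have B0: "0 <= B" using B[of 0] by linarith
  let ?S = "%x :: real^3^'n. \<Sum>j\<in>UNIV. ph (x $ j)"
  have Sm[measurable]: "?S \<in> borel_measurable borel" by measurable
  have int: "integrable lborel (%x. ?S x * (cmod (f x))^2)" if "L2 f" for f
  proof (rule Bochner_Integration.integrable_bound)
   note [measurable] = L2_measurable[OF that]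
   show "integrable lborel (%x. (real CARD('n) * B) * (cmod (f x))^2)" using L2_square_integrable[OF that] by simp
   have "\<bar>?S x\<bar> <= real CARD('n) * B" for x
    by (rule order_trans[OF sum_abs]) (rule sum_bounded_above, rule B)
   then show "AE x in lborel. norm (?S x * (cmod (f x))^2) <= norm ((real CARD('n) * B) * (cmod (f x))^2)"
    using B0 by (intro AE_I2) (auto simp: abs_mult intro!: mult_right_mono)
   show "(%x. ?S x * (cmod (f x))^2) \<in> borel_measurable lborel" by measurable
  qed
  have one: "n (e k) * (\<integral>x. ?S x * (cmod (\<Psi> k x))^2 \<partial>lborel) = (\<integral>x. ?S x * (cmod (g (e k) x))^2 \<partial>lborel)" if "k < m" for k
  proof -
   have "?S x * (cmod (\<Psi> k x))^2 = (1 / n (e k)) * (?S x * (cmod (g (e k) x))^2)" for x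
    using that npos[OF that] by (simp add: \<Psi>_def norm_mult norm_divide power_mult_distrib power_divide)
   then show ?thesis using npos[OF that] by simp
  qed
  have "(\<Sum>k<m. n (e k) * (\<integral>x. ?S x * (cmod (\<Psi> k x))^2 \<partial>lborel)) = (\<Sum>k<m. (\<integral>x. ?S x * (cmod (g (e k) x))^2 \<partial>lborel))"
   by (intro sum.cong refl one) simp
  also have "... = (\<Sum>i\<in>K'. (\<integral>x. ?S x * (cmod (g i x))^2 \<partial>lborel))" by (rule ereindex)
  also have "... = (\<Sum>i\<in>K. (\<integral>x. ?S x * (cmod (g i x))^2 \<partial>lborel))"
  proof (rule sum.mono_neutral_left[OF fin finK'(2)], intro ballI)
   fix i assume "i \<in> K - K'"
   from gz[OF this] show "(\<integral>x. ?S x * (cmod (g i x))^2 \<partial>lborel) = 0"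
    by (intro integral_eq_zero_AE) (auto elim!: eventually_mono)
  qed
  also have "... = (\<integral>x. (\<Sum>i\<in>K. ?S x * (cmod (g i x))^2) \<partial>lborel)"
   by (rule Bochner_Integration.integral_sum[symmetric]) (rule int[OF gL])
  also have "... = (\<integral>x. (\<Sum>k\<in>K. ?S x * (cmod (F k x))^2) \<partial>lborel)"
   unfolding sum_distrib_left[symmetric] gnorm ..
  also have "... = (\<Sum>k\<in>K. \<integral>x. ?S x * (cmod (F k x))^2 \<partial>lborel)"
   by (rule Bochner_Integration.integral_sum) (rule int[OF F])
  also have "... = (\<integral>y. ph y * \<rho> y \<partial>lborel)" by (rule dens[OF ph bd])
  finally show "(%k. lam k * (\<integral>x. ?S x * (cmod (\<Psi> k x))^2 \<partial>lborel)) sums (\<integral>y. ph y * \<rho> y \<partial>lborel)"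
   using lamsum[of "%k. \<integral>x. ?S x * (cmod (\<Psi> k x))^2 \<partial>lborel"] by simp
 qed
 ultimately have "levy_lieb TYPE('n) \<rho> <= (\<Sum>k. ennreal (lam k) * form_energy (\<Psi> k))"
  unfolding levy_lieb_def by (intro Inf_lower) blast
 also have "... = (\<Sum>k<m. ennreal (lam k) * form_energy (\<Psi> k))"
  by (rule suminf_finite) (auto simp: lam_def)
 also have "... = (\<Sum>k<m. (\<Sum>b\<in>Basis. \<integral>\<^sup>+x. ennreal ((cmod (H (e k) b x))^2) \<partial>lborel) + (\<integral>\<^sup>+x. coulomb x * ennreal ((cmod (g (e k) x))^2) \<partial>lborel))"
 proof (intro sum.cong refl)
  fix k assume "k \<in> {..<m}" then have k: "k < m" by simp
  let ?c = "complex_of_real (1 / sqrt (n (e k)))"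
  note [measurable] = L2_measurable[OF gL]
  have \<Psi>: "\<Psi> k = (%x. ?c * g (e k) x)" using k by (simp add: \<Psi>_def)
  have c2: "(cmod (?c * z))^2 = (1 / n (e k)) * (cmod z)^2" for z
   using npos[OF k] by (simp add: norm_mult norm_divide power_mult_distrib power_divide)
  have ww: "L2 (%x. ?c * H (e k) b x) & weak_partial (\<Psi> k) b (%x. ?c * H (e k) b x)" if "b \<in> Basis" for b
   unfolding \<Psi> using that by (intro conjI L2_cmult HL weak_partial_cmult gw)
  have h1: "H1 (\<Psi> k)" unfolding H1_def using ww L2_cmult[OF gL] unfolding \<Psi> by blast
  have sc: "(\<integral>\<^sup>+x. h x * ennreal ((cmod (?c * f x))^2) \<partial>lborel) = ennreal (1 / n (e k)) * (\<integral>\<^sup>+x. h x * ennreal ((cmod (f x))^2) \<partial>lborel)"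
   if [measurable]: "h \<in> borel_measurable borel" "f \<in> borel_measurable borel" for h f
  proof -
   have "(\<integral>\<^sup>+x. h x * ennreal ((cmod (?c * f x))^2) \<partial>lborel) = (\<integral>\<^sup>+x. ennreal (1 / n (e k)) * (h x * ennreal ((cmod (f x))^2)) \<partial>lborel)"
    unfolding c2 by (intro nn_integral_cong) (simp only: ennreal_mult''[OF zero_le_power2] mult.left_commute)
   then show ?thesis by (simp add: nn_integral_cmult)
  qed
  have nn: "ennreal (n (e k)) * (ennreal (1 / n (e k)) * X) = X" for X
   using npos[OF k] by (simp add: mult.assoc[symmetric] ennreal_mult[symmetric])
  have wg: "(\<integral>\<^sup>+x. ennreal ((cmod (wgrad (\<Psi> k) b x))^2) \<partial>lborel) = ennreal (1 / n (e k)) * (\<integral>\<^sup>+x. ennreal ((cmod (H (e k) b x))^2) \<partial>lborel)" if "b \<in> Basis" for b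
   using nn_integral_wgrad[of "%x. ?c * H (e k) b x" "\<Psi> k" b] ww[OF that] sc[of "%_. 1" "H (e k) b"] L2_measurable[OF HL[OF that]] by simp
  have "ennreal (lam k) * form_energy (\<Psi> k) = ennreal (n (e k)) * ((\<Sum>b\<in>Basis. ennreal (1 / n (e k)) * (\<integral>\<^sup>+x. ennreal ((cmod (H (e k) b x))^2) \<partial>lborel))
   + ennreal (1 / n (e k)) * (\<integral>\<^sup>+x. coulomb x * ennreal ((cmod (g (e k) x))^2) \<partial>lborel))"
   using k h1 wg sc[of coulomb "g (e k)"] by (simp add: form_energy_def lam_def \<Psi> cong: sum.cong)
  then show "ennreal (lam k) * form_energy (\<Psi> k) = (\<Sum>b\<in>Basis. \<integral>\<^sup>+x. ennreal ((cmod (H (e k) b x))^2) \<partial>lborel) + (\<integral>\<^sup>+x. coulomb x * ennreal ((cmod (g (e k) x))^2) \<partial>lborel)"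
   by (simp only: distrib_left sum_distrib_left nn)
 qed
 also have "... = (\<Sum>i\<in>K'. (\<Sum>b\<in>Basis. \<integral>\<^sup>+x. ennreal ((cmod (H i b x))^2) \<partial>lborel) + (\<integral>\<^sup>+x. coulomb x * ennreal ((cmod (g i x))^2) \<partial>lborel))"
  by (rule ereindex')
 also have "... <= (\<Sum>i\<in>K. (\<Sum>b\<in>Basis. \<integral>\<^sup>+x. ennreal ((cmod (H i b x))^2) \<partial>lborel) + (\<integral>\<^sup>+x. coulomb x * ennreal ((cmod (g i x))^2) \<partial>lborel))"
  by (rule sum_mono2[OF fin finK'(2)]) simp
 also have "... = (\<Sum>k\<in>K. (\<Sum>b\<in>Basis. \<integral>\<^sup>+x. ennreal ((cmod (G k b x))^2) \<partial>lborel) + (\<integral>\<^sup>+x. coulomb x * ennreal ((cmod (F k x))^2) \<partial>lborel))"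
 proof -
  \<comment> \<open>A weighted integral of the mixture sees the family only through the pointwise
    sum of squares, so the energies return from the diagonalized to the given family.\<close>
  have sw: "(\<Sum>i\<in>K. \<integral>\<^sup>+x. h x * ennreal ((cmod (f i x))^2) \<partial>lborel) = (\<Sum>i\<in>K. \<integral>\<^sup>+x. h x * ennreal ((cmod (f' i x))^2) \<partial>lborel)"
   if [measurable]: "h \<in> borel_measurable borel" and L: "!!i. i \<in> K ==> L2 (f i)" "!!i. i \<in> K ==> L2 (f' i)"
    and eq: "!!x. (\<Sum>i\<in>K. (cmod (f i x))^2) = (\<Sum>i\<in>K. (cmod (f' i x))^2)"
   for h and f f' :: "'k => real^3^'n => complex"
  proof -
   have m: "(%x. h x * ennreal ((cmod (q i x))^2)) \<in> borel_measurable lborel" if "L2 (q i)" for q :: "'k => real^3^'n => complex" and i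
    using L2_measurable[OF that] by measurable
   have "(\<Sum>i\<in>K. \<integral>\<^sup>+x. h x * ennreal ((cmod (f i x))^2) \<partial>lborel) = (\<integral>\<^sup>+x. (\<Sum>i\<in>K. h x * ennreal ((cmod (f i x))^2)) \<partial>lborel)"
    by (rule nn_integral_sum[symmetric]) (rule m[OF L(1)])
   also have "... = (\<integral>\<^sup>+x. (\<Sum>i\<in>K. h x * ennreal ((cmod (f' i x))^2)) \<partial>lborel)"
    unfolding sum_distrib_left[symmetric] by (simp add: sum_ennreal eq)
   also have "... = (\<Sum>i\<in>K. \<integral>\<^sup>+x. h x * ennreal ((cmod (f' i x))^2) \<partial>lborel)"
    by (rule nn_integral_sum) (rule m[OF L(2)])
   finally show ?thesis .
  qed
  have "(\<Sum>i\<in>K. \<integral>\<^sup>+x. ennreal ((cmod (H i b x))^2) \<partial>lborel) = (\<Sum>i\<in>K. \<integral>\<^sup>+x. ennreal ((cmod (G i b x))^2) \<partial>lborel)" if "b \<in> Basis" for b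
   using sw[of "%_. 1" "%i. H i b" "%i. G i b"] HL[OF that] G[OF _ that] Hnorm by simp
  moreover have "(\<Sum>i\<in>K. \<integral>\<^sup>+x. coulomb x * ennreal ((cmod (g i x))^2) \<partial>lborel) = (\<Sum>i\<in>K. \<integral>\<^sup>+x. coulomb x * ennreal ((cmod (F i x))^2) \<partial>lborel)"
   by (rule sw) (use gL F gnorm in auto)
  ultimately show ?thesis
   unfolding sum.distrib by (simp add: sum.swap[of _ Basis K])
 qed
 finally show ?thesis .
qed

section \<open>Exchanging particles in discrete plans\<close>

definition pushforward_weight :: "'t set => ('t => real) => ('t => 'z) => 'z => real" where
 "pushforward_weight T c p z = (\<Sum>t\<in>T. c t * (if p t = z then 1 else 0))"

lemma pushforward_weight_sum:
 assumes "finite T" "finite \<Omega>" "!!t. t \<in> T ==> p t \<in> \<Omega>"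
 shows "(\<Sum>z\<in>\<Omega>. pushforward_weight T c p z * h z) = (\<Sum>t\<in>T. c t * h (p t))"
proof -
 have "(\<Sum>z\<in>\<Omega>. pushforward_weight T c p z * h z) = (\<Sum>z\<in>\<Omega>. \<Sum>t\<in>T. (if p t = z then c t * h z else 0))"
  unfolding pushforward_weight_def sum_distrib_right by (intro sum.cong refl) auto
 also have "... = (\<Sum>t\<in>T. \<Sum>z\<in>\<Omega>. (if p t = z then c t * h z else 0))" by (rule sum.swap)
 also have "... = (\<Sum>t\<in>T. c t * h (p t))"
  using assms by (intro sum.cong refl) (simp add: sum.delta')
 finally show ?thesis .
qed

lemma pushforward_weight_nonneg: "(!!t. t \<in> T ==> 0 <= c t) ==> 0 <= pushforward_weight T c p z"
 unfolding pushforward_weight_def by (auto intro!: sum_nonneg)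

lemma pushforward_weight_nonzeroD:
 "pushforward_weight T c p z ~= 0 ==> \<exists>t\<in>T. c t ~= 0 & p t = z"
proof (rule ccontr)
 assume nz: "pushforward_weight T c p z ~= 0" and "~ (\<exists>t\<in>T. c t ~= 0 & p t = z)"
 then have "\<forall>t\<in>T. c t * (if p t = z then 1 else 0) = 0" by auto
 then have "pushforward_weight T c p z = 0" unfolding pushforward_weight_def by (rule sum.neutral)
 with nz show False by contradiction
qed

text \<open>All ordered pairs are summed and then halved, so that \<open>q\<close> may be
  unsymmetric.\<close>

definition pair_energy :: "('c => 'c => real) => ('n::finite => 'c) => real" where
 "pair_energy q x = (\<Sum>k\<in>UNIV. \<Sum>l\<in>UNIV. if k ~= l then q (x k) (x l) else 0) / 2"

text \<open>Fewer than \<open>2 * N\<close> ordered pairs involve the moved particle, and each of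
  them costs at most \<open>M\<close> afterwards; halving leaves \<open>N * M\<close>.\<close>

lemma pair_energy_update:
 fixes x :: "'n::finite => 'c"
 assumes q: "!!a b. 0 <= q a b" and "0 <= M" and M: "!!j. j ~= i ==> q a (x j) <= M & q (x j) a <= M"
 shows "pair_energy q (x(i := a)) <= pair_energy q x + real CARD('n) * M"
proof -
 have "(if k ~= l then q ((x(i := a)) k) ((x(i := a)) l) else 0) <= (if k ~= l then q (x k) (x l) else 0) + ((if k = i then M else 0) + (if l = i then M else 0))" for k l
  using q[of "x k" "x l"] M[of k] M[of l] \<open>0 <= M\<close> by (cases "k = i"; cases "l = i") (auto simp: add_increasing)
 then have "(\<Sum>k\<in>UNIV. \<Sum>l\<in>UNIV. if k ~= l then q ((x(i := a)) k) ((x(i := a)) l) else 0)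
  <= (\<Sum>k\<in>UNIV. \<Sum>l\<in>UNIV. (if k ~= l then q (x k) (x l) else 0) + ((if k = i then M else 0) + (if l = i then M else 0)))"
  by (intro sum_mono)
 also have "... = (\<Sum>k\<in>UNIV. \<Sum>l\<in>UNIV. if k ~= l then q (x k) (x l) else 0) + 2 * real CARD('n) * M"
  unfolding sum.distrib by (simp add: sum.delta sum_distrib_left[symmetric])
 finally show ?thesis unfolding pair_energy_def by simp
qed

lemma pair_energy_le:
 fixes x :: "'n::finite => 'c"
 assumes "0 <= M" and "!!k l. k ~= l ==> q (x k) (x l) <= M"
 shows "pair_energy q x <= (real CARD('n))^2 * M"
proof -
 have "(\<Sum>k\<in>UNIV. \<Sum>l\<in>UNIV. if k ~= l then q (x k) (x l) else 0) <= (\<Sum>k\<in>(UNIV::'n set). \<Sum>l\<in>(UNIV::'n set). M)"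
  using assms by (intro sum_mono) auto
 also have "... = (real CARD('n))^2 * M" by (simp add: power2_eq_square)
 finally have "pair_energy q x <= (real CARD('n))^2 * M / 2" unfolding pair_energy_def by simp
 also have "... <= (real CARD('n))^2 * M" using assms(1) by simp
 finally show ?thesis .
qed

lemma pair_energy_nonneg: "(!!a b. 0 <= q a b) ==> 0 <= pair_energy q x"
 unfolding pair_energy_def by (auto intro!: sum_nonneg)

text \<open>Bad configurations are removed by exchanging particles with independent copies of the good part of the weight:
 \<open>x\<close> and donors \<open>y i\<close> are replaced by the \<open>y i\<close> with \<open>i\<close>-th entry taken from \<open>x\<close>, and by the diagonal \<open>y i i\<close>.\<close>

lemma remove_bad_configurations:
 fixes W :: "('n::finite => 'c) => real" and w :: "'c => real" and q :: "'c => 'c => real"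
  and bad close :: "'c => 'c => bool"
 defines "\<Omega>' \<equiv> %A. PiE (UNIV :: 'n set) (%_. A)"
  and "good \<equiv> %x :: 'n => 'c. ALL i j. i ~= j --> ~ bad (x i) (x j)"
 assumes finA: "finite A"
  and W0: "!!x. x \<in> \<Omega>' A ==> 0 <= W x" and W1: "(\<Sum>x\<in>\<Omega>' A. W x) = 1"
  and marg: "!!i a. a \<in> A ==> (\<Sum>x\<in>\<Omega>' A. W x * (if x i = a then 1 else 0)) = w a"
  and closesym: "!!a b. close a b ==> close b a" and badclose: "!!a b. bad a b ==> close a b"
  and kap: "!!a. a \<in> A ==> (\<Sum>b\<in>A. w b * (if close a b then 1 else 0)) <= \<kappa>"
  and kapN: "2 * (real CARD('n))^2 * \<kappa> <= 1/4"
  and pN: "(\<Sum>x\<in>{x \<in> \<Omega>' A. ~ good x}. W x) <= 1 / (4 * real CARD('n))"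
  and q0: "!!a b. 0 <= q a b" and M0: "0 <= M" and qM: "!!a b. ~ close a b ==> q a b <= M"
 shows "EX W'. (\<forall>x\<in>\<Omega>' A. 0 <= W' x & (W' x ~= 0 --> good x)) &
  (ALL i. \<forall>a\<in>A. (\<Sum>x\<in>\<Omega>' A. W' x * (if x i = a then 1 else 0)) = w a) &
  (\<Sum>x\<in>\<Omega>' A. W' x * pair_energy q x) <= (\<Sum>x\<in>{x \<in> \<Omega>' A. good x}. W x * pair_energy q x)
    + 2 * (real CARD('n))^2 * M * (\<Sum>x\<in>{x \<in> \<Omega>' A. ~ good x}. W x)"
proof -
 define N where "N = real CARD('n)"
 have N1: "1 <= N"
 proof -
  have "1 <= CARD('n)" using one_le_card_finite[where 'a='n] by simp
  then have "real 1 <= real CARD('n)" by (simp only: of_nat_le_iff)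
  then show ?thesis by (simp add: N_def)
 qed
 define \<Omega> where "\<Omega> = \<Omega>' A"
 define G where "G = {x \<in> \<Omega>. good x}"
 define B where "B = {x \<in> \<Omega>. ~ good x}"
 define p where "p = (\<Sum>x\<in>B. W x)"
 have finO: "finite \<Omega>" unfolding \<Omega>_def \<Omega>'_def by (rule finite_PiE) (simp_all add: finA)
 then have fin: "finite \<Omega>" "finite G" "finite B" unfolding G_def B_def by simp_all
 have xA: "x i \<in> A" if "x \<in> \<Omega>" for x i using that by (auto simp: \<Omega>_def \<Omega>'_def)
 have memO: "x \<in> \<Omega>" if "!!i. x i \<in> A" for x using that by (auto simp: \<Omega>_def \<Omega>'_def)
 have split: "sum h \<Omega> = sum h G + sum h B" for h :: "('n => 'c) => real"
 proof -
  have u: "\<Omega> = G \<union> B" and d: "G \<inter> B = {}" unfolding G_def B_def by blast+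
  show ?thesis unfolding u by (rule sum.union_disjoint[OF fin(2,3) d])
 qed
 have WG0: "0 <= W x" if "x \<in> G" for x using W0 that by (auto simp: G_def \<Omega>_def)
 have WB0: "0 <= W x" if "x \<in> B" for x using W0 that by (auto simp: B_def \<Omega>_def)
 have p0: "0 <= p" unfolding p_def using WB0 by (intro sum_nonneg)
 have sG: "(\<Sum>x\<in>G. W x) = 1 - p" using split[of W] W1 by (simp add: p_def \<Omega>_def)
 have pN': "p <= 1 / (4 * N)" using pN by (simp add: p_def B_def \<Omega>_def N_def)
 have Np: "N * p <= 1/4"
 proof -
  have "N * p <= N * (1 / (4 * N))" using N1 by (intro mult_left_mono[OF pN']) simp
  also have "... = 1/4" using N1 by simp
  finally show ?thesis .
 qed
 have p1: "p <= 1" using mult_right_mono[OF N1 p0] Np by simp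
 have w0: "0 <= w a" if "a \<in> A" for a unfolding marg[OF that, symmetric, of undefined] using W0 by (intro sum_nonneg) auto
 have k0: "0 <= \<kappa>"
 proof -
  have "\<Omega> ~= {}" using W1 unfolding \<Omega>_def by auto
  then obtain x where "x \<in> \<Omega>" by blast
  have "0 <= (\<Sum>b\<in>A. w b * (if close (x undefined) b then 1 else 0))" using w0 by (intro sum_nonneg) auto
  also have "... <= \<kappa>" by (rule kap[OF xA[OF \<open>x \<in> \<Omega>\<close>]])
  finally show ?thesis .
 qed
 have sumw: "(\<Sum>a\<in>A. w a) = 1"
 proof -
  have "(\<Sum>a\<in>A. w a) = (\<Sum>a\<in>A. \<Sum>x\<in>\<Omega>. W x * (if x undefined = a then 1 else 0))"
   unfolding \<Omega>_def by (intro sum.cong refl) (simp add: marg)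
  also have "... = (\<Sum>x\<in>\<Omega>. \<Sum>a\<in>A. W x * (if x undefined = a then 1 else 0))" by (rule sum.swap)
  also have "... = (\<Sum>x\<in>\<Omega>. W x)"
  proof (rule sum.cong[OF refl])
   fix x assume "x \<in> \<Omega>"
   have "(\<Sum>a\<in>A. W x * (if x undefined = a then 1 else 0)) = (\<Sum>a\<in>A. if a = x undefined then W x else 0)"
    by (intro sum.cong refl) simp
   then show "(\<Sum>a\<in>A. W x * (if x undefined = a then 1 else 0)) = W x"
    using finA xA[OF \<open>x \<in> \<Omega>\<close>] by simp
  qed
  finally show ?thesis using W1 by (simp add: \<Omega>_def)
 qed
 have margG: "(\<Sum>x\<in>G. W x * (if x i = a then 1 else 0)) <= w a" if "a \<in> A" for i a
 proof -
  have "0 <= (\<Sum>x\<in>B. W x * (if x i = a then 1 else 0))" using WB0 by (intro sum_nonneg) auto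
  then show ?thesis using marg[OF that, of i] split[of "%x. W x * (if x i = a then 1 else 0)"] by (simp add: \<Omega>_def)
 qed
 have closeG: "(\<Sum>x\<in>G. W x * (if close a (x j) then 1 else 0)) <= \<kappa>" if "a \<in> A" for a j
 proof -
  have "(\<Sum>x\<in>G. W x * (if close a (x j) then 1 else 0)) = (\<Sum>x\<in>G. \<Sum>b\<in>A. (W x * (if x j = b then 1 else 0)) * (if close a b then 1 else 0))"
  proof (intro sum.cong refl)
   fix x assume "x \<in> G"
   then have "x j \<in> A" using xA by (auto simp: G_def)
   have "(\<Sum>b\<in>A. (W x * (if x j = b then 1 else 0)) * (if close a b then 1 else 0)) = (\<Sum>b\<in>A. if b = x j then W x * (if close a b then 1 else 0) else 0)"
    by (intro sum.cong refl) auto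
   then show "W x * (if close a (x j) then 1 else 0) = (\<Sum>b\<in>A. (W x * (if x j = b then 1 else 0)) * (if close a b then 1 else 0))"
    using finA \<open>x j \<in> A\<close> by simp
  qed
  also have "... = (\<Sum>b\<in>A. \<Sum>x\<in>G. (W x * (if x j = b then 1 else 0)) * (if close a b then 1 else 0))" by (rule sum.swap)
  also have "... = (\<Sum>b\<in>A. (\<Sum>x\<in>G. W x * (if x j = b then 1 else 0)) * (if close a b then 1 else 0))"
   by (simp only: sum_distrib_right)
  also have "... <= (\<Sum>b\<in>A. w b * (if close a b then 1 else 0))" using margG by (intro sum_mono) auto
  also have "... <= \<kappa>" by (rule kap[OF that])
  finally show ?thesis .
 qed
 \<comment> \<open>Tuples of donors, one for each particle, drawn independently from the good part
   with joint weight \<open>P\<close>. As the good part is not normalized, their total weight is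
   \<open>(1 - p) ^ N\<close>.\<close>
 define Y where "Y = PiE (UNIV :: 'n set) (%_. G)"
 have finY: "finite Y" unfolding Y_def by (rule finite_PiE) (simp_all add: fin)
 have yG: "y i \<in> G" if "y \<in> Y" for y i using that by (auto simp: Y_def)
 define P where "P y = (\<Prod>i\<in>UNIV. W (y i))" for y :: "'n => 'n => 'c"
 have P0: "0 <= P y" if "y \<in> Y" for y unfolding P_def using yG[OF that] WG0 by (intro prod_nonneg) auto
 have prodsum: "(\<Sum>y\<in>Y. P y * (\<Prod>j\<in>UNIV. f j (y j))) = (\<Prod>j\<in>UNIV. \<Sum>v\<in>G. W v * f j v)" for f :: "'n => ('n => 'c) => real"
  unfolding Y_def P_def prod.distrib[symmetric] using fin by (subst prod_sum_PiE) auto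
 have one: "(\<Sum>y\<in>Y. P y * f (y i)) <= (\<Sum>v\<in>G. W v * f v)" if f: "!!v. v \<in> G ==> 0 <= f v" for f i
 proof -
  have "(\<Sum>y\<in>Y. P y * f (y i)) = (\<Sum>y\<in>Y. P y * (\<Prod>j\<in>UNIV. (if j = i then f (y j) else 1)))"
   by (simp add: prod.delta)
  also have "... = (\<Prod>j\<in>UNIV. \<Sum>v\<in>G. W v * (if j = i then f v else 1))" by (rule prodsum)
  also have "... = (\<Sum>v\<in>G. W v * f v) * (\<Prod>j\<in>UNIV - {i}. 1 - p)" by (simp add: prod.remove[of UNIV i] sG)
  also have "... <= (\<Sum>v\<in>G. W v * f v) * 1"
   using p0 p1 f WG0 by (intro mult_left_mono prod_le_1 sum_nonneg) auto
  finally show ?thesis by simp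
 qed
 have two: "(\<Sum>y\<in>Y. P y * (f (y i) * g (y j))) <= (\<Sum>v\<in>G. W v * f v) * (\<Sum>v\<in>G. W v * g v)"
  if f: "!!v. v \<in> G ==> 0 <= f v" and g: "!!v. v \<in> G ==> 0 <= g v" and ij: "i ~= j" for f g i j
 proof -
  have UNIVij: "prod h (UNIV :: 'n set) = h i * (h j * prod h (UNIV - {i} - {j}))" for h :: "'n => real"
   using ij by (simp add: prod.remove[of UNIV i] prod.remove[of "UNIV - {i}" j])
  have "(\<Sum>y\<in>Y. P y * (f (y i) * g (y j))) = (\<Sum>y\<in>Y. P y * (\<Prod>k\<in>UNIV. (if k = i then f (y k) else if k = j then g (y k) else 1)))"
   unfolding UNIVij using ij by (intro sum.cong refl) simp
  also have "... = (\<Prod>k\<in>UNIV. \<Sum>v\<in>G. W v * (if k = i then f v else if k = j then g v else 1))" by (rule prodsum)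
  also have "... = ((\<Sum>v\<in>G. W v * f v) * (\<Sum>v\<in>G. W v * g v)) * (\<Prod>k\<in>UNIV - {i} - {j}. 1 - p)"
   unfolding UNIVij using ij sG by simp
  also have "... <= ((\<Sum>v\<in>G. W v * f v) * (\<Sum>v\<in>G. W v * g v)) * 1"
   using p0 p1 f g WG0 by (intro mult_left_mono prod_le_1 mult_nonneg_nonneg sum_nonneg) auto
  finally show ?thesis by simp
 qed
 \<comment> \<open>Exactly the separations that make both outputs good: \<open>x i\<close> is going
   to replace the \<open>i\<close>-th entry of \<open>y i\<close>, and the removed entries
   \<open>y i i\<close> are assembled into a new configuration.\<close>
 define compat where "compat x y \<longleftrightarrow> (ALL i j. i ~= j --> ~ close (x i) (y i j) & ~ close (y i i) (y j j))" for x :: "'n => 'c" and y :: "'n => 'n => 'c"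
 define Z where "Z x = (\<Sum>y\<in>Y. P y * (if compat x y then 1 else 0))" for x
 \<comment> \<open>Union bound. The donor tuples have total weight at least
   \<open>1 - N * p\<close>, hence at least 3/4, and the \<open>N^2\<close> pairs of indices lose at
   most \<open>2 * \<kappa>\<close> each, in total at most 1/4.\<close>
 have Z: "1/2 <= Z x" if x: "x \<in> \<Omega>" for x
 proof -
  let ?c1 = "%y i j. if close (x i) (y i j) then 1 else 0 :: real"
  let ?c2 = "%y :: 'n => 'n => 'c. %i j. if close (y i i) (y j j) & i ~= j then 1 else 0 :: real"
  have pt: "1 <= (if compat x y then 1 else 0) + (\<Sum>i\<in>UNIV. \<Sum>j\<in>UNIV. ?c1 y i j + ?c2 y i j)" for y
  proof (cases "compat x y")
   case False
   then obtain i j where "i ~= j" "close (x i) (y i j) | close (y i i) (y j j)" unfolding compat_def by blast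
   then have ij: "1 <= ?c1 y i j + ?c2 y i j" by auto
   also have "... <= (\<Sum>j\<in>UNIV. ?c1 y i j + ?c2 y i j)" by (rule member_le_sum) auto
   also have "... <= (\<Sum>i\<in>UNIV. \<Sum>j\<in>UNIV. ?c1 y i j + ?c2 y i j)"
    by (rule member_le_sum[of i UNIV "%i. \<Sum>j\<in>UNIV. ?c1 y i j + ?c2 y i j"]) (auto intro!: sum_nonneg)
   finally show ?thesis using False by simp
  qed (auto intro!: sum_nonneg)
  have "(1 - p) ^ CARD('n) = (\<Prod>j\<in>(UNIV :: 'n set). \<Sum>v\<in>G. W v * 1)" by (simp add: sG)
  also have "... = (\<Sum>y\<in>Y. P y * (\<Prod>j\<in>(UNIV :: 'n set). 1))" by (rule prodsum[symmetric])
  also have "... <= (\<Sum>y\<in>Y. P y * ((if compat x y then 1 else 0) + (\<Sum>i\<in>UNIV. \<Sum>j\<in>UNIV. ?c1 y i j + ?c2 y i j)))"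
   using pt P0 by (intro sum_mono mult_left_mono) auto
  also have "... = Z x + (\<Sum>y\<in>Y. \<Sum>i\<in>UNIV. \<Sum>j\<in>UNIV. P y * ?c1 y i j + P y * ?c2 y i j)"
   unfolding Z_def by (simp only: distrib_left sum.distrib sum_distrib_left)
  also have "(\<Sum>y\<in>Y. \<Sum>i\<in>UNIV. \<Sum>j\<in>UNIV. P y * ?c1 y i j + P y * ?c2 y i j) = (\<Sum>i\<in>UNIV. \<Sum>y\<in>Y. \<Sum>j\<in>UNIV. P y * ?c1 y i j + P y * ?c2 y i j)"
   by (rule sum.swap)
  also have "... = (\<Sum>i\<in>UNIV. \<Sum>j\<in>UNIV. \<Sum>y\<in>Y. P y * ?c1 y i j + P y * ?c2 y i j)"
   by (intro sum.cong refl sum.swap)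
  also have "... <= (\<Sum>i\<in>(UNIV :: 'n set). \<Sum>j\<in>(UNIV :: 'n set). \<kappa> + \<kappa>)"
  proof (intro sum_mono)
   fix i j :: 'n
   have "(\<Sum>y\<in>Y. P y * ?c1 y i j) <= (\<Sum>v\<in>G. W v * (if close (x i) (v j) then 1 else 0))"
    by (rule one[of "%v. if close (x i) (v j) then 1 else 0" i]) auto
   also have "... <= \<kappa>" by (rule closeG[OF xA[OF x]])
   finally have 1: "(\<Sum>y\<in>Y. P y * ?c1 y i j) <= \<kappa>" .
   have 2: "(\<Sum>y\<in>Y. P y * ?c2 y i j) <= \<kappa>"
   proof (cases "i = j")
    case False
    have "(\<Sum>y\<in>Y. P y * ?c2 y i j) = (\<Sum>y\<in>Y. \<Sum>a\<in>A. P y * ((if y i i = a then 1 else 0) * (if close a (y j j) then 1 else 0)))"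
    proof (intro sum.cong refl)
     fix y assume "y \<in> Y"
     then have "y i i \<in> A" using yG[of y i] xA by (auto simp: G_def)
     have "(\<Sum>a\<in>A. P y * ((if y i i = a then 1 else 0) * (if close a (y j j) then 1 else 0))) = (\<Sum>a\<in>A. if a = y i i then P y * (if close a (y j j) then 1 else 0) else 0)"
      by (intro sum.cong refl) auto
     then show "P y * ?c2 y i j = (\<Sum>a\<in>A. P y * ((if y i i = a then 1 else 0) * (if close a (y j j) then 1 else 0)))"
      using finA \<open>y i i \<in> A\<close> False by simp
    qed
    also have "... = (\<Sum>a\<in>A. \<Sum>y\<in>Y. P y * ((if y i i = a then 1 else 0) * (if close a (y j j) then 1 else 0)))" by (rule sum.swap)
    also have "... <= (\<Sum>a\<in>A. (\<Sum>v\<in>G. W v * (if v i = a then 1 else 0)) * (\<Sum>v\<in>G. W v * (if close a (v j) then 1 else 0)))"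
     by (intro sum_mono two[of "%v. if v i = _ then 1 else 0" "%v. if close _ (v j) then 1 else 0" i j]) (use False in auto)
    also have "... <= (\<Sum>a\<in>A. w a * \<kappa>)"
     using margG closeG w0 WG0 by (intro sum_mono mult_mono sum_nonneg) auto
    also have "... = \<kappa>" by (simp add: sum_distrib_right[symmetric] sumw)
    finally show ?thesis .
   qed (use k0 in auto)
   show "(\<Sum>y\<in>Y. P y * ?c1 y i j + P y * ?c2 y i j) <= \<kappa> + \<kappa>"
    unfolding sum.distrib using 1 2 by (rule add_mono)
  qed
  also have "... = 2 * N^2 * \<kappa>" by (simp add: N_def power2_eq_square)
  finally have "(1 - p) ^ CARD('n) <= Z x + 2 * N^2 * \<kappa>" by simp
  moreover have "1 - N * p <= (1 - p) ^ CARD('n)"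
   using Bernoulli_inequality[of "- p" "CARD('n)"] p1 by (simp add: N_def)
  ultimately show ?thesis using Np kapN by (simp add: N_def)
 qed
 \<comment> \<open>The weight of a bad \<open>x\<close> is distributed over its compatible donor
   tuples in proportion to \<open>P\<close>; \<open>Z x\<close> normalizes.\<close>
 define T where "T x y = W x * P y * (if compat x y then 1 else 0) / Z x" for x y
 have T0: "0 <= T x y" if "x \<in> B" "y \<in> Y" for x y
  using WB0[OF that(1)] P0[OF that(2)] Z[of x] that by (auto simp: T_def B_def intro!: divide_nonneg_nonneg mult_nonneg_nonneg)
 have Tcompat: "compat x y" if "T x y ~= 0" for x y using that by (auto simp: T_def split: if_splits)
 have Tsum: "(\<Sum>y\<in>Y. T x y) = W x" if "x \<in> B" for x
 proof -
  have "(\<Sum>y\<in>Y. T x y) = W x / Z x * (\<Sum>y\<in>Y. P y * (if compat x y then 1 else 0))"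
   unfolding sum_distrib_left by (intro sum.cong refl) (simp add: T_def)
  then show ?thesis using Z[of x] that unfolding Z_def[symmetric] by (auto simp: B_def)
 qed
 define I where "I = B \<times> Y \<times> (UNIV :: 'n set)"
 define J where "J = B \<times> Y"
 have finIJ: "finite I" "finite J" unfolding I_def J_def using fin finY by auto
 define cI where "cI = (%(x, y, i :: 'n). T x y)"
 define cJ where "cJ = (%(x, y). T x y)"
 define p1 where "p1 = (%(x :: 'n => 'c, y :: 'n => 'n => 'c, i :: 'n). y i)"
 define p2 where "p2 = (%(x :: 'n => 'c, y :: 'n => 'n => 'c, i :: 'n). (y i)(i := x i))"
 define p3 where "p3 = (%(x :: 'n => 'c, y :: 'n => 'n => 'c). (%i. y i i))"
 have c0: "0 <= cI t" if "t \<in> I" for t using that T0 by (auto simp: I_def cI_def)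
 have c0': "0 <= cJ t" if "t \<in> J" for t using that T0 by (auto simp: J_def cJ_def)
 have GO: "G \<subseteq> \<Omega>" "B \<subseteq> \<Omega>" by (auto simp: G_def B_def)
 have p1O: "p1 t \<in> \<Omega>" if "t \<in> I" for t using that yG GO by (auto simp: I_def p1_def)
 have p2O: "p2 t \<in> \<Omega>" if "t \<in> I" for t
  using that by (auto simp: I_def p2_def intro!: memO) (use xA yG GO in blast)+
 have p3O: "p3 t \<in> \<Omega>" if "t \<in> J" for t
  using that by (auto simp: J_def p3_def intro!: memO) (use xA yG GO in blast)+
 \<comment> \<open>The good part loses the used donors \<open>p1\<close> and gains the modified
   donors \<open>p2\<close> and the diagonals \<open>p3\<close>. The bad configurations themselves
   are dropped.\<close>
 define W' where "W' z = (if z \<in> G then W z else 0) - pushforward_weight I cI p1 z + (pushforward_weight I cI p2 z + pushforward_weight J cJ p3 z)" for z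
 have L: "(\<Sum>z\<in>\<Omega>. W' z * h z) = (\<Sum>x\<in>G. W x * h x) + (\<Sum>x\<in>B. \<Sum>y\<in>Y. T x y * ((\<Sum>i\<in>UNIV. h ((y i)(i := x i)) - h (y i)) + h (%i. y i i)))" for h
 proof -
  have "(\<Sum>z\<in>\<Omega>. (if z \<in> G then W z else 0) * h z) = (\<Sum>x\<in>G. W x * h x)"
   using fin GO by (intro sum.mono_neutral_cong_right) auto
  moreover have "(\<Sum>t\<in>I. cI t * k (p t)) = (\<Sum>x\<in>B. \<Sum>y\<in>Y. T x y * (\<Sum>i\<in>UNIV. k (p (x, y, i))))" for k :: "('n => 'c) => real" and p
   unfolding I_def sum.cartesian_product[symmetric] by (simp add: sum.cartesian_product' cI_def sum_distrib_left)
  moreover have "(\<Sum>t\<in>J. cJ t * h (p3 t)) = (\<Sum>x\<in>B. \<Sum>y\<in>Y. T x y * h (%i. y i i))"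
   unfolding J_def by (simp add: sum.cartesian_product' cJ_def p3_def)
  moreover have "(\<Sum>z\<in>\<Omega>. pushforward_weight I cI p1 z * h z) = (\<Sum>t\<in>I. cI t * h (p1 t))"
   by (rule pushforward_weight_sum[OF finIJ(1) fin(1)]) (rule p1O)
  moreover have "(\<Sum>z\<in>\<Omega>. pushforward_weight I cI p2 z * h z) = (\<Sum>t\<in>I. cI t * h (p2 t))"
   by (rule pushforward_weight_sum[OF finIJ(1) fin(1)]) (rule p2O)
  moreover have "(\<Sum>z\<in>\<Omega>. pushforward_weight J cJ p3 z * h z) = (\<Sum>t\<in>J. cJ t * h (p3 t))"
   by (rule pushforward_weight_sum[OF finIJ(2) fin(1)]) (rule p3O)
  moreover have "(\<Sum>z\<in>\<Omega>. W' z * h z) = (\<Sum>z\<in>\<Omega>. (if z \<in> G then W z else 0) * h z) - (\<Sum>z\<in>\<Omega>. pushforward_weight I cI p1 z * h z)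
   + ((\<Sum>z\<in>\<Omega>. pushforward_weight I cI p2 z * h z) + (\<Sum>z\<in>\<Omega>. pushforward_weight J cJ p3 z * h z))"
   unfolding W'_def distrib_right left_diff_distrib sum.distrib sum_subtractf ..
  ultimately have "(\<Sum>z\<in>\<Omega>. W' z * h z) = (\<Sum>x\<in>G. W x * h x) - (\<Sum>x\<in>B. \<Sum>y\<in>Y. T x y * (\<Sum>i\<in>UNIV. h (p1 (x, y, i))))
   + ((\<Sum>x\<in>B. \<Sum>y\<in>Y. T x y * (\<Sum>i\<in>UNIV. h (p2 (x, y, i)))) + (\<Sum>x\<in>B. \<Sum>y\<in>Y. T x y * h (%i. y i i)))"
   by (simp only:)
  then show ?thesis
   by (simp add: p1_def p2_def sum.distrib sum_subtractf distrib_left right_diff_distrib)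
 qed
 \<comment> \<open>The donors are not overdrawn: because \<open>Z x\<close> is at least 1/2, the
   demand on a good configuration \<open>z\<close> is at most \<open>2 * (N * p) * W z\<close>,
   which is at most half of \<open>W z\<close>.\<close>
 have use: "pushforward_weight I cI p1 z <= (if z \<in> G then W z else 0)" for z
 proof (cases "z \<in> G")
  case False
  then have "pushforward_weight I cI p1 z = 0"
   unfolding pushforward_weight_def using yG by (intro sum.neutral) (auto simp: I_def p1_def)
  then show ?thesis using False by simp
 next
  case True
  have Pz: "(\<Sum>y\<in>Y. P y * (if y i = z then 1 else 0)) <= W z" for i
  proof -
   have "(\<Sum>y\<in>Y. P y * (if y i = z then 1 else 0)) <= (\<Sum>v\<in>G. W v * (if v = z then 1 else 0))"
    by (rule one[of "%v. if v = z then 1 else 0" i]) auto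
   also have "... = (\<Sum>v\<in>G. if v = z then W z else 0)" by (intro sum.cong refl) simp
   also have "... = W z" using fin(2) True by simp
   finally show ?thesis .
  qed
  have "pushforward_weight I cI p1 z = (\<Sum>x\<in>B. \<Sum>y\<in>Y. \<Sum>i\<in>UNIV. T x y * (if y i = z then 1 else 0))"
   unfolding pushforward_weight_def I_def by (simp add: sum.cartesian_product' cI_def p1_def)
  also have "... <= (\<Sum>x\<in>B. \<Sum>y\<in>Y. \<Sum>i\<in>UNIV. (2 * W x) * (P y * (if y i = z then 1 else 0)))"
  proof (intro sum_mono)
   fix x y i assume xy: "x \<in> B" "y \<in> Y"
   have "T x y <= W x * P y / Z x"
    using WB0[OF xy(1)] P0[OF xy(2)] Z[of x] xy by (auto simp: T_def B_def intro!: divide_nonneg_nonneg)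
   also have "... <= W x * P y / (1/2)"
    using WB0[OF xy(1)] P0[OF xy(2)] Z[of x] xy by (intro divide_left_mono) (auto simp: B_def)
   finally show "T x y * (if y i = z then 1 else 0) <= (2 * W x) * (P y * (if y i = z then 1 else 0))" by auto
  qed
  also have "... = (\<Sum>x\<in>B. 2 * W x * (\<Sum>i\<in>UNIV. \<Sum>y\<in>Y. P y * (if y i = z then 1 else 0)))"
   unfolding sum_distrib_left by (intro sum.cong refl sum.swap)
  also have "... <= (\<Sum>x\<in>B. 2 * W x * (\<Sum>i\<in>(UNIV :: 'n set). W z))"
   using WB0 Pz by (intro sum_mono mult_left_mono) auto
  also have "... = 2 * (N * p) * W z" by (simp add: sum_distrib_right[symmetric] sum_distrib_left[symmetric] p_def N_def)
  also have "... <= 1 * W z" using Np WG0[OF True] by (intro mult_right_mono) auto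
  finally show ?thesis using True by simp
 qed
 have W'0: "0 <= W' z" for z
  unfolding W'_def using use[of z] pushforward_weight_nonneg[of I cI p2 z] pushforward_weight_nonneg[of J cJ p3 z] c0 c0' by auto
 \<comment> \<open>Pairs that come from one donor are good already. All other pairs in the outputs
   are kept apart by \<open>compat\<close>, since bad pairs are close.\<close>
 have W'good: "good z" if nz: "W' z ~= 0" for z
 proof (rule ccontr)
  assume ng: "~ good z"
  then have "z \<notin> G" by (simp add: G_def)
  then have "pushforward_weight I cI p1 z = 0"
   unfolding pushforward_weight_def using yG by (intro sum.neutral) (auto simp: I_def p1_def)
  then have "pushforward_weight I cI p2 z ~= 0 | pushforward_weight J cJ p3 z ~= 0"
   using nz \<open>z \<notin> G\<close> by (auto simp: W'_def)
  then show False
  proof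
   assume "pushforward_weight I cI p2 z ~= 0"
   then obtain x y i where "y \<in> Y" "T x y ~= 0" and z: "z = (y i)(i := x i)"
    using pushforward_weight_nonzeroD[of I cI p2 z] by (auto simp: I_def cI_def p2_def)
   then have c: "compat x y" and gy: "good (y i)" using Tcompat yG by (auto simp: G_def)
   have "~ bad (z k) (z l)" if "k ~= l" for k l
   proof -
    have nc: "~ close (x i) (y i l)" if "l ~= i" for l using c that unfolding compat_def by metis
    have "~ bad (x i) (y i l)" "~ bad (y i l) (x i)" if "l ~= i" for l
     using nc[OF that] badclose closesym by blast+
    then show ?thesis using gy that unfolding z good_def by (cases "k = i"; cases "l = i") auto
   qed
   with ng show False by (auto simp: good_def)
  next
   assume "pushforward_weight J cJ p3 z ~= 0"
   then obtain x y where "T x y ~= 0" and z: "z = (%i. y i i)"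
    using pushforward_weight_nonzeroD[of J cJ p3 z] by (auto simp: J_def cJ_def p3_def)
   then have c: "compat x y" using Tcompat by auto
   with ng badclose show False unfolding z good_def compat_def by metis
  qed
 qed
 have m': "(\<Sum>x\<in>\<Omega>. W' x * (if x k = a then 1 else 0)) = w a" if "a \<in> A" for k a
 proof -
  let ?h = "%x :: 'n => 'c. if x k = a then 1 else (0::real)"
  \<comment> \<open>For a test of coordinate \<open>k\<close> the terms with \<open>i ~= k\<close>
    cancel, and the entry \<open>y k k\<close> taken out of donor \<open>k\<close> reappears on the
    diagonal; what remains is \<open>x k\<close>. This is why every marginal is preserved.\<close>
  have "(\<Sum>i\<in>UNIV. ?h ((y i)(i := x i)) - ?h (y i)) + ?h (%i. y i i) = ?h x" for x :: "'n => 'c" and y :: "'n => 'n => 'c"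
   by (subst sum.remove[of UNIV k]) auto
  then have "(\<Sum>x\<in>\<Omega>. W' x * ?h x) = (\<Sum>x\<in>G. W x * ?h x) + (\<Sum>x\<in>B. \<Sum>y\<in>Y. T x y * ?h x)"
   unfolding L by simp
  also have "(\<Sum>x\<in>B. \<Sum>y\<in>Y. T x y * ?h x) = (\<Sum>x\<in>B. W x * ?h x)"
   unfolding sum_distrib_right[symmetric] by (intro sum.cong refl) (simp add: Tsum)
  finally show ?thesis using split[of "%x. W x * ?h x"] marg[OF that, of k] by (simp add: \<Omega>_def)
 qed
 have cost: "(\<Sum>x\<in>\<Omega>. W' x * pair_energy q x) <= (\<Sum>x\<in>G. W x * pair_energy q x) + 2 * N^2 * M * p"
 proof -
  let ?E = "pair_energy q :: ('n => 'c) => real"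
  \<comment> \<open>Each of the \<open>N\<close> modified donors costs at most \<open>N * M\<close>
    more than the donor it replaces, and the diagonal configuration costs at most
    \<open>N^2 * M\<close>.\<close>
  have "T x y * ((\<Sum>i\<in>UNIV. ?E ((y i)(i := x i)) - ?E (y i)) + ?E (%i. y i i)) <= T x y * (2 * N^2 * M)" if xy: "x \<in> B" "y \<in> Y" for x y
  proof (cases "T x y = 0")
   case False
   then have c: "compat x y" by (rule Tcompat)
   have "?E ((y i)(i := x i)) - ?E (y i) <= N * M" for i
   proof -
    have "q (x i) (y i j) <= M & q (y i j) (x i) <= M" if "j ~= i" for j
    proof -
     have "~ close (x i) (y i j)" using c that unfolding compat_def by metis
     then show ?thesis using closesym qM by blast
    qed
    from pair_energy_update[of q M i "x i" "y i", OF q0 M0 this] show ?thesis by (simp add: N_def)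
   qed
   then have "(\<Sum>i\<in>UNIV. ?E ((y i)(i := x i)) - ?E (y i)) <= (\<Sum>i\<in>(UNIV :: 'n set). N * M)" by (intro sum_mono)
   then have "(\<Sum>i\<in>UNIV. ?E ((y i)(i := x i)) - ?E (y i)) <= N^2 * M" by (simp add: N_def power2_eq_square mult.assoc)
   moreover have "?E (%i. y i i) <= N^2 * M"
    unfolding N_def by (rule pair_energy_le[OF M0]) (use c qM in "auto simp: compat_def")
   ultimately show ?thesis using T0[OF xy] by (intro mult_left_mono) auto
  qed simp
  then have "(\<Sum>x\<in>B. \<Sum>y\<in>Y. T x y * ((\<Sum>i\<in>UNIV. ?E ((y i)(i := x i)) - ?E (y i)) + ?E (%i. y i i))) <= (\<Sum>x\<in>B. \<Sum>y\<in>Y. T x y * (2 * N^2 * M))"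
   by (intro sum_mono)
  also have "... = 2 * N^2 * M * p"
   unfolding sum_distrib_right[symmetric] p_def by (simp add: Tsum)
  finally show ?thesis unfolding L by simp
 qed
 show ?thesis
  using W'0 W'good m' cost unfolding \<Omega>_def G_def B_def p_def N_def by (intro exI[of _ W']) auto
qed

section \<open>Spline cells\<close>

text \<open>The square \<open>\<beta>\<close> of \<open>root_spline\<close> is the quadratic B-spline: its integer translates form a partition of unity that
 reproduces linear functions, and its square root is still Lipschitz.\<close>

definition root_spline :: "real => real" where
 "root_spline t = (if \<bar>t\<bar> <= 1/2 then sqrt (3/4 - t^2) else max 0 (3/2 - \<bar>t\<bar>) / sqrt 2)"

text \<open>The outer parabola \<open>(3/2 - t)^2 / 2\<close> has a linear root, and the two
  branches meet at 1/2 with value \<open>1 / sqrt 2\<close> and slope \<open>- 1 / sqrt 2\<close>;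
  by symmetry the only corners are at 3/2 and -3/2.\<close>

definition root_spline' :: "real => real" where
 "root_spline' t = (if \<bar>t\<bar> < 1/2 then - t / sqrt (3/4 - t^2) else if \<bar>t\<bar> < 3/2 then - sgn t / sqrt 2 else 0)"

lemma square_le_quarter: "\<bar>t::real\<bar> <= 1/2 ==> t^2 <= 1/4"
 using power_mono[of "\<bar>t\<bar>" "1/2" 2] by (simp add: power2_eq_square)

lemma root_spline_square:
 "(root_spline t)^2 = (if \<bar>t\<bar> <= 1/2 then 3/4 - t^2 else if \<bar>t\<bar> <= 3/2 then (3/2 - \<bar>t\<bar>)^2 / 2 else 0)"
proof (cases "\<bar>t\<bar> <= 1/2")
 case True
 then show ?thesis using square_le_quarter[OF True] by (simp add: root_spline_def)
qed (simp add: root_spline_def power_divide max_def)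

lemma root_spline_nonneg: "0 <= root_spline t"
proof (cases "\<bar>t\<bar> <= 1/2")
 case True
 then show ?thesis using square_le_quarter[OF True] by (simp add: root_spline_def)
qed (simp add: root_spline_def)

lemma root_spline_zero: "3/2 <= \<bar>t\<bar> ==> root_spline t = 0"
 by (simp add: root_spline_def)

lemma half_le_sqrt: "1/2 <= (a::real) ==> 1/2 <= sqrt a"
proof -
 assume "1/2 <= a"
 have "sqrt ((1/2)^2) <= sqrt a" by (rule real_sqrt_le_mono) (use \<open>1/2 <= a\<close> in "simp add: power2_eq_square")
 then show ?thesis by (simp only: real_sqrt_abs)
qed

lemma root_spline_le_1: "root_spline t <= 1"
proof (cases "\<bar>t\<bar> <= 1/2")
 case True
 have "sqrt (3/4 - t^2) <= sqrt 1" by (rule real_sqrt_le_mono) (use zero_le_power2[of t] in linarith)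
 then show ?thesis using True by (simp add: root_spline_def)
next
 case False
 have "max 0 (3/2 - \<bar>t\<bar>) / sqrt 2 <= 1 / 1" by (rule frac_le) (use False in auto)
 then show ?thesis using False by (simp add: root_spline_def)
qed

lemma root_spline_half: "root_spline (1/2) = 1 / sqrt 2" "root_spline (- (1/2)) = 1 / sqrt 2"
proof -
 have "sqrt (3/4 - (1/2)^2) = 1 / sqrt (2::real)" by (simp add: power2_eq_square real_sqrt_divide)
 then show "root_spline (1/2) = 1 / sqrt 2" "root_spline (- (1/2)) = 1 / sqrt 2"
  unfolding root_spline_def by simp_all
qed

lemma root_spline_abs: "root_spline \<bar>t\<bar> = root_spline t"
 by (simp add: root_spline_def)

lemma root_spline_lipschitz: "\<bar>root_spline s - root_spline t\<bar> <= \<bar>s - t\<bar>"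
proof -
 have inner: "\<bar>root_spline s - root_spline t\<bar> <= \<bar>s - t\<bar>" if "\<bar>s\<bar> <= 1/2" "\<bar>t\<bar> <= 1/2" for s t
 proof -
  let ?a = "sqrt (3/4 - s^2)" and ?b = "sqrt (3/4 - t^2)"
  have sq: "s^2 <= 1/4" "t^2 <= 1/4" using that square_le_quarter by auto
  \<comment> \<open>Both roots are at least 1/2, so their sum is at least 1 and the difference of
    the roots is bounded by the difference of their squares.\<close>
  have "1/2 <= ?a" "1/2 <= ?b" by (rule half_le_sqrt, use sq in linarith)+
  then have "1 <= ?a + ?b" by linarith
  have "\<bar>?a - ?b\<bar> * 1 <= \<bar>?a - ?b\<bar> * (?a + ?b)" using \<open>1 <= ?a + ?b\<close> by (intro mult_left_mono) auto
  also have "... = \<bar>(?a - ?b) * (?a + ?b)\<bar>" using \<open>1 <= ?a + ?b\<close> by (simp add: abs_mult)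
  also have "(?a - ?b) * (?a + ?b) = ?a^2 - ?b^2" by (simp add: power2_eq_square algebra_simps)
  also have "... = (t - s) * (t + s)" using sq by (simp add: power2_eq_square algebra_simps)
  also have "\<bar>...\<bar> <= \<bar>t - s\<bar> * 1" unfolding abs_mult using that by (intro mult_left_mono) auto
  finally show ?thesis using that by (simp add: root_spline_def abs_minus_commute)
 qed
 have outer: "\<bar>root_spline s - root_spline t\<bar> <= \<bar>s - t\<bar>" if "1/2 <= s" "1/2 <= t" for s t
 proof -
  have f: "root_spline u = max 0 (3/2 - u) / sqrt 2" if "1/2 <= u" for u
  proof (cases "u = 1/2")
   case True show ?thesis unfolding True root_spline_half(1) by simp
  qed (use that in "simp add: root_spline_def")
  have "\<bar>root_spline s - root_spline t\<bar> = \<bar>max 0 (3/2 - s) - max 0 (3/2 - t)\<bar> / sqrt 2"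
   using that by (simp add: f diff_divide_distrib[symmetric] abs_divide)
  also have "... <= \<bar>max 0 (3/2 - s) - max 0 (3/2 - t)\<bar> / 1"
   by (intro divide_left_mono) auto
  also have "... <= \<bar>s - t\<bar>" by (simp add: max_def abs_if)
  finally show ?thesis .
 qed
 have mixed: "\<bar>root_spline s - root_spline t\<bar> <= t - s" if "0 <= s" "s <= t" for s t
 proof -
  consider "t <= 1/2" | "1/2 <= s" | "s <= 1/2" "1/2 <= t" by linarith
  then show ?thesis
  proof cases
   case 1 then show ?thesis using inner[of s t] that by simp
  next
   case 2 then show ?thesis using outer[of s t] that by simp
  next
   case 3
   then show ?thesis using inner[of s "1/2"] outer[of "1/2" t] that by simp
  qed
 qed
 have "\<bar>root_spline \<bar>s\<bar> - root_spline \<bar>t\<bar>\<bar> <= \<bar>\<bar>s\<bar> - \<bar>t\<bar>\<bar>"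
 proof (cases "\<bar>s\<bar> <= \<bar>t\<bar>")
  case True
  from mixed[OF abs_ge_zero True] show ?thesis by linarith
 next
  case False
  then have "\<bar>t\<bar> <= \<bar>s\<bar>" by simp
  from mixed[OF abs_ge_zero this] show ?thesis by linarith
 qed
 also have "... <= \<bar>s - t\<bar>" by (rule abs_triangle_ineq3)
 finally show ?thesis unfolding root_spline_abs .
qed

lemma root_spline'_bound: "\<bar>root_spline' t\<bar> <= 1"
proof (cases "\<bar>t\<bar> < 1/2")
 case True
 then have "t^2 <= 1/4" using square_le_quarter by simp
 then have "1/2 <= sqrt (3/4 - t^2)" by (intro half_le_sqrt) linarith
 then have s: "0 < sqrt (3/4 - t^2)" "\<bar>t\<bar> <= sqrt (3/4 - t^2)" using True by linarith+
 have "\<bar>root_spline' t\<bar> = \<bar>t\<bar> / \<bar>sqrt (3/4 - t^2)\<bar>" using True by (simp add: root_spline'_def abs_divide)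
 also have "... = \<bar>t\<bar> / sqrt (3/4 - t^2)" using s(1) by (simp only: abs_of_pos)
 also have "... <= 1" using s by (simp only: divide_le_eq_1_pos)
 finally show ?thesis .
next
 case False
 have "1 <= sqrt (2::real)" by simp
 then show ?thesis using False by (auto simp: root_spline'_def abs_divide abs_sgn_eq)
qed

lemma root_spline'_zero: "3/2 <= \<bar>t\<bar> ==> root_spline' t = 0"
 by (simp add: root_spline'_def)

lemma root_spline_measurable [measurable]: "root_spline \<in> borel_measurable borel" "root_spline' \<in> borel_measurable borel"
 unfolding root_spline_def[abs_def] root_spline'_def[abs_def] sgn_if by measurable

lemma root_spline_derivative:
 assumes "\<bar>t\<bar> ~= 1/2" "\<bar>t\<bar> ~= 3/2"
 shows "(root_spline has_real_derivative root_spline' t) (at t)"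
proof -
 have tr: "(root_spline has_real_derivative d) (at t)" if "open S" "t \<in> S" "(f has_real_derivative d) (at t)" "!!s. s \<in> S ==> f s = root_spline s" for S f d
  using has_field_derivative_transform_within_open[OF that(3,1,2)] that(4) by blast
 consider "\<bar>t\<bar> < 1/2" | "1/2 < t" "t < 3/2" | "- (3/2) < t" "t < - (1/2)" | "3/2 < t" | "t < - (3/2)"
  using assms by atomize_elim arith
 then show ?thesis
 proof cases
  case 1
  have "0 < 3/4 - t^2" using square_le_quarter[of t] 1 by simp
  then have "((%t. sqrt (3/4 - t^2)) has_real_derivative root_spline' t) (at t)"
   using 1 by (auto intro!: derivative_eq_intros simp: root_spline'_def field_simps)
  then show ?thesis by (rule tr[of "{-1/2<..<1/2}", rotated 2]) (use 1 in "auto simp: root_spline_def abs_if split: if_splits")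
 next
  case 2
  have "((%t. 3/2 - t) has_real_derivative - 1) (at t)" by (auto intro!: derivative_eq_intros)
  from DERIV_cdivide[OF this, of "sqrt 2"]
  have "((%t. (3/2 - t) / sqrt 2) has_real_derivative root_spline' t) (at t)"
   using 2 by (simp add: root_spline'_def)
  then show ?thesis by (rule tr[of "{1/2<..<3/2}", rotated 2]) (use 2 in "auto simp: root_spline_def")
 next
  case 3
  have "((%t. 3/2 + t) has_real_derivative 1) (at t)" by (auto intro!: derivative_eq_intros)
  from DERIV_cdivide[OF this, of "sqrt 2"]
  have "((%t. (3/2 + t) / sqrt 2) has_real_derivative root_spline' t) (at t)"
   using 3 by (simp add: root_spline'_def)
  then show ?thesis by (rule tr[of "{-3/2<..<-1/2}", rotated 2]) (use 3 in "auto simp: root_spline_def")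
 next
  case 4
  have "((%t. 0) has_real_derivative root_spline' t) (at t)" using 4 by (auto simp: root_spline'_def)
  then show ?thesis by (rule tr[of "{3/2<..}", rotated 2]) (use 4 in "auto simp: root_spline_def")
 next
  case 5
  have "((%t. 0) has_real_derivative root_spline' t) (at t)" using 5 by (auto simp: root_spline'_def)
  then show ?thesis by (rule tr[of "{..<-3/2}", rotated 2]) (use 5 in "auto simp: root_spline_def")
 qed
qed

lemma abs_diff_ge_int:
 fixes X :: real and n a :: int
 assumes "\<bar>X - of_int n\<bar> <= 1/2" "a \<notin> {n-1, n, n+1}"
 shows "3/2 <= \<bar>X - of_int a\<bar>"
proof -
 have "2 <= \<bar>n - a\<bar>" using assms(2) by auto
 then have "2 <= \<bar>of_int n - of_int a :: real\<bar>" by (metis of_int_abs of_int_diff of_int_le_iff of_int_numeral)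
 then show ?thesis using assms(1) by linarith
qed

text \<open>The support radius 3/2 leaves only three integers around \<open>round X\<close>. For
  \<open>|X| \<le> L\<close> these may reach \<open>L + 1\<close> in modulus, hence the
  window.\<close>

lemma sum_translates:
 fixes h :: "int => 'b::comm_monoid_add" and X :: real
 assumes X: "\<bar>X\<bar> <= of_int L" and h: "!!a. 3/2 <= \<bar>X - of_int a\<bar> ==> h a = 0"
 obtains n where "\<bar>X - of_int n\<bar> <= 1/2" "(\<Sum>a\<in>{-L-1..L+1}. h a) = h (n-1) + (h n + h (n+1))"
proof -
 define n where "n = round X"
 have n: "\<bar>X - of_int n\<bar> <= 1/2" unfolding n_def using of_int_round_abs_le[of X] by (simp add: abs_minus_commute)
 have "of_int n < (of_int (L + 1) :: real)" using n X unfolding of_int_add of_int_1 abs_le_iff by linarith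
 moreover have "of_int (- L - 1) < (of_int n :: real)" using n X unfolding of_int_diff of_int_minus of_int_1 abs_le_iff by linarith
 ultimately have nL: "n <= L" "-L <= n" by (simp_all only: of_int_less_iff)
 have "(\<Sum>a\<in>{-L-1..L+1}. h a) = (\<Sum>a\<in>{n-1, n, n+1}. h a)"
  by (rule sum.mono_neutral_right) (use nL h abs_diff_ge_int[OF n] in auto)
 then show ?thesis using n by (intro that[of n]) auto
qed

text \<open>With \<open>s\<close> the offset from the nearest integer, the three surviving squares
  are \<open>(1/2 - s)^2 / 2\<close>, \<open>3/4 - s^2\<close> and \<open>(1/2 + s)^2 / 2\<close>;
  they add up to 1 and have vanishing first moment.\<close>

lemma spline_partition:
 fixes X :: real
 assumes X: "\<bar>X\<bar> <= of_int L"
 shows "(\<Sum>a\<in>{-L-1..L+1}. (root_spline (X - of_int a))^2) = 1"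
  and "(\<Sum>a\<in>{-L-1..L+1}. (X - of_int a) * (root_spline (X - of_int a))^2) = 0"
proof -
 have v: "(root_spline (X - of_int (n-1)))^2 = (1/2 - s)^2 / 2" "(root_spline (X - of_int n))^2 = 3/4 - s^2"
  "(root_spline (X - of_int (n+1)))^2 = (1/2 + s)^2 / 2" if "\<bar>X - of_int n\<bar> <= 1/2" "s = X - of_int n" for n s
 proof -
  have e: "X - of_int (n-1) = s + 1" "X - of_int (n+1) = s - 1" and s: "\<bar>s\<bar> <= 1/2" using that by auto
  show "(root_spline (X - of_int n))^2 = 3/4 - s^2" using s that by (simp add: root_spline_square)
  show "(root_spline (X - of_int (n-1)))^2 = (1/2 - s)^2 / 2"
  proof (cases "s = - (1/2)")
   case True show ?thesis unfolding e root_spline_square True by (simp add: power2_eq_square)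
  next
   case False
   then have "\<bar>s + 1\<bar> = s + 1" "~ s + 1 <= 1/2" "s + 1 <= 3/2" using s by auto
   then show ?thesis unfolding e root_spline_square by (simp add: power2_eq_square algebra_simps)
  qed
  show "(root_spline (X - of_int (n+1)))^2 = (1/2 + s)^2 / 2"
  proof (cases "s = 1/2")
   case True show ?thesis unfolding e root_spline_square True by (simp add: power2_eq_square)
  next
   case False
   then have "\<bar>s - 1\<bar> = 1 - s" "~ 1 - s <= 1/2" "1 - s <= 3/2" using s by auto
   then show ?thesis unfolding e root_spline_square by (simp add: power2_eq_square algebra_simps)
  qed
 qed
 obtain n where n: "\<bar>X - of_int n\<bar> <= 1/2" "(\<Sum>a\<in>{-L-1..L+1}. (root_spline (X - of_int a))^2)
  = (root_spline (X - of_int (n-1)))^2 + ((root_spline (X - of_int n))^2 + (root_spline (X - of_int (n+1)))^2)"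
  by (rule sum_translates[OF X, of "%a. (root_spline (X - of_int a))^2"]) (auto simp: root_spline_zero)
 show "(\<Sum>a\<in>{-L-1..L+1}. (root_spline (X - of_int a))^2) = 1"
  unfolding n(2) v[OF n(1) refl] by (simp add: power2_eq_square field_simps)
 obtain n where n: "\<bar>X - of_int n\<bar> <= 1/2" "(\<Sum>a\<in>{-L-1..L+1}. (X - of_int a) * (root_spline (X - of_int a))^2)
  = (X - of_int (n-1)) * (root_spline (X - of_int (n-1)))^2 + ((X - of_int n) * (root_spline (X - of_int n))^2 + (X - of_int (n+1)) * (root_spline (X - of_int (n+1)))^2)"
  by (rule sum_translates[OF X, of "%a. (X - of_int a) * (root_spline (X - of_int a))^2"]) (auto simp: root_spline_zero)
 define s where "s = X - of_int n"
 have e: "X - of_int (n-1) = s + 1" "X - of_int (n+1) = s - 1" by (auto simp: s_def)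
 have "(\<Sum>a\<in>{-L-1..L+1}. (X - of_int a) * (root_spline (X - of_int a))^2) = (s + 1) * ((1/2 - s)^2 / 2) + (s * (3/4 - s^2) + (s - 1) * ((1/2 + s)^2 / 2))"
  unfolding n(2) v[OF n(1) s_def] by (simp only: e s_def[symmetric])
 also have "... = 0" by (simp add: power2_eq_square field_simps)
 finally show "(\<Sum>a\<in>{-L-1..L+1}. (X - of_int a) * (root_spline (X - of_int a))^2) = 0" .
qed

text \<open>By linear reproduction \<open>t \<beta>(t)\<close> is a difference of translates of a function of compact support.\<close>

definition spline_primitive :: "real => real" where
 "spline_primitive t = - (\<bar>t\<bar> + 1/2) * (max 0 (1 - \<bar>t\<bar>))^2 / 2"

lemma spline_primitive_measurable [measurable]: "spline_primitive \<in> borel_measurable borel"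
 unfolding spline_primitive_def[abs_def] by measurable

lemma spline_primitive_zero: "1 <= \<bar>t\<bar> ==> spline_primitive t = 0"
 by (simp add: spline_primitive_def)

lemma spline_primitive_bound: "\<bar>spline_primitive t\<bar> <= 1"
proof (cases "\<bar>t\<bar> <= 1")
 case True
 have "(max 0 (1 - \<bar>t\<bar>))^2 <= 1^2" by (rule power_mono) auto
 then have "(\<bar>t\<bar> + 1/2) * (max 0 (1 - \<bar>t\<bar>))^2 <= (3/2) * 1" using True by (intro mult_mono) auto
 moreover have "\<bar>spline_primitive t\<bar> = (\<bar>t\<bar> + 1/2) * (max 0 (1 - \<bar>t\<bar>))^2 / 2"
  unfolding spline_primitive_def by (simp add: abs_mult)
 ultimately show ?thesis by linarith
qed (simp add: spline_primitive_zero)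

text \<open>The supports of the two translates overlap only for \<open>|t| \<le> 1/2\<close>, where
  the cubics combine; on either side a single translate remains.\<close>

lemma spline_primitive_difference:
 "t * (root_spline t)^2 = spline_primitive (t + 1/2) - spline_primitive (t - 1/2)"
proof -
 consider "\<bar>t\<bar> <= 1/2" | "1/2 < t" "t <= 3/2" | "- (3/2) <= t" "t < - (1/2)" | "3/2 < \<bar>t\<bar>"
  by atomize_elim arith
 then show ?thesis
 proof cases
  case 1
  then have "\<bar>t + 1/2\<bar> = t + 1/2" "\<bar>t - 1/2\<bar> = 1/2 - t" "max 0 (1 - (t + 1/2)) = 1/2 - t" "max 0 (1 - (1/2 - t)) = 1/2 + t" by auto
  then show ?thesis using 1 unfolding root_spline_square spline_primitive_def by (simp add: power2_eq_square field_simps)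
 next
  case 2
  then have "\<bar>t - 1/2\<bar> = t - 1/2" "max 0 (1 - (t - 1/2)) = 3/2 - t" "\<bar>t\<bar> = t" "1 <= \<bar>t + 1/2\<bar>" by auto
  then show ?thesis using 2 unfolding root_spline_square spline_primitive_zero[OF \<open>1 <= \<bar>t + 1/2\<bar>\<close>] by (simp add: spline_primitive_def)
 next
  case 3
  then have "\<bar>t + 1/2\<bar> = - t - 1/2" "max 0 (1 - (- t - 1/2)) = 3/2 + t" "\<bar>t\<bar> = - t" "1 <= \<bar>t - 1/2\<bar>" by auto
  then show ?thesis using 3 unfolding root_spline_square spline_primitive_zero[OF \<open>1 <= \<bar>t - 1/2\<bar>\<close>] by (simp add: spline_primitive_def)
 next
  case 4
  then have "1 <= \<bar>t - 1/2\<bar>" "1 <= \<bar>t + 1/2\<bar>" by auto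
  then show ?thesis using 4 by (simp add: root_spline_zero spline_primitive_zero)
 qed
qed

definition clamp_to :: "int => real => real" where
 "clamp_to L X = max (- of_int L) (min (of_int L) X)"

definition cut :: "real => int => int => real => real" where
 "cut ep L a s = root_spline (clamp_to L (s / ep) - of_int a)"

text \<open>Where the coordinate is clamped the cutoff is constant, hence the value 0 there.\<close>

definition cut' :: "real => int => int => real => real" where
 "cut' ep L a s = (if \<bar>s / ep\<bar> < of_int L then root_spline' (s / ep - of_int a) / ep else 0)"

text \<open>A cell of side \<open>ep\<close> is indexed by an integer point; coordinates are clamped so that finitely many cells, the outer
 ones unbounded, cover the whole space.\<close>

definition cell_fun :: "real => int => (3 => int) => real^3 => real" where
 "cell_fun ep L a x = (\<Prod>l\<in>UNIV. cut ep L (a l) (x $ l))"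

definition cell_fun' :: "real => int => (3 => int) => 3 => real^3 => real" where
 "cell_fun' ep L a k x = cut' ep L (a k) (x $ k) * (\<Prod>l\<in>UNIV - {k}. cut ep L (a l) (x $ l))"

definition cells :: "int => (3 => int) set" where
 "cells L = PiE UNIV (%_. {-L-1..L+1})"

text \<open>With indices up to \<open>L - 2\<close> and support radius 3/2, an inner cell lies where
  clamping does nothing: it is a genuine translate of the product spline and has bounded
  support.\<close>

definition inner_cells :: "int => (3 => int) set" where
 "inner_cells L = PiE UNIV (%_. {-(L-2)..L-2})"

lemma finite_cells [simp]: "finite (cells L)" "finite (inner_cells L)"
 unfolding cells_def inner_cells_def by (rule finite_PiE; simp)+

lemma inner_cells_subset: "inner_cells L \<subseteq> cells L"
 unfolding cells_def inner_cells_def by (rule PiE_mono) auto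

lemma clamp_to_bound: "0 <= L ==> \<bar>clamp_to L X\<bar> <= of_int L"
 by (auto simp: clamp_to_def)

lemma clamp_to_id: "\<bar>X\<bar> <= of_int L ==> clamp_to L X = X"
 by (auto simp: clamp_to_def)

lemma clamp_to_lipschitz: "\<bar>clamp_to L X - clamp_to L Y\<bar> <= \<bar>X - Y\<bar>"
 unfolding clamp_to_def max_def min_def by (auto simp: abs_if)

lemma cut_measurable [measurable]: "cut ep L a \<in> borel_measurable borel" "cut' ep L a \<in> borel_measurable borel"
 unfolding cut_def[abs_def] cut'_def[abs_def] clamp_to_def by measurable

lemma cut_bounds: "0 <= cut ep L a s" "cut ep L a s <= 1"
 unfolding cut_def by (rule root_spline_nonneg, rule root_spline_le_1)

lemma cell_fun_measurable [measurable]: "cell_fun ep L a \<in> borel_measurable borel" "cell_fun' ep L a k \<in> borel_measurable borel"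
 unfolding cell_fun_def[abs_def] cell_fun'_def[abs_def] by measurable

lemma cell_fun_bounds: "0 <= cell_fun ep L a x" "cell_fun ep L a x <= 1"
 unfolding cell_fun_def by (auto intro!: prod_nonneg prod_le_1 simp: cut_bounds)

lemma cut_partition: "0 <= L ==> (\<Sum>a\<in>{-L-1..L+1}. (cut ep L a s)^2) = 1"
 unfolding cut_def by (rule spline_partition(1)[OF clamp_to_bound])

lemma cell_fun_partition:
 assumes "0 <= L" shows "(\<Sum>a\<in>cells L. (cell_fun ep L a x)^2) = 1"
proof -
 have "(\<Sum>a\<in>cells L. (cell_fun ep L a x)^2) = (\<Sum>a\<in>cells L. \<Prod>l\<in>UNIV. (cut ep L (a l) (x $ l))^2)"
  unfolding cell_fun_def prod_power_distrib ..
 also have "... = (\<Prod>l\<in>UNIV. \<Sum>a\<in>{-L-1..L+1}. (cut ep L a (x $ l))^2)"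
  unfolding cells_def by (rule prod_sum_PiE[symmetric]) auto
 finally show ?thesis using assms by (simp add: cut_partition)
qed

lemma cut_lipschitz:
 assumes "0 < ep" shows "\<bar>cut ep L a s - cut ep L a t\<bar> <= (1 / ep) * \<bar>s - t\<bar>"
proof -
 have "\<bar>cut ep L a s - cut ep L a t\<bar> <= \<bar>clamp_to L (s / ep) - clamp_to L (t / ep)\<bar>"
  unfolding cut_def using root_spline_lipschitz[of "clamp_to L (s / ep) - of_int a" "clamp_to L (t / ep) - of_int a"] by simp
 also have "... <= \<bar>s / ep - t / ep\<bar>" by (rule clamp_to_lipschitz)
 also have "... = (1 / ep) * \<bar>s - t\<bar>" using assms by (simp add: diff_divide_distrib[symmetric])
 finally show ?thesis .
qed

lemma cut'_bound: "0 < ep ==> \<bar>cut' ep L a s\<bar> <= 1 / ep"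
 using root_spline'_bound[of "s / ep - of_int a"] by (auto simp: cut'_def divide_right_mono)

text \<open>The excluded points are the ends of the clamping interval and the places where the
  pieces of the spline meet. They form the finite exceptional set in the product rule.\<close>

lemma cut_derivative:
 assumes e: "0 < ep"
  and s: "s \<notin> {ep * of_int L, - ep * of_int L, ep * (of_int a + 1/2), ep * (of_int a - 1/2), ep * (of_int a + 3/2), ep * (of_int a - 3/2)}"
 shows "(cut ep L a has_real_derivative cut' ep L a s) (at s)"
proof -
 define X where "X = s / ep"
 have sX: "s = ep * X" using e by (simp add: X_def)
 have ne: "X ~= of_int L" "X ~= - of_int L" "X - of_int a ~= 1/2" "X - of_int a ~= - (1/2)" "X - of_int a ~= 3/2" "X - of_int a ~= - (3/2)"
 proof -
  have key: "X ~= c" if "s ~= ep * c" for c using that sX by auto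
  have "X ~= of_int a + 1/2" "X ~= of_int a - 1/2" "X ~= of_int a + 3/2" "X ~= of_int a - 3/2"
   by (rule key, use s in simp)+
  then show "X - of_int a ~= 1/2" "X - of_int a ~= - (1/2)" "X - of_int a ~= 3/2" "X - of_int a ~= - (3/2)" by linarith+
  show "X ~= of_int L" "X ~= - of_int L" by (rule key, use s in simp)+
 qed
 have cX: "((%s. s / ep) has_real_derivative 1 / ep) (at s)" using e by (auto intro!: derivative_eq_intros)
 have cts: "continuous_on UNIV (%s. s / ep)" by (intro continuous_intros) (use e in auto)
 consider "\<bar>X\<bar> < of_int L" | "of_int L < X | X < - of_int L" using ne(1,2) by linarith
 then show ?thesis
 proof cases
  case 1
  have "(root_spline has_real_derivative root_spline' (X - of_int a)) (at (s / ep - of_int a))"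
   unfolding X_def[symmetric] by (rule root_spline_derivative) (use ne in "auto simp: abs_if")
  then have "((%s. root_spline (s / ep - of_int a)) has_real_derivative root_spline' (X - of_int a) * (1 / ep)) (at s)"
   by (rule DERIV_chain2) (use e in "auto intro!: derivative_eq_intros")
  then have "((%s. root_spline (s / ep - of_int a)) has_real_derivative cut' ep L a s) (at s)"
   using 1 by (simp add: cut'_def X_def)
  moreover have "open {s. \<bar>s / ep\<bar> < of_int L}" by (intro open_Collect_less continuous_intros) (use e in auto)
  ultimately show ?thesis
   by (rule has_field_derivative_transform_within_open) (use 1 in "auto simp: X_def cut_def clamp_to_id")
 next
  case 2
  have z: "cut' ep L a s = 0" 
  proof -
   have "~ \<bar>X\<bar> < of_int L" using 2 by linarith
   then show ?thesis unfolding cut'_def X_def[symmetric] by simp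
  qed
  show ?thesis
  proof (cases "of_int L < X")
   case True
   have "((%s. root_spline (max (- of_int L) (of_int L) - of_int a)) has_real_derivative 0) (at s)" by simp
   moreover have "open {s. of_int L < s / ep}" by (intro open_Collect_less continuous_intros) (use e in auto)
   ultimately show ?thesis unfolding z
    by (rule has_field_derivative_transform_within_open) (use True in "auto simp: X_def cut_def clamp_to_def")
  next
   case False
   then have "X < - of_int L" using 2 by simp
   have "((%s. root_spline (max (- of_int L) (min (of_int L) (- of_int L)) - of_int a)) has_real_derivative 0) (at s)" by simp
   moreover have "open {s. s / ep < - of_int L}" by (intro open_Collect_less continuous_intros) (use e in auto)
   ultimately show ?thesis unfolding z
    by (rule has_field_derivative_transform_within_open) (use \<open>X < - of_int L\<close> in "auto simp: X_def cut_def clamp_to_def max_def min_def")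
  qed
 qed
qed

text \<open>The cutoff is a product over the three coordinates. The product rule is applied to one
  coordinate at a time, by induction on the set of coordinates already included.\<close>

lemma weak_partial_cut_prod:
 fixes f g :: "real^3 => complex"
 assumes f: "L2 f" and g: "L2 g" and w: "weak_partial f (axis k 1) g" and e: "0 < ep"
 shows "L2 (%x. complex_of_real (\<Prod>l\<in>I. cut ep L (a l) (x $ l)) * g x
   + (if k \<in> I then complex_of_real (cut' ep L (a k) (x $ k) * (\<Prod>l\<in>I - {k}. cut ep L (a l) (x $ l))) * f x else 0))
  & weak_partial (%x. complex_of_real (\<Prod>l\<in>I. cut ep L (a l) (x $ l)) * f x) (axis k 1)
  (%x. complex_of_real (\<Prod>l\<in>I. cut ep L (a l) (x $ l)) * g x
   + (if k \<in> I then complex_of_real (cut' ep L (a k) (x $ k) * (\<Prod>l\<in>I - {k}. cut ep L (a l) (x $ l))) * f x else 0))"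
  (is "L2 (?G I) & weak_partial (?F I) _ (?G I)")
proof -
 have "finite I" by simp
 then show ?thesis
 proof (induction I rule: finite_induct)
  case empty then show ?case using g w by simp
 next
  case (insert j I)
  have bk: "axis k 1 \<in> (Basis :: (real^3) set)" "axis j 1 \<in> (Basis :: (real^3) set)" by (auto simp: Basis_vec_def)
  have FI: "L2 (?F I)"
  proof (rule L2_bounded_mult[OF f, where M=1])
   show "cmod (complex_of_real (\<Prod>l\<in>I. cut ep L (a l) (x $ l))) <= 1" for x
    unfolding norm_of_real by (subst abs_of_nonneg) (auto intro!: prod_nonneg prod_le_1 simp: cut_bounds)
  qed measurable
  have W: "weak_partial (%x. complex_of_real (cut ep L (a j) (x \<bullet> axis j 1)) * ?F I x) (axis k 1)
   (%x. complex_of_real (cut ep L (a j) (x \<bullet> axis j 1)) * ?G I x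
    + (if axis k 1 = (axis j 1 :: real^3) then complex_of_real (cut' ep L (a j) (x \<bullet> axis j 1)) * ?F I x else 0))"
   by (rule weak_partial_mult_coordinate[OF FI conjunct1[OF insert.IH] conjunct2[OF insert.IH] bk, where M=1 and C="1/ep"
      and S="{ep * of_int L, - ep * of_int L, ep * (of_int (a j) + 1/2), ep * (of_int (a j) - 1/2), ep * (of_int (a j) + 3/2), ep * (of_int (a j) - 3/2)}"])
    (use cut_lipschitz[OF e] cut'_bound[OF e] cut_derivative[OF e] cut_bounds in "auto simp del: insert_iff")
  have F: "(%x. complex_of_real (cut ep L (a j) (x \<bullet> axis j 1)) * ?F I x) = ?F (insert j I)"
   using insert(1,2) by (auto simp: inner_axis fun_eq_iff)
  have G: "(%x. complex_of_real (cut ep L (a j) (x \<bullet> axis j 1)) * ?G I x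
    + (if axis k 1 = (axis j 1 :: real^3) then complex_of_real (cut' ep L (a j) (x \<bullet> axis j 1)) * ?F I x else 0)) = ?G (insert j I)"
  proof (cases "k = j")
   case True
   then have "k \<notin> I" "insert j I - {k} = I" using insert(2) by auto
   then show ?thesis using insert(1,2) True by (auto simp: inner_axis fun_eq_iff mult.assoc)
  next
   case False
   then have "axis k 1 ~= (axis j 1 :: real^3)" "insert j I - {k} = insert j (I - {k})" "j \<notin> I - {k}" using insert(2) by (auto simp: axis_eq_axis)
   then show ?thesis using insert(1,2) False by (auto simp: inner_axis fun_eq_iff algebra_simps)
  qed
  have "L2 (?G (insert j I))" unfolding G[symmetric]
  proof (intro L2_add)
   show "L2 (%x. complex_of_real (cut ep L (a j) (x \<bullet> axis j 1)) * ?G I x)"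
    by (rule L2_bounded_mult[OF conjunct1[OF insert.IH], where M=1]) (auto simp: cut_bounds)
   show "L2 (%x. if axis k 1 = (axis j 1 :: real^3) then complex_of_real (cut' ep L (a j) (x \<bullet> axis j 1)) * ?F I x else 0)"
   proof (cases "axis k 1 = (axis j 1 :: real^3)")
    case True
    have "L2 (%x. complex_of_real (cut' ep L (a j) (x \<bullet> axis j 1)) * ?F I x)"
     by (rule L2_bounded_mult[OF FI, where M="1/ep"]) (use cut'_bound[OF e] in auto)
    then show ?thesis using True by simp
   qed (simp add: L2_zero)
  qed
  then show ?case using W unfolding F G by simp
 qed
qed

lemma weak_partial_cell_fun:
 fixes f g :: "real^3 => complex"
 assumes "L2 f" "L2 g" "weak_partial f (axis k 1) g" "0 < ep"
 shows "L2 (%x. complex_of_real (cell_fun ep L a x) * g x + complex_of_real (cell_fun' ep L a k x) * f x)"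
  "weak_partial (%x. complex_of_real (cell_fun ep L a x) * f x) (axis k 1)
   (%x. complex_of_real (cell_fun ep L a x) * g x + complex_of_real (cell_fun' ep L a k x) * f x)"
 using weak_partial_cut_prod[OF assms, where I=UNIV and L=L and a=a] unfolding cell_fun_def cell_fun'_def by simp_all

text \<open>At most three translates contribute at a point, each with slope at most
  \<open>1 / ep\<close>.\<close>

lemma sum_cut'_square:
 assumes e: "0 < ep" and L: "0 <= L"
 shows "(\<Sum>a\<in>{-L-1..L+1}. (cut' ep L a s)^2) <= 3 / ep^2"
proof (cases "\<bar>s / ep\<bar> < of_int L")
 case True
 obtain n where n: "(\<Sum>a\<in>{-L-1..L+1}. (cut' ep L a s)^2) = (cut' ep L (n-1) s)^2 + ((cut' ep L n s)^2 + (cut' ep L (n+1) s)^2)"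
  by (rule sum_translates[of "s / ep" L "%a. (cut' ep L a s)^2"]) (use True in "auto simp: cut'_def root_spline'_zero")
 have "(cut' ep L a s)^2 <= 1 / ep^2" for a
 proof -
  have "\<bar>cut' ep L a s\<bar>^2 <= (1 / ep)^2" by (rule power_mono[OF cut'_bound[OF e]]) simp
  then show ?thesis by (simp add: power_divide)
 qed
 from this[of "n-1"] this[of n] this[of "n+1"] show ?thesis unfolding n by simp
qed (use e in "simp add: cut'_def")

text \<open>The sum over cells factorizes over coordinates, and the two undifferentiated ones
  contribute partitions of unity.\<close>

lemma sum_cell_fun'_square:
 assumes e: "0 < ep" and L: "0 <= L"
 shows "(\<Sum>a\<in>cells L. (cell_fun' ep L a k x)^2) <= 3 / ep^2"
proof -
 have "(\<Sum>a\<in>cells L. (cell_fun' ep L a k x)^2) = (\<Sum>a\<in>cells L. \<Prod>l\<in>UNIV. (if l = k then (cut' ep L (a l) (x $ l))^2 else (cut ep L (a l) (x $ l))^2))"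
  unfolding cell_fun'_def power_mult_distrib prod_power_distrib by (intro sum.cong refl) (simp add: prod.remove[of UNIV k])
 also have "... = (\<Prod>l\<in>UNIV. \<Sum>a\<in>{-L-1..L+1}. (if l = k then (cut' ep L a (x $ l))^2 else (cut ep L a (x $ l))^2))"
  unfolding cells_def by (rule prod_sum_PiE[symmetric]) auto
 also have "... = (\<Sum>a\<in>{-L-1..L+1}. (cut' ep L a (x $ k))^2)"
  using L by (simp add: prod.remove[of UNIV k] cut_partition)
 finally show ?thesis using sum_cut'_square[OF e L] by simp
qed

text \<open>The sum factorizes, and the factor of coordinate \<open>k\<close> is the vanishing first
  moment of the spline. The bound on \<open>x $ k\<close> switches off the clamping in that
  coordinate.\<close>

lemma cell_fun_linear_reproduction:
 assumes e: "0 < ep" and L: "0 <= L" and x: "\<bar>x $ k\<bar> <= ep * of_int L"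
 shows "(\<Sum>a\<in>cells L. (cell_fun ep L a x)^2 * (ep * of_int (a k) - x $ k)) = 0"
proof -
 have xL: "\<bar>x $ k / ep\<bar> <= of_int L" using x e by (simp add: abs_divide pos_divide_le_eq mult.commute)
 have "(\<Sum>a\<in>cells L. (cell_fun ep L a x)^2 * (ep * of_int (a k) - x $ k)) = (\<Sum>a\<in>cells L. (- ep) * (\<Prod>l\<in>UNIV. (if l = k then (x $ k / ep - of_int (a l)) * (cut ep L (a l) (x $ l))^2 else (cut ep L (a l) (x $ l))^2)))"
  unfolding cell_fun_def prod_power_distrib
  by (intro sum.cong refl) (use e in "simp add: prod.remove[of UNIV k] field_simps")
 also have "... = (- ep) * (\<Prod>l\<in>UNIV. \<Sum>a\<in>{-L-1..L+1}. (if l = k then (x $ k / ep - of_int a) * (cut ep L a (x $ l))^2 else (cut ep L a (x $ l))^2))"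
  unfolding sum_distrib_left[symmetric] cells_def by (subst prod_sum_PiE) auto
 also have "(\<Prod>l\<in>UNIV. \<Sum>a\<in>{-L-1..L+1}. (if l = k then (x $ k / ep - of_int a) * (cut ep L a (x $ l))^2 else (cut ep L a (x $ l))^2)) = 0"
 proof -
  have "(\<Sum>a\<in>{-L-1..L+1}. (x $ k / ep - of_int a) * (cut ep L a (x $ k))^2) = 0"
   using spline_partition(2)[OF xL] by (simp add: cut_def clamp_to_id[OF xL])
  then show ?thesis by (intro prod_zero bexI[of _ k]) simp_all
 qed
 finally show ?thesis by simp
qed

text \<open>Beyond \<open>L\<close> both the clamped and the unclamped argument are at distance at
  least 3/2 from an inner index, so both formulas give 0.\<close>

lemma inner_cut_nonzero:
 assumes e: "0 < ep" and a: "\<bar>a\<bar> <= L - 2"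
 shows "cut ep L a s = root_spline (s / ep - of_int a)"
proof (cases "\<bar>s / ep\<bar> <= of_int L")
 case True then show ?thesis by (simp add: cut_def clamp_to_id)
next
 case False
 have a': "\<bar>of_int a :: real\<bar> <= of_int L - 2" using a by (metis of_int_abs of_int_diff of_int_le_iff of_int_numeral)
 then have "3/2 <= \<bar>s / ep - of_int a\<bar>" using False by linarith
 moreover have "3/2 <= \<bar>clamp_to L (s / ep) - of_int a\<bar>" using False a' unfolding clamp_to_def max_def min_def by (auto simp: abs_if split: if_splits)
 ultimately show ?thesis by (simp add: cut_def root_spline_zero)
qed

lemma inner_cell_fun:
 assumes "0 < ep" "a \<in> inner_cells L"
 shows "cell_fun ep L a x = (\<Prod>l\<in>UNIV. root_spline (x $ l / ep - of_int (a l)))"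
proof -
 have "\<bar>a l\<bar> <= L - 2" for l
 proof -
  have "a l \<in> {-(L-2)..L-2}" using assms(2) unfolding inner_cells_def by (rule PiE_mem) simp
  then show ?thesis by (simp add: abs_le_iff)
 qed
 then show ?thesis unfolding cell_fun_def by (simp add: inner_cut_nonzero[OF assms(1)])
qed

lemma inner_cell_support:
 assumes "0 < ep" "a \<in> inner_cells L" "cell_fun ep L a x ~= 0"
 shows "\<bar>x $ l - ep * of_int (a l)\<bar> <= 3/2 * ep"
proof -
 have "root_spline (x $ l / ep - of_int (a l)) ~= 0" using assms(3) unfolding inner_cell_fun[OF assms(1,2)] by auto
 then have "\<bar>x $ l / ep - of_int (a l)\<bar> < 3/2" using root_spline_zero by (meson not_less)
 moreover have "x $ l - ep * of_int (a l) = ep * (x $ l / ep - of_int (a l))" using assms(1) by (simp add: field_simps)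
 ultimately show ?thesis using assms(1) by (simp add: abs_mult)
qed

text \<open>An outer cell has an index of modulus at least \<open>L - 1\<close>. If the norm were at
  most \<open>ep * (L - 3)\<close>, the corresponding coordinate would be two cell sides away from
  it, more than the support radius 3/2.\<close>

lemma outer_cell_support:
 assumes e: "0 < ep" and a: "a \<in> cells L" "a \<notin> inner_cells L" and nz: "cell_fun ep L a x ~= 0"
 shows "ep * (of_int L - 3) < norm x"
proof (rule ccontr)
 assume "~ ?thesis"
 then have nx: "norm x <= ep * (of_int L - 3)" by simp
 obtain l where "a l \<notin> {-(L-2)..L-2}" using a(2) by (auto simp: inner_cells_def PiE_def Pi_iff)
 then have "L - 1 <= \<bar>a l\<bar>" by auto
 then have al: "of_int L - 1 <= \<bar>of_int (a l) :: real\<bar>" by (metis of_int_1 of_int_abs of_int_diff of_int_le_iff)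
 have "\<bar>x $ l\<bar> <= ep * (of_int L - 3)" using component_le_norm_cart[of x l] nx by linarith
 then have xl: "\<bar>x $ l / ep\<bar> <= of_int L - 3" using e by (simp add: abs_divide pos_divide_le_eq mult.commute)
 then have "clamp_to L (x $ l / ep) = x $ l / ep" by (intro clamp_to_id) linarith
 moreover have "3/2 <= \<bar>x $ l / ep - of_int (a l)\<bar>" using xl al by linarith
 ultimately have "cut ep L (a l) (x $ l) = 0" by (simp add: cut_def root_spline_zero)
 then have "cell_fun ep L a x = 0" unfolding cell_fun_def by (intro prod_zero) auto
 with nz show False by contradiction
qed

section \<open>Displacement of the cell barycentres\<close>

text \<open>Translations of \<open>|f|^2\<close> are Lipschitz in L1. The product of
  \<open>|u - v|\<close> and \<open>|u| + |v|\<close> is split by Young's inequality with weight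
  \<open>h\<close>, which matches the bound of order \<open>h^2\<close> for the squared L2
  translation.\<close>

lemma density_translation_bound:
 fixes f g :: "'a::euclidean_space => complex"
 assumes f: "L2 f" and g: "L2 g" and w: "weak_partial f b g" and b: "b \<in> Basis" and h: "0 < h"
 shows "(\<integral>x. \<bar>(cmod (f (x + h *\<^sub>R b)))^2 - (cmod (f x))^2\<bar> \<partial>lborel)
  <= h * ((\<integral>x. (cmod (g x))^2 \<partial>lborel) / 2 + 2 * (\<integral>x. (cmod (f x))^2 \<partial>lborel))"
proof -
 let ?fh = "%x. f (x + h *\<^sub>R b)"
 have fh: "L2 ?fh" by (rule L2_shift[OF f])
 note i = L2_square_integrable[OF f] L2_square_integrable[OF fh] L2_square_integrable[OF L2_diff[OF fh f]]
 have pt: "\<bar>(cmod u)^2 - (cmod v)^2\<bar> <= (1 / (2 * h)) * (cmod (u - v))^2 + h * ((cmod u)^2 + (cmod v)^2)" for u v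
 proof -
  define d s where "d = cmod (u - v)" and "s = cmod u + cmod v"
  have "\<bar>(cmod u)^2 - (cmod v)^2\<bar> = \<bar>cmod u - cmod v\<bar> * s"
   unfolding s_def power2_eq_square square_diff_square_factored abs_mult by simp
  also have "... <= d * s" unfolding d_def s_def by (intro mult_right_mono norm_triangle_ineq3) auto
  also have "... <= (1 / (2 * h)) * d^2 + (h / 2) * s^2"
  proof -
   have "0 <= (d - h * s)^2 / (2 * h)" using h by simp
   also have "(d - h * s)^2 / (2 * h) = (1 / (2 * h)) * d^2 + (h / 2) * s^2 - d * s"
    using h by (simp add: power2_eq_square field_simps)
   finally show ?thesis by simp
  qed
  also have "(h / 2) * s^2 <= h * ((cmod u)^2 + (cmod v)^2)"
  proof -
   have "s^2 <= 2 * ((cmod u)^2 + (cmod v)^2)"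
    using sum_squares_bound[of "cmod u" "cmod v"] unfolding s_def by (simp add: power2_sum)
   then have "h * s^2 <= h * (2 * ((cmod u)^2 + (cmod v)^2))" using h by (intro mult_left_mono) auto
   then show ?thesis by (simp only: mult.left_commute[of h 2])
  qed
  finally show ?thesis unfolding d_def by simp
 qed
 have shift: "(\<integral>x. (cmod (?fh x))^2 \<partial>lborel) = (\<integral>x. (cmod (f x))^2 \<partial>lborel)"
  using L2_measurable[OF f] by (intro lborel_shift(2)[of "%x. (cmod (f x))^2"]) measurable
 have tr: "(\<integral>x. (cmod (?fh x - f x))^2 \<partial>lborel) <= h^2 * (\<integral>x. (cmod (g x))^2 \<partial>lborel)"
 proof -
  have "ennreal (\<integral>x. (cmod (?fh x - f x))^2 \<partial>lborel) = (\<integral>\<^sup>+x. ennreal ((cmod (?fh x - f x))^2) \<partial>lborel)"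
   by (rule nn_integral_eq_integral[symmetric]) (use i in auto)
  also have "... <= ennreal (h^2) * (\<integral>\<^sup>+x. ennreal ((cmod (g x))^2) \<partial>lborel)"
   by (rule L2_translation_bound[OF f g w b]) (use h in simp)
  also have "(\<integral>\<^sup>+x. ennreal ((cmod (g x))^2) \<partial>lborel) = ennreal (\<integral>x. (cmod (g x))^2 \<partial>lborel)"
   by (rule nn_integral_eq_integral) (use L2_square_integrable[OF g] in auto)
  also have "ennreal (h^2) * ennreal (\<integral>x. (cmod (g x))^2 \<partial>lborel) = ennreal (h^2 * (\<integral>x. (cmod (g x))^2 \<partial>lborel))"
   by (rule ennreal_mult[symmetric]) auto
  finally show ?thesis by (subst (asm) ennreal_le_iff) auto
 qed
 have "(\<integral>x. \<bar>(cmod (?fh x))^2 - (cmod (f x))^2\<bar> \<partial>lborel)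
  <= (\<integral>x. (1 / (2 * h)) * (cmod (?fh x - f x))^2 + h * ((cmod (?fh x))^2 + (cmod (f x))^2) \<partial>lborel)"
  by (rule integral_mono) (use i pt in auto)
 also have "... = (1 / (2 * h)) * (\<integral>x. (cmod (?fh x - f x))^2 \<partial>lborel) + h * ((\<integral>x. (cmod (f x))^2 \<partial>lborel) + (\<integral>x. (cmod (f x))^2 \<partial>lborel))"
  using i shift by simp
 also have "... <= (1 / (2 * h)) * (h^2 * (\<integral>x. (cmod (g x))^2 \<partial>lborel)) + h * ((\<integral>x. (cmod (f x))^2 \<partial>lborel) + (\<integral>x. (cmod (f x))^2 \<partial>lborel))"
  using h tr by (intro add_right_mono mult_left_mono) auto
 also have "(1 / (2 * h)) * (h^2 * (\<integral>x. (cmod (g x))^2 \<partial>lborel)) = h * ((\<integral>x. (cmod (g x))^2 \<partial>lborel) / 2)"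
  using h by (simp add: power2_eq_square)
 finally show ?thesis by (simp only: distrib_left mult_2)
qed

text \<open>The function whose central difference over the step \<open>ep\<close>, multiplied by
  \<open>ep\<close>, is the integrand of the \<open>k\<close>-th first moment of a cell about its
  lattice point.\<close>

definition cell_moment :: "real => (3 => int) => 3 => real^3 => real" where
 "cell_moment ep a k x = spline_primitive (x $ k / ep - of_int (a k)) * (\<Prod>l\<in>UNIV - {k}. (root_spline (x $ l / ep - of_int (a l)))^2)"

lemma cell_moment_measurable [measurable]: "cell_moment ep a k \<in> borel_measurable borel"
 unfolding cell_moment_def[abs_def] by measurable

lemma cell_moment_difference:
 assumes e: "0 < ep" and a: "a \<in> inner_cells L"
 shows "(cell_fun ep L a x)^2 * (x $ k - ep * of_int (a k)) =
  ep * (cell_moment ep a k (x + (ep/2) *\<^sub>R axis k 1) - cell_moment ep a k (x - (ep/2) *\<^sub>R axis k 1))"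
proof -
 let ?t = "x $ k / ep - of_int (a k)"
 let ?P = "\<Prod>l\<in>UNIV - {k}. (root_spline (x $ l / ep - of_int (a l)))^2"
 have shift: "cell_moment ep a k (x + c *\<^sub>R axis k 1) = spline_primitive (?t + c / ep) * ?P" for c
 proof -
  have "(\<Prod>l\<in>UNIV - {k}. (root_spline ((x + c *\<^sub>R axis k 1) $ l / ep - of_int (a l)))^2) = ?P"
   by (intro prod.cong refl) (auto simp: axis_def)
  then show ?thesis unfolding cell_moment_def by (simp add: add_divide_distrib algebra_simps)
 qed
 have 1: "cell_moment ep a k (x + (ep/2) *\<^sub>R axis k 1) = spline_primitive (?t + 1/2) * ?P"
  using shift[of "ep/2"] e by simp
 have 2: "cell_moment ep a k (x - (ep/2) *\<^sub>R axis k 1) = spline_primitive (?t - 1/2) * ?P"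
  using shift[of "- (ep/2)"] e by simp
 have "(cell_fun ep L a x)^2 = (root_spline ?t)^2 * ?P"
  unfolding inner_cell_fun[OF e a] prod_power_distrib by (rule prod.remove) auto
 moreover have "x $ k - ep * of_int (a k) = ep * ?t" using e by (simp add: field_simps)
 ultimately have "(cell_fun ep L a x)^2 * (x $ k - ep * of_int (a k)) = ep * (?t * (root_spline ?t)^2) * ?P" by (simp only: mult_ac)
 then show ?thesis unfolding 1 2 spline_primitive_difference by (simp only: left_diff_distrib right_diff_distrib mult_ac)
qed

text \<open>Inner indices are part of the full window, and for \<open>|X| > L\<close> all their
  terms vanish. So a bound proved for clamped coordinates holds everywhere.\<close>

lemma inner_sum_le:
 fixes h :: "int => real" and X :: real
 assumes L: "0 <= L" and h0: "!!a. 0 <= h a" and h: "!!a. 3/2 <= \<bar>X - of_int a\<bar> ==> h a = 0"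
  and le: "\<bar>X\<bar> <= of_int L ==> (\<Sum>a\<in>{-L-1..L+1}. h a) <= c" and c: "0 <= c"
 shows "(\<Sum>a\<in>{-(L-2)..L-2}. h a) <= c"
proof (cases "\<bar>X\<bar> <= of_int L")
 case True
 have "(\<Sum>a\<in>{-(L-2)..L-2}. h a) <= (\<Sum>a\<in>{-L-1..L+1}. h a)" by (rule sum_mono2) (auto simp: h0)
 then show ?thesis using le[OF True] by simp
next
 case False
 have "h a = 0" if "a \<in> {-(L-2)..L-2}" for a
 proof (rule h)
  have "\<bar>a\<bar> <= L - 2" using that by (simp add: abs_le_iff)
  then have "\<bar>of_int a :: real\<bar> <= of_int L - 2" by (metis of_int_abs of_int_diff of_int_le_iff of_int_numeral)
  then show "3/2 <= \<bar>X - of_int a\<bar>" using False by linarith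
 qed
 then show ?thesis using c by simp
qed

text \<open>At most three translates of the primitive overlap, each bounded by 1, and the sums in
  the other two directions are at most 1.\<close>

lemma sum_cell_moment:
 assumes L: "0 <= L"
 shows "(\<Sum>a\<in>inner_cells L. \<bar>cell_moment ep a k x\<bar>) <= 3"
proof -
 let ?X = "%l. x $ l / ep"
 let ?h = "%l a. if l = k then \<bar>spline_primitive (?X l - of_int a)\<bar> else (root_spline (?X l - of_int a))^2"
 have "(\<Sum>a\<in>inner_cells L. \<bar>cell_moment ep a k x\<bar>) = (\<Sum>a\<in>inner_cells L. \<Prod>l\<in>UNIV. ?h l (a l))"
  by (intro sum.cong refl) (simp add: cell_moment_def abs_mult abs_prod prod.remove[of UNIV k])
 also have "... = (\<Prod>l\<in>UNIV. \<Sum>a\<in>{-(L-2)..L-2}. ?h l a)"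
  unfolding inner_cells_def by (rule prod_sum_PiE[symmetric]) auto
 also have "... = (\<Sum>a\<in>{-(L-2)..L-2}. \<bar>spline_primitive (?X k - of_int a)\<bar>) * (\<Prod>l\<in>UNIV - {k}. \<Sum>a\<in>{-(L-2)..L-2}. (root_spline (?X l - of_int a))^2)"
  by (simp add: prod.remove[of UNIV k])
 also have "... <= 3 * 1"
 proof -
  have b3: "(\<Sum>a\<in>{-(L-2)..L-2}. \<bar>spline_primitive (?X k - of_int a)\<bar>) <= 3"
  proof (rule inner_sum_le[OF L, where X="?X k"])
   show z: "\<bar>spline_primitive (?X k - of_int a)\<bar> = 0" if "3/2 <= \<bar>?X k - of_int a\<bar>" for a
    using that by (simp add: spline_primitive_zero)
   assume X: "\<bar>?X k\<bar> <= of_int L"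
   obtain n where n: "(\<Sum>a\<in>{-L-1..L+1}. \<bar>spline_primitive (?X k - of_int a)\<bar>)
    = \<bar>spline_primitive (?X k - of_int (n-1))\<bar> + (\<bar>spline_primitive (?X k - of_int n)\<bar> + \<bar>spline_primitive (?X k - of_int (n+1))\<bar>)"
    by (rule sum_translates[OF X, of "%a. \<bar>spline_primitive (?X k - of_int a)\<bar>"]) (use z in auto)
   show "(\<Sum>a\<in>{-L-1..L+1}. \<bar>spline_primitive (?X k - of_int a)\<bar>) <= 3"
    unfolding n using spline_primitive_bound[of "?X k - of_int (n-1)"] spline_primitive_bound[of "?X k - of_int n"] spline_primitive_bound[of "?X k - of_int (n+1)"] by linarith
  qed auto
  have "(\<Sum>a\<in>{-(L-2)..L-2}. (root_spline (?X l - of_int a))^2) <= 1" for l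
   by (rule inner_sum_le[OF L, where X="?X l"]) (auto simp: root_spline_zero spline_partition(1))
  then have b1: "(\<Prod>l\<in>UNIV - {k}. \<Sum>a\<in>{-(L-2)..L-2}. (root_spline (?X l - of_int a))^2) <= 1"
   by (intro prod_le_1 conjI sum_nonneg) auto
  show ?thesis by (rule mult_mono[OF b3 b1]) (auto intro!: prod_nonneg sum_nonneg)
 qed
 finally show ?thesis by simp
qed

text \<open>Summation by parts: the difference passes from the cell moment to \<open>\<rho>\<close>,
  whose translates differ by order \<open>ep\<close> in L1. Together with the factor
  \<open>ep\<close> of the moment this gives the second order, and bounded overlap allows the sum
  over all cells.\<close>

lemma cell_drift:
 fixes \<rho> :: "real^3 => real"
 assumes e: "0 < ep" and L: "0 <= L" and i: "integrable lborel \<rho>"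
  and tr: "(\<integral>x. \<bar>\<rho> (x + ep *\<^sub>R axis k 1) - \<rho> x\<bar> \<partial>lborel) <= ep * B"
 shows "(\<Sum>a\<in>inner_cells L. \<bar>\<integral>x. \<rho> x * ((cell_fun ep L a x)^2 * (x $ k - ep * of_int (a k))) \<partial>lborel\<bar>) <= 3 * B * ep^2"
proof -
 let ?e = "axis k 1 :: real^3"
 let ?R = "%a. cell_moment ep a k"
 have rm[measurable]: "\<rho> \<in> borel_measurable borel" using i by auto
 have ish: "integrable lborel (%x. \<rho> (x + c))" for c using lborel_shift(1)[of \<rho> c] i by simp
 have Rb: "\<bar>?R a x\<bar> <= 3" if "a \<in> inner_cells L" for a x
 proof -
  have "\<bar>?R a x\<bar> <= (\<Sum>a\<in>inner_cells L. \<bar>?R a x\<bar>)" by (rule member_le_sum[OF that]) auto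
  then show ?thesis using sum_cell_moment[OF L, of ep k x] by simp
 qed
 have iR: "integrable lborel (%x. \<rho> (x + c) * ?R a (x + d))" if "a \<in> inner_cells L" for a c d
 proof (rule Bochner_Integration.integrable_bound)
  show "integrable lborel (%x. 3 * \<bar>\<rho> (x + c)\<bar>)" using ish[of c] by simp
  show "AE x in lborel. norm (\<rho> (x + c) * ?R a (x + d)) <= norm (3 * \<bar>\<rho> (x + c)\<bar>)"
  proof (rule AE_I2)
   fix x
   have "\<bar>\<rho> (x + c)\<bar> * \<bar>?R a (x + d)\<bar> <= \<bar>\<rho> (x + c)\<bar> * 3" by (intro mult_left_mono Rb[OF that]) simp
   then show "norm (\<rho> (x + c) * ?R a (x + d)) <= norm (3 * \<bar>\<rho> (x + c)\<bar>)" by (simp add: abs_mult)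
  qed
 qed measurable
 have one: "\<bar>\<integral>x. \<rho> x * ((cell_fun ep L a x)^2 * (x $ k - ep * of_int (a k))) \<partial>lborel\<bar>
  <= ep * (\<integral>x. \<bar>\<rho> (x + ep *\<^sub>R ?e) - \<rho> x\<bar> * \<bar>?R a (x + (ep/2) *\<^sub>R ?e)\<bar> \<partial>lborel)" if a: "a \<in> inner_cells L" for a
 proof -
  let ?c = "(ep/2) *\<^sub>R ?e"
  have i1: "integrable lborel (%x. \<rho> x * ?R a (x + ?c))" using iR[OF a, of 0 ?c] by simp
  have i2: "integrable lborel (%x. \<rho> x * ?R a (x - ?c))" using iR[OF a, of 0 "- ?c"] by simp
  have i3: "integrable lborel (%x. \<rho> (x + ep *\<^sub>R ?e) * ?R a (x + ?c))" using iR[OF a] .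
  have cc: "?c + ?c = ep *\<^sub>R ?e" by (simp add: scaleR_add_left[symmetric])
  have "(\<integral>x. \<rho> x * ((cell_fun ep L a x)^2 * (x $ k - ep * of_int (a k))) \<partial>lborel)
   = (\<integral>x. ep * (\<rho> x * ?R a (x + ?c) - \<rho> x * ?R a (x - ?c)) \<partial>lborel)"
   unfolding cell_moment_difference[OF e a] by (intro Bochner_Integration.integral_cong refl) (simp only: right_diff_distrib mult.left_commute)
  also have "... = ep * ((\<integral>x. \<rho> x * ?R a (x + ?c) \<partial>lborel) - (\<integral>x. \<rho> x * ?R a (x - ?c) \<partial>lborel))"
   using i1 i2 by simp
  \<comment> \<open>A translation by the full step \<open>ep\<close> turns the backward half step
    into the forward one, so that both terms carry the same moment function.\<close>
  also have "(\<integral>x. \<rho> x * ?R a (x - ?c) \<partial>lborel) = (\<integral>x. \<rho> (x + ep *\<^sub>R ?e) * ?R a (x + ?c) \<partial>lborel)"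
  proof -
   have "(\<integral>x. \<rho> (x + ep *\<^sub>R ?e) * ?R a ((x + ep *\<^sub>R ?e) - ?c) \<partial>lborel) = (\<integral>x. \<rho> x * ?R a (x - ?c) \<partial>lborel)"
    by (rule lborel_shift(2)[of "%x. \<rho> x * ?R a (x - ?c)" "ep *\<^sub>R ?e"]) measurable
   moreover have "(x + ep *\<^sub>R ?e) - ?c = x + ?c" for x unfolding cc[symmetric] by simp
   ultimately show ?thesis by simp
  qed
  also have "(\<integral>x. \<rho> x * ?R a (x + ?c) \<partial>lborel) - (\<integral>x. \<rho> (x + ep *\<^sub>R ?e) * ?R a (x + ?c) \<partial>lborel)
   = (\<integral>x. \<rho> x * ?R a (x + ?c) - \<rho> (x + ep *\<^sub>R ?e) * ?R a (x + ?c) \<partial>lborel)"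
   using i1 i3 by simp
  finally have "\<bar>\<integral>x. \<rho> x * ((cell_fun ep L a x)^2 * (x $ k - ep * of_int (a k))) \<partial>lborel\<bar>
   = ep * \<bar>\<integral>x. \<rho> x * ?R a (x + ?c) - \<rho> (x + ep *\<^sub>R ?e) * ?R a (x + ?c) \<partial>lborel\<bar>"
   using e by (simp only: abs_mult abs_of_pos)
  also have "... <= ep * (\<integral>x. \<bar>\<rho> x * ?R a (x + ?c) - \<rho> (x + ep *\<^sub>R ?e) * ?R a (x + ?c)\<bar> \<partial>lborel)"
   using e by (intro mult_left_mono integral_abs_bound) auto
  also have "(%x. \<bar>\<rho> x * ?R a (x + ?c) - \<rho> (x + ep *\<^sub>R ?e) * ?R a (x + ?c)\<bar>) = (%x. \<bar>\<rho> (x + ep *\<^sub>R ?e) - \<rho> x\<bar> * \<bar>?R a (x + ?c)\<bar>)"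
   by (simp add: fun_eq_iff abs_mult[symmetric] left_diff_distrib abs_minus_commute)
  finally show ?thesis .
 qed
 have iA: "integrable lborel (%x. \<bar>\<rho> (x + ep *\<^sub>R ?e) - \<rho> x\<bar> * \<bar>?R a (x + (ep/2) *\<^sub>R ?e)\<bar>)" if "a \<in> inner_cells L" for a
 proof (rule Bochner_Integration.integrable_bound)
  show "integrable lborel (%x. 3 * \<bar>\<rho> (x + ep *\<^sub>R ?e) - \<rho> x\<bar>)" using ish i by simp
  show "AE x in lborel. norm (\<bar>\<rho> (x + ep *\<^sub>R ?e) - \<rho> x\<bar> * \<bar>?R a (x + (ep/2) *\<^sub>R ?e)\<bar>) <= norm (3 * \<bar>\<rho> (x + ep *\<^sub>R ?e) - \<rho> x\<bar>)"
  proof (rule AE_I2)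
   fix x
   have "\<bar>\<rho> (x + ep *\<^sub>R ?e) - \<rho> x\<bar> * \<bar>?R a (x + (ep/2) *\<^sub>R ?e)\<bar> <= \<bar>\<rho> (x + ep *\<^sub>R ?e) - \<rho> x\<bar> * 3" by (intro mult_left_mono Rb[OF that]) simp
   then show "norm (\<bar>\<rho> (x + ep *\<^sub>R ?e) - \<rho> x\<bar> * \<bar>?R a (x + (ep/2) *\<^sub>R ?e)\<bar>) <= norm (3 * \<bar>\<rho> (x + ep *\<^sub>R ?e) - \<rho> x\<bar>)" by (simp add: abs_mult)
  qed
 qed measurable
 have "(\<Sum>a\<in>inner_cells L. \<bar>\<integral>x. \<rho> x * ((cell_fun ep L a x)^2 * (x $ k - ep * of_int (a k))) \<partial>lborel\<bar>)
  <= (\<Sum>a\<in>inner_cells L. ep * (\<integral>x. \<bar>\<rho> (x + ep *\<^sub>R ?e) - \<rho> x\<bar> * \<bar>?R a (x + (ep/2) *\<^sub>R ?e)\<bar> \<partial>lborel))"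
  by (rule sum_mono[OF one])
 also have "... = ep * (\<integral>x. (\<Sum>a\<in>inner_cells L. \<bar>\<rho> (x + ep *\<^sub>R ?e) - \<rho> x\<bar> * \<bar>?R a (x + (ep/2) *\<^sub>R ?e)\<bar>) \<partial>lborel)"
 proof -
  have "(\<integral>x. (\<Sum>a\<in>inner_cells L. \<bar>\<rho> (x + ep *\<^sub>R ?e) - \<rho> x\<bar> * \<bar>?R a (x + (ep/2) *\<^sub>R ?e)\<bar>) \<partial>lborel)
    = (\<Sum>a\<in>inner_cells L. (\<integral>x. \<bar>\<rho> (x + ep *\<^sub>R ?e) - \<rho> x\<bar> * \<bar>?R a (x + (ep/2) *\<^sub>R ?e)\<bar> \<partial>lborel))"
   by (rule Bochner_Integration.integral_sum[OF iA])
  then show ?thesis by (simp only: sum_distrib_left[of ep])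
 qed
 also have "... <= ep * (\<integral>x. 3 * \<bar>\<rho> (x + ep *\<^sub>R ?e) - \<rho> x\<bar> \<partial>lborel)"
 proof (intro mult_left_mono integral_mono Bochner_Integration.integrable_sum iA)
  show "(\<Sum>a\<in>inner_cells L. \<bar>\<rho> (x + ep *\<^sub>R ?e) - \<rho> x\<bar> * \<bar>?R a (x + (ep/2) *\<^sub>R ?e)\<bar>) <= 3 * \<bar>\<rho> (x + ep *\<^sub>R ?e) - \<rho> x\<bar>" for x
   unfolding sum_distrib_left[symmetric] using sum_cell_moment[OF L, of ep k "x + (ep/2) *\<^sub>R ?e"]
   by (subst mult.commute) (rule mult_right_mono, auto)
  show "integrable lborel (%x. 3 * \<bar>\<rho> (x + ep *\<^sub>R ?e) - \<rho> x\<bar>)" using ish i by simp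
 qed (use e in auto)
 also have "... <= ep * (3 * (ep * B))" using e tr by (intro mult_left_mono) auto
 also have "... = 3 * B * ep^2" by (simp add: power2_eq_square)
 finally show ?thesis .
qed

section \<open>Lower bound: transport plans from states\<close>

lemma coulomb_scale:
 fixes x :: "real^3^'n::finite"
 assumes c: "0 < c"
 shows "coulomb (c *\<^sub>R x) = ennreal (1 / c) * coulomb x"
proof -
 have one: "inverse (ennreal (dist ((c *\<^sub>R x) $ j) ((c *\<^sub>R x) $ k))) = ennreal (1 / c) * inverse (ennreal (dist (x $ j) (x $ k)))" for j k
 proof -
  define d where "d = dist (x $ j) (x $ k)"
  have "dist ((c *\<^sub>R x) $ j) ((c *\<^sub>R x) $ k) = c * d"
   using c by (simp add: d_def dist_norm scaleR_diff_right[symmetric])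
  moreover have "inverse (ennreal (c * d)) = ennreal (1 / c) * inverse (ennreal d)"
  \<comment> \<open>For coincident particles the reciprocal is infinite on both sides; the positive
    factor \<open>1 / c\<close> does not change that.\<close>
  proof (cases "d = 0")
   case True
   then show ?thesis using c by (simp add: ennreal_mult_top)
  next
   case False
   then have d: "0 < d" by (simp add: d_def)
   then have "inverse (ennreal (c * d)) = ennreal (inverse (c * d))" using c by (simp add: inverse_ennreal)
   also have "... = ennreal (1 / c) * ennreal (inverse d)" using c d by (simp add: ennreal_mult[symmetric] divide_inverse)
   also have "ennreal (inverse d) = inverse (ennreal d)" using d by (simp add: inverse_ennreal)
   finally show ?thesis .
  qed
  ultimately show ?thesis by (simp add: d_def)
 qed
 show ?thesis
  unfolding coulomb_def one case_prod_beta ennreal_divide_times[symmetric] sum_distrib_left[symmetric]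
  by (simp only: divide_ennreal_def mult_ac)
qed

lemma coulomb_perm:
 assumes p: "p permutes (UNIV :: 'n::finite set)"
 shows "coulomb (perm_conf p x) = coulomb x"
proof -
 have inj: "inj p" and surj: "surj p" using p by (auto simp: permutes_inj permutes_surj)
 have "bij_betw (%(j, k). (p j, p k)) {(j, k). j ~= k} {(j, k). j ~= k}"
 proof (rule bij_betwI[where g="%(j, k). (inv p j, inv p k)"])
  show "(%(j, k). (p j, p k)) \<in> {(j, k). j ~= k} \<rightarrow> {(j, k). j ~= k}" using inj by (auto simp: inj_eq[OF inj])
  show "(%(j, k). (inv p j, inv p k)) \<in> {(j, k). j ~= k} \<rightarrow> {(j, k). j ~= k}"
   using permutes_inv[OF p] by (auto simp: inj_eq[OF permutes_inj[OF permutes_inv[OF p]]])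
 qed (use permutes_inverses[OF p] in auto)
 from sum.reindex_bij_betw[OF this, of "%(j, k). inverse (ennreal (dist (x $ j) (x $ k)))"]
 show ?thesis unfolding coulomb_def perm_conf_def by (simp add: case_prod_beta)
qed

lemma perm_conf_scale: "perm_conf p (c *\<^sub>R x) = c *\<^sub>R perm_conf p x"
 by (simp add: perm_conf_def vec_eq_iff)

text \<open>The dilated diagonal of a state is an admissible transport plan.\<close>

lemma state_gives_plan:
 fixes \<Psi> :: "nat => real^3^'n::finite => complex"
 assumes ms: "mixed_state lam \<Psi>" and sd: "state_density lam \<Psi> (%x. \<eta> ^ 3 * \<rho> (\<eta> *\<^sub>R x))"
  and \<eta>: "0 < \<eta>" and rm[measurable]: "\<rho> \<in> borel_measurable borel" and r0: "!!x. 0 <= \<rho> x" and ri: "integrable lborel \<rho>"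
 shows "\<exists>P :: (real^3^'n) measure. OT_admissible P \<rho> & ennreal \<eta> * (\<integral>\<^sup>+x. coulomb x \<partial>P) <= (\<Sum>k. ennreal (lam k) * form_energy (\<Psi> k))"
proof -
 have lam0: "0 <= lam k" and lams: "lam sums 1" and L: "L2 (\<Psi> k)" and anti: "antisym_fun (\<Psi> k)"
  and nrm: "(\<integral>x. \<Psi> k x * cnj (\<Psi> k x) \<partial>lborel) = 1" for k
  using ms by (auto simp: mixed_state_def)
 note [measurable] = L2_measurable[OF L]
 have n1: "(\<integral>x. (cmod (\<Psi> k x))^2 \<partial>lborel) = 1" for k
 proof -
  have "complex_of_real (\<integral>x. (cmod (\<Psi> k x))^2 \<partial>lborel) = 1"
   using nrm[of k] unfolding complex_norm_square[symmetric] integral_complex_of_real .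
  then show ?thesis by (simp only: of_real_eq_1_iff)
 qed
 \<comment> \<open>The diagonal of the density matrix, that is, the joint position density of all
   particles.\<close>
 define D where "D x = (\<Sum>k. ennreal (lam k) * ennreal ((cmod (\<Psi> k x))^2))" for x
 have Dm[measurable]: "D \<in> borel_measurable borel" unfolding D_def[abs_def] by measurable
 have sm[measurable]: "(%x :: real^3^'n. \<eta> *\<^sub>R x) \<in> borel_measurable borel" by measurable
 define P where "P = distr (density lborel D) borel (%x :: real^3^'n. \<eta> *\<^sub>R x)"
 have nnP: "(\<integral>\<^sup>+x. F x \<partial>P) = (\<Sum>k. ennreal (lam k) * (\<integral>\<^sup>+x. F (\<eta> *\<^sub>R x) * ennreal ((cmod (\<Psi> k x))^2) \<partial>lborel))"
  if [measurable]: "F \<in> borel_measurable borel" for F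
 proof -
  have "(\<integral>\<^sup>+x. F x \<partial>P) = (\<integral>\<^sup>+x. D x * F (\<eta> *\<^sub>R x) \<partial>lborel)"
   unfolding P_def by (subst nn_integral_distr) (auto simp: nn_integral_density)
  also have "... = (\<integral>\<^sup>+x. (\<Sum>k. ennreal (lam k) * (F (\<eta> *\<^sub>R x) * ennreal ((cmod (\<Psi> k x))^2))) \<partial>lborel)"
   unfolding D_def ennreal_suminf_multc[symmetric] by (intro nn_integral_cong arg_cong[of _ _ suminf] ext) (simp only: mult_ac)
  also have "... = (\<Sum>k. \<integral>\<^sup>+x. ennreal (lam k) * (F (\<eta> *\<^sub>R x) * ennreal ((cmod (\<Psi> k x))^2)) \<partial>lborel)"
   by (rule nn_integral_suminf) measurable
  also have "... = (\<Sum>k. ennreal (lam k) * (\<integral>\<^sup>+x. F (\<eta> *\<^sub>R x) * ennreal ((cmod (\<Psi> k x))^2) \<partial>lborel))"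
   by (intro arg_cong[of _ _ suminf] ext nn_integral_cmult) measurable
  finally show ?thesis .
 qed
 have spP: "space P = UNIV" "sets P = sets borel" by (auto simp: P_def)
 have emP: "emeasure P A = (\<integral>\<^sup>+x. indicator A x \<partial>P)" if "A \<in> sets borel" for A
  using that spP by simp
 have nn1: "(\<integral>\<^sup>+x. ennreal ((cmod (\<Psi> k x))^2) \<partial>lborel) = 1" for k
  using nn_integral_eq_integral[OF L2_square_integrable[OF L[of k]]] n1[of k] by simp
 have prob: "prob_space P"
 proof
  have "emeasure P (space P) = (\<integral>\<^sup>+x. 1 \<partial>P)" by simp
  also have "... = (\<Sum>k. ennreal (lam k))" by (subst nnP) (simp_all add: nn1)
  also have "... = ennreal 1" by (rule suminf_ennreal_eq[OF lam0 lams])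
  finally show "emeasure P (space P) = 1" by simp
 qed
 have Pinv: "(\<integral>\<^sup>+x. F (perm_conf p x) \<partial>P) = (\<integral>\<^sup>+x. F x \<partial>P)"
  if p: "p permutes (UNIV :: 'n set)" and [measurable]: "F \<in> borel_measurable borel" for p F
 proof -
  have "(\<integral>\<^sup>+x. F (\<eta> *\<^sub>R x) * ennreal ((cmod (\<Psi> k x))^2) \<partial>lborel) = (\<integral>\<^sup>+x. F (perm_conf p (\<eta> *\<^sub>R x)) * ennreal ((cmod (\<Psi> k x))^2) \<partial>lborel)" for k
  proof -
   have "(\<integral>\<^sup>+x. F (\<eta> *\<^sub>R x) * ennreal ((cmod (\<Psi> k x))^2) \<partial>lborel) = (\<integral>\<^sup>+x. F (\<eta> *\<^sub>R perm_conf p x) * ennreal ((cmod (\<Psi> k (perm_conf p x)))^2) \<partial>lborel)"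
    by (subst lborel_perm_conf[OF p, symmetric], subst nn_integral_distr) auto
   moreover have "cmod (\<Psi> k (perm_conf p x)) = cmod (\<Psi> k x)" for x
   proof -
    have e: "\<Psi> k (perm_conf p x) = of_int (sign p) * \<Psi> k x" using anti[of k] p unfolding antisym_fun_def by blast
    show ?thesis unfolding e norm_mult norm_sign by simp
   qed
   ultimately show ?thesis by (simp add: perm_conf_scale)
  qed
  then show ?thesis by (simp add: nnP)
 qed
 have adm: "OT_admissible P \<rho>"
  unfolding OT_admissible_def
 proof (intro conjI allI impI ballI)
  show "prob_space P" by (rule prob)
  show "sets P = sets borel" by (rule spP)
  show "distr P borel (perm_conf p) = P" if p: "p permutes UNIV" for p
  proof (rule measure_eqI)
   fix A assume "A \<in> sets (distr P borel (perm_conf p))"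
   then have A[measurable]: "A \<in> sets borel" by simp
   have "emeasure (distr P borel (perm_conf p)) A = (\<integral>\<^sup>+x. indicator A x \<partial>distr P borel (perm_conf p))" by simp
   also have "... = (\<integral>\<^sup>+x. indicator A (perm_conf p x) \<partial>P)"
    by (rule nn_integral_distr) (auto simp: P_def)
   also have "... = (\<integral>\<^sup>+x. indicator A x \<partial>P)" by (rule Pinv[OF p]) simp
   also have "... = emeasure P A" by (rule emP[OF A, symmetric])
   finally show "emeasure (distr P borel (perm_conf p)) A = emeasure P A" .
  qed (simp add: spP)
  fix A :: "(real^3) set" and j :: 'n assume A[measurable]: "A \<in> sets borel"
  let ?I = "%i. \<integral>\<^sup>+x. indicator A (x $ i) \<partial>P"
  \<comment> \<open>All one-particle marginals agree, by a transposition of particles. Hence the sum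
    over particles tested by \<open>state_density\<close> is the number of particles times any one
    of them.\<close>
  have eq: "?I i = ?I j" for i
  proof -
   have "Transposition.transpose i j permutes (UNIV :: 'n set)" by (rule permutes_swap_id) auto
   from Pinv[OF this, of "%x. indicator A (x $ j)"] show ?thesis by (simp add: perm_conf_def)
  qed
  \<comment> \<open>The state lives in the coordinates before dilation, so the set \<open>A\<close>
    is pulled back by the dilation.\<close>
  define ph where "ph y = indicat_real A (\<eta> *\<^sub>R y)" for y :: "real^3"
  have phm[measurable]: "ph \<in> borel_measurable borel" unfolding ph_def[abs_def] by measurable
  have ph01: "0 <= ph y" "ph y <= 1" for y by (auto simp: ph_def indicator_def)
  have "bounded (range ph)" using ph01 by (intro boundedI[of _ 1]) auto
  then have sm': "(%k. lam k * (\<integral>x. (\<Sum>j\<in>UNIV. ph (x $ j)) * (cmod (\<Psi> k x))^2 \<partial>lborel)) sums (\<integral>y. ph y * (\<eta> ^ 3 * \<rho> (\<eta> *\<^sub>R y)) \<partial>lborel)"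
   using sd phm unfolding state_density_def by blast
  have tm: "ennreal (lam k * (\<integral>x. (\<Sum>j\<in>UNIV. ph (x $ j)) * (cmod (\<Psi> k x))^2 \<partial>lborel))
   = ennreal (lam k) * (\<integral>\<^sup>+x. (\<Sum>i\<in>UNIV. indicator A ((\<eta> *\<^sub>R x) $ i)) * ennreal ((cmod (\<Psi> k x))^2) \<partial>lborel)" for k
  proof -
   have "integrable lborel (%x. (\<Sum>j\<in>UNIV. ph (x $ j)) * (cmod (\<Psi> k x))^2)"
   proof (rule Bochner_Integration.integrable_bound)
    show "integrable lborel (%x. real CARD('n) * (cmod (\<Psi> k x))^2)" using L2_square_integrable[OF L[of k]] by simp
    have "0 <= (\<Sum>j\<in>UNIV. ph (x $ j))" "(\<Sum>j\<in>UNIV. ph (x $ j)) <= real CARD('n)" for x :: "real^3^'n"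
     using ph01 sum_bounded_above[of UNIV "%j. ph (x $ j)" 1] by (auto intro: sum_nonneg)
    then show "AE x in lborel. norm ((\<Sum>j\<in>UNIV. ph (x $ j)) * (cmod (\<Psi> k x))^2) <= norm (real CARD('n) * (cmod (\<Psi> k x))^2)"
     by (intro AE_I2) (simp add: abs_mult mult_right_mono)
   qed measurable
   then have "ennreal (\<integral>x. (\<Sum>j\<in>UNIV. ph (x $ j)) * (cmod (\<Psi> k x))^2 \<partial>lborel) = (\<integral>\<^sup>+x. ennreal ((\<Sum>j\<in>UNIV. ph (x $ j)) * (cmod (\<Psi> k x))^2) \<partial>lborel)"
    using ph01 by (intro nn_integral_eq_integral[symmetric]) (auto intro!: AE_I2 mult_nonneg_nonneg sum_nonneg)
   also have "... = (\<integral>\<^sup>+x. (\<Sum>i\<in>UNIV. indicator A ((\<eta> *\<^sub>R x) $ i)) * ennreal ((cmod (\<Psi> k x))^2) \<partial>lborel)"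
   proof (intro nn_integral_cong)
    fix x :: "real^3^'n"
    have "ennreal (\<Sum>j\<in>UNIV. ph (x $ j)) = (\<Sum>i\<in>UNIV. ennreal (ph (x $ i)))" using ph01 by (simp add: sum_ennreal)
    also have "... = (\<Sum>i\<in>UNIV. indicator A ((\<eta> *\<^sub>R x) $ i))" by (intro sum.cong refl) (simp add: ph_def ennreal_indicator)
    finally show "ennreal ((\<Sum>j\<in>UNIV. ph (x $ j)) * (cmod (\<Psi> k x))^2) = (\<Sum>i\<in>UNIV. indicator A ((\<eta> *\<^sub>R x) $ i)) * ennreal ((cmod (\<Psi> k x))^2)"
     using ph01 by (simp add: ennreal_mult'')
   qed
   finally show ?thesis using lam0 by (simp add: ennreal_mult')
  qed
  have "of_nat CARD('n) * ?I j = (\<Sum>i\<in>UNIV. ?I i)"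
  proof -
   have "(\<Sum>i\<in>UNIV. ?I i) = (\<Sum>i\<in>(UNIV :: 'n set). ?I j)" by (rule sum.cong[OF refl eq])
   then show ?thesis by (simp only: sum_constant)
  qed
  also have "... = (\<integral>\<^sup>+x. (\<Sum>i\<in>UNIV. indicator A (x $ i)) \<partial>P)"
   by (rule nn_integral_sum[symmetric]) (simp add: P_def)
  also have "... = (\<Sum>k. ennreal (lam k * (\<integral>x. (\<Sum>j\<in>UNIV. ph (x $ j)) * (cmod (\<Psi> k x))^2 \<partial>lborel)))"
   unfolding tm by (rule nnP) measurable
  also have "... = ennreal (\<integral>y. ph y * (\<eta> ^ 3 * \<rho> (\<eta> *\<^sub>R y)) \<partial>lborel)"
   using lam0 ph01 by (intro suminf_ennreal_eq[OF _ sm']) (intro mult_nonneg_nonneg Bochner_Integration.integral_nonneg sum_nonneg zero_le_power2; simp)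
  also have "(\<integral>y. ph y * (\<eta> ^ 3 * \<rho> (\<eta> *\<^sub>R y)) \<partial>lborel) = (\<integral>y. indicat_real A y * \<rho> y \<partial>lborel)"
  proof -
   have "(\<integral>y. indicat_real A y * \<rho> y \<partial>lborel) = (\<eta> ^ DIM(real^3)) *\<^sub>R (\<integral>y. indicat_real A (\<eta> *\<^sub>R y) * \<rho> (\<eta> *\<^sub>R y) \<partial>lborel)"
    by (rule lborel_scale(2)[OF _ \<eta>]) measurable
   then show ?thesis by (simp add: ph_def mult.left_commute[of _ "\<eta> ^ 3"])
  qed
  also have "ennreal (\<integral>y. indicat_real A y * \<rho> y \<partial>lborel) = (\<integral>\<^sup>+y. ennreal (indicat_real A y * \<rho> y) \<partial>lborel)"
  proof (rule nn_integral_eq_integral[symmetric])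
   have "integrable lborel (%y. \<rho> y * indicat_real A y)" by (rule integrable_real_mult_indicator[OF _ ri]) simp
   then show "integrable lborel (%y. indicat_real A y * \<rho> y)" by (simp only: mult.commute[of "indicat_real A _"])
   show "AE y in lborel. 0 <= indicat_real A y * \<rho> y" using r0 by (intro AE_I2 mult_nonneg_nonneg) simp_all
  qed
  also have "... = (\<integral>\<^sup>+y\<in>A. ennreal (\<rho> y) \<partial>lborel)"
   by (intro nn_integral_cong) (auto simp: indicator_def)
  finally have fin: "of_nat CARD('n) * ?I j = (\<integral>\<^sup>+y\<in>A. ennreal (\<rho> y) \<partial>lborel)" .
  have "{x \<in> space P. x $ j \<in> A} = (%x. x $ j) -` A" by (simp add: spP vimage_def)
  moreover have "(%x :: real^3^'n. x $ j) -` A \<in> sets borel" using measurable_sets[OF vec_nth_measurable A, of j] by simp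
  ultimately have "emeasure P {x \<in> space P. x $ j \<in> A} = (\<integral>\<^sup>+x. indicator ((%x. x $ j) -` A) x \<partial>P)" by (simp add: emP)
  also have "... = ?I j" by (intro nn_integral_cong) (simp add: indicator_def)
  finally show "of_nat CARD('n) * emeasure P {x \<in> space P. x $ j \<in> A} = (\<integral>\<^sup>+y\<in>A. ennreal (\<rho> y) \<partial>lborel)" using fin by simp
 qed
 have "(\<integral>\<^sup>+x. coulomb x \<partial>P) = (\<Sum>k. ennreal (lam k) * (\<integral>\<^sup>+x. coulomb (\<eta> *\<^sub>R x) * ennreal ((cmod (\<Psi> k x))^2) \<partial>lborel))"
  by (rule nnP) measurable
 also have "... = (\<Sum>k. ennreal (1 / \<eta>) * (ennreal (lam k) * (\<integral>\<^sup>+x. coulomb x * ennreal ((cmod (\<Psi> k x))^2) \<partial>lborel)))"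
  unfolding coulomb_scale[OF \<eta>] mult.assoc
  by (intro arg_cong[of _ _ suminf] ext, subst nn_integral_cmult, measurable) (simp only: mult.left_commute)
 also have "... = ennreal (1 / \<eta>) * (\<Sum>k. ennreal (lam k) * (\<integral>\<^sup>+x. coulomb x * ennreal ((cmod (\<Psi> k x))^2) \<partial>lborel))"
  by (rule ennreal_suminf_cmult)
 finally have "ennreal \<eta> * (\<integral>\<^sup>+x. coulomb x \<partial>P) = (\<Sum>k. ennreal (lam k) * (\<integral>\<^sup>+x. coulomb x * ennreal ((cmod (\<Psi> k x))^2) \<partial>lborel))"
  using \<eta> by (simp add: mult.assoc[symmetric] ennreal_mult[symmetric])
 \<comment> \<open>The kinetic energy is nonnegative and dropped; outside the form domain the energy
   is infinite.\<close>
 also have "... <= (\<Sum>k. ennreal (lam k) * form_energy (\<Psi> k))"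
  by (intro suminf_le summableI mult_left_mono) (auto simp: form_energy_def)
 finally show ?thesis using adm by blast
qed

lemma E_OT_le_levy_lieb:
 fixes \<rho> :: "real^3 => real"
 assumes "0 < \<eta>" "\<rho> \<in> borel_measurable borel" "!!x. 0 <= \<rho> x" "integrable lborel \<rho>"
 shows "ennreal \<eta> * E_OT TYPE('n::finite) \<rho> <= levy_lieb TYPE('n) (%x. \<eta> ^ 3 * \<rho> (\<eta> *\<^sub>R x))"
 unfolding levy_lieb_def
proof (rule Inf_greatest, clarify)
 fix lam and \<Psi> :: "nat => real^3^'n => complex"
 assume "mixed_state lam \<Psi>" "state_density lam \<Psi> (%x. \<eta> ^ 3 * \<rho> (\<eta> *\<^sub>R x))"
 from state_gives_plan[OF this assms] obtain P :: "(real^3^'n) measure" where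
  P: "OT_admissible P \<rho>" "ennreal \<eta> * (\<integral>\<^sup>+x. coulomb x \<partial>P) <= (\<Sum>k. ennreal (lam k) * form_energy (\<Psi> k))" by blast
 have "E_OT TYPE('n) \<rho> <= (\<integral>\<^sup>+x. coulomb x \<partial>P)" unfolding E_OT_def by (rule Inf_lower) (use P(1) in blast)
 then have "ennreal \<eta> * E_OT TYPE('n) \<rho> <= ennreal \<eta> * (\<integral>\<^sup>+x. coulomb x \<partial>P)" by (rule mult_left_mono) simp
 also note P(2)
 finally show "ennreal \<eta> * E_OT TYPE('n) \<rho> <= (\<Sum>k. ennreal (lam k) * form_energy (\<Psi> k))" .
qed

section \<open>From cell weights to energy bounds\<close>

text \<open>Dilating a mixture with density \<open>\<rho>\<close> produces one with the dilated
  density; squared gradients gain the factor \<open>\<eta>^2\<close> and the Coulomb energy the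
  factor \<open>\<eta>\<close>.\<close>

lemma levy_lieb_le_scaled_mixture:
 fixes F :: "'k => real^3^'n::finite => complex" and G :: "'k => real^3^'n => real^3^'n => complex"
 assumes fin: "finite K" and dl: "dl > 0" and \<eta>: "0 < \<eta>" and rm[measurable]: "\<rho> \<in> borel_measurable borel"
  and F: "!!k. k \<in> K ==> L2 (F k)" and anti: "!!k. k \<in> K ==> antisym_fun (F k)"
  and re: "!!k x. k \<in> K ==> cnj (F k x) = F k x"
  and G: "!!k b. k \<in> K ==> b \<in> Basis ==> L2 (G k b)" and w: "!!k b. k \<in> K ==> b \<in> Basis ==> weak_partial (F k) b (G k b)"
  and near: "!!k x. k \<in> K ==> (!!i. norm (x $ i) < dl) ==> F k x = 0"
  and mass: "(\<Sum>k\<in>K. \<integral>x. (cmod (F k x))^2 \<partial>lborel) = 1"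
  and dens: "!!ph. ph \<in> borel_measurable borel ==> bounded (range ph) ==>
   (\<Sum>k\<in>K. \<integral>x. (\<Sum>j\<in>UNIV. ph (x $ j)) * (cmod (F k x))^2 \<partial>lborel) = (\<integral>y. ph y * \<rho> y \<partial>lborel)"
 shows "levy_lieb TYPE('n) (%x. \<eta> ^ 3 * \<rho> (\<eta> *\<^sub>R x)) <= (\<Sum>k\<in>K. ennreal (\<eta>^2) * (\<Sum>b\<in>Basis. \<integral>\<^sup>+x. ennreal ((cmod (G k b x))^2) \<partial>lborel)
   + ennreal \<eta> * (\<integral>\<^sup>+x. coulomb x * ennreal ((cmod (F k x))^2) \<partial>lborel))"
proof -
 \<comment> \<open>The Jacobian of the dilation of configuration space; its square root, in
   \<open>s\<close>, keeps the L2 norms.\<close>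
 define c where "c = \<eta> ^ DIM(real^3^'n)"
 have c: "0 < c" unfolding c_def using \<eta> by simp
 define s where "s = complex_of_real (sqrt c)"
 have s2: "(cmod (s * z))^2 = c * (cmod z)^2" for z using c by (simp add: s_def norm_mult power_mult_distrib)
 define F' where "F' k x = s * F k (\<eta> *\<^sub>R x)" for k x
 define G' where "G' k b x = s * (complex_of_real \<eta> * G k b (\<eta> *\<^sub>R x))" for k b x
 have sc: "(\<integral>x. S (\<eta> *\<^sub>R x) * (cmod (F' k x))^2 \<partial>lborel) = (\<integral>x. S x * (cmod (F k x))^2 \<partial>lborel)"
  if "k \<in> K" and [measurable]: "S \<in> borel_measurable borel" for k and S :: "real^3^'n => real"
 proof -
  note [measurable] = L2_measurable[OF F[OF that(1)]]
  have "(\<integral>x. S x * (cmod (F k x))^2 \<partial>lborel) = c *\<^sub>R (\<integral>x. S (\<eta> *\<^sub>R x) * (cmod (F k (\<eta> *\<^sub>R x)))^2 \<partial>lborel)"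
   unfolding c_def by (rule lborel_scale(2)[OF _ \<eta>]) measurable
  then show ?thesis by (simp add: F'_def s2 mult.left_commute[of _ c])
 qed
 have nsc: "(\<integral>\<^sup>+x. S (\<eta> *\<^sub>R x) * ennreal (c * (cmod (H (\<eta> *\<^sub>R x)))^2) \<partial>lborel) = (\<integral>\<^sup>+x. S x * ennreal ((cmod (H x))^2) \<partial>lborel)"
  if [measurable]: "S \<in> borel_measurable borel" "H \<in> borel_measurable borel" for S and H :: "real^3^'n => complex"
 proof -
  have "(\<integral>\<^sup>+x. S x * ennreal ((cmod (H x))^2) \<partial>lborel) = ennreal c * (\<integral>\<^sup>+x. S (\<eta> *\<^sub>R x) * ennreal ((cmod (H (\<eta> *\<^sub>R x)))^2) \<partial>lborel)"
   unfolding c_def by (rule nn_integral_lborel_scale[OF _ \<eta>]) measurable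
  also have "... = (\<integral>\<^sup>+x. ennreal c * (S (\<eta> *\<^sub>R x) * ennreal ((cmod (H (\<eta> *\<^sub>R x)))^2)) \<partial>lborel)"
   by (rule nn_integral_cmult[symmetric]) measurable
  also have "... = (\<integral>\<^sup>+x. S (\<eta> *\<^sub>R x) * ennreal (c * (cmod (H (\<eta> *\<^sub>R x)))^2) \<partial>lborel)"
   by (intro nn_integral_cong) (simp only: ennreal_mult''[OF zero_le_power2] mult.left_commute)
  finally show ?thesis by simp
 qed
 have "levy_lieb TYPE('n) (%x. \<eta> ^ 3 * \<rho> (\<eta> *\<^sub>R x)) <= (\<Sum>k\<in>K. (\<Sum>b\<in>Basis. \<integral>\<^sup>+x. ennreal ((cmod (G' k b x))^2) \<partial>lborel)
   + (\<integral>\<^sup>+x. coulomb x * ennreal ((cmod (F' k x))^2) \<partial>lborel))"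
 proof (rule levy_lieb_le_mixture[OF fin, where dl="dl / \<eta>"])
  show "0 < dl / \<eta>" using dl \<eta> by simp
  show "L2 (F' k)" if "k \<in> K" for k unfolding F'_def[abs_def] by (intro L2_cmult L2_scale[OF F[OF that] \<eta>])
  show "antisym_fun (F' k)" if "k \<in> K" for k
   using anti[OF that] unfolding antisym_fun_def F'_def by (simp add: perm_conf_scale[symmetric])
  show "cnj (F' k x) = F' k x" if "k \<in> K" for k x using re[OF that] by (simp add: F'_def s_def)
  show "L2 (G' k b)" if "k \<in> K" "b \<in> Basis" for k b unfolding G'_def[abs_def] by (intro L2_cmult L2_scale[OF G[OF that] \<eta>])
  show "weak_partial (F' k) b (G' k b)" if "k \<in> K" "b \<in> Basis" for k b
   unfolding F'_def[abs_def] G'_def[abs_def]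
   by (intro weak_partial_cmult weak_partial_scale[OF F[OF that(1)] G[OF that] w[OF that] that(2) \<eta>])
  show "F' k x = 0" if "k \<in> K" "!!i. norm (x $ i) < dl / \<eta>" for k x
  proof -
   have "norm ((\<eta> *\<^sub>R x) $ i) < dl" for i using that(2)[of i] \<eta> by (simp add: pos_less_divide_eq mult.commute)
   then have "F k (\<eta> *\<^sub>R x) = 0" by (rule near[OF that(1)])
   then show ?thesis by (simp add: F'_def)
  qed
  show "(\<Sum>k\<in>K. \<integral>x. (cmod (F' k x))^2 \<partial>lborel) = 1"
   using sc[of _ "%_. 1"] mass by simp
  fix ph :: "real^3 => real" assume pm[measurable]: "ph \<in> borel_measurable borel" and pb: "bounded (range ph)"
  let ?ph = "%y. ph ((1/\<eta>) *\<^sub>R y)"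
  have "bounded (range ?ph)" using pb by (rule bounded_subset) auto
  then have "(\<Sum>k\<in>K. \<integral>x. (\<Sum>j\<in>UNIV. ?ph (x $ j)) * (cmod (F k x))^2 \<partial>lborel) = (\<integral>y. ?ph y * \<rho> y \<partial>lborel)"
   by (intro dens) measurable
  moreover have "(\<integral>x. (\<Sum>j\<in>UNIV. ph (x $ j)) * (cmod (F' k x))^2 \<partial>lborel) = (\<integral>x. (\<Sum>j\<in>UNIV. ?ph (x $ j)) * (cmod (F k x))^2 \<partial>lborel)" if "k \<in> K" for k
   using sc[OF that, of "%x. \<Sum>j\<in>UNIV. ?ph (x $ j)"] \<eta> by simp
  moreover have "(\<integral>y. ?ph y * \<rho> y \<partial>lborel) = (\<integral>y. ph y * (\<eta> ^ 3 * \<rho> (\<eta> *\<^sub>R y)) \<partial>lborel)"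
  proof -
   have "(\<integral>y. ?ph y * \<rho> y \<partial>lborel) = (\<eta> ^ DIM(real^3)) *\<^sub>R (\<integral>y. ?ph (\<eta> *\<^sub>R y) * \<rho> (\<eta> *\<^sub>R y) \<partial>lborel)"
    by (rule lborel_scale(2)[OF _ \<eta>]) measurable
   then show ?thesis using \<eta> by (simp add: mult.left_commute[of _ "\<eta> ^ 3"])
  qed
  ultimately show "(\<Sum>k\<in>K. \<integral>x. (\<Sum>j\<in>UNIV. ph (x $ j)) * (cmod (F' k x))^2 \<partial>lborel) = (\<integral>y. ph y * (\<eta> ^ 3 * \<rho> (\<eta> *\<^sub>R y)) \<partial>lborel)"
   by simp
 qed
 also have "... = (\<Sum>k\<in>K. ennreal (\<eta>^2) * (\<Sum>b\<in>Basis. \<integral>\<^sup>+x. ennreal ((cmod (G k b x))^2) \<partial>lborel)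
   + ennreal \<eta> * (\<integral>\<^sup>+x. coulomb x * ennreal ((cmod (F k x))^2) \<partial>lborel))"
 proof (rule sum.cong[OF refl])
  fix k assume k: "k \<in> K"
  have kin: "(\<integral>\<^sup>+x. ennreal ((cmod (G' k b x))^2) \<partial>lborel) = ennreal (\<eta>^2) * (\<integral>\<^sup>+x. ennreal ((cmod (G k b x))^2) \<partial>lborel)" if b: "b \<in> Basis" for b
  proof -
   note [measurable] = L2_measurable[OF G[OF k b]]
   have "(cmod (G' k b x))^2 = \<eta>^2 * (c * (cmod (G k b (\<eta> *\<^sub>R x)))^2)" for x
    unfolding G'_def s2 by (simp add: norm_mult power_mult_distrib)
   then have "(\<integral>\<^sup>+x. ennreal ((cmod (G' k b x))^2) \<partial>lborel) = (\<integral>\<^sup>+x. ennreal (\<eta>^2) * ennreal (c * (cmod (G k b (\<eta> *\<^sub>R x)))^2) \<partial>lborel)"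
    using c by (intro nn_integral_cong) (simp add: ennreal_mult)
   also have "... = ennreal (\<eta>^2) * (\<integral>\<^sup>+x. 1 * ennreal (c * (cmod (G k b (\<eta> *\<^sub>R x)))^2) \<partial>lborel)"
    by (simp add: nn_integral_cmult)
   also have "(\<integral>\<^sup>+x. 1 * ennreal (c * (cmod (G k b (\<eta> *\<^sub>R x)))^2) \<partial>lborel) = (\<integral>\<^sup>+x. 1 * ennreal ((cmod (G k b x))^2) \<partial>lborel)"
    by (rule nsc) measurable
   finally show ?thesis by simp
  qed
  have pot: "(\<integral>\<^sup>+x. coulomb x * ennreal ((cmod (F' k x))^2) \<partial>lborel) = ennreal \<eta> * (\<integral>\<^sup>+x. coulomb x * ennreal ((cmod (F k x))^2) \<partial>lborel)"
  proof -
   note [measurable] = L2_measurable[OF F[OF k]]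
   have cs: "coulomb x = ennreal \<eta> * coulomb (\<eta> *\<^sub>R x)" for x :: "real^3^'n"
    unfolding coulomb_scale[OF \<eta>] mult.assoc[symmetric] using \<eta> by (simp add: ennreal_mult[symmetric])
   have "(\<integral>\<^sup>+x. coulomb x * ennreal ((cmod (F' k x))^2) \<partial>lborel) = (\<integral>\<^sup>+x. ennreal \<eta> * (coulomb (\<eta> *\<^sub>R x) * ennreal (c * (cmod (F k (\<eta> *\<^sub>R x)))^2)) \<partial>lborel)"
    by (intro nn_integral_cong) (subst cs, simp only: F'_def s2 mult.assoc)
   also have "... = ennreal \<eta> * (\<integral>\<^sup>+x. coulomb (\<eta> *\<^sub>R x) * ennreal (c * (cmod (F k (\<eta> *\<^sub>R x)))^2) \<partial>lborel)"
    by (rule nn_integral_cmult) measurable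
   also have "(\<integral>\<^sup>+x. coulomb (\<eta> *\<^sub>R x) * ennreal (c * (cmod (F k (\<eta> *\<^sub>R x)))^2) \<partial>lborel) = (\<integral>\<^sup>+x. coulomb x * ennreal ((cmod (F k x))^2) \<partial>lborel)"
    by (rule nsc) measurable
   finally show ?thesis .
  qed
  have "(\<Sum>b\<in>Basis. \<integral>\<^sup>+x. ennreal ((cmod (G' k b x))^2) \<partial>lborel) = ennreal (\<eta>^2) * (\<Sum>b\<in>Basis. \<integral>\<^sup>+x. ennreal ((cmod (G k b x))^2) \<partial>lborel)"
   unfolding sum_distrib_left by (rule sum.cong[OF refl kin])
  then show "(\<Sum>b\<in>Basis. \<integral>\<^sup>+x. ennreal ((cmod (G' k b x))^2) \<partial>lborel) + (\<integral>\<^sup>+x. coulomb x * ennreal ((cmod (F' k x))^2) \<partial>lborel)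
   = ennreal (\<eta>^2) * (\<Sum>b\<in>Basis. \<integral>\<^sup>+x. ennreal ((cmod (G k b x))^2) \<partial>lborel) + ennreal \<eta> * (\<integral>\<^sup>+x. coulomb x * ennreal ((cmod (F k x))^2) \<partial>lborel)"
   unfolding pot by simp
 qed
 finally show ?thesis .
qed

text \<open>The counterpart of \<open>nn_integral_slater\<close> for Bochner integrals: the
  functions testing a density may have either sign.\<close>

lemma integral_slater:
 fixes f :: "'n::finite => real^3 => complex" and S :: "real^3^'n => real"
 assumes f: "!!i. L2 (f i)" and d: "!!i j y. i ~= j ==> f i y = 0 | f j y = 0"
  and Sm[measurable]: "S \<in> borel_measurable borel" and inv: "!!p x. p permutes UNIV ==> S (perm_conf p x) = S x"
  and B: "!!x. \<bar>S x\<bar> <= B"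
 shows "(\<integral>x. S x * (cmod (slater f x))^2 \<partial>lborel) = (\<integral>x. S x * (\<Prod>i\<in>UNIV. (cmod (f i (x $ i)))^2) \<partial>lborel)"
proof -
 note [measurable] = L2_measurable[OF f]
 let ?G = "%x. \<Prod>i\<in>UNIV. (cmod (f i (x $ i)))^2"
 have iG: "integrable lborel ?G" by (rule integral_vec_prod) (rule L2_square_integrable[OF f])
 have B0: "0 <= B" using B[of 0] by linarith
 have iSG: "integrable lborel (%x. S x * ?G x)"
 proof (rule Bochner_Integration.integrable_bound)
  show "integrable lborel (%x. B * ?G x)" using iG by simp
  show "AE x in lborel. norm (S x * ?G x) <= norm (B * ?G x)"
   using B B0 by (intro AE_I2) (simp add: abs_mult mult_right_mono)
 qed measurable
 have m: "(%x. S x * ?G x) \<in> borel_measurable borel" by measurable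
 have tr: "integrable lborel (%x. S x * ?G (perm_conf (inv p) x)) & (\<integral>x. S x * ?G (perm_conf (inv p) x) \<partial>lborel) = (\<integral>x. S x * ?G x \<partial>lborel)"
  if "p permutes UNIV" for p
 proof -
  have ip: "inv p permutes UNIV" using that by (rule permutes_inv)
  have e: "S x * ?G (perm_conf (inv p) x) = (%x. S x * ?G x) (perm_conf (inv p) x)" for x by (simp add: inv[OF ip])
  have "integrable (distr lborel borel (perm_conf (inv p))) (%x. S x * ?G x)" unfolding lborel_perm_conf[OF ip] by (rule iSG)
  then have 1: "integrable lborel (%x. (%x. S x * ?G x) (perm_conf (inv p) x))" by (subst (asm) integrable_distr_eq) (use m in auto)
  have "(\<integral>x. S x * ?G x \<partial>distr lborel borel (perm_conf (inv p))) = (\<integral>x. (%x. S x * ?G x) (perm_conf (inv p) x) \<partial>lborel)"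
   by (rule integral_distr) (use m in auto)
  then have 2: "(\<integral>x. S x * ?G x \<partial>lborel) = (\<integral>x. (%x. S x * ?G x) (perm_conf (inv p) x) \<partial>lborel)" unfolding lborel_perm_conf[OF ip] .
  show ?thesis unfolding e using 1 2 by simp
 qed
 have "(\<integral>x. S x * (cmod (slater f x))^2 \<partial>lborel) = (\<integral>x. (\<Sum>p\<in>perms. (1 / fact CARD('n)) * (S x * ?G (perm_conf (inv p) x))) \<partial>lborel)"
 proof (rule Bochner_Integration.integral_cong[OF refl])
  fix x
  have "(cmod (slater f x))^2 = (\<Sum>p\<in>perms. (\<Prod>i\<in>UNIV. (cmod (f (p i) (x $ i)))^2)) / fact CARD('n)"
   by (rule slater_norm_disjoint) (rule d)
  also have "... = (\<Sum>p\<in>perms. ?G (perm_conf (inv p) x)) / fact CARD('n)"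
   by (intro arg_cong2[of _ _ _ _ "(/)"] refl sum.cong) (simp add: slater_norm_perm)
  finally show "S x * (cmod (slater f x))^2 = (\<Sum>p\<in>perms. (1 / fact CARD('n)) * (S x * ?G (perm_conf (inv p) x)))"
   unfolding sum_distrib_left[symmetric] by simp
 qed
 also have "... = (\<Sum>p\<in>perms. \<integral>x. (1 / fact CARD('n)) * (S x * ?G (perm_conf (inv p) x)) \<partial>lborel)"
  by (rule Bochner_Integration.integral_sum) (use tr in auto)
 also have "... = (\<Sum>p\<in>(perms :: ('n => 'n) set). (1 / fact CARD('n)) * (\<integral>x. S x * ?G x \<partial>lborel))"
  by (rule sum.cong[OF refl]) (use tr in auto)
 also have "... = (\<integral>x. S x * ?G x \<partial>lborel)" by (simp add: card_perms)
 finally show ?thesis .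
qed

lemma marginal_sum:
 fixes W :: "('n::finite => 'c) => real"
 assumes finA: "finite A" and marg: "!!a. a \<in> A ==> (\<Sum>x\<in>PiE UNIV (%_. A). W x * (if x i = a then 1 else 0)) = w a"
 shows "(\<Sum>x\<in>PiE UNIV (%_. A). W x * h (x i)) = (\<Sum>a\<in>A. w a * h a)"
proof -
 have "(\<Sum>x\<in>PiE UNIV (%_. A). W x * h (x i)) = (\<Sum>x\<in>PiE UNIV (%_. A). \<Sum>a\<in>A. (W x * (if x i = a then 1 else 0)) * h a)"
 proof (rule sum.cong[OF refl])
  fix x assume "x \<in> PiE (UNIV :: 'n set) (%_. A)"
  then have xi: "x i \<in> A" by (rule PiE_mem) simp
  have "(\<Sum>a\<in>A. (W x * (if x i = a then 1 else 0)) * h a) = (\<Sum>a\<in>A. if a = x i then W x * h (x i) else 0)"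
   by (rule sum.cong[OF refl]) simp
  then show "W x * h (x i) = (\<Sum>a\<in>A. (W x * (if x i = a then 1 else 0)) * h a)" using finA xi by simp
 qed
 also have "... = (\<Sum>a\<in>A. \<Sum>x\<in>PiE UNIV (%_. A). (W x * (if x i = a then 1 else 0)) * h a)" by (rule sum.swap)
 also have "... = (\<Sum>a\<in>A. w a * h a)"
  by (rule sum.cong[OF refl]) (simp only: sum_distrib_right[symmetric] marg)
 finally show ?thesis .
qed

text \<open>The weight is symmetric, so \<open>integral_slater\<close> replaces the determinant by
  the plain product of orbitals; in each summand all factors but one integrate to 1.\<close>

lemma slater_density:
 fixes f :: "'n::finite => real^3 => complex" and ph :: "real^3 => real"
 assumes f: "!!i. L2 (f i)" and d: "!!i j y. i ~= j ==> f i y = 0 | f j y = 0"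
  and n: "!!i. (\<integral>y. (cmod (f i y))^2 \<partial>lborel) = 1"
  and [measurable]: "ph \<in> borel_measurable borel" and B: "!!y. \<bar>ph y\<bar> <= B"
 shows "(\<integral>x. (\<Sum>j\<in>UNIV. ph (x $ j)) * (cmod (slater f x))^2 \<partial>lborel) = (\<Sum>j\<in>UNIV. \<integral>y. ph y * (cmod (f j y))^2 \<partial>lborel)"
proof -
 note [measurable] = L2_measurable[OF f]
 let ?S = "%x :: real^3^'n. \<Sum>j\<in>UNIV. ph (x $ j)"
 have inv: "?S (perm_conf p x) = ?S x" if "p permutes UNIV" for p x
 proof -
  have "(\<Sum>j\<in>UNIV. ph (x $ p j)) = (\<Sum>j\<in>UNIV. ph (x $ j))"
   by (rule sum.reindex_bij_betw[OF permutes_imp_bij[OF that], of "%j. ph (x $ j)"])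
  then show ?thesis by (simp add: perm_conf_def)
 qed
 have bd: "\<bar>?S x\<bar> <= real CARD('n) * B" for x
 proof -
  have "\<bar>?S x\<bar> <= (\<Sum>j\<in>UNIV. \<bar>ph (x $ j)\<bar>)" by (rule sum_abs)
  also have "... <= of_nat (card (UNIV :: 'n set)) * B" by (rule sum_bounded_above) (rule B)
  finally show ?thesis by simp
 qed
 have ih: "integrable lborel (%y. (if l = j then ph y else 1) * (cmod (f l y))^2)" for j l
 proof (cases "l = j")
  case True
  have "integrable lborel (%y. ph y * (cmod (f l y))^2)"
  proof (rule Bochner_Integration.integrable_bound)
   show "integrable lborel (%y. B * (cmod (f l y))^2)" using L2_square_integrable[OF f] by simp
   have B0: "0 <= B" using B[of 0] by linarith
   show "AE y in lborel. norm (ph y * (cmod (f l y))^2) <= norm (B * (cmod (f l y))^2)"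
    using B B0 by (intro AE_I2) (simp add: abs_mult mult_right_mono)
  qed measurable
  then show ?thesis using True by simp
 next
  case False
  then show ?thesis using L2_square_integrable[OF f] by simp
 qed
 have fac: "ph (x $ j) * (\<Prod>i\<in>UNIV. (cmod (f i (x $ i)))^2) = (\<Prod>l\<in>UNIV. (if l = j then ph (x $ l) else 1) * (cmod (f l (x $ l)))^2)" for x j
  by (simp add: prod.distrib)
 have one: "integrable lborel (%x. ph (x $ j) * (\<Prod>i\<in>UNIV. (cmod (f i (x $ i)))^2))"
  "(\<integral>x. ph (x $ j) * (\<Prod>i\<in>UNIV. (cmod (f i (x $ i)))^2) \<partial>lborel) = (\<integral>y. ph y * (cmod (f j y))^2 \<partial>lborel)" for j
 proof -
  show "integrable lborel (%x. ph (x $ j) * (\<Prod>i\<in>UNIV. (cmod (f i (x $ i)))^2))"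
   unfolding fac by (rule integral_vec_prod(1)[of "%l y. (if l = j then ph y else 1) * (cmod (f l y))^2", OF ih])
  have "(\<integral>x. ph (x $ j) * (\<Prod>i\<in>UNIV. (cmod (f i (x $ i)))^2) \<partial>lborel) = (\<Prod>l\<in>UNIV. \<integral>y. (if l = j then ph y else 1) * (cmod (f l y))^2 \<partial>lborel)"
   unfolding fac by (rule integral_vec_prod(2)[of "%l y. (if l = j then ph y else 1) * (cmod (f l y))^2", OF ih])
  also have "... = (\<Prod>l\<in>UNIV. if l = j then \<integral>y. ph y * (cmod (f j y))^2 \<partial>lborel else 1)"
   by (rule prod.cong[OF refl]) (simp add: n)
  finally show "(\<integral>x. ph (x $ j) * (\<Prod>i\<in>UNIV. (cmod (f i (x $ i)))^2) \<partial>lborel) = (\<integral>y. ph y * (cmod (f j y))^2 \<partial>lborel)"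
   by simp
 qed
 have "(\<integral>x. ?S x * (cmod (slater f x))^2 \<partial>lborel) = (\<integral>x. ?S x * (\<Prod>i\<in>UNIV. (cmod (f i (x $ i)))^2) \<partial>lborel)"
 proof (rule integral_slater)
  show "L2 (f i)" for i by (rule f)
  show "f i y = 0 | f j y = 0" if "i ~= j" for i j y by (rule d[OF that])
  show "?S \<in> borel_measurable borel" by measurable
  show "?S (perm_conf p x) = ?S x" if "p permutes UNIV" for p x by (rule inv[OF that])
  show "\<bar>?S x\<bar> <= real CARD('n) * B" for x by (rule bd)
 qed
 also have "... = (\<integral>x. (\<Sum>j\<in>UNIV. ph (x $ j) * (\<Prod>i\<in>UNIV. (cmod (f i (x $ i)))^2)) \<partial>lborel)"
  by (simp only: sum_distrib_right)
 also have "... = (\<Sum>j\<in>UNIV. \<integral>x. ph (x $ j) * (\<Prod>i\<in>UNIV. (cmod (f i (x $ i)))^2) \<partial>lborel)"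
  by (rule Bochner_Integration.integral_sum) (rule one(1))
 finally show ?thesis unfolding one(2) .
qed

text \<open>Disjoint supports remove the exchange term, so the Coulomb energy is the classical
  interaction of the orbital densities, summed over pairs.\<close>

lemma slater_coulomb_le:
 fixes f :: "'n::finite => real^3 => complex"
 assumes f: "!!i. L2 (f i)" and d: "!!i j y. i ~= j ==> f i y = 0 | f j y = 0"
  and n: "!!i. (\<integral>\<^sup>+y. ennreal ((cmod (f i y))^2) \<partial>lborel) = 1"
  and q0: "!!i j. 0 <= q i j"
  and q: "!!i j. i ~= j ==> (\<integral>\<^sup>+z. (\<integral>\<^sup>+y. inverse (ennreal (dist y z)) * ennreal ((cmod (f i y))^2) \<partial>lborel) * ennreal ((cmod (f j z))^2) \<partial>lborel) <= ennreal (q i j)"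
 shows "(\<integral>\<^sup>+x. coulomb x * ennreal ((cmod (slater f x))^2) \<partial>lborel) <= ennreal ((\<Sum>i\<in>UNIV. \<Sum>j\<in>UNIV. if i ~= j then q i j else 0) / 2)"
proof -
 note [measurable] = L2_measurable[OF f]
 let ?P = "%x. \<Prod>i\<in>UNIV. ennreal ((cmod (f i (x $ i)))^2)"
 let ?I = "%i j x. inverse (ennreal (dist (x $ i) (x $ j)))"
 let ?N = "{(i :: 'n, j). i ~= j}"
 have "(\<integral>\<^sup>+x. coulomb x * ennreal ((cmod (slater f x))^2) \<partial>lborel) = (\<integral>\<^sup>+x. coulomb x * ennreal (\<Prod>i\<in>UNIV. (cmod (f i (x $ i)))^2) \<partial>lborel)"
 proof (rule nn_integral_slater)
  show "L2 (f i)" for i by (rule f)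
  show "f i y = 0 | f j y = 0" if "i ~= j" for i j y by (rule d[OF that])
  show "coulomb (perm_conf p x) = coulomb x" if "p permutes UNIV" for p and x :: "real^3^'n" by (rule coulomb_perm[OF that])
 qed measurable
 also have "... = (\<integral>\<^sup>+x. inverse 2 * (\<Sum>p\<in>?N. ?I (fst p) (snd p) x * ?P x) \<partial>lborel)"
 proof (rule nn_integral_cong)
  fix x :: "real^3^'n"
  have "ennreal (\<Prod>i\<in>UNIV. (cmod (f i (x $ i)))^2) = ?P x" by (rule prod_ennreal[symmetric]) simp
  then show "coulomb x * ennreal (\<Prod>i\<in>UNIV. (cmod (f i (x $ i)))^2) = inverse 2 * (\<Sum>p\<in>?N. ?I (fst p) (snd p) x * ?P x)"
   by (simp only: coulomb_def split_def divide_ennreal_def sum_distrib_right[symmetric] mult_ac)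
 qed
 also have "... = inverse 2 * (\<Sum>p\<in>?N. \<integral>\<^sup>+x. ?I (fst p) (snd p) x * ?P x \<partial>lborel)"
  by (subst nn_integral_cmult, measurable, subst nn_integral_sum) simp_all
 also have "... <= inverse 2 * (\<Sum>p\<in>?N. ennreal (q (fst p) (snd p)))"
 proof (intro mult_left_mono sum_mono)
  fix p assume "p \<in> ?N"
  then have ij: "fst p ~= snd p" by (auto simp: case_prod_beta)
  have "(\<integral>\<^sup>+x. ?I (fst p) (snd p) x * ?P x \<partial>lborel) = (\<integral>\<^sup>+z. (\<integral>\<^sup>+y. inverse (ennreal (dist y z)) * ennreal ((cmod (f (fst p) y))^2) \<partial>lborel) * ennreal ((cmod (f (snd p) z))^2) \<partial>lborel)"
   by (rule nn_integral_vec_pair[of "%i y. ennreal ((cmod (f i y))^2)" "%y z. inverse (ennreal (dist y z))", OF _ _ n ij]) measurable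
  also have "... <= ennreal (q (fst p) (snd p))" by (rule q[OF ij])
  finally show "(\<integral>\<^sup>+x. ?I (fst p) (snd p) x * ?P x \<partial>lborel) <= ennreal (q (fst p) (snd p))" .
 qed simp
 also have "(\<Sum>p\<in>?N. ennreal (q (fst p) (snd p))) = ennreal (\<Sum>p\<in>?N. q (fst p) (snd p))" by (rule sum_ennreal) (rule q0)
 also have "(\<Sum>p\<in>?N. q (fst p) (snd p)) = (\<Sum>p\<in>UNIV \<times> UNIV. if fst p ~= snd p then q (fst p) (snd p) else 0)"
  by (rule sum.mono_neutral_cong_left) (auto simp: case_prod_beta)
 also have "... = (\<Sum>i\<in>UNIV. \<Sum>j\<in>UNIV. if i ~= j then q i j else 0)"
  by (subst sum.cartesian_product) (simp add: case_prod_beta)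
 finally show ?thesis
  by (simp add: ennreal_divide_numeral[symmetric] divide_ennreal_def mult.commute sum_nonneg q0)
qed

text \<open>Each configuration of cells gives the Slater determinant of the normalized cell
  functions. As each marginal is \<open>m a / N\<close>, summation over the \<open>N\<close>
  particles restores every cell with its full mass. The density is therefore the sum of the squared
  cell functions, and the kinetic energy is bounded by theirs up to the factor
  \<open>N!\<close>.\<close>

lemma levy_lieb_le_cell_mixture:
 fixes f :: "'c => real^3 => complex" and g :: "'c => real^3 => real^3 => complex" and W :: "('n::finite => 'c) => real"
  and q :: "'c => 'c => real"
 defines "\<Omega> \<equiv> %A. PiE (UNIV :: 'n set) (%_. A)" and "m \<equiv> %a. \<integral>y. (cmod (f a y))^2 \<partial>lborel"
 assumes N2: "2 <= CARD('n)" and finA: "finite A" and \<eta>: "0 < \<eta>" and dl: "0 < dl" and rm: "\<rho> \<in> borel_measurable borel"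
  and f: "!!a. L2 (f a)" and re: "!!a y. cnj (f a y) = f a y"
  and g: "!!a u. u \<in> Basis ==> L2 (g a u)" and w: "!!a u. u \<in> Basis ==> weak_partial (f a) u (g a u)"
  and dec: "!!y. (\<Sum>a\<in>A. (cmod (f a y))^2) = \<rho> y"
  and W0: "!!x. x \<in> \<Omega> A ==> 0 <= W x" and W1: "(\<Sum>x\<in>\<Omega> A. W x) = 1"
  and marg: "!!i a. a \<in> A ==> (\<Sum>x\<in>\<Omega> A. W x * (if x i = a then 1 else 0)) = m a / real CARD('n)"
  and sep: "!!x i j y z. x \<in> \<Omega> A ==> W x ~= 0 ==> i ~= j ==> f (x i) y ~= 0 ==> f (x j) z ~= 0 ==> dl <= dist y z"
  and q0: "!!a b. 0 <= q a b"
  and q: "!!x i j. x \<in> \<Omega> A ==> W x ~= 0 ==> i ~= j ==>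
   (\<integral>\<^sup>+z. (\<integral>\<^sup>+y. inverse (ennreal (dist y z)) * ennreal ((cmod (f (x i) y))^2 / m (x i)) \<partial>lborel) * ennreal ((cmod (f (x j) z))^2 / m (x j)) \<partial>lborel) <= ennreal (q (x i) (x j))"
 shows "levy_lieb TYPE('n) (%x. \<eta> ^ 3 * \<rho> (\<eta> *\<^sub>R x)) <=
  ennreal (\<eta>^2 * (fact CARD('n) * (\<Sum>a\<in>A. \<Sum>u\<in>Basis. \<integral>y. (cmod (g a u y))^2 \<partial>lborel)) + \<eta> * (\<Sum>x\<in>\<Omega> A. W x * pair_energy q x))"
proof -
 let ?N = "real CARD('n)"
 have Npos: "0 < ?N" using N2 by simp
 define K where "K = {x \<in> \<Omega> A. W x ~= 0}"
 have fin\<Omega>: "finite (\<Omega> A)" unfolding \<Omega>_def using finA by (intro finite_PiE) auto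
 have finK: "finite K" using fin\<Omega> by (simp add: K_def)
 have sumK: "(\<Sum>x\<in>K. W x * F x) = (\<Sum>x\<in>\<Omega> A. W x * F x)" for F :: "_ => real"
  by (rule sum.mono_neutral_left[OF fin\<Omega>]) (auto simp: K_def)
 have memA: "x i \<in> A" if "x \<in> \<Omega> A" for x i using that unfolding \<Omega>_def by (rule PiE_mem) simp
 have m0: "0 <= m a" for a unfolding m_def by simp
 \<comment> \<open>A cell occurring with positive weight has positive mass by the marginal
   condition, so its orbital can be normalized.\<close>
 have mpos: "0 < m (x i)" if "x \<in> K" for x i
 proof -
  have x: "x \<in> \<Omega> A" "W x ~= 0" using that by (auto simp: K_def)
  have "W x * (if x i = x i then 1 else 0) <= (\<Sum>x'\<in>\<Omega> A. W x' * (if x' i = x i then 1 else 0))"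
   by (rule member_le_sum[OF x(1) _ fin\<Omega>]) (use W0 in auto)
  also have "... = m (x i) / ?N" by (rule marg[OF memA[OF x(1)]])
  finally have "0 < m (x i) / ?N" using W0[OF x(1)] x(2) by simp
  then show ?thesis using Npos by (simp add: zero_less_divide_iff)
 qed
 define h where "h x i y = complex_of_real (1 / sqrt (m (x i))) * f (x i) y" for x :: "'n => 'c" and i y
 define hg where "hg x i u y = complex_of_real (1 / sqrt (m (x i))) * g (x i) u y" for x :: "'n => 'c" and i u y
 have hL: "L2 (h x i)" for x i unfolding h_def[abs_def] by (rule L2_cmult[OF f])
 have hgL: "L2 (hg x i u)" if "u \<in> Basis" for x i u unfolding hg_def[abs_def] by (rule L2_cmult[OF g[OF that]])
 have hw: "weak_partial (h x i) u (hg x i u)" if "u \<in> Basis" for x i u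
  unfolding h_def[abs_def] hg_def[abs_def] by (rule weak_partial_cmult[OF w[OF that]])
 have h2: "(cmod (h x i y))^2 = (cmod (f (x i) y))^2 / m (x i)" for x i y
  using m0[of "x i"] by (simp add: h_def norm_mult norm_divide power_mult_distrib power_divide)
 have hg2: "(cmod (hg x i u y))^2 = (cmod (g (x i) u y))^2 / m (x i)" for x i u y
  using m0[of "x i"] by (simp add: hg_def norm_mult norm_divide power_mult_distrib power_divide)
 have n1: "(\<integral>y. (cmod (h x i y))^2 \<partial>lborel) = 1" if "x \<in> K" for x i
  using mpos[OF that, of i] unfolding h2 by (simp add: m_def)
 have nn1: "(\<integral>\<^sup>+y. ennreal ((cmod (h x i y))^2) \<partial>lborel) = 1" if "x \<in> K" for x i
  using nn_integral_eq_integral[OF L2_square_integrable[OF hL[of x i]]] n1[OF that, of i] by simp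
 have disj: "h x i y = 0 | h x j y = 0" if "x \<in> K" "i ~= j" for x i j y
 proof (rule ccontr)
  assume "~ (h x i y = 0 | h x j y = 0)"
  then have ne: "f (x i) y ~= 0" "f (x j) y ~= 0" by (auto simp: h_def)
  have "x \<in> \<Omega> A" "W x ~= 0" using that(1) by (auto simp: K_def)
  then have "dl <= dist y y" by (rule sep[OF _ _ that(2) ne])
  then show False using dl by simp
 qed
 \<comment> \<open>Decodes a basis vector of configuration space into a particle and a direction in
   space.\<close>
 define idx where "idx b = (SOME p. snd p \<in> Basis & b = axis (fst p) (snd p))" for b :: "real^3^'n"
 have idx: "idx (axis i u) = (i, u)" if u: "u \<in> Basis" for i u
 proof -
  have "snd (idx (axis i u)) \<in> Basis & axis i u = axis (fst (idx (axis i u))) (snd (idx (axis i u)))"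
   unfolding idx_def by (rule someI[of _ "(i, u)"]) (simp add: u)
  then have "fst (idx (axis i u)) = i & snd (idx (axis i u)) = u"
   using nonzero_Basis[OF u] by (auto simp: axis_eq_axis)
  then show ?thesis by (simp add: prod_eq_iff)
 qed
 define F where "F x y = complex_of_real (sqrt (W x)) * slater (h x) y" for x y
 define G where "G x b y = complex_of_real (sqrt (W x)) * slater_partial (h x) (%i. hg x i (snd (idx b))) (fst (idx b)) y" for x b y
 have F2: "(cmod (F x y))^2 = W x * (cmod (slater (h x) y))^2" if "x \<in> K" for x y
  using W0 that by (simp add: F_def K_def norm_mult power_mult_distrib)
 have G2: "(cmod (G x b y))^2 = W x * (cmod (slater_partial (h x) (%i. hg x i (snd (idx b))) (fst (idx b)) y))^2" if "x \<in> K" for x b y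
  using W0 that by (simp add: G_def K_def norm_mult power_mult_distrib)
 have Bas: "EX i u. u \<in> Basis & b = axis i u" if "b \<in> Basis" for b :: "real^3^'n" using that unfolding axis_image_Basis by auto
 have GL: "L2 (G x b) & weak_partial (F x) b (G x b)" if bB: "b \<in> Basis" for x b
 proof -
  obtain i u where u: "u \<in> Basis" and b: "b = axis i u" using Bas[OF bB] by blast
  have "L2 (slater_partial (h x) (%i. hg x i u) i)" by (rule weak_partial_slater(1)[OF hL hgL[OF u] u hw[OF u]])
  moreover have "weak_partial (slater (h x)) b (slater_partial (h x) (%i. hg x i u) i)"
   unfolding b by (rule weak_partial_slater(2)[OF hL hgL[OF u] u hw[OF u]])
  ultimately show ?thesis unfolding G_def[abs_def] F_def[abs_def] b idx[OF u] fst_conv snd_conv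
   by (intro conjI L2_cmult weak_partial_cmult)
 qed
 have "levy_lieb TYPE('n) (%x. \<eta> ^ 3 * \<rho> (\<eta> *\<^sub>R x)) <= (\<Sum>k\<in>K. ennreal (\<eta>^2) * (\<Sum>b\<in>Basis. \<integral>\<^sup>+x. ennreal ((cmod (G k b x))^2) \<partial>lborel)
   + ennreal \<eta> * (\<integral>\<^sup>+x. coulomb x * ennreal ((cmod (F k x))^2) \<partial>lborel))"
 proof (rule levy_lieb_le_scaled_mixture[OF finK _ \<eta> rm, where dl="dl / 2"])
  show "0 < dl / 2" using dl by simp
  show "L2 (F k)" for k unfolding F_def[abs_def] by (rule L2_cmult[OF L2_slater[OF hL]])
  show "antisym_fun (F k)" for k unfolding F_def[abs_def] by (rule antisym_cmult[OF antisym_slater])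
  have hre: "cnj (h k i y) = h k i y" for k i y by (simp add: h_def re)
  show "cnj (F k x) = F k x" for k x
   unfolding F_def slater_def det_def by (simp add: cnj_sum cnj_prod hre)
  show "L2 (G k b)" if "b \<in> Basis" for k b using GL[OF that] by blast
  show "weak_partial (F k) b (G k b)" if "b \<in> Basis" for k b using GL[OF that] by blast
  \<comment> \<open>Two particles within \<open>dl / 2\<close> of the origin would be closer than
    \<open>dl\<close>, against the separation of their cells. This is where two particles are
    needed, and why the radius is halved.\<close>
  show "F k x = 0" if k: "k \<in> K" and near: "!!i. norm (x $ i) < dl / 2" for k x
  proof (rule ccontr)
   assume "F k x ~= 0"
   then have "slater (h k) x ~= 0" by (auto simp: F_def)
   then obtain p where p: "p permutes UNIV" "!!i. h k (p i) (x $ i) ~= 0" using slater_nonzeroD by blast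
   have "~ (\<forall>i j :: 'n. i = j)"
   proof
    assume "\<forall>i j :: 'n. i = j"
    then have "(UNIV :: 'n set) \<subseteq> {undefined}" by auto
    from card_mono[OF _ this] N2 show False by simp
   qed
   then obtain i j :: 'n where "i ~= j" by blast
   then have "p i ~= p j" using permutes_inj[OF p(1)] by (auto dest: injD)
   moreover have "f (k (p i)) (x $ i) ~= 0" "f (k (p j)) (x $ j) ~= 0" using p(2)[of i] p(2)[of j] by (auto simp: h_def)
   ultimately have "dl <= dist (x $ i) (x $ j)" using k unfolding K_def by (intro sep[of k "p i" "p j"]) auto
   also have "... <= norm (x $ i) + norm (x $ j)" unfolding dist_norm by (rule norm_triangle_ineq4)
   finally show False using near[of i] near[of j] by linarith
  qed
  have den: "(\<integral>x. (\<Sum>j\<in>UNIV. ph (x $ j)) * (cmod (F k x))^2 \<partial>lborel) = W k * (\<Sum>j\<in>UNIV. (\<integral>y. ph y * (cmod (f (k j) y))^2 \<partial>lborel) / m (k j))"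
   if k: "k \<in> K" and pm: "ph \<in> borel_measurable borel" and B: "!!y. \<bar>ph y\<bar> <= B" for k and ph :: "real^3 => real" and B
  proof -
   have "(\<integral>x. (\<Sum>j\<in>UNIV. ph (x $ j)) * (cmod (F k x))^2 \<partial>lborel) = W k * (\<integral>x. (\<Sum>j\<in>UNIV. ph (x $ j)) * (cmod (slater (h k) x))^2 \<partial>lborel)"
    unfolding F2[OF k] mult.left_commute[of _ "W k"] by simp
   also have "(\<integral>x. (\<Sum>j\<in>UNIV. ph (x $ j)) * (cmod (slater (h k) x))^2 \<partial>lborel) = (\<Sum>j\<in>UNIV. \<integral>y. ph y * (cmod (h k j y))^2 \<partial>lborel)"
    by (rule slater_density[OF hL disj[OF k] n1[OF k] pm B])
   finally show ?thesis unfolding h2 times_divide_eq_right by simp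
  qed
  \<comment> \<open>Division by a mass 0 gives 0; the identity survives because such a cell function
    vanishes almost everywhere.\<close>
  have mz: "m a * ((\<integral>y. ph y * (cmod (f a y))^2 \<partial>lborel) / m a) = (\<integral>y. ph y * (cmod (f a y))^2 \<partial>lborel)" for a and ph :: "real^3 => real"
  proof (cases "m a = 0")
   case True
   have "AE y in lborel. (cmod (f a y))^2 = 0"
    using True integral_nonneg_eq_0_iff_AE[OF L2_square_integrable[OF f[of a]]] by (simp add: m_def)
   then have "AE y in lborel. ph y * (cmod (f a y))^2 = 0" by eventually_elim simp
   then have "(\<integral>y. ph y * (cmod (f a y))^2 \<partial>lborel) = 0" by (rule integral_eq_zero_AE)
   then show ?thesis by simp
  qed simp
  show "(\<Sum>k\<in>K. \<integral>x. (\<Sum>j\<in>UNIV. ph (x $ j)) * (cmod (F k x))^2 \<partial>lborel) = (\<integral>y. ph y * \<rho> y \<partial>lborel)"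
   if pm[measurable]: "ph \<in> borel_measurable borel" and pb: "bounded (range ph)" for ph
  proof -
   obtain B where B: "!!y. \<bar>ph y\<bar> <= B" using pb unfolding bounded_iff by auto
   have B0: "0 <= B" using B[of 0] by linarith
   define H where "H a = (\<integral>y. ph y * (cmod (f a y))^2 \<partial>lborel) / m a" for a
   have "(\<Sum>k\<in>K. \<integral>x. (\<Sum>j\<in>UNIV. ph (x $ j)) * (cmod (F k x))^2 \<partial>lborel) = (\<Sum>k\<in>K. W k * (\<Sum>j\<in>UNIV. H (k j)))"
    by (rule sum.cong[OF refl]) (simp only: den[OF _ pm B] H_def)
   also have "... = (\<Sum>k\<in>\<Omega> A. \<Sum>j\<in>UNIV. W k * H (k j))" by (subst sumK) (simp only: sum_distrib_left)
   also have "... = (\<Sum>j\<in>UNIV. \<Sum>k\<in>\<Omega> A. W k * H (k j))" by (rule sum.swap)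
   also have "... = (\<Sum>j\<in>(UNIV :: 'n set). \<Sum>a\<in>A. m a / ?N * H a)"
    by (rule sum.cong[OF refl]) (unfold \<Omega>_def, rule marginal_sum[OF finA], rule marg[unfolded \<Omega>_def])
   also have "... = (\<Sum>a\<in>A. m a * H a)" using Npos by (simp add: sum_distrib_left[symmetric] sum_divide_distrib[symmetric])
   also have "... = (\<Sum>a\<in>A. \<integral>y. ph y * (cmod (f a y))^2 \<partial>lborel)" unfolding H_def by (rule sum.cong[OF refl mz])
   also have "... = (\<integral>y. (\<Sum>a\<in>A. ph y * (cmod (f a y))^2) \<partial>lborel)"
   proof (rule Bochner_Integration.integral_sum[symmetric])
    fix a
    note [measurable] = L2_measurable[OF f[of a]]
    show "integrable lborel (%y. ph y * (cmod (f a y))^2)"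
    proof (rule Bochner_Integration.integrable_bound)
     show "integrable lborel (%y. B * (cmod (f a y))^2)" using L2_square_integrable[OF f] by simp
     show "AE y in lborel. norm (ph y * (cmod (f a y))^2) <= norm (B * (cmod (f a y))^2)"
      using B B0 by (intro AE_I2) (simp add: abs_mult mult_right_mono)
    qed measurable
   qed
   also have "... = (\<integral>y. ph y * \<rho> y \<partial>lborel)" by (simp only: sum_distrib_left[symmetric] dec)
   finally show ?thesis .
  qed
  have "(\<integral>x. (cmod (F k x))^2 \<partial>lborel) = W k" if k: "k \<in> K" for k
  proof -
   have "(\<integral>x. (\<Sum>j\<in>(UNIV :: 'n set). 1 / ?N) * (cmod (F k x))^2 \<partial>lborel) = W k * (\<Sum>j\<in>UNIV. (\<integral>y. 1 / ?N * (cmod (f (k j) y))^2 \<partial>lborel) / m (k j))"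
    by (rule den[OF k, of "%_. 1 / ?N" "1 / ?N"]) auto
   also have "... = W k * (\<Sum>j\<in>(UNIV :: 'n set). 1 / ?N)"
   proof -
    have "(\<integral>y. 1 / ?N * (cmod (f (k j) y))^2 \<partial>lborel) / m (k j) = 1 / ?N" for j
    proof -
     have "(\<integral>y. 1 / ?N * (cmod (f (k j) y))^2 \<partial>lborel) = 1 / ?N * m (k j)"
      unfolding m_def by (rule integral_mult_right_zero)
     then show ?thesis using mpos[OF k, of j] by simp
    qed
    then show ?thesis by (simp only:)
   qed
   finally show ?thesis using Npos by simp
  qed
  then show "(\<Sum>k\<in>K. \<integral>x. (cmod (F k x))^2 \<partial>lborel) = 1" using sumK[of "%_. 1"] W1 by simp
 qed
 also have "... <= (\<Sum>k\<in>K. ennreal (\<eta>^2 * (fact CARD('n) * (W k * (\<Sum>i\<in>UNIV. (\<Sum>u\<in>Basis. \<integral>y. (cmod (g (k i) u y))^2 \<partial>lborel) / m (k i)))) + \<eta> * (W k * pair_energy q k)))"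
 proof (rule sum_mono)
  fix k assume k: "k \<in> K"
  then have Wk: "0 <= W k" and k\<Omega>: "k \<in> \<Omega> A" "W k ~= 0" using W0 by (auto simp: K_def)
  define T where "T = (\<Sum>i\<in>UNIV. (\<Sum>u\<in>Basis. \<integral>y. (cmod (g (k i) u y))^2 \<partial>lborel) / m (k i))"
  have T0: "0 <= T" unfolding T_def by (intro sum_nonneg divide_nonneg_nonneg m0) auto
  have "(\<Sum>b\<in>Basis. \<integral>\<^sup>+x. ennreal ((cmod (G k b x))^2) \<partial>lborel) = (\<Sum>i\<in>UNIV. \<Sum>u\<in>Basis. \<integral>\<^sup>+x. ennreal ((cmod (G k (axis i u) x))^2) \<partial>lborel)"
   by (rule sum_Basis_vec)
  also have "... = (\<Sum>i\<in>UNIV. \<Sum>u\<in>Basis. ennreal (W k) * (\<integral>\<^sup>+x. ennreal ((cmod (slater_partial (h k) (%i. hg k i u) i x))^2) \<partial>lborel))"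
  proof (intro sum.cong refl)
   fix i :: 'n and u :: "real^3" assume u: "u \<in> Basis"
   have [measurable]: "slater_partial (h k) (%i. hg k i u) i \<in> borel_measurable borel"
    by (rule L2_measurable[OF weak_partial_slater(1)[OF hL hgL[OF u] u hw[OF u]]])
   show "(\<integral>\<^sup>+x. ennreal ((cmod (G k (axis i u) x))^2) \<partial>lborel) = ennreal (W k) * (\<integral>\<^sup>+x. ennreal ((cmod (slater_partial (h k) (%i. hg k i u) i x))^2) \<partial>lborel)"
    unfolding G2[OF k] idx[OF u] fst_conv snd_conv ennreal_mult[OF Wk zero_le_power2] by (rule nn_integral_cmult) measurable
  qed
  also have "... = ennreal (W k) * (\<Sum>i\<in>UNIV. \<Sum>u\<in>Basis. \<integral>\<^sup>+x. ennreal ((cmod (slater_partial (h k) (%i. hg k i u) i x))^2) \<partial>lborel)"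
   by (simp only: sum_distrib_left)
  also have "... <= ennreal (W k) * (fact CARD('n) * (\<Sum>i\<in>UNIV. \<Sum>u\<in>Basis. \<integral>\<^sup>+y. ennreal ((cmod (hg k i u y))^2) \<partial>lborel))"
   by (intro mult_left_mono slater_kinetic[OF hL hgL nn1[OF k]]) simp_all
  also have "(\<Sum>i\<in>UNIV. \<Sum>u\<in>Basis. \<integral>\<^sup>+y. ennreal ((cmod (hg k i u y))^2) \<partial>lborel) = ennreal T"
  proof -
   have e: "(\<integral>\<^sup>+y. ennreal ((cmod (hg k i u y))^2) \<partial>lborel) = ennreal ((\<integral>y. (cmod (g (k i) u y))^2 \<partial>lborel) / m (k i))" if "u \<in> Basis" for i u
    using nn_integral_eq_integral[OF L2_square_integrable[OF hgL[OF that, of k i]] AE_I2[OF zero_le_power2]] unfolding hg2 by simp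
   have "(\<Sum>i\<in>UNIV. \<Sum>u\<in>Basis. \<integral>\<^sup>+y. ennreal ((cmod (hg k i u y))^2) \<partial>lborel) = (\<Sum>i\<in>UNIV. \<Sum>u\<in>Basis. ennreal ((\<integral>y. (cmod (g (k i) u y))^2 \<partial>lborel) / m (k i)))"
    by (intro sum.cong refl e)
   also have "... = ennreal T"
    unfolding T_def sum_divide_distrib by (simp add: sum_ennreal sum_nonneg m0)
   finally show ?thesis .
  qed
  also have "ennreal (W k) * (fact CARD('n) * ennreal T) = ennreal (fact CARD('n) * (W k * T))"
  proof -
   have "(fact CARD('n) :: ennreal) = ennreal (fact CARD('n))" by (metis ennreal_of_nat_eq_real_of_nat of_nat_fact)
   then show ?thesis using Wk T0 by (simp add: ennreal_mult[symmetric] mult.left_commute)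
  qed
  finally have 1: "(\<Sum>b\<in>Basis. \<integral>\<^sup>+x. ennreal ((cmod (G k b x))^2) \<partial>lborel) <= ennreal (fact CARD('n) * (W k * T))" .
  have [measurable]: "slater (h k) \<in> borel_measurable borel" by (rule L2_measurable[OF L2_slater[OF hL]])
  have "(\<integral>\<^sup>+x. coulomb x * ennreal ((cmod (F k x))^2) \<partial>lborel) = (\<integral>\<^sup>+x. ennreal (W k) * (coulomb x * ennreal ((cmod (slater (h k) x))^2)) \<partial>lborel)"
   unfolding F2[OF k] ennreal_mult[OF Wk zero_le_power2] by (simp only: mult.left_commute)
  also have "... = ennreal (W k) * (\<integral>\<^sup>+x. coulomb x * ennreal ((cmod (slater (h k) x))^2) \<partial>lborel)" by (rule nn_integral_cmult) measurable
  also have "... <= ennreal (W k) * ennreal (pair_energy q k)"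
  proof (rule mult_left_mono)
   show "(\<integral>\<^sup>+x. coulomb x * ennreal ((cmod (slater (h k) x))^2) \<partial>lborel) <= ennreal (pair_energy q k)"
    unfolding pair_energy_def
   proof (rule slater_coulomb_le[OF hL disj[OF k] nn1[OF k]])
    show "0 <= q (k i) (k j)" for i j by (rule q0)
    show "(\<integral>\<^sup>+z. (\<integral>\<^sup>+y. inverse (ennreal (dist y z)) * ennreal ((cmod (h k i y))^2) \<partial>lborel) * ennreal ((cmod (h k j z))^2) \<partial>lborel) <= ennreal (q (k i) (k j))" if "i ~= j" for i j
     unfolding h2 by (rule q[OF k\<Omega> that])
   qed
  qed simp
  also have "... = ennreal (W k * pair_energy q k)" using Wk pair_energy_nonneg[of q k] q0 by (simp add: ennreal_mult)
  finally have 2: "(\<integral>\<^sup>+x. coulomb x * ennreal ((cmod (F k x))^2) \<partial>lborel) <= ennreal (W k * pair_energy q k)" .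
  have "ennreal (\<eta>^2) * (\<Sum>b\<in>Basis. \<integral>\<^sup>+x. ennreal ((cmod (G k b x))^2) \<partial>lborel) + ennreal \<eta> * (\<integral>\<^sup>+x. coulomb x * ennreal ((cmod (F k x))^2) \<partial>lborel)
   <= ennreal (\<eta>^2) * ennreal (fact CARD('n) * (W k * T)) + ennreal \<eta> * ennreal (W k * pair_energy q k)"
   by (intro add_mono mult_left_mono 1 2) simp_all
  also have "... = ennreal (\<eta>^2 * (fact CARD('n) * (W k * T)) + \<eta> * (W k * pair_energy q k))"
   using \<eta> Wk T0 pair_energy_nonneg[of q k] q0 by (simp add: ennreal_mult[symmetric] ennreal_plus)
  finally show "ennreal (\<eta>^2) * (\<Sum>b\<in>Basis. \<integral>\<^sup>+x. ennreal ((cmod (G k b x))^2) \<partial>lborel) + ennreal \<eta> * (\<integral>\<^sup>+x. coulomb x * ennreal ((cmod (F k x))^2) \<partial>lborel)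
   <= ennreal (\<eta>^2 * (fact CARD('n) * (W k * (\<Sum>i\<in>UNIV. (\<Sum>u\<in>Basis. \<integral>y. (cmod (g (k i) u y))^2 \<partial>lborel) / m (k i)))) + \<eta> * (W k * pair_energy q k))"
   unfolding T_def .
 qed
 also have "... <= ennreal (\<eta>^2 * (fact CARD('n) * (\<Sum>a\<in>A. \<Sum>u\<in>Basis. \<integral>y. (cmod (g a u y))^2 \<partial>lborel)) + \<eta> * (\<Sum>x\<in>\<Omega> A. W x * pair_energy q x))"
 proof -
  define S where "S a = (\<Sum>u\<in>Basis. \<integral>y. (cmod (g a u y))^2 \<partial>lborel)" for a
  have S0: "0 <= S a" for a unfolding S_def by (intro sum_nonneg) simp
  have pe0: "0 <= pair_energy q x" for x :: "'n => 'c" using pair_energy_nonneg[of q x] q0 by blast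
  have "(\<Sum>k\<in>K. ennreal (\<eta>^2 * (fact CARD('n) * (W k * (\<Sum>i\<in>UNIV. S (k i) / m (k i)))) + \<eta> * (W k * pair_energy q k)))
   = ennreal (\<Sum>k\<in>K. \<eta>^2 * (fact CARD('n) * (W k * (\<Sum>i\<in>UNIV. S (k i) / m (k i)))) + \<eta> * (W k * pair_energy q k))"
  proof (rule sum_ennreal)
   fix k assume "k \<in> K"
   then have "0 <= W k" using W0 by (auto simp: K_def)
   then show "0 <= \<eta>^2 * (fact CARD('n) * (W k * (\<Sum>i\<in>UNIV. S (k i) / m (k i)))) + \<eta> * (W k * pair_energy q k)"
    using \<eta> pe0 by (intro add_nonneg_nonneg mult_nonneg_nonneg sum_nonneg divide_nonneg_nonneg S0 m0) simp_all
  qed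
  also have "(\<Sum>k\<in>K. \<eta>^2 * (fact CARD('n) * (W k * (\<Sum>i\<in>UNIV. S (k i) / m (k i)))) + \<eta> * (W k * pair_energy q k))
   = \<eta>^2 * (fact CARD('n) * (\<Sum>k\<in>\<Omega> A. W k * (\<Sum>i\<in>UNIV. S (k i) / m (k i)))) + \<eta> * (\<Sum>k\<in>\<Omega> A. W k * pair_energy q k)"
   by (simp only: sum.distrib sum_distrib_left[symmetric] sumK)
  also have "(\<Sum>k\<in>\<Omega> A. W k * (\<Sum>i\<in>UNIV. S (k i) / m (k i))) = (\<Sum>k\<in>\<Omega> A. \<Sum>i\<in>UNIV. W k * (%a. S a / m a) (k i))" by (simp only: sum_distrib_left)
  also have "... = (\<Sum>i\<in>UNIV. \<Sum>k\<in>\<Omega> A. W k * (%a. S a / m a) (k i))" by (rule sum.swap)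
  also have "... = (\<Sum>i\<in>(UNIV :: 'n set). \<Sum>a\<in>A. m a / ?N * (S a / m a))"
   by (rule sum.cong[OF refl]) (unfold \<Omega>_def, rule marginal_sum[OF finA], rule marg[unfolded \<Omega>_def])
  also have "... = (\<Sum>a\<in>A. m a * (S a / m a))"
  proof -
   have c: "?N * (m a / ?N * t) = m a * t" for a t using Npos by simp
   show ?thesis by (simp only: sum_constant sum_distrib_left c)
  qed
  finally have e: "(\<Sum>k\<in>K. ennreal (\<eta>^2 * (fact CARD('n) * (W k * (\<Sum>i\<in>UNIV. S (k i) / m (k i)))) + \<eta> * (W k * pair_energy q k)))
   = ennreal (\<eta>^2 * (fact CARD('n) * (\<Sum>a\<in>A. m a * (S a / m a))) + \<eta> * (\<Sum>k\<in>\<Omega> A. W k * pair_energy q k))" .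
  \<comment> \<open>Equality holds for cells of positive mass; on the others the left side is
    0.\<close>
  have "(\<Sum>a\<in>A. m a * (S a / m a)) <= (\<Sum>a\<in>A. S a)" by (rule sum_mono) (use S0 in simp)
  then show ?thesis unfolding e[unfolded S_def] unfolding S_def
   by (intro ennreal_leI add_right_mono mult_left_mono) simp_all
 qed
 finally show ?thesis .
qed

section \<open>Semiconcavity of the truncated kernel\<close>

text \<open>The truncated kernel is a minimum of smooth functions, hence semiconcave: it lies below its
 first-order expansion up to a quadratic error.\<close>

definition kern :: "real => real^3 => real" where
 "kern dl w = 1 / max dl (norm w)"

definition kern_grad :: "real => real^3 => real^3" where
 "kern_grad dl w = (if norm w < dl then 0 else (- 1 / norm w ^ 3) *\<^sub>R w)"

lemma kern_measurable [measurable]: "kern dl \<in> borel_measurable borel"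
 unfolding kern_def[abs_def] by measurable

lemma kern_nonneg: "0 < dl ==> 0 <= kern dl w"
 by (simp add: kern_def)

lemma kern_le: "0 < dl ==> kern dl w <= 1 / dl"
 by (simp add: kern_def frac_le)

lemma kern_antimono: "0 < dl ==> 0 < d ==> d <= norm w ==> kern dl w <= 1 / d"
 by (simp add: kern_def frac_le)

lemma kern_ge: "0 < dl ==> norm w <= d ==> dl <= d ==> 1 / d <= kern dl w"
 by (simp add: kern_def frac_le)

lemma ennreal_kern_le: "0 < dl ==> ennreal (kern dl (y - z)) <= inverse (ennreal (dist y z))"
proof (cases "y = z")
 case False
 assume dl: "0 < dl"
 have "kern dl (y - z) <= inverse (dist y z)" using dl False by (simp add: kern_def dist_norm divide_inverse le_imp_inverse_le)
 then have "ennreal (kern dl (y - z)) <= ennreal (inverse (dist y z))" by (rule ennreal_leI)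
 also have "... = inverse (ennreal (dist y z))" using False by (simp add: inverse_ennreal)
 finally show ?thesis .
qed simp

lemma ennreal_kern_eq:
 assumes "0 < dl" "dl <= dist y z"
 shows "ennreal (kern dl (y - z)) = inverse (ennreal (dist y z))"
proof -
 have "0 < dist y z" using assms by linarith
 then show ?thesis using assms by (simp add: kern_def dist_norm inverse_ennreal divide_inverse max_absorb2)
qed

lemma kern_grad_bound:
 assumes "0 < dl"
 shows "norm (kern_grad dl w) <= 1 / dl^2"
proof (cases "norm w < dl")
 case False
 then have w: "dl <= norm w" "0 < norm w" using assms by auto
 have "norm (kern_grad dl w) = 1 / (norm w)^2" using False w by (simp add: kern_grad_def power2_eq_square power3_eq_cube)
 also have "... <= 1 / dl^2" using assms w by (intro divide_left_mono power_mono) simp_all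
 finally show ?thesis .
qed (simp add: kern_grad_def)

text \<open>Three regimes. Inside the truncation radius the kernel is at its maximum. For
  \<open>norm u\<close> at least \<open>dl / 2\<close> the quadratic term dominates all others. In
  the remaining case \<open>1 / s\<close> is expanded around \<open>1 / r\<close> by an exact
  identity in the squared norms.\<close>

lemma kern_taylor:
 assumes dl: "0 < dl"
 shows "kern dl (w + u) <= kern dl w + kern_grad dl w \<bullet> u + 6 * (norm u)^2 / dl ^ 3"
proof (cases "norm w < dl")
 case True
 then have "kern dl w = 1 / dl" "kern_grad dl w = 0" by (simp_all add: kern_def kern_grad_def)
 moreover have "0 <= 6 * (norm u)^2 / dl ^ 3" using dl by simp
 ultimately show ?thesis using kern_le[OF dl, of "w + u"] by simp
next
 case False
 define r s t where "r = norm w" and "s = norm (w + u)" and "t = norm u"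
 have r: "dl <= r" "0 < r" using False dl by (auto simp: r_def)
 have t0: "0 <= t" by (simp add: t_def)
 have kw: "kern dl w = 1 / r" using r by (simp add: kern_def r_def max_absorb2)
 show ?thesis
 proof (cases "dl / 2 <= t")
  case True
  have "\<bar>kern_grad dl w \<bullet> u\<bar> <= norm (kern_grad dl w) * t" unfolding t_def by (rule Cauchy_Schwarz_ineq2)
  also have "... <= 1 / dl^2 * t" by (rule mult_right_mono[OF kern_grad_bound[OF dl] t0])
  finally have g: "- (t / dl^2) <= kern_grad dl w \<bullet> u" by simp
  \<comment> \<open>This factorization fixes the constant 6: the expression
    \<open>6 * t^2 - t * dl - dl^2\<close> has its positive zero exactly at
    \<open>t = dl / 2\<close>.\<close>
  have "0 <= (2 * t - dl) * (3 * t + dl)" using True t0 dl by (intro mult_nonneg_nonneg) auto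
  then have "0 <= (6 * t^2 - t * dl - dl^2) / dl ^ 3" using dl by (intro divide_nonneg_pos) (simp_all add: algebra_simps power2_eq_square)
  also have "(6 * t^2 - t * dl - dl^2) / dl ^ 3 = 6 * t^2 / dl ^ 3 - t / dl^2 - 1 / dl"
   using dl by (simp add: diff_divide_distrib power2_eq_square power3_eq_cube)
  finally have "1 / dl <= 6 * t^2 / dl ^ 3 - t / dl^2" by simp
  moreover have "0 <= kern dl w" by (rule kern_nonneg[OF dl])
  ultimately show ?thesis using g kern_le[OF dl, of "w + u"] unfolding t_def by linarith
 next
  case False
  have "r <= s + t" using norm_triangle_ineq4[of "w + u" u] by (simp add: r_def s_def t_def)
  moreover have "s <= r + t" using norm_triangle_ineq[of w u] by (simp add: r_def s_def t_def)
  ultimately have st: "\<bar>s - r\<bar> <= t" "r / 2 <= s" using False r by linarith+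
  then have s0: "0 < s" using r by linarith
  \<comment> \<open>Polarization, which expresses the linear term through the squared norms that
    occur in the expansion of \<open>1 / s\<close>.\<close>
  have wu: "w \<bullet> u = (s^2 - r^2 - t^2) / 2"
   unfolding r_def s_def t_def power2_norm_eq_inner by (simp add: inner_add_left inner_add_right inner_commute)
  have ks: "kern dl (w + u) <= 1 / s" by (rule kern_antimono[OF dl s0]) (simp add: s_def)
  have id: "1 / s = 1 / r - (s^2 - r^2) / (2 * r ^ 3) + (s - r)^2 * ((s + 2 * r) / (2 * s)) / r ^ 3"
  proof -
   have "1 / r - (s^2 - r^2) / (2 * r ^ 3) + (s - r)^2 * ((s + 2 * r) / (2 * s)) / r ^ 3 = (2 * s * r^2 - s * (s^2 - r^2) + (s - r)^2 * (s + 2 * r)) / (2 * s * r ^ 3)"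
    using s0 r by (simp add: divide_simps power2_eq_square power3_eq_cube) (simp add: algebra_simps)
   also have "2 * s * r^2 - s * (s^2 - r^2) + (s - r)^2 * (s + 2 * r) = 2 * r ^ 3"
    by (simp add: power2_eq_square power3_eq_cube algebra_simps)
   finally show ?thesis using s0 r by simp
  qed
  \<comment> \<open>This is \<open>r \<le> 2 * s\<close>. Passing from \<open>s^2 - r^2\<close> to
    \<open>s^2 - r^2 - t^2\<close> gives back one half, which explains the factor 2 below.\<close>
  have "(s + 2 * r) / (2 * s) <= 5 / 2" using st s0 by (simp add: divide_le_eq)
  moreover have "(s - r)^2 <= t^2" using st(1) t0 by (rule power2_le_iff_abs_le[THEN iffD2, rotated])
  ultimately have "(s - r)^2 * ((s + 2 * r) / (2 * s)) <= t^2 * (5 / 2)" using s0 r by (intro mult_mono) simp_all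
  then have "(s - r)^2 * ((s + 2 * r) / (2 * s)) / r ^ 3 <= t^2 * (5 / 2) / r ^ 3" using r by (intro divide_right_mono) simp_all
  then have "1 / s <= 1 / r - (s^2 - r^2 - t^2) / (2 * r ^ 3) + 2 * t^2 / r ^ 3"
   unfolding id by (simp add: diff_divide_distrib)
  moreover have "2 * t^2 / r ^ 3 <= 6 * t^2 / dl ^ 3"
   using r dl by (intro frac_le power_mono) simp_all
  moreover have "kern_grad dl w \<bullet> u = - ((s^2 - r^2 - t^2) / (2 * r ^ 3))"
   using r by (simp add: kern_grad_def r_def[symmetric] wu)
  ultimately show ?thesis using ks kw unfolding t_def by linarith
 qed
qed

definition kern_avg :: "real => (real^3) measure => (real^3) measure => real" where
 "kern_avg dl M1 M2 = (\<integral>z. (\<integral>y. kern dl (y - z) \<partial>M1) \<partial>M2)"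

lemma kern_avg_facts:
 assumes dl: "0 < dl" and M1: "prob_space M1" "sets M1 = sets borel" and M2: "prob_space M2" "sets M2 = sets borel"
 shows kern_integrable: "integrable M1 (%y. kern dl (y - z))"
  and kern_avg_integrable: "integrable M2 (%z. \<integral>y. kern dl (y - z) \<partial>M1)"
  and kern_inner_bounds: "0 <= (\<integral>y. kern dl (y - z) \<partial>M1)" "(\<integral>y. kern dl (y - z) \<partial>M1) <= 1 / dl"
  and kern_avg_nonneg: "0 <= kern_avg dl M1 M2"
  and kern_avg_le: "kern_avg dl M1 M2 <= 1 / dl"
proof -
 interpret P1: prob_space M1 by (rule M1(1))
 interpret P2: prob_space M2 by (rule M2(1))
 note [measurable_cong] = M1(2) M2(2)
 show i1: "integrable M1 (%y. kern dl (y - z))" for z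
  by (rule P1.integrable_const_bound[of _ "1 / dl"]) (use kern_nonneg[OF dl] kern_le[OF dl] in auto)
 show b: "0 <= (\<integral>y. kern dl (y - z) \<partial>M1)" for z by (rule Bochner_Integration.integral_nonneg) (rule kern_nonneg[OF dl])
 show c: "(\<integral>y. kern dl (y - z) \<partial>M1) <= 1 / dl" for z
  by (rule P1.integral_le_const[OF i1]) (use kern_le[OF dl] in auto)
 show i2: "integrable M2 (%z. \<integral>y. kern dl (y - z) \<partial>M1)"
 proof (rule P2.integrable_const_bound[of _ "1 / dl"])
  show "AE z in M2. norm (\<integral>y. kern dl (y - z) \<partial>M1) <= 1 / dl" using b c by simp
  show "(%z. \<integral>y. kern dl (y - z) \<partial>M1) \<in> borel_measurable M2" by measurable
 qed
 show "0 <= kern_avg dl M1 M2" unfolding kern_avg_def by (rule Bochner_Integration.integral_nonneg) (rule b)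
 show "kern_avg dl M1 M2 <= 1 / dl" unfolding kern_avg_def by (rule P2.integral_le_const[OF i2]) (use c in auto)
qed

text \<open>Pointwise bounds on sets of full measure pass to the average. At distances of at least
  \<open>dl\<close> the truncation is inactive, so there the average is the true Coulomb interaction
  of the two measures.\<close>

lemma kern_avg_bounds:
 assumes dl: "0 < dl" and M1: "prob_space M1" "sets M1 = sets borel" and M2: "prob_space M2" "sets M2 = sets borel"
  and P: "AE y in M1. P y" and Q: "AE z in M2. Q z"
 shows kern_avg_upper: "(!!y z. P y ==> Q z ==> kern dl (y - z) <= c) ==> kern_avg dl M1 M2 <= c"
  and kern_avg_lower: "(!!y z. P y ==> Q z ==> c <= kern dl (y - z)) ==> c <= kern_avg dl M1 M2"
  and nn_kern_avg: "(!!y z. P y ==> Q z ==> dl <= dist y z) ==>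
   (\<integral>\<^sup>+z. (\<integral>\<^sup>+y. inverse (ennreal (dist y z)) \<partial>M1) \<partial>M2) = ennreal (kern_avg dl M1 M2)"
proof -
 interpret P1: prob_space M1 by (rule M1(1))
 interpret P2: prob_space M2 by (rule M2(1))
 note facts = kern_avg_facts[OF dl M1 M2]
 show "kern_avg dl M1 M2 <= c" if c: "!!y z. P y ==> Q z ==> kern dl (y - z) <= c"
  unfolding kern_avg_def
 proof (rule P2.integral_le_const[OF facts(2)])
  show "AE z in M2. (\<integral>y. kern dl (y - z) \<partial>M1) <= c" using Q
  proof eventually_elim
   fix z assume "Q z"
   then have "AE y in M1. kern dl (y - z) <= c" using P by (auto intro: c elim!: eventually_mono)
   then show "(\<integral>y. kern dl (y - z) \<partial>M1) <= c" by (rule P1.integral_le_const[OF facts(1)])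
  qed
 qed
 show "c <= kern_avg dl M1 M2" if c: "!!y z. P y ==> Q z ==> c <= kern dl (y - z)"
  unfolding kern_avg_def
 proof (rule P2.integral_ge_const[OF facts(2)])
  show "AE z in M2. c <= (\<integral>y. kern dl (y - z) \<partial>M1)" using Q
  proof eventually_elim
   fix z assume "Q z"
   then have "AE y in M1. c <= kern dl (y - z)" using P by (auto intro: c elim!: eventually_mono)
   then show "c <= (\<integral>y. kern dl (y - z) \<partial>M1)" by (rule P1.integral_ge_const[OF facts(1)])
  qed
 qed
 show "(\<integral>\<^sup>+z. (\<integral>\<^sup>+y. inverse (ennreal (dist y z)) \<partial>M1) \<partial>M2) = ennreal (kern_avg dl M1 M2)"
  if c: "!!y z. P y ==> Q z ==> dl <= dist y z"
 proof -
  have "(\<integral>\<^sup>+z. (\<integral>\<^sup>+y. inverse (ennreal (dist y z)) \<partial>M1) \<partial>M2) = (\<integral>\<^sup>+z. ennreal (\<integral>y. kern dl (y - z) \<partial>M1) \<partial>M2)"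
  proof (rule nn_integral_cong_AE)
   show "AE z in M2. (\<integral>\<^sup>+y. inverse (ennreal (dist y z)) \<partial>M1) = ennreal (\<integral>y. kern dl (y - z) \<partial>M1)" using Q
   proof eventually_elim
    fix z assume z: "Q z"
    have "AE y in M1. inverse (ennreal (dist y z)) = ennreal (kern dl (y - z))" using P
     by eventually_elim (rule ennreal_kern_eq[OF dl c[OF _ z], symmetric])
    then have "(\<integral>\<^sup>+y. inverse (ennreal (dist y z)) \<partial>M1) = (\<integral>\<^sup>+y. ennreal (kern dl (y - z)) \<partial>M1)" by (rule nn_integral_cong_AE)
    also have "... = ennreal (\<integral>y. kern dl (y - z) \<partial>M1)"
     by (rule nn_integral_eq_integral[OF facts(1)]) (simp add: kern_nonneg[OF dl])
    finally show "(\<integral>\<^sup>+y. inverse (ennreal (dist y z)) \<partial>M1) = ennreal (\<integral>y. kern dl (y - z) \<partial>M1)" .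
   qed
  qed
  also have "... = ennreal (kern_avg dl M1 M2)"
   unfolding kern_avg_def by (rule nn_integral_eq_integral[OF facts(2)]) (simp add: facts(3))
  finally show ?thesis .
 qed
qed

text \<open>When the expansion about \<open>x - x'\<close> is averaged, its linear term sees only
  the barycentres of the two measures. The relative displacement has norm at most
  \<open>6 * d\<close>, and 216 is \<open>6 * 6^2\<close>.\<close>

lemma kern_avg_taylor:
 assumes dl: "0 < dl" and M1: "prob_space M1" "sets M1 = sets borel" and M2: "prob_space M2" "sets M2 = sets borel"
  and A1: "AE y in M1. ALL k. \<bar>y $ k - x $ k\<bar> <= d" and A2: "AE z in M2. ALL k. \<bar>z $ k - x' $ k\<bar> <= d"
 shows "kern_avg dl M1 M2 <= kern dl (x - x')
  + (\<Sum>k\<in>UNIV. kern_grad dl (x - x') $ k * (((\<integral>y. y $ k \<partial>M1) - x $ k) - ((\<integral>z. z $ k \<partial>M2) - x' $ k))) + 216 * d^2 / dl ^ 3"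
proof -
 interpret P1: prob_space M1 by (rule M1(1))
 interpret P2: prob_space M2 by (rule M2(1))
 note [measurable_cong] = M1(2) M2(2)
 note facts = kern_avg_facts[OF dl M1 M2]
 let ?g = "%k. kern_grad dl (x - x') $ k"
 have i1: "integrable M1 (%y. y $ k)" for k
 proof (rule P1.integrable_const_bound[of _ "\<bar>x $ k\<bar> + d"])
  show "AE y in M1. norm (y $ k) <= \<bar>x $ k\<bar> + d" using A1
  proof eventually_elim
   fix y :: "real^3" assume "ALL k. \<bar>y $ k - x $ k\<bar> <= d"
   then have "\<bar>y $ k - x $ k\<bar> <= d" by blast
   then show "norm (y $ k) <= \<bar>x $ k\<bar> + d" by simp
  qed
 qed measurable
 have i2: "integrable M2 (%y. y $ k)" for k
 proof (rule P2.integrable_const_bound[of _ "\<bar>x' $ k\<bar> + d"])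
  show "AE y in M2. norm (y $ k) <= \<bar>x' $ k\<bar> + d" using A2
  proof eventually_elim
   fix y :: "real^3" assume "ALL k. \<bar>y $ k - x' $ k\<bar> <= d"
   then have "\<bar>y $ k - x' $ k\<bar> <= d" by blast
   then show "norm (y $ k) <= \<bar>x' $ k\<bar> + d" by simp
  qed
 qed measurable
 let ?R = "%y z. kern dl (x - x') + (\<Sum>k\<in>UNIV. ?g k * ((y $ k - x $ k) - (z $ k - x' $ k))) + 216 * d^2 / dl ^ 3"
 have pt: "kern dl (y - z) <= ?R y z" if y: "ALL k. \<bar>y $ k - x $ k\<bar> <= d" and z: "ALL k. \<bar>z $ k - x' $ k\<bar> <= d" for y z
 proof -
  define u where "u = (y - x) - (z - x')"
  have "norm u <= (\<Sum>k\<in>UNIV. \<bar>u $ k\<bar>)" by (rule norm_le_l1_cart)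
  also have "... <= (\<Sum>k\<in>(UNIV :: 3 set). 2 * d)"
  proof (rule sum_mono)
   fix k :: 3
   have "\<bar>y $ k - x $ k\<bar> <= d" "\<bar>z $ k - x' $ k\<bar> <= d" using y z by auto
   then show "\<bar>u $ k\<bar> <= 2 * d" by (simp add: u_def)
  qed
  also have "... = 6 * d" by simp
  finally have "(norm u)^2 <= (6 * d)^2" by (rule power_mono) simp
  then have u2: "6 * (norm u)^2 / dl ^ 3 <= 216 * d^2 / dl ^ 3" using dl by (intro divide_right_mono) (simp_all add: power_mult_distrib)
  have "y - z = (x - x') + u" by (simp add: u_def)
  then have "kern dl (y - z) <= kern dl (x - x') + kern_grad dl (x - x') \<bullet> u + 6 * (norm u)^2 / dl ^ 3" using kern_taylor[OF dl, of "x - x'" u] by simp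
  moreover have "kern_grad dl (x - x') \<bullet> u = (\<Sum>k\<in>UNIV. ?g k * ((y $ k - x $ k) - (z $ k - x' $ k)))"
   by (simp add: inner_vec_def u_def)
  ultimately show ?thesis using u2 by linarith
 qed
 have inner: "(\<integral>y. kern dl (y - z) \<partial>M1) <= kern dl (x - x') + (\<Sum>k\<in>UNIV. ?g k * (((\<integral>y. y $ k \<partial>M1) - x $ k) - (z $ k - x' $ k))) + 216 * d^2 / dl ^ 3"
  if z: "ALL k. \<bar>z $ k - x' $ k\<bar> <= d" for z
 proof -
  have "(\<integral>y. kern dl (y - z) \<partial>M1) <= (\<integral>y. ?R y z \<partial>M1)"
  proof (rule integral_mono_AE[OF facts(1)])
   show "integrable M1 (%y. ?R y z)"
    by (intro Bochner_Integration.integrable_add Bochner_Integration.integrable_diff Bochner_Integration.integrable_sum integrable_mult_right i1 P1.integrable_const)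
   show "AE y in M1. kern dl (y - z) <= ?R y z" using A1 by eventually_elim (rule pt[OF _ z])
  qed
  also have "... = kern dl (x - x') + (\<Sum>k\<in>UNIV. ?g k * (((\<integral>y. y $ k \<partial>M1) - x $ k) - (z $ k - x' $ k))) + 216 * d^2 / dl ^ 3"
   using i1 by (simp add: P1.prob_space)
  finally show ?thesis .
 qed
 have "kern_avg dl M1 M2 <= (\<integral>z. kern dl (x - x') + (\<Sum>k\<in>UNIV. ?g k * (((\<integral>y. y $ k \<partial>M1) - x $ k) - (z $ k - x' $ k))) + 216 * d^2 / dl ^ 3 \<partial>M2)"
  unfolding kern_avg_def
 proof (rule integral_mono_AE[OF facts(2)])
  show "integrable M2 (%z. kern dl (x - x') + (\<Sum>k\<in>UNIV. ?g k * (((\<integral>y. y $ k \<partial>M1) - x $ k) - (z $ k - x' $ k))) + 216 * d^2 / dl ^ 3)"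
   by (intro Bochner_Integration.integrable_add Bochner_Integration.integrable_diff Bochner_Integration.integrable_sum integrable_mult_right i2 P2.integrable_const)
  show "AE z in M2. (\<integral>y. kern dl (y - z) \<partial>M1) <= kern dl (x - x') + (\<Sum>k\<in>UNIV. ?g k * (((\<integral>y. y $ k \<partial>M1) - x $ k) - (z $ k - x' $ k))) + 216 * d^2 / dl ^ 3"
   using A2 by eventually_elim (rule inner)
 qed
 also have "... = kern dl (x - x') + (\<Sum>k\<in>UNIV. ?g k * (((\<integral>y. y $ k \<partial>M1) - x $ k) - ((\<integral>z. z $ k \<partial>M2) - x' $ k))) + 216 * d^2 / dl ^ 3"
  using i2 by (simp add: P2.prob_space)
 finally show ?thesis .
qed

text \<open>These are the weights of independent choices, so that summation over the coordinates not
  being tested gives factors 1.\<close>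

lemma sum_product_weights:
 fixes p :: "'n::finite => 'c => real"
 assumes A: "finite A" and p: "!!l. (\<Sum>a\<in>A. p l a) = 1"
 shows sum_product_weights_single: "a \<in> A ==> (\<Sum>c\<in>PiE UNIV (%_. A). (\<Prod>l\<in>UNIV. p l (c l)) * (if c i = a then 1 else 0)) = p i a"
  and sum_product_weights_all: "(\<Sum>c\<in>PiE UNIV (%_. A). \<Prod>l\<in>UNIV. p l (c l)) = 1"
  and sum_product_weights_pair: "i ~= j ==> (\<Sum>c\<in>PiE UNIV (%_. A). (\<Prod>l\<in>UNIV. p l (c l)) * h (c i) (c j)) = (\<Sum>a\<in>A. \<Sum>b\<in>A. p i a * p j b * h a b)"
proof -
 have gen: "(\<Sum>c\<in>PiE UNIV (%_. A). (\<Prod>l\<in>UNIV. p l (c l)) * (\<Prod>l\<in>UNIV. r l (c l))) = (\<Prod>l\<in>UNIV. \<Sum>a\<in>A. p l a * r l a)" for r :: "'n => 'c => real"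
  unfolding prod.distrib[symmetric] by (rule prod_sum_PiE[symmetric]) (use A in auto)
 show "(\<Sum>c\<in>PiE UNIV (%_. A). \<Prod>l\<in>UNIV. p l (c l)) = 1" using gen[of "%_ _. 1"] by (simp add: p)
 show "(\<Sum>c\<in>PiE UNIV (%_. A). (\<Prod>l\<in>UNIV. p l (c l)) * (if c i = a then 1 else 0)) = p i a" if a: "a \<in> A"
 proof -
  let ?r = "%l x. if l = i then (if x = a then 1 else 0) else (1::real)"
  have "(\<Prod>l\<in>UNIV. ?r l (c l)) = (if c i = a then 1 else 0)" for c by (simp add: prod.delta)
  moreover have "(\<Sum>x\<in>A. p l x * ?r l x) = (if l = i then p i a else 1)" for l
  proof (cases "l = i")
   case True
   have "(\<Sum>x\<in>A. p i x * (if x = a then 1 else 0)) = (\<Sum>x\<in>A. if x = a then p i x else 0)" by (rule sum.cong) auto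
   then show ?thesis using True A a by simp
  qed (simp add: p)
  ultimately show ?thesis using gen[of ?r] by (simp add: prod.delta)
 qed
 show "(\<Sum>c\<in>PiE UNIV (%_. A). (\<Prod>l\<in>UNIV. p l (c l)) * h (c i) (c j)) = (\<Sum>a\<in>A. \<Sum>b\<in>A. p i a * p j b * h a b)" if ij: "i ~= j"
 proof -
  let ?Om = "PiE (UNIV :: 'n set) (%_. A)"
  let ?d = "%x y. if x = y then 1 else (0::real)"
  have two: "(\<Sum>c\<in>?Om. (\<Prod>l\<in>UNIV. p l (c l)) * (?d (c i) a * ?d (c j) b)) = p i a * p j b" if a: "a \<in> A" and b: "b \<in> A" for a b
  proof -
   let ?r = "%l x. (if l = i then ?d x a else 1) * (if l = j then ?d x b else (1::real))"
   have 1: "(\<Prod>l\<in>UNIV. ?r l (c l)) = ?d (c i) a * ?d (c j) b" for c by (simp add: prod.distrib prod.delta)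
   have 2: "(\<Sum>x\<in>A. p l x * ?r l x) = (if l = i then p i a else 1) * (if l = j then p j b else 1)" for l
   proof -
    have d: "(\<Sum>x\<in>A. p l x * ?d x y) = p l y" if "y \<in> A" for l y
    proof -
     have "(\<Sum>x\<in>A. p l x * ?d x y) = (\<Sum>x\<in>A. if x = y then p l x else 0)" by (rule sum.cong) auto
     then show ?thesis using A that by simp
    qed
    show ?thesis using ij d[OF a, of i] d[OF b, of j] p[of l] by (cases "l = i"; cases "l = j") simp_all
   qed
   show ?thesis using gen[of ?r] unfolding 1 2 by (simp add: prod.distrib prod.delta)
  qed
  have ex: "h (c i) (c j) = (\<Sum>a\<in>A. \<Sum>b\<in>A. (?d (c i) a * ?d (c j) b) * h a b)" if "c \<in> ?Om" for c
  proof -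
   have c: "c i \<in> A" "c j \<in> A" using that by (auto elim: PiE_mem)
   have "(\<Sum>a\<in>A. \<Sum>b\<in>A. (?d (c i) a * ?d (c j) b) * h a b) = (\<Sum>a\<in>A. if a = c i then (\<Sum>b\<in>A. if b = c j then h a b else 0) else 0)"
   proof (rule sum.cong[OF refl])
    fix a
    have "(\<Sum>b\<in>A. (?d (c i) a * ?d (c j) b) * h a b) = (\<Sum>b\<in>A. ?d (c i) a * (if b = c j then h a b else 0))"
     by (rule sum.cong) auto
    also have "... = (if a = c i then (\<Sum>b\<in>A. if b = c j then h a b else 0) else 0)"
     by (cases "a = c i") auto
    finally show "(\<Sum>b\<in>A. (?d (c i) a * ?d (c j) b) * h a b) = (if a = c i then (\<Sum>b\<in>A. if b = c j then h a b else 0) else 0)" .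
   qed
   then show ?thesis using A c by simp
  qed
  have "(\<Sum>c\<in>?Om. (\<Prod>l\<in>UNIV. p l (c l)) * h (c i) (c j)) = (\<Sum>c\<in>?Om. \<Sum>a\<in>A. \<Sum>b\<in>A. ((\<Prod>l\<in>UNIV. p l (c l)) * (?d (c i) a * ?d (c j) b)) * h a b)"
   by (rule sum.cong[OF refl]) (simp only: ex sum_distrib_left mult.assoc)
  also have "... = (\<Sum>a\<in>A. \<Sum>c\<in>?Om. \<Sum>b\<in>A. ((\<Prod>l\<in>UNIV. p l (c l)) * (?d (c i) a * ?d (c j) b)) * h a b)" by (rule sum.swap)
  also have "... = (\<Sum>a\<in>A. \<Sum>b\<in>A. \<Sum>c\<in>?Om. ((\<Prod>l\<in>UNIV. p l (c l)) * (?d (c i) a * ?d (c j) b)) * h a b)"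
   by (intro sum.cong refl sum.swap)
  also have "... = (\<Sum>a\<in>A. \<Sum>b\<in>A. p i a * p j b * h a b)"
   by (intro sum.cong refl) (simp only: sum_distrib_right[symmetric] two)
  finally show ?thesis .
 qed
qed

section \<open>Discretized plans and their interaction energy\<close>

locale cell_partition =
 fixes \<rho> :: "real^3 => real" and ep :: real and L :: int
 assumes rho_measurable [measurable]: "\<rho> \<in> borel_measurable borel" and rho_nonneg: "!!x. 0 <= \<rho> x"
  and rho_integrable: "integrable lborel \<rho>" and eps: "0 < ep" and L0: "0 <= L"
begin

definition bump :: "(3 => int) => real^3 => real" where
 "bump a x = (cell_fun ep L a x)^2"

definition mass :: "(3 => int) => real" where
 "mass a = (\<integral>x. \<rho> x * bump a x \<partial>lborel)"

text \<open>A cell without mass carries the point mass at its centre, so that every cell has a probability measure.\<close>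

definition cell_measure :: "(3 => int) => (real^3) measure" where
 "cell_measure a = (if 0 < mass a then density lborel (%x. ennreal (\<rho> x * bump a x / mass a)) else return borel (\<chi> k. ep * of_int (a k)))"

definition barycentre :: "(3 => int) => 3 => real" where
 "barycentre a k = (\<integral>y. y $ k \<partial>cell_measure a)"

abbreviation Q :: "real => (3 => int) => (3 => int) => real" where
 "Q dl a b \<equiv> kern_avg dl (cell_measure a) (cell_measure b)"

text \<open>Error charged to one particle: the gradient bound \<open>1 / dl^2\<close> times the mean
  displacement of barycentres from lattice points, plus the trivial kernel bound
  \<open>1 / dl\<close> far out, where the outer cells, which need not be small, come into
  play.\<close>

definition err :: "real => real^3 => real" where
 "err dl x = (\<Sum>k\<in>UNIV. \<Sum>a\<in>inner_cells L. bump a x * \<bar>barycentre a k - ep * of_int (a k)\<bar>) / dl^2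
  + 1 / dl * indicat_real {x. ep * (of_int L - 3) < norm x} x"

lemma bump_measurable [measurable]: "bump a \<in> borel_measurable borel"
 unfolding bump_def[abs_def] by measurable

lemma bump_bounds: "0 <= bump a x" "bump a x <= 1"
 using cell_fun_bounds[where ep=ep and L=L and a=a and x=x] by (simp_all add: bump_def power_le_one)

lemma bump_sum: "(\<Sum>a\<in>cells L. bump a x) = 1"
 unfolding bump_def by (rule cell_fun_partition[OF L0])

lemma rho_bounded_integrable:
 assumes [measurable]: "h \<in> borel_measurable borel" and B: "!!x. \<bar>h x\<bar> <= B"
 shows "integrable lborel (%x. \<rho> x * h x)"
proof (rule Bochner_Integration.integrable_bound)
 show "integrable lborel (%x. \<rho> x * B)" using rho_integrable by simp
 show "AE x in lborel. norm (\<rho> x * h x) <= norm (\<rho> x * B)"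
  using B rho_nonneg order_trans[OF abs_ge_zero B] by (intro AE_I2) (simp add: abs_mult mult_left_mono)
qed measurable

lemma rho_bump_integrable: "integrable lborel (%x. \<rho> x * bump a x)"
 by (rule rho_bounded_integrable[of _ 1]) (use bump_bounds in auto)

lemma mass_nonneg: "0 <= mass a"
 unfolding mass_def by (intro Bochner_Integration.integral_nonneg mult_nonneg_nonneg rho_nonneg bump_bounds)

lemma sum_mass: "(\<Sum>a\<in>I. mass a * c a) = (\<integral>x. \<rho> x * (\<Sum>a\<in>I. bump a x * c a) \<partial>lborel)"
proof -
 have "(\<integral>x. \<rho> x * (\<Sum>a\<in>I. bump a x * c a) \<partial>lborel) = (\<integral>x. (\<Sum>a\<in>I. (\<rho> x * bump a x) * c a) \<partial>lborel)"
  by (simp only: sum_distrib_left mult.assoc)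
 also have "... = (\<Sum>a\<in>I. \<integral>x. (\<rho> x * bump a x) * c a \<partial>lborel)"
  by (rule Bochner_Integration.integral_sum) (rule integrable_mult_left[OF rho_bump_integrable])
 finally show ?thesis by (simp add: mass_def)
qed

lemma sets_cell_measure: "sets (cell_measure a) = sets borel"
 by (simp add: cell_measure_def)

lemma prob_cell_measure: "prob_space (cell_measure a)"
proof (cases "0 < mass a")
 case True
 have i: "integrable lborel (%x. \<rho> x * bump a x / mass a)" using rho_bump_integrable by simp
 have "(\<integral>\<^sup>+x. ennreal (\<rho> x * bump a x / mass a) \<partial>lborel) = ennreal (\<integral>x. \<rho> x * bump a x / mass a \<partial>lborel)"
  by (rule nn_integral_eq_integral[OF i]) (use True rho_nonneg bump_bounds in "auto intro!: AE_I2 divide_nonneg_nonneg mult_nonneg_nonneg")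
 also have "(\<integral>x. \<rho> x * bump a x / mass a \<partial>lborel) = 1" using True by (simp add: mass_def)
 finally show ?thesis using True by (intro prob_spaceI) (simp add: cell_measure_def emeasure_density)
next
 case False
 then show ?thesis by (simp add: cell_measure_def prob_space_return)
qed

lemma AE_cell_measure:
 assumes "0 < mass a"
 shows "AE y in cell_measure a. cell_fun ep L a y ~= 0"
proof -
 have e: "cell_measure a = density lborel (%x. ennreal (\<rho> x * bump a x / mass a))" using assms by (simp add: cell_measure_def)
 have m: "(%x. ennreal (\<rho> x * bump a x / mass a)) \<in> borel_measurable lborel" by measurable
 show ?thesis unfolding e AE_density[OF m] by (rule AE_I2) (auto simp: bump_def)
qed

lemma AE_inner_cell:
 assumes a: "a \<in> inner_cells L"
 shows "AE y in cell_measure a. ALL k. \<bar>y $ k - ep * of_int (a k)\<bar> <= 3/2 * ep"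
proof (cases "0 < mass a")
 case True
 show ?thesis using AE_cell_measure[OF True]
  by eventually_elim (use inner_cell_support[OF eps a] in blast)
next
 case False
 then have e: "cell_measure a = return borel (\<chi> k. ep * of_int (a k))" by (simp add: cell_measure_def)
 have m: "Measurable.pred borel (%y :: real^3. ALL k. \<bar>y $ k - ep * of_int (a k)\<bar> <= 3/2 * ep)" by measurable
 have x: "(\<chi> k. ep * of_int (a k)) \<in> space (borel :: (real^3) measure)" by simp
 show ?thesis unfolding e AE_return[OF x m] using eps by simp
qed

lemma integral_cell_measure:
 assumes [measurable]: "h \<in> borel_measurable borel" and "0 < mass a"
 shows "(\<integral>y. h y \<partial>cell_measure a) = (\<integral>y. \<rho> y * (bump a y * h y) \<partial>lborel) / mass a"
proof -
 have "(\<integral>y. h y \<partial>cell_measure a) = (\<integral>y. (\<rho> y * bump a y / mass a) *\<^sub>R h y \<partial>lborel)"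
  unfolding cell_measure_def using assms(2) rho_nonneg bump_bounds
  by (simp only: if_True) (rule integral_density; auto intro!: AE_I2 divide_nonneg_nonneg mult_nonneg_nonneg)
 also have "... = (\<integral>y. \<rho> y * (bump a y * h y) / mass a \<partial>lborel)" by (simp add: mult.assoc)
 finally show ?thesis by simp
qed

text \<open>Mass times displacement is the first moment of the cell about its lattice point, the
  quantity summed in \<open>cell_drift\<close>.\<close>

lemma barycentre_drift:
 assumes a: "a \<in> inner_cells L"
 shows "mass a * \<bar>barycentre a k - ep * of_int (a k)\<bar> <= \<bar>\<integral>x. \<rho> x * ((cell_fun ep L a x)^2 * (x $ k - ep * of_int (a k))) \<partial>lborel\<bar>"
proof (cases "0 < mass a")
 case True
 interpret prob_space "cell_measure a" by (rule prob_cell_measure)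
 note [measurable_cong] = sets_cell_measure[of a]
 have i: "integrable (cell_measure a) (%y. y $ k)"
 proof (rule integrable_const_bound[of _ "\<bar>ep * of_int (a k)\<bar> + 3/2 * ep"])
  show "AE y in cell_measure a. norm (y $ k) <= \<bar>ep * of_int (a k)\<bar> + 3/2 * ep" using AE_inner_cell[OF a]
  proof eventually_elim
   fix y :: "real^3" assume "ALL k. \<bar>y $ k - ep * of_int (a k)\<bar> <= 3/2 * ep"
   then have "\<bar>y $ k - ep * of_int (a k)\<bar> <= 3/2 * ep" by blast
   then show "norm (y $ k) <= \<bar>ep * of_int (a k)\<bar> + 3/2 * ep" unfolding real_norm_def by linarith
  qed
 qed measurable
 have "barycentre a k - ep * of_int (a k) = (\<integral>y. y $ k - ep * of_int (a k) \<partial>cell_measure a)"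
  using i by (simp add: barycentre_def prob_space)
 also have "... = (\<integral>y. \<rho> y * (bump a y * (y $ k - ep * of_int (a k))) \<partial>lborel) / mass a"
  by (rule integral_cell_measure[OF _ True]) measurable
 finally have "mass a * (barycentre a k - ep * of_int (a k)) = (\<integral>x. \<rho> x * ((cell_fun ep L a x)^2 * (x $ k - ep * of_int (a k))) \<partial>lborel)"
  using True by (simp add: bump_def)
 then have "\<bar>mass a * (barycentre a k - ep * of_int (a k))\<bar> = \<bar>\<integral>x. \<rho> x * ((cell_fun ep L a x)^2 * (x $ k - ep * of_int (a k))) \<partial>lborel\<bar>" by simp
 then show ?thesis using mass_nonneg[of a] by (simp add: abs_mult)
next
 case False
 then have "mass a = 0" using mass_nonneg[of a] by simp
 then show ?thesis by simp
qed

lemmas Q_facts = kern_avg_facts[OF _ prob_cell_measure sets_cell_measure prob_cell_measure sets_cell_measure]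

lemma err_measurable [measurable]: "err dl \<in> borel_measurable borel"
 unfolding err_def[abs_def] by measurable

lemma err_nonneg: "0 < dl ==> 0 <= err dl x"
 unfolding err_def by (intro add_nonneg_nonneg divide_nonneg_nonneg sum_nonneg mult_nonneg_nonneg bump_bounds) simp_all

lemma err_bounded:
 assumes "0 < dl"
 shows "\<bar>err dl x\<bar> <= (\<Sum>k\<in>UNIV. \<Sum>a\<in>inner_cells L. \<bar>barycentre a k - ep * of_int (a k)\<bar>) / dl^2 + 1 / dl"
proof -
 have "err dl x <= (\<Sum>k\<in>UNIV. \<Sum>a\<in>inner_cells L. \<bar>barycentre a k - ep * of_int (a k)\<bar>) / dl^2 + 1 / dl"
  unfolding err_def
  by (intro add_mono divide_right_mono sum_mono mult_left_le_one_le bump_bounds) (use assms in "auto simp: indicator_def")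
 then show ?thesis using err_nonneg[OF assms, of x] by simp
qed

text \<open>Each of the three directions contributes \<open>3 * B * ep^2\<close> by
  \<open>cell_drift\<close>, hence the 9.\<close>

lemma integral_err_le:
 assumes dl: "0 < dl" and tr: "!!k. (\<integral>x. \<bar>\<rho> (x + ep *\<^sub>R axis k 1) - \<rho> x\<bar> \<partial>lborel) <= ep * B"
 shows "(\<integral>x. \<rho> x * err dl x \<partial>lborel) <= 9 * B * ep^2 / dl^2 + (\<integral>x. \<rho> x * indicat_real {x. ep * (of_int L - 3) < norm x} x \<partial>lborel) / dl"
proof -
 let ?I = "indicat_real {x :: real^3. ep * (of_int L - 3) < norm x}"
 let ?s = "%k x. \<Sum>a\<in>inner_cells L. bump a x * \<bar>barycentre a k - ep * of_int (a k)\<bar>"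
 have ish: "integrable lborel (%x. \<rho> x * ?s k x)" for k
  unfolding sum_distrib_left mult.assoc[symmetric]
  by (intro Bochner_Integration.integrable_sum integrable_mult_left rho_bump_integrable)
 have iI: "integrable lborel (%x. \<rho> x * ?I x)" by (rule rho_bounded_integrable[of _ 1]) (auto simp: indicator_def)
 have s: "(\<integral>x. \<rho> x * ?s k x \<partial>lborel) <= 3 * B * ep^2" for k
 proof -
  have "(\<integral>x. \<rho> x * ?s k x \<partial>lborel) = (\<Sum>a\<in>inner_cells L. mass a * \<bar>barycentre a k - ep * of_int (a k)\<bar>)" by (rule sum_mass[symmetric])
  also have "... <= (\<Sum>a\<in>inner_cells L. \<bar>\<integral>x. \<rho> x * ((cell_fun ep L a x)^2 * (x $ k - ep * of_int (a k))) \<partial>lborel\<bar>)"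
   by (rule sum_mono) (rule barycentre_drift)
  also have "... <= 3 * B * ep^2" by (rule cell_drift[OF eps L0 rho_integrable tr])
  finally show ?thesis .
 qed
 have "(\<integral>x. \<rho> x * err dl x \<partial>lborel) = (\<integral>x. (\<Sum>k\<in>UNIV. \<rho> x * ?s k x) / dl^2 + (\<rho> x * ?I x) / dl \<partial>lborel)"
  unfolding err_def by (simp add: distrib_left sum_distrib_left)
 also have "... = (\<integral>x. (\<Sum>k\<in>UNIV. \<rho> x * ?s k x) / dl^2 \<partial>lborel) + (\<integral>x. (\<rho> x * ?I x) / dl \<partial>lborel)"
  by (rule Bochner_Integration.integral_add) (intro integrable_divide_zero Bochner_Integration.integrable_sum ish iI impI)+
 also have "... = (\<Sum>k\<in>UNIV. \<integral>x. \<rho> x * ?s k x \<partial>lborel) / dl^2 + (\<integral>x. \<rho> x * ?I x \<partial>lborel) / dl"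
  unfolding integral_divide_zero by (subst Bochner_Integration.integral_sum) (rule ish, rule refl)
 also have "... <= (\<Sum>k\<in>(UNIV :: 3 set). 3 * B * ep^2) / dl^2 + (\<integral>x. \<rho> x * ?I x \<partial>lborel) / dl"
  by (intro add_right_mono divide_right_mono sum_mono s) simp
 finally show ?thesis by simp
qed

text \<open>The particles at \<open>x\<close> and \<open>x'\<close> choose cells independently, with
  probabilities \<open>bump a x\<close> and \<open>bump b x'\<close>, and the expansion of
  \<open>Q\<close> is averaged over these choices. Lattice points average exactly to the positions,
  so of the first-order term only the displacement of barycentres from lattice points
  survives.\<close>

lemma cell_energy_pointwise:
 assumes dl: "0 < dl"
 shows "(\<Sum>a\<in>cells L. \<Sum>b\<in>cells L. bump a x * bump b x' * Q dl a b) <= kern dl (x - x') + err dl x + err dl x' + 1944 * ep^2 / dl ^ 3"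
proof (cases "norm x <= ep * (of_int L - 3) & norm x' <= ep * (of_int L - 3)")
 case False
 have "(\<Sum>a\<in>cells L. \<Sum>b\<in>cells L. bump a x * bump b x' * Q dl a b) <= (\<Sum>a\<in>cells L. \<Sum>b\<in>cells L. bump a x * bump b x' * (1 / dl))"
  by (intro sum_mono mult_left_mono mult_nonneg_nonneg bump_bounds Q_facts(6)[OF dl])
 also have "... = (\<Sum>a\<in>cells L. bump a x) * (\<Sum>b\<in>cells L. bump b x') * (1 / dl)"
  by (subst sum_product) (simp only: sum_distrib_right)
 also have "... = 1 / dl" by (simp add: bump_sum)
 finally have le: "(\<Sum>a\<in>cells L. \<Sum>b\<in>cells L. bump a x * bump b x' * Q dl a b) <= 1 / dl" .
 \<comment> \<open>If one of the particles is far out, the total interaction, at most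
   \<open>1 / dl\<close>, is covered by the indicator in \<open>err\<close>.\<close>
 have far: "1 / dl <= err dl z" if "~ norm z <= ep * (of_int L - 3)" for z
 proof -
  have "0 <= (\<Sum>k\<in>UNIV. \<Sum>a\<in>inner_cells L. bump a z * \<bar>barycentre a k - ep * of_int (a k)\<bar>) / dl^2"
   by (intro divide_nonneg_nonneg sum_nonneg mult_nonneg_nonneg bump_bounds) simp_all
  then show ?thesis using that by (simp add: err_def indicator_def)
 qed
 have "1 / dl <= err dl x | 1 / dl <= err dl x'" using False far by blast
 moreover have "0 <= err dl x" "0 <= err dl x'" "0 <= kern dl (x - x')" "0 <= 1944 * ep^2 / dl ^ 3"
  using dl by (simp_all add: err_nonneg kern_nonneg)
 ultimately show ?thesis using le by linarith
next
 case True
 let ?g = "%k. kern_grad dl (x - x') $ k"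
 define T where "T a b = kern dl (x - x') + (\<Sum>k\<in>UNIV. ?g k * ((barycentre a k - x $ k) - (barycentre b k - x' $ k))) + 1944 * ep^2 / dl ^ 3" for a b
 have inner: "a \<in> inner_cells L" if "a \<in> cells L" "bump a z ~= 0" "norm z <= ep * (of_int L - 3)" for a z
  using outer_cell_support[OF eps that(1), of z] that(2,3) by (auto simp: bump_def)
 \<comment> \<open>Both \<open>y\<close> and \<open>z\<close> lie within \<open>3/2 * ep\<close> of
   the same lattice point in each coordinate, hence the scale \<open>3 * ep\<close> and the constant
   \<open>216 * 9 = 1944\<close>.\<close>
 have near: "AE y in cell_measure a. ALL k. \<bar>y $ k - z $ k\<bar> <= 3 * ep" if a: "a \<in> inner_cells L" and z: "bump a z ~= 0" for a z
  using AE_inner_cell[OF a]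
 proof eventually_elim
  fix y :: "real^3" assume y: "ALL k. \<bar>y $ k - ep * of_int (a k)\<bar> <= 3/2 * ep"
  show "ALL k. \<bar>y $ k - z $ k\<bar> <= 3 * ep"
  proof
   fix k
   have "\<bar>z $ k - ep * of_int (a k)\<bar> <= 3/2 * ep" using inner_cell_support[OF eps a, of z k] z by (auto simp: bump_def)
   moreover have "\<bar>y $ k - ep * of_int (a k)\<bar> <= 3/2 * ep" using y by blast
   ultimately show "\<bar>y $ k - z $ k\<bar> <= 3 * ep" by linarith
  qed
 qed
 have tm: "bump a x * bump b x' * Q dl a b <= bump a x * bump b x' * T a b" if a: "a \<in> cells L" and b: "b \<in> cells L" for a b
 proof (cases "bump a x = 0 | bump b x' = 0")
  case False
  have "Q dl a b <= kern dl (x - x') + (\<Sum>k\<in>UNIV. ?g k * (((\<integral>y. y $ k \<partial>cell_measure a) - x $ k) - ((\<integral>z. z $ k \<partial>cell_measure b) - x' $ k))) + 216 * (3 * ep)^2 / dl ^ 3"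
  proof (rule kern_avg_taylor[OF dl prob_cell_measure sets_cell_measure prob_cell_measure sets_cell_measure])
   show "AE y in cell_measure a. ALL k. \<bar>y $ k - x $ k\<bar> <= 3 * ep" using near inner a False True by blast
   show "AE y in cell_measure b. ALL k. \<bar>y $ k - x' $ k\<bar> <= 3 * ep" using near inner b False True by blast
  qed
  then have "Q dl a b <= T a b" by (simp add: T_def barycentre_def power_mult_distrib)
  then show ?thesis by (intro mult_left_mono mult_nonneg_nonneg bump_bounds)
 qed auto
 \<comment> \<open>The mean displacement of the chosen cell's barycentre from the position
   \<open>z\<close>. Subtracting the reproduction identity replaces \<open>z\<close> by the lattice
   points.\<close>
 define D where "D z k = (\<Sum>a\<in>cells L. bump a z * (barycentre a k - z $ k))" for z :: "real^3" and k
 have Dle: "\<bar>D z k\<bar> <= (\<Sum>a\<in>inner_cells L. bump a z * \<bar>barycentre a k - ep * of_int (a k)\<bar>)" if z: "norm z <= ep * (of_int L - 3)" for z k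
 proof -
  have "\<bar>z $ k\<bar> <= norm z" by (rule component_le_norm_cart)
  also note z
  also have "ep * (of_int L - 3) <= ep * of_int L" using eps by simp
  finally have zk: "\<bar>z $ k\<bar> <= ep * of_int L" .
  have "D z k = (\<Sum>a\<in>cells L. bump a z * (barycentre a k - ep * of_int (a k))) + (\<Sum>a\<in>cells L. bump a z * (ep * of_int (a k) - z $ k))"
   unfolding D_def sum.distrib[symmetric] by (simp add: algebra_simps)
  also have "(\<Sum>a\<in>cells L. bump a z * (ep * of_int (a k) - z $ k)) = 0"
   unfolding bump_def by (rule cell_fun_linear_reproduction[OF eps L0 zk])
  finally have "\<bar>D z k\<bar> <= (\<Sum>a\<in>cells L. \<bar>bump a z * (barycentre a k - ep * of_int (a k))\<bar>)" by (simp add: sum_abs)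
  also have "... = (\<Sum>a\<in>cells L. bump a z * \<bar>barycentre a k - ep * of_int (a k)\<bar>)"
   using bump_bounds(1) by (simp add: abs_mult)
  also have "... = (\<Sum>a\<in>inner_cells L. bump a z * \<bar>barycentre a k - ep * of_int (a k)\<bar>)"
   using inner z by (intro sum.mono_neutral_right inner_cells_subset) auto
  finally show ?thesis .
 qed
 have "(\<Sum>a\<in>cells L. \<Sum>b\<in>cells L. bump a x * bump b x' * Q dl a b) <= (\<Sum>a\<in>cells L. \<Sum>b\<in>cells L. bump a x * bump b x' * T a b)"
  by (intro sum_mono tm)
 also have "... = kern dl (x - x') + 1944 * ep^2 / dl ^ 3 + (\<Sum>k\<in>UNIV. ?g k * (D x k - D x' k))"
 proof -
  define c0 where "c0 = kern dl (x - x') + 1944 * ep^2 / dl ^ 3"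
  define A where "A a = (\<Sum>k\<in>UNIV. ?g k * (barycentre a k - x $ k))" for a
  define A' where "A' b = (\<Sum>k\<in>UNIV. ?g k * (barycentre b k - x' $ k))" for b
  have T: "T a b = c0 + A a - A' b" for a b
   unfolding T_def c0_def A_def A'_def by (simp add: right_diff_distrib sum_subtractf)
  have row: "(\<Sum>b\<in>cells L. bump a x * bump b x' * T a b) = bump a x * (c0 + A a) - bump a x * (\<Sum>b\<in>cells L. bump b x' * A' b)" for a
  proof -
   have "(\<Sum>b\<in>cells L. bump a x * bump b x' * T a b) = (\<Sum>b\<in>cells L. bump b x' * (bump a x * (c0 + A a)) - bump a x * (bump b x' * A' b))"
    by (rule sum.cong[OF refl]) (simp add: T algebra_simps)
   also have "... = (\<Sum>b\<in>cells L. bump b x') * (bump a x * (c0 + A a)) - bump a x * (\<Sum>b\<in>cells L. bump b x' * A' b)"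
    by (simp only: sum_subtractf sum_distrib_right sum_distrib_left)
   finally show ?thesis by (simp add: bump_sum)
  qed
  have "(\<Sum>a\<in>cells L. \<Sum>b\<in>cells L. bump a x * bump b x' * T a b) = (\<Sum>a\<in>cells L. bump a x * c0 + bump a x * A a - bump a x * (\<Sum>b\<in>cells L. bump b x' * A' b))"
   unfolding row by (simp add: distrib_left)
  also have "... = (\<Sum>a\<in>cells L. bump a x) * c0 + (\<Sum>a\<in>cells L. bump a x * A a) - (\<Sum>a\<in>cells L. bump a x) * (\<Sum>b\<in>cells L. bump b x' * A' b)"
   by (simp only: sum_subtractf sum.distrib sum_distrib_right)
  also have "... = c0 + (\<Sum>a\<in>cells L. bump a x * A a) - (\<Sum>b\<in>cells L. bump b x' * A' b)" by (simp add: bump_sum)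
  also have "(\<Sum>a\<in>cells L. bump a x * A a) = (\<Sum>k\<in>UNIV. ?g k * D x k)"
   unfolding A_def D_def sum_distrib_left by (subst sum.swap) (intro sum.cong refl mult.left_commute)
  also have "(\<Sum>a\<in>cells L. bump a x' * A' a) = (\<Sum>k\<in>UNIV. ?g k * D x' k)"
   unfolding A'_def D_def sum_distrib_left by (subst sum.swap) (intro sum.cong refl mult.left_commute)
  finally show ?thesis unfolding c0_def by (simp add: right_diff_distrib sum_subtractf)
 qed
 also have "(\<Sum>k\<in>UNIV. ?g k * (D x k - D x' k)) <= (\<Sum>k\<in>UNIV. 1 / dl^2 * ((\<Sum>a\<in>inner_cells L. bump a x * \<bar>barycentre a k - ep * of_int (a k)\<bar>) + (\<Sum>a\<in>inner_cells L. bump a x' * \<bar>barycentre a k - ep * of_int (a k)\<bar>)))"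
 proof (rule sum_mono)
  fix k :: 3
  have "\<bar>?g k\<bar> <= 1 / dl^2" using component_le_norm_cart[of "kern_grad dl (x - x')" k] kern_grad_bound[OF dl, of "x - x'"] by linarith
  moreover have "\<bar>D x k - D x' k\<bar> <= (\<Sum>a\<in>inner_cells L. bump a x * \<bar>barycentre a k - ep * of_int (a k)\<bar>) + (\<Sum>a\<in>inner_cells L. bump a x' * \<bar>barycentre a k - ep * of_int (a k)\<bar>)"
   using Dle[of x k] Dle[of x' k] True by linarith
  ultimately have "\<bar>?g k\<bar> * \<bar>D x k - D x' k\<bar> <= 1 / dl^2 * ((\<Sum>a\<in>inner_cells L. bump a x * \<bar>barycentre a k - ep * of_int (a k)\<bar>) + (\<Sum>a\<in>inner_cells L. bump a x' * \<bar>barycentre a k - ep * of_int (a k)\<bar>))"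
   by (intro mult_mono) simp_all
  then show "?g k * (D x k - D x' k) <= 1 / dl^2 * ((\<Sum>a\<in>inner_cells L. bump a x * \<bar>barycentre a k - ep * of_int (a k)\<bar>) + (\<Sum>a\<in>inner_cells L. bump a x' * \<bar>barycentre a k - ep * of_int (a k)\<bar>))"
   using abs_ge_self[of "?g k * (D x k - D x' k)"] unfolding abs_mult by linarith
 qed
 also have "... = (\<Sum>k\<in>UNIV. \<Sum>a\<in>inner_cells L. bump a x * \<bar>barycentre a k - ep * of_int (a k)\<bar>) / dl^2 + (\<Sum>k\<in>UNIV. \<Sum>a\<in>inner_cells L. bump a x' * \<bar>barycentre a k - ep * of_int (a k)\<bar>) / dl^2"
  by (simp only: sum_distrib_left[symmetric] sum.distrib) (simp add: add_divide_distrib)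
 also have "... <= err dl x + err dl x'"
  unfolding err_def using dl by (intro add_mono) (simp_all add: indicator_def)
 finally show ?thesis by simp
qed

end

context cell_partition begin

text \<open>Admissibility prescribes the law of a single particle on Borel sets, and so all its
  integrals.\<close>

lemma plan_marginal:
 fixes P :: "(real^3^'n::finite) measure"
 assumes P: "OT_admissible P \<rho>" and [measurable]: "h \<in> borel_measurable borel"
 shows "(\<integral>x. h (x $ j) \<partial>P) = (\<integral>y. \<rho> y * h y \<partial>lborel) / real CARD('n)"
proof -
 have sP: "sets P = sets borel" using P by (simp add: OT_admissible_def)
 note [measurable_cong] = sP
 let ?N = "real CARD('n)"
 have "distr P borel (%x. x $ j) = density lborel (%y. ennreal (\<rho> y / ?N))"
 proof (rule measure_eqI)
  fix A assume "A \<in> sets (distr P borel (%x. x $ j))"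
  then have A[measurable]: "A \<in> sets borel" by simp
  have "emeasure (density lborel (%y. ennreal (\<rho> y / ?N))) A = (\<integral>\<^sup>+y. ennreal (1 / ?N) * (ennreal (\<rho> y) * indicator A y) \<partial>lborel)"
   by (subst emeasure_density) (use rho_nonneg in "auto intro!: nn_integral_cong simp: ennreal_mult[symmetric] mult.assoc[symmetric]")
  also have "... = ennreal (1 / ?N) * (\<integral>\<^sup>+y. ennreal (\<rho> y) * indicator A y \<partial>lborel)" by (rule nn_integral_cmult) measurable
  also have "(\<integral>\<^sup>+y. ennreal (\<rho> y) * indicator A y \<partial>lborel) = ennreal ?N * emeasure P {x \<in> space P. x $ j \<in> A}"
   using P A unfolding OT_admissible_def by (simp add: ennreal_of_nat_eq_real_of_nat)
  also have "ennreal (1 / ?N) * (ennreal ?N * emeasure P {x \<in> space P. x $ j \<in> A}) = emeasure P {x \<in> space P. x $ j \<in> A}"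
   unfolding mult.assoc[symmetric] ennreal_mult[symmetric, OF divide_nonneg_nonneg[OF zero_le_one of_nat_0_le_iff] of_nat_0_le_iff] by simp
  also have "... = emeasure (distr P borel (%x. x $ j)) A"
   by (subst emeasure_distr) (auto simp: vimage_def Int_def conj_commute)
  finally show "emeasure (distr P borel (%x. x $ j)) A = emeasure (density lborel (%y. ennreal (\<rho> y / ?N))) A" by simp
 qed simp
 moreover have "(\<integral>x. h (x $ j) \<partial>P) = (\<integral>y. h y \<partial>distr P borel (%x. x $ j))" by (rule integral_distr[symmetric]) measurable
 moreover have "(\<integral>y. h y \<partial>density lborel (%y. ennreal (\<rho> y / ?N))) = (\<integral>y. (\<rho> y / ?N) *\<^sub>R h y \<partial>lborel)"
  by (rule integral_density) (use rho_nonneg in auto)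
 ultimately show ?thesis by simp
qed

text \<open>The probability of a cell configuration when positions are drawn from the plan and each
  particle then chooses its cell independently, with the bumps at its position as
  probabilities.\<close>

definition weight :: "(real^3^'n::finite) measure => ('n => 3 => int) => real" where
 "weight P c = (\<integral>x. (\<Prod>l\<in>UNIV. bump (c l) (x $ l)) \<partial>P)"

abbreviation configs :: "('n::finite => 3 => int) set" where
 "configs \<equiv> PiE UNIV (%_. cells L)"

lemma weight_nonneg: "0 <= weight P c"
 unfolding weight_def by (intro Bochner_Integration.integral_nonneg prod_nonneg) (simp add: bump_bounds)

lemma sum_weight:
 fixes P :: "(real^3^'n::finite) measure"
 assumes P: "OT_admissible P \<rho>"
 shows "(\<Sum>c\<in>configs. weight P c * k c) = (\<integral>x. (\<Sum>c\<in>configs. (\<Prod>l\<in>UNIV. bump (c l) (x $ l)) * k c) \<partial>P)"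
  and "integrable P (%x. \<Sum>c\<in>configs. (\<Prod>l\<in>UNIV. bump (c l) (x $ l)) * k c)"
proof -
 interpret prob_space P using P by (simp add: OT_admissible_def)
 have sP[measurable_cong]: "sets P = sets borel" using P by (simp add: OT_admissible_def)
 have i: "integrable P (%x. (\<Prod>l\<in>UNIV. bump (c l) (x $ l)) * k c)" for c :: "'n => 3 => int"
 proof (rule integrable_mult_left, rule integrable_const_bound[of _ 1])
  have "(\<Prod>l\<in>UNIV. bump (c l) (x $ l)) <= 1" "0 <= (\<Prod>l\<in>UNIV. bump (c l) (x $ l))" for x
   by (auto intro!: prod_le_1 prod_nonneg simp: bump_bounds)
  then show "AE x in P. norm (\<Prod>l\<in>UNIV. bump (c l) (x $ l)) <= 1" by simp
 qed measurable
 show "integrable P (%x. \<Sum>c\<in>configs. (\<Prod>l\<in>UNIV. bump (c l) (x $ l)) * k c)" by (rule Bochner_Integration.integrable_sum) (rule i)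
 show "(\<Sum>c\<in>configs. weight P c * k c) = (\<integral>x. (\<Sum>c\<in>configs. (\<Prod>l\<in>UNIV. bump (c l) (x $ l)) * k c) \<partial>P)"
  unfolding weight_def by (subst Bochner_Integration.integral_sum) (rule i, simp)
qed

lemma weight_total:
 fixes P :: "(real^3^'n::finite) measure"
 assumes P: "OT_admissible P \<rho>"
 shows "(\<Sum>c\<in>configs. weight P c) = 1"
proof -
 interpret prob_space P using P by (simp add: OT_admissible_def)
 show ?thesis using sum_weight(1)[OF P, of "%_. 1"] sum_product_weights_all[of "cells L" "%l a. bump a (x $ l)" for x :: "real^3^'n", OF finite_cells(1) bump_sum]
  by (simp add: prob_space)
qed

lemma weight_marginal:
 fixes P :: "(real^3^'n::finite) measure"
 assumes P: "OT_admissible P \<rho>" and a: "a \<in> cells L"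
 shows "(\<Sum>c\<in>configs. weight P c * (if c i = a then 1 else 0)) = mass a / real CARD('n)"
proof -
 have "(\<Sum>c\<in>configs. weight P c * (if c i = a then 1 else 0)) = (\<integral>x. bump a (x $ i) \<partial>P)"
  unfolding sum_weight(1)[OF P] using sum_product_weights_single[of "cells L" "%l a. bump a (x $ l)" for x :: "real^3^'n", OF finite_cells(1) bump_sum a, where i=i]
  by simp
 also have "... = mass a / real CARD('n)" unfolding mass_def by (rule plan_marginal[OF P]) measurable
 finally show ?thesis .
qed

text \<open>The pointwise estimate is integrated against the plan. The truncated kernel lies below
  the Coulomb kernel, the one-particle marginals of the plan add up to \<open>\<rho>\<close>, and
  halving the sum over ordered pairs turns 1944 into 972.\<close>

lemma weight_energy:
 fixes P :: "(real^3^'n::finite) measure"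
 assumes P: "OT_admissible P \<rho>" and fin: "(\<integral>\<^sup>+x. coulomb x \<partial>P) < top" and dl: "0 < dl"
 shows "(\<Sum>c\<in>configs. weight P c * pair_energy (Q dl) c) <= enn2real (\<integral>\<^sup>+x. coulomb x \<partial>P)
  + real CARD('n) * (\<integral>x. \<rho> x * err dl x \<partial>lborel) + 972 * (real CARD('n))^2 * ep^2 / dl ^ 3"
proof -
 interpret prob_space P using P by (simp add: OT_admissible_def)
 have sP[measurable_cong]: "sets P = sets borel" using P by (simp add: OT_admissible_def)
 let ?N = "real CARD('n)" and ?c = "1944 * ep^2 / dl ^ 3"
 define K where "K x = (\<Sum>i\<in>UNIV. \<Sum>j\<in>UNIV. if i ~= j then kern dl (x $ i - x $ j) else 0) / 2" for x :: "real^3^'n"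
 have Km[measurable]: "K \<in> borel_measurable borel" unfolding K_def[abs_def] by measurable
 have K0: "0 <= K x" for x unfolding K_def using kern_nonneg[OF dl] by (intro divide_nonneg_pos sum_nonneg) auto
 have Kb: "K x <= (\<Sum>i\<in>(UNIV :: 'n set). \<Sum>j\<in>(UNIV :: 'n set). 1 / dl) / 2" for x
  unfolding K_def by (intro divide_right_mono sum_mono) (use kern_le[OF dl] dl in auto)
 have iK: "integrable P K" by (rule integrable_const_bound[of _ "(\<Sum>i\<in>(UNIV :: 'n set). \<Sum>j\<in>(UNIV :: 'n set). 1 / dl) / 2"]) (use K0 Kb in auto)
 have ie: "integrable P (%x. err dl (x $ i))" for i
  by (rule integrable_const_bound[OF AE_I2]) (use err_bounded[OF dl] in auto)
 have Kc: "ennreal (K x) <= coulomb x" for x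
 proof -
  have "K x = (\<Sum>p\<in>UNIV \<times> UNIV. if fst p ~= snd p then kern dl (x $ fst p - x $ snd p) else 0) / 2"
   unfolding K_def by (subst sum.cartesian_product) (simp add: case_prod_beta)
  also have "... = (\<Sum>p\<in>{(j, k). j ~= k}. kern dl (x $ fst p - x $ snd p)) / 2"
   by (intro arg_cong2[of _ _ _ _ "(/)"] refl sum.mono_neutral_cong_right) auto
  finally have e: "K x = (\<Sum>p\<in>{(j, k). j ~= k}. kern dl (x $ fst p - x $ snd p)) / 2" .
  have "ennreal (K x) = ennreal (\<Sum>p\<in>{(j, k). j ~= k}. kern dl (x $ fst p - x $ snd p)) / 2"
   unfolding e by (rule ennreal_divide_numeral[symmetric]) (intro sum_nonneg kern_nonneg dl)
  also have "... = (\<Sum>p\<in>{(j, k). j ~= k}. ennreal (kern dl (x $ fst p - x $ snd p))) / 2"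
   by (simp only: sum_ennreal[OF kern_nonneg[OF dl]])
  also have "... <= (\<Sum>p\<in>{(j, k). j ~= k}. inverse (ennreal (dist (x $ fst p) (x $ snd p)))) / 2"
   by (intro divide_right_mono_ennreal sum_mono ennreal_kern_le[OF dl])
  finally show ?thesis by (simp add: coulomb_def split_def)
 qed
 have IK: "(\<integral>x. K x \<partial>P) <= enn2real (\<integral>\<^sup>+x. coulomb x \<partial>P)"
 proof -
  have "ennreal (\<integral>x. K x \<partial>P) = (\<integral>\<^sup>+x. ennreal (K x) \<partial>P)" by (rule nn_integral_eq_integral[symmetric, OF iK]) (simp add: K0)
  also have "... <= (\<integral>\<^sup>+x. coulomb x \<partial>P)" by (rule nn_integral_mono) (rule Kc)
  finally have "enn2real (ennreal (\<integral>x. K x \<partial>P)) <= enn2real (\<integral>\<^sup>+x. coulomb x \<partial>P)" by (rule enn2real_mono) (rule fin)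
  moreover have "0 <= (\<integral>x. K x \<partial>P)" by (rule Bochner_Integration.integral_nonneg) (rule K0)
  ultimately show ?thesis by simp
 qed
 have pt: "(\<Sum>c\<in>configs. (\<Prod>l\<in>UNIV. bump (c l) (x $ l)) * pair_energy (Q dl) c) <= K x + (?N * (\<Sum>i\<in>UNIV. err dl (x $ i)) + ?N^2 * ?c / 2)" for x :: "real^3^'n"
 proof -
  let ?b = "%c. \<Prod>l\<in>UNIV. bump (c l) (x $ l)"
  have half: "(\<Sum>c\<in>configs. ?b c * pair_energy (Q dl) c) = (\<Sum>c\<in>configs. \<Sum>i\<in>UNIV. \<Sum>j\<in>UNIV. if i ~= j then ?b c * Q dl (c i) (c j) else 0) / 2"
   unfolding pair_energy_def times_divide_eq_right sum_divide_distrib[symmetric] sum_distrib_left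
   by (intro arg_cong2[of _ _ _ _ "(/)"] refl sum.cong) auto
  have "(\<Sum>c\<in>configs. \<Sum>i\<in>UNIV. \<Sum>j\<in>UNIV. if i ~= j then ?b c * Q dl (c i) (c j) else 0)
   = (\<Sum>i\<in>UNIV. \<Sum>j\<in>UNIV. \<Sum>c\<in>configs. if i ~= j then ?b c * Q dl (c i) (c j) else 0)"
   by (subst sum.swap) (intro sum.cong refl sum.swap)
  also have "... <= (\<Sum>i\<in>UNIV. \<Sum>j\<in>UNIV. (if i ~= j then kern dl (x $ i - x $ j) else 0) + (err dl (x $ i) + err dl (x $ j) + ?c))"
  proof (intro sum_mono)
   fix i j :: 'n
   show "(\<Sum>c\<in>configs. if i ~= j then ?b c * Q dl (c i) (c j) else 0) <= (if i ~= j then kern dl (x $ i - x $ j) else 0) + (err dl (x $ i) + err dl (x $ j) + ?c)"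
   proof (cases "i = j")
    case True
    then show ?thesis using err_nonneg[OF dl] dl by simp
   next
    case False
    have "(\<Sum>c\<in>configs. ?b c * Q dl (c i) (c j)) = (\<Sum>a\<in>cells L. \<Sum>b\<in>cells L. bump a (x $ i) * bump b (x $ j) * Q dl a b)"
     by (rule sum_product_weights_pair[of "cells L" "%l a. bump a (x $ l)", OF finite_cells(1) bump_sum False])
    also have "... <= kern dl (x $ i - x $ j) + err dl (x $ i) + err dl (x $ j) + ?c" by (rule cell_energy_pointwise[OF dl])
    finally show ?thesis using False by simp
   qed
  qed
  also have "... = (\<Sum>i\<in>UNIV. \<Sum>j\<in>UNIV. if i ~= j then kern dl (x $ i - x $ j) else 0) + (?N * (\<Sum>i\<in>UNIV. err dl (x $ i)) + ?N * (\<Sum>i\<in>UNIV. err dl (x $ i)) + ?N * (?N * ?c))"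
   by (simp only: sum.distrib sum_constant sum_distrib_left[symmetric])
  finally have le: "(\<Sum>c\<in>configs. \<Sum>i\<in>UNIV. \<Sum>j\<in>UNIV. if i ~= j then ?b c * Q dl (c i) (c j) else 0) <= (\<Sum>i\<in>UNIV. \<Sum>j\<in>UNIV. if i ~= j then kern dl (x $ i - x $ j) else 0) + (?N * (\<Sum>i\<in>UNIV. err dl (x $ i)) + ?N * (\<Sum>i\<in>UNIV. err dl (x $ i)) + ?N * (?N * ?c))" .
  have lin: "s / 2 <= k / 2 + (e + ?N^2 * c / 2)" if "s <= k + (e + e + ?N * (?N * c))" for s k e c :: real
   using that by (simp add: power2_eq_square mult.assoc)
  show ?thesis unfolding half K_def by (rule lin[OF le])
 qed
 have i1: "integrable P (%x. ?N * (\<Sum>i\<in>UNIV. err dl (x $ i)))" by (intro integrable_mult_right Bochner_Integration.integrable_sum ie)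
 have "(\<Sum>c\<in>configs. weight P c * pair_energy (Q dl) c) <= (\<integral>x. K x + (?N * (\<Sum>i\<in>UNIV. err dl (x $ i)) + ?N^2 * ?c / 2) \<partial>P)"
  unfolding sum_weight(1)[OF P]
  by (rule integral_mono[OF sum_weight(2)[OF P] Bochner_Integration.integrable_add[OF iK Bochner_Integration.integrable_add[OF i1 integrable_const]] pt])
 also have "... = (\<integral>x. K x \<partial>P) + ((\<integral>x. ?N * (\<Sum>i\<in>UNIV. err dl (x $ i)) \<partial>P) + ?N^2 * ?c / 2)"
  by (simp only: Bochner_Integration.integral_add[OF iK Bochner_Integration.integrable_add[OF i1 integrable_const]]
   Bochner_Integration.integral_add[OF i1 integrable_const] lebesgue_integral_const prob_space) simp
 also have "(\<integral>x. ?N * (\<Sum>i\<in>UNIV. err dl (x $ i)) \<partial>P) = ?N * (\<integral>x. \<rho> x * err dl x \<partial>lborel)"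
 proof -
  have "(\<integral>x. (\<Sum>i\<in>UNIV. err dl (x $ i)) \<partial>P) = (\<Sum>i\<in>UNIV. \<integral>x. err dl (x $ i) \<partial>P)" by (rule Bochner_Integration.integral_sum) (rule ie)
  also have "... = (\<Sum>i\<in>(UNIV :: 'n set). (\<integral>x. \<rho> x * err dl x \<partial>lborel) / ?N)" by (rule sum.cong[OF refl], rule plan_marginal[OF P]) measurable
  finally show ?thesis by simp
 qed
 finally show ?thesis using IK by (simp add: mult_ac)
qed

end

section \<open>Separation of the particles\<close>

lemma norm_le_components:
 fixes v :: "real^3"
 assumes "!!k. \<bar>v $ k\<bar> <= d"
 shows "norm v <= 3 * d"
proof -
 have "norm v <= (\<Sum>k\<in>UNIV. \<bar>v $ k\<bar>)" by (rule norm_le_l1_cart)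
 also have "... <= (\<Sum>k\<in>(UNIV :: 3 set). d)" by (rule sum_mono) (rule assms)
 finally show ?thesis by simp
qed

context cell_partition begin

definition near_cells :: "real => (3 => int) => (3 => int) => bool" where
 "near_cells d a b \<longleftrightarrow> (EX y z. cell_fun ep L a y ~= 0 & cell_fun ep L b z ~= 0 & dist y z < d)"

definition tail :: real where
 "tail = (\<integral>x. \<rho> x * indicat_real {x. ep * (of_int L - 3) < norm x} x \<partial>lborel)"

lemma inner_centre:
 assumes "a \<in> inner_cells L" "!!k. \<bar>y $ k - ep * of_int (a k)\<bar> <= 3/2 * ep"
 shows "dist y (\<chi> k. ep * of_int (a k)) <= 9/2 * ep"
 unfolding dist_norm using norm_le_components[of "y - (\<chi> k. ep * of_int (a k))" "3/2 * ep"] assms(2) by simp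

text \<open>Points of one inner cell are at most \<open>9 * ep\<close> apart, so points of two near
  ones are within \<open>dl + 18 * ep\<close>, which is at most \<open>2 * dl\<close>. Near cells
  thus carry a definite interaction energy.\<close>

lemma near_inner_cells:
 assumes nr: "near_cells dl a b" and a: "a \<in> inner_cells L" and b: "b \<in> inner_cells L" and e: "18 * ep <= dl"
 shows "1 / (2 * dl) <= Q dl a b"
proof -
 have dl: "0 < dl" using e eps by linarith
 obtain y' z' where yz: "cell_fun ep L a y' ~= 0" "cell_fun ep L b z' ~= 0" "dist y' z' < dl" using nr by (auto simp: near_cells_def)
 note y' = inner_centre[OF a inner_cell_support[OF eps a yz(1)]] and z' = inner_centre[OF b inner_cell_support[OF eps b yz(2)]]
 show ?thesis
 proof (rule kern_avg_lower[OF dl prob_cell_measure sets_cell_measure prob_cell_measure sets_cell_measure AE_inner_cell[OF a] AE_inner_cell[OF b]])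
  fix y z :: "real^3"
  assume "ALL k. \<bar>y $ k - ep * of_int (a k)\<bar> <= 3/2 * ep" "ALL k. \<bar>z $ k - ep * of_int (b k)\<bar> <= 3/2 * ep"
  then have y: "dist y (\<chi> k. ep * of_int (a k)) <= 9/2 * ep" and z: "dist z (\<chi> k. ep * of_int (b k)) <= 9/2 * ep"
   using inner_centre[OF a, of y] inner_centre[OF b, of z] by blast+
  have "dist y y' <= 9 * ep" "dist z z' <= 9 * ep"
   using dist_triangle2[of y y' "\<chi> k. ep * of_int (a k)"] dist_triangle2[of z z' "\<chi> k. ep * of_int (b k)"] y z y' z' by linarith+
  then have "dist y z <= 2 * dl"
   using dist_triangle[of y z y'] dist_triangle[of y' z z'] yz(3) e dist_commute[of z z'] by linarith
  then show "1 / (2 * dl) <= kern dl (y - z)" using dl by (intro kern_ge) (simp_all add: dist_norm)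
 qed
qed

text \<open>Cells near \<open>a\<close> are contained in a fixed ball or lie far out, so the
  smallness of \<open>\<rho>\<close> on such sets bounds their total mass. The condition
  \<open>18 * ep \<le> d\<close> absorbs the diameters of inner cells.\<close>

lemma near_mass:
 assumes a: "a \<in> cells L" and e: "18 * ep <= d"
  and small: "!!z. (\<integral>x. \<rho> x * indicat_real (ball z (3 * d) \<union> {y. ep * (of_int L - 3) - 2 * d < norm y}) x \<partial>lborel) <= c"
 shows "(\<Sum>b\<in>cells L. mass b * (if near_cells d a b then 1 else 0)) <= c"
proof -
 have d: "0 < d" using e eps by linarith
 let ?R = "ep * (of_int L - 3)"
 have out: "?R < norm y" if "b \<in> cells L" "b \<notin> inner_cells L" "cell_fun ep L b y ~= 0" for b y
  by (rule outer_cell_support[OF eps that])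
 \<comment> \<open>The lattice point of \<open>a\<close> serves as centre in every case. If
   \<open>a\<close> or \<open>b\<close> is an outer cell, the point \<open>y\<close> is far out, up
   to \<open>2 * d\<close>; otherwise \<open>y\<close> is within \<open>3 * d\<close> of the
   centre.\<close>
 have "EX z. \<forall>b\<in>cells L. ALL y. cell_fun ep L b y ~= 0 --> near_cells d a b --> y \<in> ball z (3 * d) \<union> {y. ?R - 2 * d < norm y}"
 proof (intro exI ballI allI impI)
  fix b y assume b: "b \<in> cells L" and y: "cell_fun ep L b y ~= 0" and nr: "near_cells d a b"
  obtain y0 z0 where yz: "cell_fun ep L a y0 ~= 0" "cell_fun ep L b z0 ~= 0" "dist y0 z0 < d" using nr by (auto simp: near_cells_def)
  show "y \<in> ball (\<chi> k. ep * of_int (a k)) (3 * d) \<union> {y. ?R - 2 * d < norm y}"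
  proof (cases "b \<in> inner_cells L")
   case False
   then show ?thesis using out[OF b False y] d by simp
  next
   case True
   have yz0: "dist y z0 <= 9 * ep"
    using dist_triangle2[of y z0 "\<chi> k. ep * of_int (b k)"] inner_centre[OF True inner_cell_support[OF eps True y]] inner_centre[OF True inner_cell_support[OF eps True yz(2)]] by linarith
   then have yy: "dist y0 y <= 9 * ep + d" using dist_triangle[of y0 y z0] yz(3) dist_commute[of y z0] by linarith
   show ?thesis
   proof (cases "a \<in> inner_cells L")
    case True
    have "dist (\<chi> k. ep * of_int (a k)) y < 3 * d"
     using dist_triangle[of "\<chi> k. ep * of_int (a k)" y y0] inner_centre[OF True inner_cell_support[OF eps True yz(1)]] yy e d
      dist_commute[of y0 "\<chi> k. ep * of_int (a k)"] by linarith
    then show ?thesis by simp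
   next
    case False
    have "norm y0 <= norm y + dist y0 y" using norm_triangle_sub[of y0 y] by (simp add: dist_norm)
    then show ?thesis using out[OF a False yz(1)] yy e d by simp
   qed
  qed
 qed
 then obtain z where z: "!!b y. b \<in> cells L ==> cell_fun ep L b y ~= 0 ==> near_cells d a b ==> y \<in> ball z (3 * d) \<union> {y. ?R - 2 * d < norm y}" by blast
 let ?S = "ball z (3 * d) \<union> {y. ?R - 2 * d < norm y}"
 have Sm[measurable]: "?S \<in> sets borel" by measurable
 have "(\<Sum>b\<in>cells L. mass b * (if near_cells d a b then 1 else 0)) = (\<integral>x. \<rho> x * (\<Sum>b\<in>cells L. bump b x * (if near_cells d a b then 1 else 0)) \<partial>lborel)" by (rule sum_mass)
 also have "... <= (\<integral>x. \<rho> x * indicat_real ?S x \<partial>lborel)"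
 proof (rule integral_mono)
  have b1: "(\<Sum>b\<in>cells L. bump b x * (if near_cells d a b then 1 else 0)) <= 1" for x
  by (rule order_trans[OF sum_mono eq_refl[OF bump_sum[of x]]]) (simp add: bump_bounds)
  moreover have "0 <= (\<Sum>b\<in>cells L. bump b x * (if near_cells d a b then 1 else 0))" for x by (rule sum_nonneg) (simp add: bump_bounds)
  ultimately show "integrable lborel (%x. \<rho> x * (\<Sum>b\<in>cells L. bump b x * (if near_cells d a b then 1 else 0)))"
   by (intro rho_bounded_integrable[of _ 1]) simp_all
  show "integrable lborel (%x. \<rho> x * indicat_real ?S x)" by (rule rho_bounded_integrable[of _ 1]) (auto simp: indicator_def)
  fix x
  have "(\<Sum>b\<in>cells L. bump b x * (if near_cells d a b then 1 else 0)) <= indicat_real ?S x"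
  proof (cases "x \<in> ?S")
   case True
   then show ?thesis using b1[of x] by simp
  next
   case False
   have "(\<Sum>b\<in>cells L. bump b x * (if near_cells d a b then 1 else 0)) = 0"
    by (rule sum.neutral) (use z False in "auto simp: bump_def")
   then show ?thesis by simp
  qed
  then show "\<rho> x * (\<Sum>b\<in>cells L. bump b x * (if near_cells d a b then 1 else 0)) <= \<rho> x * indicat_real ?S x" by (rule mult_left_mono[OF _ rho_nonneg])
 qed
 also have "... <= c" by (rule small)
 finally show ?thesis .
qed

text \<open>The outer cells are supported beyond the radius that defines \<open>tail\<close>, and
  the bumps add up to at most 1 there.\<close>

lemma outer_mass_le: "(\<Sum>a\<in>cells L. mass a * (if a \<in> inner_cells L then 0 else 1)) <= tail"
 unfolding sum_mass tail_def
proof (rule integral_mono)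
 have b1: "(\<Sum>b\<in>cells L. bump b x * (if b \<in> inner_cells L then 0 else 1)) <= 1" for x
  by (rule order_trans[OF sum_mono eq_refl[OF bump_sum[of x]]]) (simp add: bump_bounds)
 moreover have "0 <= (\<Sum>b\<in>cells L. bump b x * (if b \<in> inner_cells L then 0 else 1))" for x by (rule sum_nonneg) (simp add: bump_bounds)
 ultimately show "integrable lborel (%x. \<rho> x * (\<Sum>b\<in>cells L. bump b x * (if b \<in> inner_cells L then 0 else 1)))"
  by (intro rho_bounded_integrable[of _ 1]) simp_all
 show "integrable lborel (%x. \<rho> x * indicat_real {x. ep * (of_int L - 3) < norm x} x)" by (rule rho_bounded_integrable[of _ 1]) (auto simp: indicator_def)
 fix x
 have "(\<Sum>b\<in>cells L. bump b x * (if b \<in> inner_cells L then 0 else 1)) <= indicat_real {x. ep * (of_int L - 3) < norm x} x"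
 proof (cases "ep * (of_int L - 3) < norm x")
  case True
  then show ?thesis using b1[of x] by simp
 next
  case False
  have "(\<Sum>b\<in>cells L. bump b x * (if b \<in> inner_cells L then 0 else 1)) = 0"
   by (rule sum.neutral) (use outer_cell_support[OF eps, of _ L x] False in "auto simp: bump_def")
  then show ?thesis by simp
 qed
 then show "\<rho> x * (\<Sum>b\<in>cells L. bump b x * (if b \<in> inner_cells L then 0 else 1)) <= \<rho> x * indicat_real {x. ep * (of_int L - 3) < norm x} x" by (rule mult_left_mono[OF _ rho_nonneg])
qed

text \<open>Configurations with two near cells are exchanged away. Their interaction energy pays for the exchange,
 except when an outer cell takes part.\<close>

lemma separated_weights:
 fixes P :: "(real^3^'n::finite) measure"
 assumes P: "OT_admissible P \<rho>" and E: "(\<Sum>c\<in>configs. weight P c * pair_energy (Q dl) (c :: 'n => 3 => int)) <= E"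
  and e: "18 * ep <= dl" and d: "8 * (real CARD('n))^2 * dl <= d"
  and markov: "4 * dl * E + tail <= 1 / (4 * real CARD('n))"
  and small: "!!z. (\<integral>x. \<rho> x * indicat_real (ball z (3 * d) \<union> {y. ep * (of_int L - 3) - 2 * d < norm y}) x \<partial>lborel) <= 1 / (8 * real CARD('n))"
 shows "EX W q. (\<forall>c\<in>configs. 0 <= W c & (W c ~= 0 --> (ALL i j. i ~= j --> ~ near_cells dl (c i) (c j)))) &
  (\<forall>i :: 'n. \<forall>a\<in>cells L. (\<Sum>c\<in>configs. W c * (if c i = a then 1 else 0)) = mass a / real CARD('n)) &
  (ALL a b. 0 <= q a b & (0 < mass a --> 0 < mass b --> Q dl a b <= q a b)) &
  (\<Sum>c\<in>configs. W c * pair_energy q c) <= E + 2 * (real CARD('n))^2 / d * tail"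
proof -
 let ?N = "real CARD('n)"
 have N1: "1 <= ?N" using zero_less_card_finite[where 'a='n] by linarith
 have dl: "0 < dl" using e eps by linarith
 have "1 <= ?N^2" using N1 by (simp add: one_le_power)
 then have "8 * 1 * dl <= 8 * ?N^2 * dl" using dl by (intro mult_right_mono) auto
 then have dld: "dl <= d" and dpos: "0 < d" using d dl by linarith+
 \<comment> \<open>The price of exchanging a unit of weight is at most the least energy of a bad
   configuration of inner cells. This is what ties \<open>dl\<close> to
   \<open>d / N^2\<close>.\<close>
 have gap: "2 * ?N^2 * (1 / d) <= 1 / (4 * dl)" using d dl dpos by (simp add: divide_simps mult.commute)
 \<comment> \<open>The minimum makes the bound \<open>1 / d\<close> for separated cells hold without
   reference to masses. For cells of positive mass it changes nothing, since their averaged kernel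
   obeys this bound anyway.\<close>
 define q where "q a b = (if near_cells d a b then Q dl a b else min (Q dl a b) (1 / d))" for a b
 have q0: "0 <= q a b" for a b using Q_facts(5)[OF dl, of a b] dpos by (simp add: q_def)
 have qQ: "q a b <= Q dl a b" for a b by (simp add: q_def)
 have badclose: "near_cells dl a b ==> near_cells d a b" for a b using dld by (auto simp: near_cells_def intro: less_le_trans)
 define out where "out a = (if a \<in> inner_cells L then 0 else (1::real))" for a
 let ?good = "%c :: 'n => 3 => int. ALL i j. i ~= j --> ~ near_cells dl (c i) (c j)"
 have out0: "0 <= out a" for a by (simp add: out_def)
 have pe0: "0 <= pair_energy q c" for c :: "'n => 3 => int" using pair_energy_nonneg[of q c] q0 by blast
 have peQ: "pair_energy q c <= pair_energy (Q dl) c" for c :: "'n => 3 => int"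
  unfolding pair_energy_def by (intro divide_right_mono sum_mono) (simp_all add: qQ)
 \<comment> \<open>A bad configuration of inner cells has energy at least
   \<open>1 / (4 * dl)\<close>, half of the interaction \<open>1 / (2 * dl)\<close> of its near pair
   because of the halving in \<open>pair_energy\<close>. The alternative is that it contains an
   outer cell.\<close>
 have gain: "1 / (4 * dl) <= pair_energy q c | 1 <= (\<Sum>i\<in>UNIV. out (c i))" if bad: "~ ?good c" for c :: "'n => 3 => int"
 proof (cases "ALL i. c i \<in> inner_cells L")
  case True
  obtain i j where ij: "i ~= j" "near_cells dl (c i) (c j)" using bad by blast
  have "1 / (2 * dl) <= q (c i) (c j)" using near_inner_cells[OF ij(2) _ _ e] True badclose[OF ij(2)] by (simp add: q_def)
  also have "... <= (\<Sum>l\<in>UNIV. if i ~= l then q (c i) (c l) else 0)"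
   using member_le_sum[of j UNIV "%l. if i ~= l then q (c i) (c l) else 0"] q0 ij(1) by auto
  also have "... <= (\<Sum>k\<in>UNIV. \<Sum>l\<in>UNIV. if k ~= l then q (c k) (c l) else 0)"
   by (rule member_le_sum[of i UNIV "%k. \<Sum>l\<in>UNIV. if k ~= l then q (c k) (c l) else 0"]) (use q0 in "auto intro!: sum_nonneg")
  finally show ?thesis using dl unfolding pair_energy_def by simp
 next
  case False
  then obtain i where "c i \<notin> inner_cells L" by blast
  then have "1 <= out (c i)" by (simp add: out_def)
  also have "... <= (\<Sum>i\<in>UNIV. out (c i))" by (rule member_le_sum) (auto simp: out0)
  finally show ?thesis by blast
 qed
 have fin: "finite (configs :: ('n => 3 => int) set)" by (intro finite_PiE) auto
 have Wq: "(\<Sum>c\<in>configs. weight P c * pair_energy q c) <= E"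
  using E by (rule order_trans[rotated]) (intro sum_mono mult_left_mono peQ weight_nonneg)
 have Wout: "(\<Sum>c\<in>configs. weight P c * (\<Sum>i\<in>UNIV. out (c i))) <= tail"
 proof -
  have "(\<Sum>c\<in>configs. weight P c * (\<Sum>i\<in>UNIV. out (c i))) = (\<Sum>c\<in>configs. \<Sum>i\<in>UNIV. weight P c * out (c i))" by (simp only: sum_distrib_left)
  also have "... = (\<Sum>i\<in>UNIV. \<Sum>c\<in>configs. weight P c * out (c i))" by (rule sum.swap)
  also have "... = (\<Sum>i\<in>(UNIV :: 'n set). \<Sum>a\<in>cells L. mass a / ?N * out a)"
   by (rule sum.cong[OF refl], rule marginal_sum[OF finite_cells(1)], rule weight_marginal[OF P])
  also have "... = (\<Sum>a\<in>cells L. mass a * out a)"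
  proof -
   have c: "?N * (m / ?N * t) = m * t" for m t using N1 by simp
   show ?thesis by (simp only: sum_constant sum_distrib_left c)
  qed
  also have "... <= tail" unfolding out_def by (rule outer_mass_le)
  finally show ?thesis .
 qed
 \<comment> \<open>Markov's inequality for the energy, together with the mass of the outer cells,
   bounds the weight of bad configurations.\<close>
 have pN: "(\<Sum>c\<in>{c \<in> configs. ~ ?good c}. weight P c) <= 1 / (4 * ?N)"
 proof -
  have "(\<Sum>c\<in>{c \<in> configs. ~ ?good c}. weight P c) <= (\<Sum>c\<in>{c \<in> configs. ~ ?good c}. weight P c * (4 * dl * pair_energy q c + (\<Sum>i\<in>UNIV. out (c i))))"
  proof (rule sum_mono)
   fix c assume "c \<in> {c \<in> configs. ~ ?good c}"
   then have "1 / (4 * dl) <= pair_energy q c | 1 <= (\<Sum>i\<in>UNIV. out (c i))" by (intro gain) simp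
   moreover have "0 <= (\<Sum>i\<in>UNIV. out (c i))" by (intro sum_nonneg out0)
   moreover have "0 <= 4 * dl * pair_energy q c" using dl pe0[of c] by simp
   moreover have "1 <= 4 * dl * pair_energy q c" if "1 / (4 * dl) <= pair_energy q c" using that dl by (simp add: divide_le_eq mult.commute)
   ultimately have "1 <= 4 * dl * pair_energy q c + (\<Sum>i\<in>UNIV. out (c i))" by linarith
   then show "weight P c <= weight P c * (4 * dl * pair_energy q c + (\<Sum>i\<in>UNIV. out (c i)))"
    using mult_left_mono[OF _ weight_nonneg[of P c], of 1] by simp
  qed
  also have "... <= (\<Sum>c\<in>configs. weight P c * (4 * dl * pair_energy q c + (\<Sum>i\<in>UNIV. out (c i))))"
  proof (rule sum_mono2[OF fin])
   show "0 <= weight P c * (4 * dl * pair_energy q c + (\<Sum>i\<in>UNIV. out (c i)))" for c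
    using dl by (intro mult_nonneg_nonneg add_nonneg_nonneg sum_nonneg weight_nonneg pe0 out0) simp_all
  qed auto
  also have "... = 4 * dl * (\<Sum>c\<in>configs. weight P c * pair_energy q c) + (\<Sum>c\<in>configs. weight P c * (\<Sum>i\<in>UNIV. out (c i)))"
   by (simp only: distrib_left sum.distrib mult.left_commute[of "weight P _"] sum_distrib_left)
  also have "... <= 4 * dl * E + tail" using dl by (intro add_mono mult_left_mono Wq Wout) simp
  finally show ?thesis using markov by linarith
 qed
 have "EX W'. (\<forall>c\<in>configs. 0 <= W' c & (W' c ~= 0 --> ?good c)) &
  (\<forall>i :: 'n. \<forall>a\<in>cells L. (\<Sum>c\<in>configs. W' c * (if c i = a then 1 else 0)) = mass a / ?N) &
  (\<Sum>c\<in>configs. W' c * pair_energy q c) <= (\<Sum>c\<in>{c \<in> configs. ?good c}. weight P c * pair_energy q c)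
    + 2 * ?N^2 * (1 / d) * (\<Sum>c\<in>{c \<in> configs. ~ ?good c}. weight P c)" (is "EX W'. ?R W'")
 proof (rule remove_bad_configurations[where close="near_cells d" and \<kappa>="1 / (8 * ?N^2)"])
  show "finite (cells L)" by simp
  show "0 <= weight P c" for c by (rule weight_nonneg)
  show "(\<Sum>c\<in>configs. weight P c) = 1" by (rule weight_total[OF P])
  show "(\<Sum>c\<in>configs. weight P c * (if c i = a then 1 else 0)) = mass a / ?N" if "a \<in> cells L" for i a by (rule weight_marginal[OF P that])
  show "near_cells d b a" if "near_cells d a b" for a b using that unfolding near_cells_def by (metis dist_commute)
  show "near_cells d a b" if "near_cells dl a b" for a b by (rule badclose[OF that])
  show "(\<Sum>b\<in>cells L. mass b / ?N * (if near_cells d a b then 1 else 0)) <= 1 / (8 * ?N^2)" if a: "a \<in> cells L" for a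
  proof -
   have "18 * ep <= d" using e dld by linarith
   then have "(\<Sum>b\<in>cells L. mass b * (if near_cells d a b then 1 else 0)) / ?N <= 1 / (8 * ?N) / ?N"
    using near_mass[OF a _ small] by (intro divide_right_mono) auto
   then show ?thesis by (simp add: sum_divide_distrib power2_eq_square)
  qed
  show "2 * ?N^2 * (1 / (8 * ?N^2)) <= 1/4" using N1 by simp
  show "(\<Sum>c\<in>{c \<in> configs. ~ ?good c}. weight P c) <= 1 / (4 * ?N)" by (rule pN)
  show "0 <= q a b" for a b by (rule q0)
  show "0 <= 1 / d" using dpos by simp
  show "q a b <= 1 / d" if "~ near_cells d a b" for a b using that by (simp add: q_def)
 qed
 then obtain W' where R: "?R W'" by (rule exE)
 note W' = R[THEN conjunct1] R[THEN conjunct2, THEN conjunct1] R[THEN conjunct2, THEN conjunct2]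
 have "2 * ?N^2 * (1 / d) * (\<Sum>c\<in>{c \<in> configs. ~ ?good c}. weight P c) = (\<Sum>c\<in>{c \<in> configs. ~ ?good c}. 2 * ?N^2 * (1 / d) * weight P c)"
  by (rule sum_distrib_left)
 \<comment> \<open>The exchange is paid by the energy of the bad configurations that disappear, or
   by outer cells, whose total weight is at most \<open>tail\<close>.\<close>
 also have "... <= (\<Sum>c\<in>{c \<in> configs. ~ ?good c}. weight P c * pair_energy q c + 2 * ?N^2 * (1 / d) * (weight P c * (\<Sum>i\<in>UNIV. out (c i))))"
 proof (rule sum_mono)
  fix c assume "c \<in> {c \<in> configs. ~ ?good c}"
  then have g: "1 / (4 * dl) <= pair_energy q c | 1 <= (\<Sum>i\<in>UNIV. out (c i))" by (intro gain) simp
  define k where "k = 2 * ?N^2 * (1 / d)"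
  have k0: "0 <= k" using dpos by (simp add: k_def)
  have o0: "0 <= (\<Sum>i\<in>UNIV. out (c i))" by (intro sum_nonneg out0)
  have "k <= pair_energy q c + k * (\<Sum>i\<in>UNIV. out (c i))"
  proof (cases "1 <= (\<Sum>i\<in>UNIV. out (c i))")
   case True
   then show ?thesis using mult_left_mono[OF True k0] pe0[of c] by simp
  next
   case False
   then show ?thesis using g gap mult_nonneg_nonneg[OF k0 o0] unfolding k_def by linarith
  qed
  from mult_left_mono[OF this weight_nonneg[of P c]]
  have "k * weight P c <= weight P c * pair_energy q c + k * (weight P c * (\<Sum>i\<in>UNIV. out (c i)))"
   by (simp only: distrib_left mult.commute[of k] mult.assoc)
  then show "2 * ?N^2 * (1 / d) * weight P c <= weight P c * pair_energy q c + (2 * ?N^2 * (1 / d) * (weight P c * (\<Sum>i\<in>UNIV. out (c i))))"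
   unfolding k_def .
 qed
 also have "... = (\<Sum>c\<in>{c \<in> configs. ~ ?good c}. weight P c * pair_energy q c) + 2 * ?N^2 * (1 / d) * (\<Sum>c\<in>{c \<in> configs. ~ ?good c}. weight P c * (\<Sum>i\<in>UNIV. out (c i)))"
  by (simp only: sum.distrib sum_distrib_left)
 also have "... <= (\<Sum>c\<in>{c \<in> configs. ~ ?good c}. weight P c * pair_energy q c) + 2 * ?N^2 * (1 / d) * tail"
 proof (intro add_left_mono mult_left_mono)
  have "(\<Sum>c\<in>{c \<in> configs. ~ ?good c}. weight P c * (\<Sum>i\<in>UNIV. out (c i))) <= (\<Sum>c\<in>configs. weight P c * (\<Sum>i\<in>UNIV. out (c i)))"
   by (rule sum_mono2[OF fin]) (auto intro!: mult_nonneg_nonneg weight_nonneg sum_nonneg out0)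
  then show "(\<Sum>c\<in>{c \<in> configs. ~ ?good c}. weight P c * (\<Sum>i\<in>UNIV. out (c i))) <= tail" using Wout by linarith
  show "0 <= 2 * ?N^2 * (1 / d)" using dpos by simp
 qed
 finally have swap: "2 * ?N^2 * (1 / d) * (\<Sum>c\<in>{c \<in> configs. ~ ?good c}. weight P c) <= (\<Sum>c\<in>{c \<in> configs. ~ ?good c}. weight P c * pair_energy q c) + 2 * ?N^2 * (1 / d) * tail" .
 have "configs = {c \<in> configs. ?good c} \<union> {c \<in> configs. ~ ?good c}" by blast
 then have "(\<Sum>c\<in>configs. weight P c * pair_energy q c) = (\<Sum>c\<in>{c \<in> configs. ?good c} \<union> {c \<in> configs. ~ ?good c}. weight P c * pair_energy q c)" by simp
 also have "... = (\<Sum>c\<in>{c \<in> configs. ?good c}. weight P c * pair_energy q c) + (\<Sum>c\<in>{c \<in> configs. ~ ?good c}. weight P c * pair_energy q c)"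
  by (rule sum.union_disjoint) (use fin in auto)
 finally have total: "(\<Sum>c\<in>configs. W' c * pair_energy q c) <= E + 2 * ?N^2 / d * tail" using W'(3) swap Wq by simp
 have Qq: "Q dl a b <= q a b" if "0 < mass a" "0 < mass b" for a b
 proof (cases "near_cells d a b")
  case False
  have "Q dl a b <= 1 / d"
  proof (rule kern_avg_upper[OF dl prob_cell_measure sets_cell_measure prob_cell_measure sets_cell_measure AE_cell_measure[OF that(1)] AE_cell_measure[OF that(2)]])
   fix y z assume "cell_fun ep L a y ~= 0" "cell_fun ep L b z ~= 0"
   then have "d <= dist y z" using False unfolding near_cells_def by (meson not_le)
   then show "kern dl (y - z) <= 1 / d" by (intro kern_antimono dl dpos) (simp add: dist_norm)
  qed
  then show ?thesis by (simp add: q_def)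
 qed (simp add: q_def)
 show ?thesis
  by (rule exI[of _ W'], rule exI[of _ q]) (intro conjI W'(1) W'(2) total allI impI q0 Qq)
qed

end

section \<open>Energy of the localized mixture\<close>

lemma norm_add_squared_le: "(cmod (x + y))^2 <= 2 * (cmod x)^2 + 2 * (cmod y)^2"
proof -
 have "(cmod (x + y))^2 <= (cmod x + cmod y)^2" by (rule power_mono[OF norm_triangle_ineq norm_ge_zero])
 also have "... <= 2 * (cmod x)^2 + 2 * (cmod y)^2" using zero_le_power2[of "cmod x - cmod y"] unfolding power2_sum power2_diff by linarith
 finally show ?thesis .
qed

context cell_partition begin

text \<open>The orbitals are \<open>sqrt \<rho>\<close> times the cell functions, whose squares sum
  to 1. In the kinetic energy the mixed terms are absorbed by a factor 2, and the squared
  derivatives of the cutoffs sum to at most \<open>3 / ep^2\<close> in each of the three directions,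
  which makes 18.\<close>

lemma levy_lieb_le_cells:
 fixes P :: "(real^3^'n::finite) measure" and G :: "real^3 => real^3 => complex"
 assumes N2: "2 <= CARD('n)" and total: "(\<integral>x. \<rho> x \<partial>lborel) = real CARD('n)" and \<eta>: "0 < \<eta>"
  and G: "!!u. u \<in> Basis ==> L2 (G u)" and w: "!!u. u \<in> Basis ==> weak_partial (%x. complex_of_real (sqrt (\<rho> x))) u (G u)"
  and P: "OT_admissible P \<rho>" and E: "(\<Sum>c\<in>configs. weight P c * pair_energy (Q dl) (c :: 'n => 3 => int)) <= E"
  and e: "18 * ep <= dl" and d: "8 * (real CARD('n))^2 * dl <= d"
  and markov: "4 * dl * E + tail <= 1 / (4 * real CARD('n))"
  and small: "!!z. (\<integral>x. \<rho> x * indicat_real (ball z (3 * d) \<union> {y. ep * (of_int L - 3) - 2 * d < norm y}) x \<partial>lborel) <= 1 / (8 * real CARD('n))"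
 shows "levy_lieb TYPE('n) (%x. \<eta> ^ 3 * \<rho> (\<eta> *\<^sub>R x)) <=
  ennreal (\<eta>^2 * (fact CARD('n) * (2 * (\<Sum>u\<in>Basis. \<integral>y. (cmod (G u y))^2 \<partial>lborel) + 18 * real CARD('n) / ep^2)) + \<eta> * (E + 2 * (real CARD('n))^2 / d * tail))"
proof -
 let ?N = "real CARD('n)"
 have dl: "0 < dl" using e eps by linarith
 obtain W q where W0: "\<forall>c\<in>configs. 0 <= W c & (W c ~= 0 --> (ALL i j. i ~= j --> ~ near_cells dl (c i) (c j)))"
  and Wm: "\<forall>i :: 'n. \<forall>a\<in>cells L. (\<Sum>c\<in>configs. W c * (if c i = a then 1 else 0)) = mass a / ?N"
  and q: "ALL a b. 0 <= q a b & (0 < mass a --> 0 < mass b --> Q dl a b <= q a b)"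
  and We: "(\<Sum>c\<in>configs. W c * pair_energy q c) <= E + 2 * ?N^2 / d * tail"
  using separated_weights[OF P E e d markov small] by (elim exE conjE)
 define r where "r x = complex_of_real (sqrt (\<rho> x))" for x
 have r2: "(cmod (r x))^2 = \<rho> x" for x using rho_nonneg[of x] by (simp add: r_def)
 have rm[measurable]: "r \<in> borel_measurable borel" unfolding r_def[abs_def] by measurable
 have rL: "L2 r" unfolding L2_def using rm by (simp add: r2 rho_integrable)
 define f where "f a x = complex_of_real (cell_fun ep L a x) * r x" for a x
 have f2: "(cmod (f a x))^2 = \<rho> x * bump a x" for a x
  by (simp add: f_def norm_mult power_mult_distrib r2 bump_def mult.commute)
 have fm: "(\<integral>x. (cmod (f a x))^2 \<partial>lborel) = mass a" for a by (simp add: f2 mass_def)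
 have fL: "L2 (f a)" for a
 proof -
  have "f a \<in> borel_measurable lborel" unfolding f_def[abs_def] by measurable
  then show ?thesis unfolding L2_def f2 using rho_bump_integrable by blast
 qed
 \<comment> \<open>The coordinate index of a basis vector, since the cell functions are built
   coordinatewise.\<close>
 define kk where "kk u = (SOME k. u = axis k (1 :: real))" for u :: "real^3"
 have kk: "axis (kk u) 1 = u" if "u \<in> Basis" for u :: "real^3"
 proof -
  have "EX k. u = axis k (1 :: real)" using that by (auto simp: Basis_vec_def)
  then have "u = axis (kk u) 1" unfolding kk_def by (rule someI_ex)
  then show ?thesis by simp
 qed
 define g where "g a u x = complex_of_real (cell_fun ep L a x) * G u x + complex_of_real (cell_fun' ep L a (kk u) x) * r x" for a u x
 have gw: "L2 (g a u)" "weak_partial (f a) u (g a u)" if u: "u \<in> Basis" for a u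
 proof -
  have wr: "weak_partial r (axis (kk u) 1) (G u)" using w[OF u] unfolding r_def[abs_def] kk[OF u] .
  show "L2 (g a u)" unfolding g_def[abs_def] by (rule weak_partial_cell_fun(1)[OF rL G[OF u] wr eps])
  have "weak_partial (f a) (axis (kk u) 1) (g a u)" unfolding f_def[abs_def] g_def[abs_def] by (rule weak_partial_cell_fun(2)[OF rL G[OF u] wr eps])
  then show "weak_partial (f a) u (g a u)" unfolding kk[OF u] .
 qed
 have kin: "(\<Sum>a\<in>cells L. \<Sum>u\<in>Basis. \<integral>y. (cmod (g a u y))^2 \<partial>lborel) <= 2 * (\<Sum>u\<in>Basis. \<integral>y. (cmod (G u y))^2 \<partial>lborel) + 18 * ?N / ep^2"
 proof -
  have one: "(\<Sum>a\<in>cells L. \<integral>y. (cmod (g a u y))^2 \<partial>lborel) <= 2 * (\<integral>y. (cmod (G u y))^2 \<partial>lborel) + 6 / ep^2 * ?N" if u: "u \<in> Basis" for u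
  proof -
   have iG: "integrable lborel (%y. 2 * (cmod (G u y))^2)" using L2_square_integrable[OF G[OF u]] by simp
   have ir: "integrable lborel (%y. 6 / ep^2 * \<rho> y)" using rho_integrable by simp
   have ig: "integrable lborel (%y. \<Sum>a\<in>cells L. (cmod (g a u y))^2)" by (rule Bochner_Integration.integrable_sum) (rule L2_square_integrable[OF gw(1)[OF u]])
   have "(\<Sum>a\<in>cells L. \<integral>y. (cmod (g a u y))^2 \<partial>lborel) = (\<integral>y. (\<Sum>a\<in>cells L. (cmod (g a u y))^2) \<partial>lborel)"
    by (rule Bochner_Integration.integral_sum[symmetric]) (rule L2_square_integrable[OF gw(1)[OF u]])
   also have "... <= (\<integral>y. 2 * (cmod (G u y))^2 + 6 / ep^2 * \<rho> y \<partial>lborel)"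
   proof (rule integral_mono[OF ig Bochner_Integration.integrable_add[OF iG ir]])
    fix y
    have "(\<Sum>a\<in>cells L. (cmod (g a u y))^2) <= (\<Sum>a\<in>cells L. bump a y * (2 * (cmod (G u y))^2) + (cell_fun' ep L a (kk u) y)^2 * (2 * \<rho> y))"
    proof (rule sum_mono)
     fix a
     have "(cmod (g a u y))^2 <= 2 * (cmod (complex_of_real (cell_fun ep L a y) * G u y))^2 + 2 * (cmod (complex_of_real (cell_fun' ep L a (kk u) y) * r y))^2"
      unfolding g_def by (rule norm_add_squared_le)
     then show "(cmod (g a u y))^2 <= bump a y * (2 * (cmod (G u y))^2) + (cell_fun' ep L a (kk u) y)^2 * (2 * \<rho> y)"
      by (simp add: norm_mult power_mult_distrib r2 bump_def mult.left_commute)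
    qed
    also have "... = 1 * (2 * (cmod (G u y))^2) + (\<Sum>a\<in>cells L. (cell_fun' ep L a (kk u) y)^2) * (2 * \<rho> y)"
     by (simp only: sum.distrib sum_distrib_right[symmetric] bump_sum)
    also have "... <= 1 * (2 * (cmod (G u y))^2) + 3 / ep^2 * (2 * \<rho> y)"
     using rho_nonneg[of y] by (intro add_left_mono mult_right_mono sum_cell_fun'_square[OF eps L0]) simp
    finally show "(\<Sum>a\<in>cells L. (cmod (g a u y))^2) <= 2 * (cmod (G u y))^2 + 6 / ep^2 * \<rho> y" by simp
   qed
   also have "... = 2 * (\<integral>y. (cmod (G u y))^2 \<partial>lborel) + 6 / ep^2 * ?N"
    by (simp only: Bochner_Integration.integral_add[OF iG ir] integral_mult_right_zero total)
   finally show ?thesis .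
  qed
  have "(\<Sum>a\<in>cells L. \<Sum>u\<in>Basis. \<integral>y. (cmod (g a u y))^2 \<partial>lborel) = (\<Sum>u\<in>Basis. \<Sum>a\<in>cells L. \<integral>y. (cmod (g a u y))^2 \<partial>lborel)" by (rule sum.swap)
  also have "... <= (\<Sum>u\<in>(Basis :: (real^3) set). 2 * (\<integral>y. (cmod (G u y))^2 \<partial>lborel) + 6 / ep^2 * ?N)" by (rule sum_mono) (rule one)
  finally show ?thesis by (simp add: sum.distrib sum_distrib_left)
 qed
 have mpos: "0 < mass (c i)" if c: "c \<in> configs" "W c ~= 0" for c and i :: 'n
 proof -
  have fin: "finite (configs :: ('n => 3 => int) set)" by (intro finite_PiE) auto
  have ci: "c i \<in> cells L" using c(1) by (rule PiE_mem) simp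
  have "W c * (if c i = c i then 1 else 0) <= (\<Sum>c'\<in>configs. W c' * (if c' i = c i then 1 else 0))"
   by (rule member_le_sum[OF c(1) _ fin]) (use W0 in auto)
  also have "... = mass (c i) / ?N" using Wm ci by blast
  finally have "0 < mass (c i) / ?N" using W0 c by (auto simp: less_le)
  then show ?thesis using N2 by (simp add: zero_less_divide_iff)
 qed
 have "levy_lieb TYPE('n) (%x. \<eta> ^ 3 * \<rho> (\<eta> *\<^sub>R x)) <=
  ennreal (\<eta>^2 * (fact CARD('n) * (\<Sum>a\<in>cells L. \<Sum>u\<in>Basis. \<integral>y. (cmod (g a u y))^2 \<partial>lborel)) + \<eta> * (\<Sum>c\<in>configs. W c * pair_energy q c))"
 proof (rule levy_lieb_le_cell_mixture[OF N2 finite_cells(1) \<eta> dl rho_measurable fL _ gw])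
  show "cnj (f a y) = f a y" for a y by (simp add: f_def r_def)
  show "(\<Sum>a\<in>cells L. (cmod (f a y))^2) = \<rho> y" for y by (simp only: f2 sum_distrib_left[symmetric] bump_sum mult_1_right)
  show "0 <= W c" if "c \<in> configs" for c using W0 that by blast
  show "(\<Sum>c\<in>configs. W c * (if c i = a then 1 else 0)) = (\<integral>x. (cmod (f a x))^2 \<partial>lborel) / ?N" if "a \<in> cells L" for i :: 'n and a
   unfolding fm using Wm that by blast
  show "(\<Sum>c\<in>configs. W c) = 1"
  proof -
   have "(\<Sum>c\<in>configs. W c * 1) = (\<Sum>a\<in>cells L. mass a / ?N * 1)"
    by (rule marginal_sum[OF finite_cells(1), where i=undefined and h="%_. 1"]) (use Wm in blast)
   also have "... = (\<Sum>a\<in>cells L. mass a * 1) / ?N" by (simp add: sum_divide_distrib)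
   also have "(\<Sum>a\<in>cells L. mass a * 1) = ?N" unfolding sum_mass by (simp add: bump_sum total)
   finally show ?thesis using N2 by simp
  qed
  show "dl <= dist y z" if c: "c \<in> configs" "W c ~= 0" "i ~= j" and y: "f (c i) y ~= 0" and z: "f (c j) z ~= 0" for c and i j :: 'n and y z
  proof -
   have "~ near_cells dl (c i) (c j)" using W0 c by blast
   moreover have "cell_fun ep L (c i) y ~= 0" "cell_fun ep L (c j) z ~= 0" using y z by (auto simp: f_def)
   ultimately show ?thesis unfolding near_cells_def by (meson not_le)
  qed
  show "0 <= q a b" for a b using q by blast
  show "(\<integral>\<^sup>+z. (\<integral>\<^sup>+y. inverse (ennreal (dist y z)) * ennreal ((cmod (f (c i) y))^2 / (\<integral>x. (cmod (f (c i) x))^2 \<partial>lborel)) \<partial>lborel)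
    * ennreal ((cmod (f (c j) z))^2 / (\<integral>x. (cmod (f (c j) x))^2 \<partial>lborel)) \<partial>lborel) <= ennreal (q (c i) (c j))"
   if c: "c \<in> configs" "W c ~= 0" "i ~= j" for c and i j :: 'n
  proof -
   have dens: "(\<integral>\<^sup>+y. h y * ennreal ((cmod (f (c l) y))^2 / (\<integral>x. (cmod (f (c l) x))^2 \<partial>lborel)) \<partial>lborel) = (\<integral>\<^sup>+y. h y \<partial>cell_measure (c l))"
    if [measurable]: "h \<in> borel_measurable borel" for h l
   proof -
    have "cell_measure (c l) = density lborel (%x. ennreal (\<rho> x * bump (c l) x / mass (c l)))" using mpos[OF c(1,2)] by (simp add: cell_measure_def)
    then have "(\<integral>\<^sup>+y. h y \<partial>cell_measure (c l)) = (\<integral>\<^sup>+y. ennreal (\<rho> y * bump (c l) y / mass (c l)) * h y \<partial>lborel)"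
     by (simp add: nn_integral_density)
    then show ?thesis unfolding fm unfolding f2 by (simp only: mult.commute)
   qed
   note [measurable_cong] = sets_cell_measure
   interpret prob_space "cell_measure (c i)" by (rule prob_cell_measure)
   have "(\<integral>\<^sup>+z. (\<integral>\<^sup>+y. inverse (ennreal (dist y z)) * ennreal ((cmod (f (c i) y))^2 / (\<integral>x. (cmod (f (c i) x))^2 \<partial>lborel)) \<partial>lborel)
    * ennreal ((cmod (f (c j) z))^2 / (\<integral>x. (cmod (f (c j) x))^2 \<partial>lborel)) \<partial>lborel)
    = (\<integral>\<^sup>+z. (\<integral>\<^sup>+y. inverse (ennreal (dist y z)) \<partial>cell_measure (c i)) * ennreal ((cmod (f (c j) z))^2 / (\<integral>x. (cmod (f (c j) x))^2 \<partial>lborel)) \<partial>lborel)"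
    by (subst dens) measurable
   also have "... = (\<integral>\<^sup>+z. (\<integral>\<^sup>+y. inverse (ennreal (dist y z)) \<partial>cell_measure (c i)) \<partial>cell_measure (c j))"
    by (rule dens) measurable
   \<comment> \<open>Cells occurring together with nonzero weight are at least \<open>dl\<close>
     apart, so the truncated kernel agrees with the Coulomb kernel on them.\<close>
   also have "... = ennreal (Q dl (c i) (c j))"
   proof (rule nn_kern_avg[OF dl prob_cell_measure sets_cell_measure prob_cell_measure sets_cell_measure AE_cell_measure[OF mpos[OF c(1,2)]] AE_cell_measure[OF mpos[OF c(1,2)]]])
    fix y z assume "cell_fun ep L (c i) y ~= 0" "cell_fun ep L (c j) z ~= 0"
    moreover have "~ near_cells dl (c i) (c j)" using W0 c by blast
    ultimately show "dl <= dist y z" unfolding near_cells_def by (meson not_le)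
   qed
   also have "... <= ennreal (q (c i) (c j))" by (rule ennreal_leI) (use q mpos[OF c(1,2)] in blast)
   finally show ?thesis .
  qed
 qed
 also have "... <= ennreal (\<eta>^2 * (fact CARD('n) * (2 * (\<Sum>u\<in>Basis. \<integral>y. (cmod (G u y))^2 \<partial>lborel) + 18 * ?N / ep^2)) + \<eta> * (E + 2 * ?N^2 / d * tail))"
  using \<eta> by (intro ennreal_leI add_mono mult_left_mono kin We) simp_all
 finally show ?thesis .
qed

end

section \<open>Choice of the parameters\<close>

lemma integral_levels_tendsto_zero:
 fixes \<rho> v :: "real^3 => real"
 assumes [measurable]: "\<rho> \<in> borel_measurable borel" "v \<in> borel_measurable borel" and i: "integrable lborel \<rho>"
 shows "(%n. \<integral>x. \<rho> x * indicat_real {x. real n < v x} x \<partial>lborel) \<longlonglongrightarrow> 0"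
proof -
 have "(%n. \<integral>x. \<rho> x * indicat_real {x. real n < v x} x \<partial>lborel) \<longlonglongrightarrow> (\<integral>x. 0 \<partial>(lborel :: (real^3) measure))"
 proof (rule integral_dominated_convergence[where w="%x. norm (\<rho> x)"])
  show "AE x in lborel. (%n. \<rho> x * indicat_real {x. real n < v x} x) \<longlonglongrightarrow> 0"
  proof (rule AE_I2)
   fix x
   have "eventually (%n. \<rho> x * indicat_real {x. real n < v x} x = 0) sequentially"
    using eventually_ge_at_top[of "nat \<lceil>v x\<rceil>"]
   proof eventually_elim
    fix n assume "nat \<lceil>v x\<rceil> <= n"
    then have "v x <= real n" by linarith
    then show "\<rho> x * indicat_real {x. real n < v x} x = 0" by simp
   qed
   then show "(%n. \<rho> x * indicat_real {x. real n < v x} x) \<longlonglongrightarrow> 0" by (rule tendsto_eventually)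
  qed
  show "AE x in lborel. norm (\<rho> x * indicat_real {x. real n < v x} x) <= norm (\<rho> x)" for n
   by (rule AE_I2) (simp add: indicator_def)
  show "integrable lborel (%x. norm (\<rho> x))" using i by simp
 qed measurable
 then show ?thesis by simp
qed

text \<open>For the balls, \<open>\<rho>\<close> is cut at a height \<open>n\<close> above which
  little mass remains; below it the mass of a ball is at most \<open>n\<close> times its volume. A
  radius of at most 1 makes the volume bounded linearly in the radius.\<close>

lemma small_mass:
 fixes \<rho> :: "real^3 => real"
 assumes rm[measurable]: "\<rho> \<in> borel_measurable borel" and r0: "!!x. 0 <= \<rho> x" and i: "integrable lborel \<rho>" and c: "0 < c"
 shows small_tail: "\<exists>n :: nat. (\<integral>x. \<rho> x * indicat_real {x. real n < norm x} x \<partial>lborel) <= c"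
  and small_balls: "\<exists>s>0. ALL z. (\<integral>x. \<rho> x * indicat_real (ball z s) x \<partial>lborel) <= c"
proof -
 have ii: "integrable lborel (%x. \<rho> x * indicat_real S x)" if "S \<in> sets borel" for S
  by (rule integrable_real_mult_indicator[OF _ i]) (use that in simp)
 have ex: "\<exists>n :: nat. (\<integral>x. \<rho> x * indicat_real {x. real n < v x} x \<partial>lborel) <= c'" if [measurable]: "v \<in> borel_measurable borel" and "0 < c'" for v and c' :: real
  using eventually_happens'[OF sequentially_bot order_tendstoD(2)[OF integral_levels_tendsto_zero[OF rm that(1) i] that(2)]] by (auto intro: less_imp_le)
 show "\<exists>n :: nat. (\<integral>x. \<rho> x * indicat_real {x. real n < norm x} x \<partial>lborel) <= c" by (rule ex[OF _ c]) measurable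
 obtain n :: nat where n: "(\<integral>x. \<rho> x * indicat_real {x. real n < \<rho> x} x \<partial>lborel) <= c / 2" using ex[OF rm, of "c / 2"] c by auto
 define V where "V = unit_ball_vol (real DIM(real^3))"
 have V: "0 <= V" by (simp add: V_def)
 define s where "s = min 1 (c / (2 * (real n * V + 1)))"
 have nV: "0 < real n * V + 1" using V by (simp add: add_nonneg_pos)
 have s: "0 < s" "s <= 1" using c nV by (simp_all add: s_def)
 have "s <= c / (2 * (real n * V + 1))" by (simp add: s_def)
 then have "s * (2 * (real n * V + 1)) <= c" using nV by (simp add: pos_le_divide_eq)
 then have sc: "real n * (V * s) <= c / 2" using s by (simp add: algebra_simps)
 have "(\<integral>x. \<rho> x * indicat_real (ball z s) x \<partial>lborel) <= c" for z
 proof -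
  have vol: "measure lborel (ball z s) <= V * s"
  proof -
   have "measure lborel (ball z s) = V * s ^ 3" using content_ball[of s z] s by (simp add: V_def)
   also have "s ^ 3 <= s ^ 1" using s by (intro power_decreasing) auto
   finally show ?thesis using V by (simp add: mult_left_mono)
  qed
  have ib: "integrable lborel (%x. real n * indicat_real (ball z s) x)"
   by (intro integrable_mult_right integrable_real_indicator) (use emeasure_bounded_finite[OF bounded_ball, of z s] in auto)
  have "(\<integral>x. \<rho> x * indicat_real (ball z s) x \<partial>lborel) <= (\<integral>x. real n * indicat_real (ball z s) x + \<rho> x * indicat_real {x. real n < \<rho> x} x \<partial>lborel)"
   by (rule integral_mono[OF ii Bochner_Integration.integrable_add[OF ib ii]]) (use r0 in "auto simp: indicator_def")
  also have "... = real n * measure lborel (ball z s) + (\<integral>x. \<rho> x * indicat_real {x. real n < \<rho> x} x \<partial>lborel)"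
   by (subst Bochner_Integration.integral_add[OF ib ii]) simp_all
  also have "... <= real n * (V * s) + c / 2" by (intro add_mono mult_left_mono vol n) simp
  finally show ?thesis using sc by linarith
 qed
 then show "\<exists>s>0. ALL z. (\<integral>x. \<rho> x * indicat_real (ball z s) x \<partial>lborel) <= c" using s(1) by blast
qed

text \<open>The constants \<open>d\<close>, \<open>dl\<close>, \<open>K\<close>, \<open>ep0\<close>
  are fixed in this order from \<open>\<rho>\<close>, the number of particles and the transport
  value. Only the box size \<open>L\<close> and the nearly optimal plan depend on \<open>ep\<close>,
  and neither enters the final bound, so \<open>C\<close> is uniform in \<open>ep\<close> and
  \<open>\<eta>\<close>.\<close>

lemma semiclassical_upper_bound:
 fixes \<rho> :: "real^3 => real"
 assumes N2: "2 <= CARD('n::finite)" and rm[measurable]: "\<rho> \<in> borel_measurable borel" and r0: "!!x. 0 <= \<rho> x"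
  and i: "integrable lborel \<rho>" and total: "(\<integral>x. \<rho> x \<partial>lborel) = real CARD('n)"
  and H: "H1 (%x. complex_of_real (sqrt (\<rho> x)))" and fin: "E_OT TYPE('n) \<rho> < top"
 shows "EX ep0 C. 0 < ep0 & 0 <= C & (\<forall>ep \<eta>. 0 < ep --> ep <= ep0 --> 0 < \<eta> -->
  levy_lieb TYPE('n) (%x. \<eta> ^ 3 * \<rho> (\<eta> *\<^sub>R x)) <= ennreal (\<eta> * enn2real (E_OT TYPE('n) \<rho>) + C * (\<eta> * ep^2 + \<eta>^2 / ep^2 + \<eta>^2)))"
proof -
 let ?N = "real CARD('n)" and ?r = "%x. complex_of_real (sqrt (\<rho> x))"
 have N1: "1 <= ?N" using N2 by simp
 obtain G where G: "!!u. u \<in> Basis ==> L2 (G u)" "!!u. u \<in> Basis ==> weak_partial ?r u (G u)"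
  using H unfolding H1_def by metis
 have rL: "L2 ?r" using H by (simp add: H1_def)
 define S where "S = (\<Sum>u\<in>Basis. \<integral>y. (cmod (G u y))^2 \<partial>lborel)"
 have S0: "0 <= S" unfolding S_def by (intro sum_nonneg) simp
 define B where "B = S / 2 + 2 * ?N"
 have B0: "0 <= B" using S0 by (simp add: B_def)
 define E where "E = enn2real (E_OT TYPE('n) \<rho>)"
 have E0: "0 <= E" by (simp add: E_def)
 obtain s where s: "0 < s" "!!z. (\<integral>x. \<rho> x * indicat_real (ball z s) x \<partial>lborel) <= 1 / (16 * ?N)"
  using small_balls[OF rm r0 i, of "1 / (16 * ?N)"] N1 by auto
 define d where "d = s / 3"
 have d0: "0 < d" using s by (simp add: d_def)
 \<comment> \<open>The first bound makes the exchange affordable; the second makes bad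
   configurations rare by Markov's inequality, for energies up to \<open>E + 1\<close>.\<close>
 define dl where "dl = min (d / (8 * ?N^2)) (1 / (32 * ?N * (E + 1)))"
 have dl: "0 < dl" using d0 N1 E0 by (simp add: dl_def)
 have dl1: "8 * ?N^2 * dl <= d"
 proof -
  have "dl <= d / (8 * ?N^2)" by (simp add: dl_def)
  then show ?thesis using N1 by (simp add: pos_le_divide_eq mult.commute)
 qed
 have dl2: "4 * dl * (E + 1) <= 1 / (8 * ?N)"
 proof -
  have "dl <= 1 / (32 * ?N * (E + 1))" by (simp add: dl_def)
  then have "dl * (4 * (E + 1)) <= 1 / (32 * ?N * (E + 1)) * (4 * (E + 1))" using E0 by (intro mult_right_mono) auto
  also have "... = 1 / (8 * ?N)" using E0 N1 by (simp add: divide_simps)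
  finally show ?thesis by (simp add: mult.commute mult.left_commute)
 qed
 \<comment> \<open>Collects, in units of \<open>ep^2\<close>, the slack of the plan, the integrated
   error of the cells and the quadratic remainder of the kernel.\<close>
 define K where "K = 1 + ?N * (9 * B / dl^2 + 1 / dl) + 972 * ?N^2 / dl ^ 3"
 have K1: "1 <= K" unfolding K_def using B0 dl by simp
 \<comment> \<open>The first bound makes cells small compared with \<open>dl\<close>. The second
   keeps \<open>K * ep^2\<close> and the tail at most \<open>1 / (8 * N)\<close>, as the Markov
   condition requires.\<close>
 define ep0 where "ep0 = min (dl / 18) (1 / (8 * ?N * K))"
 have NK: "1 <= 8 * ?N * K" using mult_mono[of 1 "8 * ?N" 1 K] N1 K1 by simp
 have "0 < K" using K1 by linarith
 then have ep0: "0 < ep0" using dl by (simp add: ep0_def)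
 have inv1: "1 / x <= 1" if "1 <= x" for x :: real using that by (simp add: divide_le_eq)
 define C where "C = K + 2 * ?N^2 / d + fact CARD('n) * (2 * S) + fact CARD('n) * (18 * ?N)"
 have F0: "0 <= (fact CARD('n) :: real)" by simp
 have C0: "0 <= C" unfolding C_def using K1 d0 S0 by (intro add_nonneg_nonneg mult_nonneg_nonneg) simp_all
 have main: "levy_lieb TYPE('n) (%x. \<eta> ^ 3 * \<rho> (\<eta> *\<^sub>R x)) <= ennreal (\<eta> * E + C * (\<eta> * ep^2 + \<eta>^2 / ep^2 + \<eta>^2))"
  if ep: "0 < ep" "ep <= ep0" and \<eta>: "0 < \<eta>" for ep \<eta>
 proof -
  have e18: "18 * ep <= dl" using ep(2) by (simp add: ep0_def)
  have "ep <= 1 / (8 * ?N * K)" using ep(2) by (simp add: ep0_def)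
  also have "... <= 1" by (rule inv1[OF NK])
  finally have e1: "ep <= 1" .
  have "ep^2 <= ep" using mult_left_mono[OF e1, of ep] ep(1) by (simp add: power2_eq_square)
  then have "ep^2 <= 1 / (8 * ?N * K)" using ep(2) by (simp add: ep0_def)
  then have eK: "K * ep^2 <= 1 / (8 * ?N)" using K1 N1 by (simp add: field_simps)
  have eN: "ep^2 <= 1 / (8 * ?N)" using eK mult_right_mono[OF K1, of "ep^2"] by simp
  have "1 / (8 * ?N) <= 1" by (rule inv1) (use N1 in linarith)
  then have eK1: "K * ep^2 <= 1" using eK by linarith
  have cpos: "0 < min (ep^2) (1 / (16 * ?N))" using ep N1 by simp
  obtain n :: nat where n: "(\<integral>x. \<rho> x * indicat_real {x. real n < norm x} x \<partial>lborel) <= min (ep^2) (1 / (16 * ?N))"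
   using small_tail[OF rm r0 i cpos] by blast
  \<comment> \<open>Large enough that everything beyond \<open>ep * (L - 3) - 2 * d\<close> belongs
    to the small tail; the 3 matches \<open>outer_cell_support\<close> and the \<open>2 * d\<close>
    matches \<open>near_mass\<close>.\<close>
  define L where "L = \<lceil>(real n + 2 * d) / ep\<rceil> + 3"
  have Lr: "(real n + 2 * d) / ep <= of_int L - 3" by (simp add: L_def)
  then have far: "real n + 2 * d <= ep * (of_int L - 3)" using ep(1) by (simp add: pos_divide_le_eq mult.commute)
  have "0 <= (real n + 2 * d) / ep" using ep d0 by simp
  then have L0: "0 <= L" using Lr by linarith
  interpret cell_partition \<rho> ep L by unfold_locales (use rm r0 i ep L0 in auto)
  have tl: "(\<integral>x. \<rho> x * indicat_real {x. R < norm x} x \<partial>lborel) <= min (ep^2) (1 / (16 * ?N))" if R: "real n <= R" for R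
  proof -
   have "(\<integral>x. \<rho> x * indicat_real {x. R < norm x} x \<partial>lborel) <= (\<integral>x. \<rho> x * indicat_real {x. real n < norm x} x \<partial>lborel)"
    by (rule integral_mono; (rule rho_bounded_integrable[of _ 1] | rule mult_left_mono[OF _ r0])) (use R in "auto simp: indicator_def")
   then show ?thesis using n by linarith
  qed
  have tail: "tail <= ep^2" unfolding tail_def using tl[of "ep * (of_int L - 3)"] far d0 by simp
  have small: "(\<integral>x. \<rho> x * indicat_real (ball z (3 * d) \<union> {y. ep * (of_int L - 3) - 2 * d < norm y}) x \<partial>lborel) <= 1 / (8 * ?N)" for z
  proof -
   let ?T = "{y. ep * (of_int L - 3) - 2 * d < norm y} :: (real^3) set"
   have i1: "integrable lborel (%x. \<rho> x * indicat_real (ball z (3 * d)) x)" and i2: "integrable lborel (%x. \<rho> x * indicat_real ?T x)"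
    and i3: "integrable lborel (%x. \<rho> x * indicat_real (ball z (3 * d) \<union> ?T) x)"
    by (rule rho_bounded_integrable[of _ 1]; auto simp: indicator_def)+
   have "(\<integral>x. \<rho> x * indicat_real (ball z (3 * d) \<union> ?T) x \<partial>lborel) <= (\<integral>x. \<rho> x * indicat_real (ball z (3 * d)) x + \<rho> x * indicat_real ?T x \<partial>lborel)"
    by (rule integral_mono[OF i3 Bochner_Integration.integrable_add[OF i1 i2]]) (use r0 in "auto simp: indicator_def")
   also have "... = (\<integral>x. \<rho> x * indicat_real (ball z (3 * d)) x \<partial>lborel) + (\<integral>x. \<rho> x * indicat_real ?T x \<partial>lborel)"
    by (rule Bochner_Integration.integral_add[OF i1 i2])
   also have "... <= 1 / (16 * ?N) + 1 / (16 * ?N)"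
    using s(2)[of z] tl[of "ep * (of_int L - 3) - 2 * d"] far by (intro add_mono) (simp_all add: d_def)
   finally show ?thesis by simp
  qed
  have tr: "(\<integral>x. \<bar>\<rho> (x + ep *\<^sub>R axis k 1) - \<rho> x\<bar> \<partial>lborel) <= ep * B" for k
  proof -
   have u: "axis k 1 \<in> (Basis :: (real^3) set)" by (simp add: axis_in_Basis_iff)
   have "(\<integral>x. \<bar>(cmod (?r (x + ep *\<^sub>R axis k 1)))^2 - (cmod (?r x))^2\<bar> \<partial>lborel) <= ep * ((\<integral>x. (cmod (G (axis k 1) x))^2 \<partial>lborel) / 2 + 2 * (\<integral>x. (cmod (?r x))^2 \<partial>lborel))"
    by (rule density_translation_bound[OF rL G(1)[OF u] G(2)[OF u] u ep(1)])
   moreover have "(\<integral>x. (cmod (G (axis k 1) x))^2 \<partial>lborel) <= S"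
    unfolding S_def by (rule member_le_sum[OF u]) simp_all
   moreover have "(cmod (?r x))^2 = \<rho> x" for x using r0[of x] by simp
   ultimately show ?thesis
    unfolding B_def using ep(1) total by (simp only:) (rule order_trans, assumption, intro mult_left_mono, simp_all)
  qed
  have Eenn: "E_OT TYPE('n) \<rho> = ennreal E" using fin by (simp add: E_def)
  \<comment> \<open>A plan within \<open>ep^2\<close> of the infimum suffices, since the
    discretization loses as much anyway; no minimizer has to be constructed.\<close>
  have "E_OT TYPE('n) \<rho> < E_OT TYPE('n) \<rho> + ennreal (ep^2)"
   unfolding Eenn ennreal_plus[OF E0 zero_le_power2, symmetric]
   by (rule ennreal_lessI) (use E0 zero_less_power[OF ep(1), of 2] in linarith)+
  then obtain P :: "(real^3^'n) measure" where P: "OT_admissible P \<rho>" and Pc: "(\<integral>\<^sup>+x. coulomb x \<partial>P) < E_OT TYPE('n) \<rho> + ennreal (ep^2)"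
   unfolding E_OT_def Inf_less_iff by blast
  have Pfin: "(\<integral>\<^sup>+x. coulomb x \<partial>P) < top" using Pc by (rule less_le_trans) simp
  have cost: "enn2real (\<integral>\<^sup>+x. coulomb x \<partial>P) <= E + ep^2"
  proof -
   have "(\<integral>\<^sup>+x. coulomb x \<partial>P) <= ennreal (E + ep^2)" using Pc unfolding Eenn using E0 by (simp add: ennreal_plus)
   then have "enn2real (\<integral>\<^sup>+x. coulomb x \<partial>P) <= enn2real (ennreal (E + ep^2))" by (rule enn2real_mono) simp
   then show ?thesis unfolding enn2real_ennreal[OF add_nonneg_nonneg[OF E0 zero_le_power2]] .
  qed
  have errI: "(\<integral>x. \<rho> x * err dl x \<partial>lborel) <= 9 * B * ep^2 / dl^2 + ep^2 / dl"
   using integral_err_le[OF dl tr] divide_right_mono[OF tail[unfolded tail_def], of dl] dl by linarith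
  have en: "(\<Sum>c\<in>configs. weight P c * pair_energy (Q dl) c) <= E + K * ep^2"
  proof -
   have "(\<Sum>c\<in>configs. weight P c * pair_energy (Q dl) c) <= E + ep^2 + ?N * (9 * B * ep^2 / dl^2 + ep^2 / dl) + 972 * ?N^2 * ep^2 / dl ^ 3"
    using weight_energy[OF P Pfin dl] cost mult_left_mono[OF errI, of ?N] N1 by linarith
   also have "... = E + K * ep^2" by (simp add: K_def algebra_simps)
   finally show ?thesis .
  qed
  have markov: "4 * dl * (E + K * ep^2) + tail <= 1 / (4 * ?N)"
  proof -
   have "4 * dl * (E + K * ep^2) <= 4 * dl * (E + 1)" using eK1 dl by (intro mult_left_mono) auto
   then have "4 * dl * (E + K * ep^2) + tail <= 1 / (8 * ?N) + 1 / (8 * ?N)" using dl2 tail eN by linarith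
   then show ?thesis by simp
  qed
  have "levy_lieb TYPE('n) (%x. \<eta> ^ 3 * \<rho> (\<eta> *\<^sub>R x)) <= ennreal (\<eta>^2 * (fact CARD('n) * (2 * S + 18 * ?N / ep^2)) + \<eta> * (E + K * ep^2 + 2 * ?N^2 / d * tail))"
   unfolding S_def by (rule levy_lieb_le_cells[OF N2 total \<eta> G P en e18 dl1 markov small])
  also have "... <= ennreal (\<eta> * E + C * (\<eta> * ep^2 + \<eta>^2 / ep^2 + \<eta>^2))"
  proof (rule ennreal_leI)
   let ?X = "\<eta> * ep^2" and ?Y = "\<eta>^2 / ep^2" and ?Z = "\<eta>^2" and ?F = "fact CARD('n) :: real"
   have X: "0 <= ?X" "0 <= ?Y" "0 <= ?Z" using \<eta> by simp_all
   have "2 * ?N^2 / d * tail <= 2 * ?N^2 / d * ep^2" using tail d0 by (intro mult_left_mono) auto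
   then have "\<eta> * (E + K * ep^2 + 2 * ?N^2 / d * tail) <= \<eta> * (E + K * ep^2 + 2 * ?N^2 / d * ep^2)" using \<eta> by (intro mult_left_mono) auto
   also have "... = \<eta> * E + (K + 2 * ?N^2 / d) * ?X" by (simp add: algebra_simps)
   also have "(K + 2 * ?N^2 / d) * ?X <= C * ?X"
    using X S0 F0 unfolding C_def by (intro mult_right_mono) simp_all
   finally have 1: "\<eta> * (E + K * ep^2 + 2 * ?N^2 / d * tail) <= \<eta> * E + C * ?X" by simp
   have 2: "\<eta>^2 * (?F * (2 * S + 18 * ?N / ep^2)) = ?F * (2 * S) * ?Z + ?F * (18 * ?N) * ?Y" by (simp add: algebra_simps)
   have 3: "?F * (2 * S) * ?Z <= C * ?Z" using X S0 F0 K1 d0 unfolding C_def by (intro mult_right_mono) simp_all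
   have 4: "?F * (18 * ?N) * ?Y <= C * ?Y" using X S0 F0 K1 d0 unfolding C_def by (intro mult_right_mono) simp_all
   show "\<eta>^2 * (?F * (2 * S + 18 * ?N / ep^2)) + \<eta> * (E + K * ep^2 + 2 * ?N^2 / d * tail) <= \<eta> * E + C * (?X + ?Y + ?Z)"
    unfolding 2 distrib_left[of C] using 1 3 4 by linarith
  qed
  finally show ?thesis .
 qed
 show ?thesis by (intro exI[of _ ep0] exI[of _ C] conjI ep0 C0 allI impI) (use main in "simp add: E_def")
qed

theorem theorem2:
  fixes \<rho> :: "real^3 \<Rightarrow> real"
  assumes N2: "CARD('n::finite) \<ge> 2"
    and meas: "\<rho> \<in> borel_measurable lborel"
    and nonneg: "\<forall>x. \<rho> x \<ge> 0"
    and mass: "integrable lborel \<rho>" "(\<integral>x. \<rho> x \<partial>lborel) = real CARD('n)"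
    and sobolev: "H1 (\<lambda>x. complex_of_real (sqrt (\<rho> x)))"
  shows "(\<exists>C::real. \<forall>\<eta>::real. \<eta> > 0 \<longrightarrow>
            E_OT TYPE('n) \<rho> \<le> levy_lieb TYPE('n) (\<lambda>x. \<eta> ^ 3 * \<rho> (\<eta> *\<^sub>R x)) / ennreal \<eta>
          \<and> levy_lieb TYPE('n) (\<lambda>x. \<eta> ^ 3 * \<rho> (\<eta> *\<^sub>R x)) / ennreal \<eta>
              \<le> E_OT TYPE('n) \<rho> + ennreal (C * (sqrt \<eta> + \<eta>)))
         \<and> ((\<lambda>\<eta>. levy_lieb TYPE('n) (\<lambda>x. \<eta> ^ 3 * \<rho> (\<eta> *\<^sub>R x)) / ennreal \<eta>)
            \<longlongrightarrow> E_OT TYPE('n) \<rho>) (at_right 0)"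
proof -
 have rm: "\<rho> \<in> borel_measurable borel" using meas by simp
 let ?F = "%\<eta>. levy_lieb TYPE('n) (%x. \<eta> ^ 3 * \<rho> (\<eta> *\<^sub>R x)) / ennreal \<eta>"
 have lower: "E_OT TYPE('n) \<rho> <= ?F \<eta>" if \<eta>: "0 < \<eta>" for \<eta>
 proof -
  have "ennreal \<eta> * E_OT TYPE('n) \<rho> <= levy_lieb TYPE('n) (%x. \<eta> ^ 3 * \<rho> (\<eta> *\<^sub>R x))"
   using nonneg by (intro E_OT_le_levy_lieb[OF \<eta> rm _ mass(1)]) blast
  then have "E_OT TYPE('n) \<rho> * ennreal \<eta> / ennreal \<eta> <= ?F \<eta>" by (intro divide_right_mono_ennreal) (simp add: mult.commute)
  then show ?thesis using \<eta> by (simp add: mult_divide_eq_ennreal)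
 qed
 have upper: "EX C. \<forall>\<eta>>0. ?F \<eta> <= E_OT TYPE('n) \<rho> + ennreal (C * (sqrt \<eta> + \<eta>))"
 proof (cases "E_OT TYPE('n) \<rho> < top")
  case True
  define E where "E = enn2real (E_OT TYPE('n) \<rho>)"
  have E: "E_OT TYPE('n) \<rho> = ennreal E" "0 <= E" using True by (simp_all add: E_def)
  obtain ep0 C where ep0: "0 < ep0" and C: "0 <= C" and bd: "!!ep \<eta>. 0 < ep ==> ep <= ep0 ==> 0 < \<eta> ==>
   levy_lieb TYPE('n) (%x. \<eta> ^ 3 * \<rho> (\<eta> *\<^sub>R x)) <= ennreal (\<eta> * E + C * (\<eta> * ep^2 + \<eta>^2 / ep^2 + \<eta>^2))"
   using semiclassical_upper_bound[OF N2 rm _ mass sobolev True] nonneg unfolding E_def by blast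
  define C' where "C' = C * (2 + 1 / ep0^2)"
  have "?F \<eta> <= E_OT TYPE('n) \<rho> + ennreal (C' * (sqrt \<eta> + \<eta>))" if \<eta>: "0 < \<eta>" for \<eta>
  proof -
   text \<open>Balances the kinetic cost \<open>\<eta>^2 / ep^2\<close> against the smearing error \<open>\<eta> * ep^2\<close>.\<close>
   define ep where "ep = min (sqrt (sqrt \<eta>)) ep0"
   have ep: "0 < ep" "ep <= ep0" using \<eta> ep0 by (simp_all add: ep_def)
   have s0: "0 < sqrt \<eta>" and ss: "sqrt \<eta> * sqrt \<eta> = \<eta>" using \<eta> by simp_all
   have "ep^2 <= (sqrt (sqrt \<eta>))^2" using ep(1) by (intro power_mono) (simp_all add: ep_def)
   then have e2: "ep^2 <= sqrt \<eta>" using s0 by simp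
   \<comment> \<open>For large \<open>\<eta>\<close> the cell side stays at \<open>ep0\<close>, and
     the localization cost is then linear in \<open>\<eta>\<close>; this is one source of the term
     \<open>\<eta>\<close> in the error.\<close>
   have ei: "\<eta> / ep^2 <= sqrt \<eta> + \<eta> / ep0^2"
   proof (cases "sqrt (sqrt \<eta>) <= ep0")
    case True
    then have "\<eta> / ep^2 = sqrt \<eta>" using s0 by (simp add: ep_def min_absorb1 real_div_sqrt)
    then show ?thesis using \<eta> by simp
   next
    case False
    then have "ep = ep0" by (simp add: ep_def)
    then show ?thesis using s0 by simp
   qed
   have "\<eta> * E + C * (\<eta> * ep^2 + \<eta>^2 / ep^2 + \<eta>^2) = \<eta> * (E + C * (ep^2 + \<eta> / ep^2 + \<eta>))" by (simp add: algebra_simps power2_eq_square)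
   also have "... <= \<eta> * (E + C' * (sqrt \<eta> + \<eta>))"
   proof (intro mult_left_mono add_left_mono)
    have "ep^2 + \<eta> / ep^2 + \<eta> <= 2 * sqrt \<eta> + (1 + 1 / ep0^2) * \<eta>" using e2 ei by (simp add: distrib_right)
    also have "... <= (2 + 1 / ep0^2) * sqrt \<eta> + (2 + 1 / ep0^2) * \<eta>"
     using \<eta> s0 ep0 by (intro add_mono mult_right_mono) simp_all
    finally have "ep^2 + \<eta> / ep^2 + \<eta> <= (2 + 1 / ep0^2) * (sqrt \<eta> + \<eta>)" by (simp only: distrib_left)
    then show "C * (ep^2 + \<eta> / ep^2 + \<eta>) <= C' * (sqrt \<eta> + \<eta>)" unfolding C'_def mult.assoc by (rule mult_left_mono[OF _ C])
   qed (use \<eta> in simp)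
   finally have "levy_lieb TYPE('n) (%x. \<eta> ^ 3 * \<rho> (\<eta> *\<^sub>R x)) <= ennreal (\<eta> * (E + C' * (sqrt \<eta> + \<eta>)))"
    using bd[OF ep \<eta>] ennreal_leI order_trans by blast
   then have "?F \<eta> <= ennreal (\<eta> * (E + C' * (sqrt \<eta> + \<eta>))) / ennreal \<eta>" by (rule divide_right_mono_ennreal)
   also have "... = ennreal (E + C' * (sqrt \<eta> + \<eta>))"
    using \<eta> E(2) C ep0 by (subst divide_ennreal) (simp_all add: C'_def)
   also have "... = E_OT TYPE('n) \<rho> + ennreal (C' * (sqrt \<eta> + \<eta>))"
    unfolding E(1) using E(2) C ep0 \<eta> by (intro ennreal_plus) (simp_all add: C'_def)
   finally show ?thesis .
  qed
  then show ?thesis by blast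
 next
  case False
  \<comment> \<open>With an infinite transport value the upper bound is trivial, for any
    constant.\<close>
  then have "E_OT TYPE('n) \<rho> = top" using top.not_eq_extremum by blast
  then show ?thesis by (intro exI[of _ 0]) simp
 qed
 then obtain C where C: "!!\<eta>. 0 < \<eta> ==> ?F \<eta> <= E_OT TYPE('n) \<rho> + ennreal (C * (sqrt \<eta> + \<eta>))" by blast
 have "(?F \<longlongrightarrow> E_OT TYPE('n) \<rho>) (at_right 0)"
 proof (rule tendsto_sandwich)
  show "eventually (%\<eta>. E_OT TYPE('n) \<rho> <= ?F \<eta>) (at_right 0)"
   using eventually_at_right_less[of 0] by eventually_elim (rule lower)
  show "eventually (%\<eta>. ?F \<eta> <= E_OT TYPE('n) \<rho> + ennreal (C * (sqrt \<eta> + \<eta>))) (at_right 0)"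
   using eventually_at_right_less[of 0] by eventually_elim (rule C)
  have "((%\<eta>::real. C * (sqrt \<eta> + \<eta>)) \<longlongrightarrow> C * (sqrt 0 + 0)) (at_right 0)" by (intro tendsto_intros)
  then have "((%\<eta>::real. ennreal (C * (sqrt \<eta> + \<eta>))) \<longlongrightarrow> ennreal (C * (sqrt 0 + 0))) (at_right 0)" by (rule tendsto_ennrealI)
  from tendsto_add[OF tendsto_const this]
  show "((%\<eta>. E_OT TYPE('n) \<rho> + ennreal (C * (sqrt \<eta> + \<eta>))) \<longlongrightarrow> E_OT TYPE('n) \<rho>) (at_right 0)" by simp
 qed simp
 then show ?thesis using lower C by blast
qed

end
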